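(* Let $(X,d,\mathfrak m)$ be a metric measure space with $p$-independent weak upper gradients in the weak sense. Then there is a unique couple $(L^0(T^*X),\mathrm d)$, where $L^0(T^*X)$ is an $L^0(\mathfrak m)$-normed module and $\mathrm d:\bigcup_{p\in(1,\infty)}S^p_{loc}(X)\to L^0(T^*X)$ is such that for any $p\in(1,\infty)$: (i) the restriction of $\mathrm d$ to $S^p_{loc}(X)$ is linear; (ii) for any $f\in S^p_{loc}(X)$ it holds $|Df|_p=|\mathrm df|$ $\mathfrak m$-a.e.; (iii) the space $\{\mathrm df: f\in W^{1,p}(X)\}$ generates $L^0(T^*X)$ as a module (for each fixed $p\in(1,\infty)$; in particular also $\bigcup_p\{\mathrm df: f\in W^{1,p}(X)\}$ generates $L^0(T^*X)$). Here uniqueness is intended up to unique isomorphism: if $(\mathscr M,L)$ is another couple with the same properties, there is a unique module isomorphism $\Phi:\mathscr M\to L^0(T^*X)$ such that $\Phi\circ L=\mathrm d$. Moreover, for each $p\in(1,\infty)$, the identification $I_p:L^0_p(T^*X)\to L^0(T^*X)$ sending $\mathrm d_pf\mapsto\mathrm df$ induces a module isomorphism $J_p:L^0_p(TX)\to(L^0(T^*X))^*$.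
   Context: Metric measure space $(X,d,\mathfrak m)$: $(X,d)$ is a complete and separable metric space and $\mathfrak m\neq 0$ is a non-negative Borel measure, finite on bounded sets. $p$ and $q$ always denote conjugate exponents. $L^p_{loc}(\mathfrak m)$: functions whose restriction to bounded sets is in $L^p$. $\mathrm{Lip}_{bs}(X)$: Lipschitz functions with bounded support. $C([0,1],X)$ carries the sup distance; $e_t(\gamma):=\gamma_t$; $|\dot\gamma_t|$ is the metric speed of $\gamma\in AC^q([0,1],X)$ ($q$-absolutely continuous curves). $q$-test plan ($q\in(1,\infty)$): a Borel probability $\pi$ on $C([0,1],X)$ such that for some $C>0$, $(e_t)_\sharp\pi\le C\mathfrak m$ for every $t\in[0,1]$, and $\int\int_0^1|\dot\gamma_t|^q\,dt\,d\pi<\infty$ (inner integral $+\infty$ if $\gamma\notin AC^q$). $S^p(X)$, $p\in(1,\infty)$: Borel $f:X\to\mathbb R$ for which there is $0\le G\in L^p(\mathfrak m)$ ($p$-weak upper gradient) with $\int|f(\gamma_1)-f(\gamma_0)|\,d\pi\le\int\int_0^1G(\gamma_t)|\dot\gamma_t|\,dt\,d\pi$ for every $q$-test plan $\pi$; $|Df|_p$ is the $\mathfrak m$-a.e. minimal such $G$. $W^{1,p}(X):=L^p(\mathfrak m)\cap S^p(X)$ with norm $(\|f\|_{L^p}^p+\||Df|_p\|_{L^p}^p)^{1/p}$. $S^p_{loc}(X)$: real valued Borel $f$ for which there is $0\le G\in L^p_{loc}(\mathfrak m)$ such that for every $k>0$, $\eta\in\mathrm{Lip}_{bs}(X)$,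 with $f^k:=k\wedge(f\vee -k)$, one has $\eta f^k\in S^p(X)$ and $|D(\eta f^k)|_p\le|\eta|G$ $\mathfrak m$-a.e. on $\{\eta=1\}$; then $|Df|_p:=|D(\eta f^k)|_p$ $\mathfrak m$-a.e. on $\{\eta=1\}\cap\{|f|<k\}$. $p$-independent weak upper gradients in the weak sense: for any $p_1,p_2\in(1,\infty)$, (a) $W^{1,p_1}(X)\cap W^{1,p_2}(X)$ is dense in both $W^{1,p_1}(X)$ and $W^{1,p_2}(X)$; (b) $|Df|_{p_1}=|Df|_{p_2}$ $\mathfrak m$-a.e. for every $f\in W^{1,p_1}(X)\cap W^{1,p_2}(X)$. $L^0(\mathfrak m)$: Borel functions up to $\mathfrak m$-a.e. equality, with the topology of local convergence in measure. $L^0(\mathfrak m)$-normed module: a topological space $(\mathscr M,\tau)$ with a bilinear product $\cdot:L^0(\mathfrak m)\times\mathscr M\to\mathscr M$ satisfying $g\cdot(f\cdot v)=(fg)\cdot v$ and $\hat 1\cdot v=v$, and a pointwise norm $|\cdot|:\mathscr M\to L^0(\mathfrak m)$ with $|v|\ge0$, $|f\cdot v|=|f||v|$ $\mathfrak m$-a.e., such that $d_{\mathscr M}(v,w):=\int|v-w|\wedge1\,d\mathfrak m'$ ($\mathfrak m'$ a fixed finite Borel measure with $\mathfrak m\ll\mathfrak m'\ll\mathfrak m$) is a complete distance inducing $\tau$. A set generates $\mathscr M$ if simple $L^0$-linear combinations of its elements are $d_{\mathscr M}$-dense. A module isomorphism is a map preserving the module operations which is a pointwise isometry (and bijective). Dual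 module: $\mathscr M^*$ is the set of $L^0(\mathfrak m)$-linear continuous $L:\mathscr M\to L^0(\mathfrak m)$, with $(f\cdot L)(v)=L(f\cdot v)$ and $|L|_*:=\mathrm{ess\,sup}\{L(v):|v|\le1\ \mathfrak m\text{-a.e.}\}$; it is an $L^0(\mathfrak m)$-normed module. $p$-cotangent module: $(L^0_p(T^*X),\mathrm d_p)$ is the (known to exist, unique up to unique isomorphism) couple of an $L^0(\mathfrak m)$-normed module and a linear map $\mathrm d_p:S^p_{loc}(X)\to L^0_p(T^*X)$ with $|\mathrm d_pf|=|Df|_p$ $\mathfrak m$-a.e. for all $f\in S^p_{loc}(X)$ and such that $\{\mathrm d_pf:f\in W^{1,p}(X)\}$ generates $L^0_p(T^*X)$. The $p$-tangent module is $L^0_p(TX):=(L^0_p(T^*X))^*$. *)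

theory Defs
  imports "HOL-Probability.Probability_Measure" "HOL-Algebra.Module"
begin

section \<open>Metric measure spaces\<close>

text \<open>The complete separable metric space is the type \<open>'x::polish_space\<close>.\<close>

definition metric_measure :: "'x::polish_space measure \<Rightarrow> bool" where
  "metric_measure m \<longleftrightarrow> sets m = sets borel \<and> emeasure m (space m) \<noteq> 0 \<and>
     (\<forall>B\<in>sets borel. bounded B \<longrightarrow> emeasure m B < \<infinity>)"

definition reference_measure :: "'x::polish_space measure \<Rightarrow> 'x measure \<Rightarrow> bool" where
  "reference_measure m m' \<longleftrightarrow> sets m' = sets borel \<and> finite_measure m' \<and>
     absolutely_continuous m m' \<and> absolutely_continuous m' m"

definition Lp_fun :: "'x::polish_space measure \<Rightarrow> real \<Rightarrow> ('x \<Rightarrow> real) set" where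
  "Lp_fun m p = {f \<in> borel_measurable borel. integrable m (\<lambda>x. \<bar>f x\<bar> powr p)}"

definition Lp_loc_fun :: "'x::polish_space measure \<Rightarrow> real \<Rightarrow> ('x \<Rightarrow> real) set" where
  "Lp_loc_fun m p = {f \<in> borel_measurable borel.
     \<forall>B\<in>sets borel. bounded B \<longrightarrow> set_integrable m B (\<lambda>x. \<bar>f x\<bar> powr p)}"

definition Lip_bs :: "('x::metric_space \<Rightarrow> real) set" where
  "Lip_bs = {\<eta>. (\<exists>C. C-lipschitz_on UNIV \<eta>) \<and> bounded {x. \<eta> x \<noteq> 0}}"

definition conj_exp :: "real \<Rightarrow> real" where
  "conj_exp p = p / (p - 1)"


section \<open>Curves and test plans\<close>

text \<open>\<open>C([0,1],X)\<close> with the sup distance is represented isometrically by the bounded continuous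
  functions on the real line that are constant on each side of \<open>[0,1]\<close>.\<close>

definition curves :: "(real \<Rightarrow>\<^sub>C 'x::metric_space) set" where
  "curves = {\<gamma>. \<forall>t. apply_bcontfun \<gamma> t = apply_bcontfun \<gamma> (min 1 (max 0 t))}"

definition AC :: "real \<Rightarrow> (real \<Rightarrow> 'x::metric_space) \<Rightarrow> bool" where
  "AC q \<gamma> \<longleftrightarrow> (\<exists>g \<in> borel_measurable borel.
     (\<forall>t. 0 \<le> g t) \<and> set_integrable lborel {0..1} (\<lambda>t. g t powr q) \<and>
     (\<forall>s t. 0 \<le> s \<and> s \<le> t \<and> t \<le> 1 \<longrightarrow>
        ennreal (dist (\<gamma> s) (\<gamma> t)) \<le> (\<integral>\<^sup>+r\<in>{s..t}. ennreal (g r) \<partial>lborel)))"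

text \<open>The limit exists for almost every \<open>t\<close> when \<open>\<gamma>\<close> is absolutely continuous on \<open>[0,1]\<close>;
  elsewhere the value \<open>0\<close> is a convention.\<close>

definition metric_speed :: "(real \<Rightarrow> 'x::metric_space) \<Rightarrow> real \<Rightarrow> real" where
  "metric_speed \<gamma> t =
     (if \<exists>l. ((\<lambda>s. dist (\<gamma> s) (\<gamma> t) / \<bar>s - t\<bar>) \<longlongrightarrow> l) (at t within {0..1})
      then Lim (at t within {0..1}) (\<lambda>s. dist (\<gamma> s) (\<gamma> t) / \<bar>s - t\<bar>) else 0)"

definition energy :: "real \<Rightarrow> (real \<Rightarrow> 'x::metric_space) \<Rightarrow> ennreal" where
  "energy q \<gamma> = (if AC q \<gamma>
     then \<integral>\<^sup>+t\<in>{0..1}. ennreal (metric_speed \<gamma> t powr q) \<partial>lborel else \<infinity>)"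

definition test_plan ::
  "'x::polish_space measure \<Rightarrow> real \<Rightarrow> (real \<Rightarrow>\<^sub>C 'x) measure \<Rightarrow> bool" where
  "test_plan m q \<pi> \<longleftrightarrow>
     prob_space \<pi> \<and> sets \<pi> = sets (restrict_space borel curves) \<and>
     (\<exists>C>0. \<forall>t\<in>{0..1}. \<forall>B\<in>sets borel.
        emeasure (distr \<pi> borel (\<lambda>\<gamma>. apply_bcontfun \<gamma> t)) B \<le> ennreal C * emeasure m B) \<and>
     (\<integral>\<^sup>+\<gamma>. energy q (apply_bcontfun \<gamma>) \<partial>\<pi>) < \<infinity>"


section \<open>Sobolev classes and minimal weak upper gradients\<close>

definition weak_upper_gradient ::
  "'x::polish_space measure \<Rightarrow> real \<Rightarrow> ('x \<Rightarrow> real) \<Rightarrow> ('x \<Rightarrow> real) \<Rightarrow> bool" where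
  "weak_upper_gradient m p f G \<longleftrightarrow> G \<in> Lp_fun m p \<and> (AE x in m. 0 \<le> G x) \<and>
     (\<forall>\<pi>. test_plan m (conj_exp p) \<pi> \<longrightarrow>
        (\<integral>\<^sup>+\<gamma>. ennreal \<bar>f (apply_bcontfun \<gamma> 1) - f (apply_bcontfun \<gamma> 0)\<bar> \<partial>\<pi>) \<le>
        (\<integral>\<^sup>+\<gamma>. (\<integral>\<^sup>+t\<in>{0..1}. ennreal (G (apply_bcontfun \<gamma> t) *
            metric_speed (apply_bcontfun \<gamma>) t) \<partial>lborel) \<partial>\<pi>))"

definition Sob :: "'x::polish_space measure \<Rightarrow> real \<Rightarrow> ('x \<Rightarrow> real) set" where
  "Sob m p = {f \<in> borel_measurable borel. \<exists>G. weak_upper_gradient m p f G}"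

text \<open>A representative of \<open>|Df|\<^sub>p\<close> for \<open>f \<in> S\<^sup>p(X)\<close>; it is determined up to null sets.\<close>

definition min_wug ::
  "'x::polish_space measure \<Rightarrow> real \<Rightarrow> ('x \<Rightarrow> real) \<Rightarrow> 'x \<Rightarrow> real" where
  "min_wug m p f = (SOME G. weak_upper_gradient m p f G \<and>
     (\<forall>G'. weak_upper_gradient m p f G' \<longrightarrow> (AE x in m. G x \<le> G' x)))"

definition W1 :: "'x::polish_space measure \<Rightarrow> real \<Rightarrow> ('x \<Rightarrow> real) set" where
  "W1 m p = Lp_fun m p \<inter> Sob m p"

definition W1_norm :: "'x::polish_space measure \<Rightarrow> real \<Rightarrow> ('x \<Rightarrow> real) \<Rightarrow> real" where
  "W1_norm m p f = ((\<integral>x. \<bar>f x\<bar> powr p \<partial>m) + (\<integral>x. \<bar>min_wug m p f x\<bar> powr p \<partial>m)) powr (1 / p)"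

definition truncate_at :: "real \<Rightarrow> ('x \<Rightarrow> real) \<Rightarrow> 'x \<Rightarrow> real" where
  "truncate_at k f x = min k (max (f x) (- k))"

definition Sob_loc :: "'x::polish_space measure \<Rightarrow> real \<Rightarrow> ('x \<Rightarrow> real) set" where
  "Sob_loc m p = {f \<in> borel_measurable borel. \<exists>G \<in> Lp_loc_fun m p. (AE x in m. 0 \<le> G x) \<and>
     (\<forall>k>0. \<forall>\<eta>\<in>Lip_bs.
        (\<lambda>x. \<eta> x * truncate_at k f x) \<in> Sob m p \<and>
        (AE x in m. \<eta> x = 1 \<longrightarrow>
           min_wug m p (\<lambda>x. \<eta> x * truncate_at k f x) x \<le> \<bar>\<eta> x\<bar> * G x))}"

text \<open>A representative of \<open>|Df|\<^sub>p\<close> for \<open>f \<in> S\<^sup>p\<^sub>l\<^sub>o\<^sub>c(X)\<close>.\<close>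

definition min_wug_loc ::
  "'x::polish_space measure \<Rightarrow> real \<Rightarrow> ('x \<Rightarrow> real) \<Rightarrow> 'x \<Rightarrow> real" where
  "min_wug_loc m p f = (SOME G. G \<in> borel_measurable borel \<and>
     (\<forall>k>0. \<forall>\<eta>\<in>Lip_bs. AE x in m. \<eta> x = 1 \<and> \<bar>f x\<bar> < k \<longrightarrow>
        G x = min_wug m p (\<lambda>x. \<eta> x * truncate_at k f x) x))"

definition p_independent_wug :: "'x::polish_space measure \<Rightarrow> bool" where
  "p_independent_wug m \<longleftrightarrow> (\<forall>p1>1. \<forall>p2>1.
     (\<forall>f\<in>W1 m p1. \<forall>\<epsilon>>0. \<exists>g\<in>W1 m p1 \<inter> W1 m p2. W1_norm m p1 (\<lambda>x. f x - g x) < \<epsilon>) \<and>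
     (\<forall>f\<in>W1 m p2. \<forall>\<epsilon>>0. \<exists>g\<in>W1 m p1 \<inter> W1 m p2. W1_norm m p2 (\<lambda>x. f x - g x) < \<epsilon>) \<and>
     (\<forall>f\<in>W1 m p1 \<inter> W1 m p2. AE x in m. min_wug m p1 f x = min_wug m p2 f x))"


section \<open>The ring \<open>L\<^sup>0\<close>\<close>

type_synonym 'x l0 = "('x \<Rightarrow> real) set"

definition L0_class :: "'x measure \<Rightarrow> ('x \<Rightarrow> real) \<Rightarrow> 'x l0" where
  "L0_class m f = {g \<in> borel_measurable m. AE x in m. g x = f x}"

definition L0_lift2 ::
  "'x measure \<Rightarrow> (real \<Rightarrow> real \<Rightarrow> real) \<Rightarrow> 'x l0 \<Rightarrow> 'x l0 \<Rightarrow> 'x l0" where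
  "L0_lift2 m c F G =
     {h \<in> borel_measurable m. \<exists>f\<in>F. \<exists>g\<in>G. AE x in m. h x = c (f x) (g x)}"

definition L0 :: "'x measure \<Rightarrow> 'x l0 ring" where
  "L0 m = \<lparr>carrier = L0_class m ` borel_measurable m,
     monoid.mult = L0_lift2 m (*), one = L0_class m (\<lambda>_. 1),
     zero = L0_class m (\<lambda>_. 0), add = L0_lift2 m (+)\<rparr>"

definition L0_abs :: "'x measure \<Rightarrow> 'x l0 \<Rightarrow> 'x l0" where
  "L0_abs m F = {h \<in> borel_measurable m. \<exists>f\<in>F. AE x in m. h x = \<bar>f x\<bar>}"

definition L0_le :: "'x measure \<Rightarrow> 'x l0 \<Rightarrow> 'x l0 \<Rightarrow> bool" where
  "L0_le m F G \<longleftrightarrow> (\<forall>f\<in>F. \<forall>g\<in>G. AE x in m. f x \<le> g x)"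

definition L0_rep :: "'x l0 \<Rightarrow> 'x \<Rightarrow> real" where
  "L0_rep F = (SOME f. f \<in> F)"

definition L0_ess_sup :: "'x measure \<Rightarrow> 'x l0 set \<Rightarrow> 'x l0" where
  "L0_ess_sup m S = (THE F. F \<in> carrier (L0 m) \<and> (\<forall>H\<in>S. L0_le m H F) \<and>
     (\<forall>F'\<in>carrier (L0 m). (\<forall>H\<in>S. L0_le m H F') \<longrightarrow> L0_le m F F'))"

text \<open>The topology of local convergence in measure, where local means on bounded Borel sets.\<close>

definition L0_topology :: "'x::polish_space measure \<Rightarrow> 'x l0 topology" where
  "L0_topology m = topology (\<lambda>U. U \<subseteq> carrier (L0 m) \<and>
     (\<forall>F\<in>U. \<exists>B\<in>sets borel. bounded B \<and> (\<exists>\<epsilon>>0. \<forall>H\<in>carrier (L0 m).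
        emeasure m {x\<in>B. \<epsilon> < \<bar>L0_rep F x - L0_rep H x\<bar>} < ennreal \<epsilon> \<longrightarrow> H \<in> U)))"


section \<open>Normed modules\<close>

text \<open>The real vector space structure is the one induced by the constant functions in \<open>L\<^sup>0\<close>, and
  the topology is the one induced by \<open>mod_dist\<close>, so neither is a separate component.\<close>

record ('x, 'v) normed_module = "('x l0, 'v) module" +
  pnorm :: "'v \<Rightarrow> 'x l0"

text \<open>\<open>Metric_space\<close> asks for symmetry also off the carrier, whence the case distinction.\<close>

definition mod_dist ::
  "'x measure \<Rightarrow> ('x, 'v) normed_module \<Rightarrow> 'v \<Rightarrow> 'v \<Rightarrow> real" where
  "mod_dist m' M v w = (if v \<in> carrier M \<and> w \<in> carrier M
     then \<integral>x. min (L0_rep (pnorm M (v \<ominus>\<^bsub>M\<^esub> w)) x) 1 \<partial>m' else 0)"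

abbreviation mod_topology :: "'x measure \<Rightarrow> ('x, 'v) normed_module \<Rightarrow> 'v topology" where
  "mod_topology m' M \<equiv> Metric_space.mtopology (carrier M) (mod_dist m' M)"

definition L0_normed_module ::
  "'x measure \<Rightarrow> 'x measure \<Rightarrow> ('x, 'v) normed_module \<Rightarrow> bool" where
  "L0_normed_module m m' M \<longleftrightarrow>
     Module.module (L0 m) M \<and>
     pnorm M \<in> carrier M \<rightarrow> carrier (L0 m) \<and>
     (\<forall>v\<in>carrier M. L0_le m \<zero>\<^bsub>L0 m\<^esub> (pnorm M v)) \<and>
     (\<forall>f\<in>carrier (L0 m). \<forall>v\<in>carrier M.
        pnorm M (f \<odot>\<^bsub>M\<^esub> v) = L0_abs m f \<otimes>\<^bsub>L0 m\<^esub> pnorm M v) \<and>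
     Metric_space (carrier M) (mod_dist m' M) \<and>
     Metric_space.mcomplete (carrier M) (mod_dist m' M)"

definition L0_combinations ::
  "'x measure \<Rightarrow> ('x, 'v) normed_module \<Rightarrow> 'v set \<Rightarrow> 'v set" where
  "L0_combinations m M V = {\<Oplus>\<^bsub>M\<^esub>i\<in>{..<n}. f i \<odot>\<^bsub>M\<^esub> v i | (n::nat) f v.
     f \<in> {..<n} \<rightarrow> carrier (L0 m) \<and> v \<in> {..<n} \<rightarrow> V}"

definition generates ::
  "'x measure \<Rightarrow> 'x measure \<Rightarrow> ('x, 'v) normed_module \<Rightarrow> 'v set \<Rightarrow> bool" where
  "generates m m' M V \<longleftrightarrow> V \<subseteq> carrier M \<and>
     mod_topology m' M closure_of L0_combinations m M V = carrier M"

definition module_iso :: "'x measure \<Rightarrow> ('x, 'v) normed_module \<Rightarrow> ('x, 'w) normed_module \<Rightarrow>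
    ('v \<Rightarrow> 'w) set" where
  "module_iso m M N = {\<Phi> \<in> carrier M \<rightarrow>\<^sub>E carrier N.
     bij_betw \<Phi> (carrier M) (carrier N) \<and>
     (\<forall>v\<in>carrier M. \<forall>w\<in>carrier M. \<Phi> (v \<oplus>\<^bsub>M\<^esub> w) = \<Phi> v \<oplus>\<^bsub>N\<^esub> \<Phi> w) \<and>
     (\<forall>f\<in>carrier (L0 m). \<forall>v\<in>carrier M. \<Phi> (f \<odot>\<^bsub>M\<^esub> v) = f \<odot>\<^bsub>N\<^esub> \<Phi> v) \<and>
     (\<forall>v\<in>carrier M. pnorm N (\<Phi> v) = pnorm M v)}"

text \<open>The multiplicative components of the ring record are irrelevant for a module.\<close>

definition dual_module :: "'x::polish_space measure \<Rightarrow> 'x measure \<Rightarrow> ('x, 'v) normed_module \<Rightarrow>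
    ('x, 'v \<Rightarrow> 'x l0) normed_module" where
  "dual_module m m' M =
     \<lparr>carrier = {L \<in> carrier M \<rightarrow>\<^sub>E carrier (L0 m).
        (\<forall>v\<in>carrier M. \<forall>w\<in>carrier M. L (v \<oplus>\<^bsub>M\<^esub> w) = L v \<oplus>\<^bsub>L0 m\<^esub> L w) \<and>
        (\<forall>f\<in>carrier (L0 m). \<forall>v\<in>carrier M. L (f \<odot>\<^bsub>M\<^esub> v) = f \<otimes>\<^bsub>L0 m\<^esub> L v) \<and>
        continuous_map (mod_topology m' M) (L0_topology m) L},
      monoid.mult = undefined, one = undefined,
      zero = (\<lambda>v\<in>carrier M. \<zero>\<^bsub>L0 m\<^esub>),
      add = (\<lambda>L K. \<lambda>v\<in>carrier M. L v \<oplus>\<^bsub>L0 m\<^esub> K v),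
      smult = (\<lambda>f L. \<lambda>v\<in>carrier M. L (f \<odot>\<^bsub>M\<^esub> v)),
      pnorm = (\<lambda>L. L0_ess_sup m
        (L ` {v \<in> carrier M. L0_le m (pnorm M v) \<one>\<^bsub>L0 m\<^esub>}))\<rparr>"


section \<open>Cotangent modules\<close>

text \<open>The differential is a total function on real functions; only its values on
  \<open>S\<^sup>p\<^sub>l\<^sub>o\<^sub>c(X)\<close> are constrained.\<close>

definition p_differential :: "'x::polish_space measure \<Rightarrow> 'x measure \<Rightarrow> real \<Rightarrow>
    ('x, 'v) normed_module \<Rightarrow> (('x \<Rightarrow> real) \<Rightarrow> 'v) \<Rightarrow> bool" where
  "p_differential m m' p M d \<longleftrightarrow>
     d \<in> Sob_loc m p \<rightarrow> carrier M \<and>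
     (\<forall>f\<in>Sob_loc m p. \<forall>g\<in>Sob_loc m p. \<forall>a b :: real.
        d (\<lambda>x. a * f x + b * g x) =
          L0_class m (\<lambda>_. a) \<odot>\<^bsub>M\<^esub> d f \<oplus>\<^bsub>M\<^esub> L0_class m (\<lambda>_. b) \<odot>\<^bsub>M\<^esub> d g) \<and>
     (\<forall>f\<in>Sob_loc m p. pnorm M (d f) = L0_class m (min_wug_loc m p f)) \<and>
     generates m m' M (d ` W1 m p)"

definition p_cotangent :: "'x::polish_space measure \<Rightarrow> 'x measure \<Rightarrow> real \<Rightarrow>
    ('x, 'v) normed_module \<Rightarrow> (('x \<Rightarrow> real) \<Rightarrow> 'v) \<Rightarrow> bool" where
  "p_cotangent m m' p M d \<longleftrightarrow> L0_normed_module m m' M \<and> p_differential m m' p M d"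

definition cotangent :: "'x::polish_space measure \<Rightarrow> 'x measure \<Rightarrow>
    ('x, 'v) normed_module \<Rightarrow> (('x \<Rightarrow> real) \<Rightarrow> 'v) \<Rightarrow> bool" where
  "cotangent m m' M d \<longleftrightarrow>
     L0_normed_module m m' M \<and> (\<forall>p>1. p_differential m m' p M d)"

text \<open>The map \<open>L \<mapsto> L \<circ> I\<inverse>\<close> between the duals induced by a bijection \<open>I\<close> of \<open>M\<close> onto \<open>N\<close>.\<close>

definition dual_map :: "'x::polish_space measure \<Rightarrow> 'x measure \<Rightarrow> ('x, 'v) normed_module \<Rightarrow>
    ('x, 'w) normed_module \<Rightarrow> ('v \<Rightarrow> 'w) \<Rightarrow> ('v \<Rightarrow> 'x l0) \<Rightarrow> ('w \<Rightarrow> 'x l0)" where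
  "dual_map m m' M N I = (\<lambda>L\<in>carrier (dual_module m m' M). \<lambda>w\<in>carrier N.
     L (inv_into (carrier M) I w))"

text \<open>A concrete type carrying a cotangent module: equivalence classes of sequences of formal sums
  \<open>\<Sum> g\<^sub>i df\<^sub>i\<close>, coded as lists of pairs \<open>(g\<^sub>i, f\<^sub>i)\<close>. Existence is asserted on this type, since
  types cannot be quantified existentially.\<close>

type_synonym 'x formal_forms = "(nat \<Rightarrow> (('x \<Rightarrow> real) \<times> ('x \<Rightarrow> real)) list) set"

end

theory Submission
  imports Defs
begin

text \<open>Along almost every curve of a test plan, a function with a weak upper gradient has increments
bounded by the path integral of the gradient. On the line, Lebesgue differentiation then gives the
lattice property, the locality and the Leibniz rule of minimal weak upper gradients, and Hoelder's
inequality makes \<open>S\<^sup>p\<^sub>l\<^sub>o\<^sub>c\<close> decreasing in \<open>p\<close>. Together with the \<open>p\<close>-independence on \<open>W\<^sup>1\<^sup>,\<^sup>p\<close> this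
yields one pointwise seminorm \<open>|Df|\<close> on the vector space \<open>\<Union>\<^sub>p S\<^sup>p\<^sub>l\<^sub>o\<^sub>c\<close>, in which \<open>W\<^sup>1\<^sup>,\<^sup>p\<close> is dense for
every \<open>p\<close>.

The norm of a formal sum \<open>\<Sum> g\<^sub>i df\<^sub>i\<close> is forced: at almost every point it is the limit of
\<open>|D(\<Sum> a\<^sub>i f\<^sub>i)|\<close> as rational constants \<open>a\<^sub>i\<close> approach the values \<open>g\<^sub>i\<close>. Hence every module with a
differential contains an isometric copy of the same formal sums, whose completion is the cotangent
module; existence, uniqueness and the identification with the \<open>p\<close>-cotangent modules follow, and the
isomorphism of the duals is transposition.\<close>


text \<open>Exceptional null sets shape the proof. An upper gradient controls a function, for each
  pair of times, along almost every curve, so on one curve only countably many times are available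
  at once, and the function need not be continuous along it. The estimates on the line are therefore
  stated for functions known at rational times, or at almost all times when zeros have to be
  located. In the same way a seminorm inequality holds almost everywhere for each choice of
  constants, with a null set depending on the choice; this is why the norm of a formal sum is an
  infimum over rational tuples. Integrated inequalities are localised to curves by conditioning a
  test plan on a bad set of curves and cutting the curves to a time interval.

  The module part is carried out for an abstract vector space of functions with an almost everywhere
  seminorm. Its instances are a single \<open>Sob_loc m p\<close> and the union over all exponents,
  so one uniqueness theorem gives both the uniqueness of the cotangent module and its identification
  with the \<open>p\<close>-cotangent modules.\<close>

abbreviation borel_fun :: "('a::topological_space => 'b::topological_space) set" where
 "borel_fun \<equiv> borel_measurable borel"

section \<open>Absolutely continuous functions on an interval\<close>

text \<open>Henstock's lemma bounds the summed errors of every fine tagged partial division. A bad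
  point \<open>t\<close> tags the interval between \<open>t\<close> and a bad \<open>s\<close>,
  whose error exceeds \<open>c\<close> times its length; disjoint such intervals therefore have
  total length below \<open>e / 5\<close>, and the factor 5 of the Vitali covering lemma brings this
  to \<open>e\<close>.\<close>

lemma negligible_not_differentiable_indefinite_integral:
 fixes f :: "real => real"
 assumes f: "f integrable_on {a..b}" and c: "0 < c"
 shows "negligible {t\<in>{a<..<b}. \<forall>\<delta>>0. \<exists>s\<in>{a..b}. 0 < \<bar>s - t\<bar> \<and> \<bar>s - t\<bar> < \<delta> \<and>
  c * \<bar>s - t\<bar> < \<bar>integral {a..s} f - integral {a..t} f - f t * (s - t)\<bar>}" (is "negligible ?E")
 unfolding negligible_outer_le
proof (intro allI impI)
 fix e :: real assume e: "0 < e"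
 have "0 < e * c / 5" using e c by simp
 have f': "f integrable_on cbox a b" using f by simp
 obtain cv where g: "gauge cv"
  and cv: "!!p. p tagged_partial_division_of (cbox a b) ==> cv fine p ==>
    (\<Sum>(x,k)\<in>p. norm (measure lborel k *\<^sub>R f x - integral k f)) < e * c / 5"
  by (rule Henstock_lemma[OF f' \<open>0 < e * c / 5\<close>]) blast
 define P where "P t s \<longleftrightarrow> s \<in> {a..b} \<and> 0 < \<bar>s - t\<bar> \<and> {min s t..max s t} \<subseteq> cv t \<and>
  c * \<bar>s - t\<bar> < \<bar>integral {a..s} f - integral {a..t} f - f t * (s - t)\<bar>" for t s
 have ex: "\<exists>s. P t s" if t: "t \<in> ?E" for t
 proof -
  have "open (cv t)" "t \<in> cv t" using g by (auto simp: gauge_def)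
  then obtain \<delta> where d: "0 < \<delta>" "ball t \<delta> \<subseteq> cv t" using open_contains_ball by blast
  then obtain s where s: "s\<in>{a..b}" "0 < \<bar>s - t\<bar>" "\<bar>s - t\<bar> < \<delta>"
   "c * \<bar>s - t\<bar> < \<bar>integral {a..s} f - integral {a..t} f - f t * (s - t)\<bar>" using t by blast
  have "{min s t..max s t} \<subseteq> ball t \<delta>"
   using s(3) by (auto simp: dist_real_def)
  with d s have "P t s" unfolding P_def by blast
  then show ?thesis ..
 qed
 define s where "s t = (SOME s. P t s)" for t
 have s: "s t \<in> {a..b} \<and> 0 < \<bar>s t - t\<bar> \<and> {min (s t) t..max (s t) t} \<subseteq> cv t \<and>
  c * \<bar>s t - t\<bar> < \<bar>integral {a..s t} f - integral {a..t} f - f t * (s t - t)\<bar>" if "t \<in> ?E" for t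
  using someI_ex[OF ex[OF that]] unfolding s_def P_def .
 define x where "x t = (s t + t) / 2" for t
 define r where "r t = \<bar>s t - t\<bar> / 2" for t
 have cb: "cball (x t) (r t) = {min (s t) t..max (s t) t}" for t
  unfolding cball_eq_atLeastAtMost x_def r_def by (auto simp: min_def max_def field_simps abs_if)
 have cover: "?E \<subseteq> (\<Union>t\<in>?E. cball (x t) (r t))" unfolding cb by auto
 have rb: "0 < r t \<and> r t <= b - a" if "t \<in> ?E" for t
  using s[OF that] that by (auto simp: r_def abs_if)
 obtain C where C: "countable C" "C \<subseteq> ?E" "pairwise (\<lambda>i j. disjnt (cball (x i) (r i)) (cball (x j) (r j))) C"
  "?E \<subseteq> (\<Union>i\<in>C. cball (x i) (5 * r i))"
  by (rule Vitali_covering_lemma_cballs[OF cover rb]) auto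
 let ?T = "\<Union>i\<in>C. cball (x i) (5 * r i)"
 \<comment> \<open>Divisions are finite, so the countable Vitali family is estimated through its
   finite subfamilies.\<close>
 have bound: "measure lebesgue (\<Union>i\<in>C'. cball (x i) (5 * r i)) <= e" if C': "C' \<subseteq> C" "finite C'" for C'
 proof -
  let ?K = "\<lambda>t. cball (x t) (r t)"
  let ?p = "(\<lambda>t. (t, ?K t)) ` C'"
  have int_diff: "integral (?K t) f = (if t <= s t then 1 else -1) * (integral {a..s t} f - integral {a..t} f)"
   if "t \<in> C'" for t
  proof -
   have t: "t \<in> ?E" using that C' C by auto
   have st: "s t \<in> {a..b}" "t \<in> {a..b}" using s[OF t] t by auto
   have "integral {a..min (s t) t} f + integral {min (s t) t..max (s t) t} f = integral {a..max (s t) t} f"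
    by (rule Henstock_Kurzweil_Integration.integral_combine)
     (use st in \<open>auto intro!: integrable_subinterval_real[OF f]\<close>)
   then show ?thesis unfolding cb by (auto simp: min_def max_def split: if_splits)
  qed
  have "?p tagged_partial_division_of (cbox a b)"
   unfolding tagged_partial_division_of_def
  proof (intro conjI allI impI)
   show "finite ?p" using C' by auto
   fix u K assume uK: "(u, K) \<in> ?p"
   then have u: "u \<in> ?E" "K = ?K u" using C' C by auto
   show "u \<in> K" using u unfolding cb by auto
   show "K \<subseteq> cbox a b" using u s[OF u(1)] unfolding cb by auto
   show "\<exists>a b. K = cbox a b" using u unfolding cb by (metis box_real(2))
  next
   fix u K v L assume H: "(u, K) \<in> ?p \<and> (v, L) \<in> ?p \<and> (u, K) \<noteq> (v, L)"
   then have "u \<in> C" "v \<in> C" "u \<noteq> v" "K = ?K u" "L = ?K v" using C' by auto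
   then have "disjnt K L" using C(3) by (auto simp: pairwise_def)
   then show "interior K \<inter> interior L = {}"
    by (metis disjnt_def interior_Int interior_empty)
  qed
  moreover have "cv fine ?p"
   unfolding fine_def
  proof clarsimp
   fix t y assume t: "t \<in> C'" and y: "dist (x t) y <= r t"
   have "y \<in> ?K t" using y by simp
   moreover have "t \<in> ?E" using t C' C by auto
   ultimately show "y \<in> cv t" using s[of t] unfolding cb by blast
  qed
  ultimately have "(\<Sum>(u,k)\<in>?p. norm (measure lborel k *\<^sub>R f u - integral k f)) < e * c / 5" by (rule cv)
  moreover have "(\<Sum>(u,k)\<in>?p. norm (measure lborel k *\<^sub>R f u - integral k f))
    = (\<Sum>t\<in>C'. norm (measure lborel (?K t) *\<^sub>R f t - integral (?K t) f))"
   by (subst sum.reindex) (auto simp: inj_on_def)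
  moreover have "(\<Sum>t\<in>C'. c * (2 * r t)) <= (\<Sum>t\<in>C'. norm (measure lborel (?K t) *\<^sub>R f t - integral (?K t) f))"
  proof (rule sum_mono)
   fix t assume t: "t \<in> C'"
   then have tE: "t \<in> ?E" using C' C by auto
   have cont: "measure lborel (?K t) = \<bar>s t - t\<bar>" unfolding cb by (auto simp: min_def max_def)
   have "c * \<bar>s t - t\<bar> < \<bar>integral {a..s t} f - integral {a..t} f - f t * (s t - t)\<bar>"
    using s[OF tE] by blast
   also have "... = norm (measure lborel (?K t) *\<^sub>R f t - integral (?K t) f)"
    unfolding int_diff[OF t] cont by (auto simp: algebra_simps abs_if split: if_splits)
   finally show "c * (2 * r t) <= norm (measure lborel (?K t) *\<^sub>R f t - integral (?K t) f)" by (simp add: r_def)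
  qed
  ultimately have "(\<Sum>t\<in>C'. c * (2 * r t)) < e * c / 5" by linarith
  moreover have "(\<Sum>t\<in>C'. c * (2 * r t)) = c * (\<Sum>t\<in>C'. 2 * r t)" by (simp only: sum_distrib_left)
  moreover have "c * (e / 5) = e * c / 5" by simp
  ultimately have "c * (\<Sum>t\<in>C'. 2 * r t) < c * (e / 5)" by linarith
  then have S: "(\<Sum>t\<in>C'. 2 * r t) < e / 5" using c by simp
  have "measure lebesgue (\<Union>i\<in>C'. cball (x i) (5 * r i)) <= (\<Sum>i\<in>C'. measure lebesgue (cball (x i) (5 * r i)))"
   by (rule measure_UNION_le) (use C' in auto)
  also have "... = (\<Sum>i\<in>C'. 5 * (2 * r i))"
  proof (rule sum.cong)
   fix i assume "i \<in> C'"
   then have "0 < r i" using rb C' C by auto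
   then show "measure lebesgue (cball (x i) (5 * r i)) = 5 * (2 * r i)"
    unfolding cball_eq_atLeastAtMost by simp
  qed simp
  also have "... = 5 * (\<Sum>t\<in>C'. 2 * r t)" by (simp add: sum_distrib_left)
  finally show ?thesis using S by simp
 qed
 have "?T \<in> lmeasurable" "measure lebesgue ?T <= e"
  using fmeasurable_UN_bound[OF C(1) _ bound] measure_UN_bound[OF C(1) _ bound] by auto
 then show "\<exists>T. ?E \<subseteq> T \<and> T \<in> lmeasurable \<and> measure lebesgue T <= e" using C(4) by blast
qed

text \<open>If the difference quotients at \<open>t\<close> do not tend to \<open>f t\<close>, some
  threshold \<open>1 / real (Suc n)\<close> is exceeded arbitrarily close to \<open>t\<close>; so
  countably many negligible sets cover the exceptional points.\<close>

theorem lebesgue_differentiation: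
 fixes f :: "real => real"
 assumes f: "f integrable_on {a..b}"
 obtains N where "negligible N"
  "!!t. t \<in> {a<..<b} - N ==> ((\<lambda>s. integral {a..s} f) has_real_derivative f t) (at t)"
proof -
 define E where "E n = {t\<in>{a<..<b}. \<forall>\<delta>>0. \<exists>s\<in>{a..b}. 0 < \<bar>s - t\<bar> \<and> \<bar>s - t\<bar> < \<delta> \<and>
  1 / real (Suc n) * \<bar>s - t\<bar> < \<bar>integral {a..s} f - integral {a..t} f - f t * (s - t)\<bar>}" for n
 have "negligible (\<Union>n. E n)"
  unfolding E_def
  by (intro negligible_Union_nat negligible_not_differentiable_indefinite_integral[OF f]) simp
 moreover have "((\<lambda>s. integral {a..s} f) has_real_derivative f t) (at t)" if t: "t \<in> {a<..<b} - (\<Union>n. E n)" for t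
  unfolding has_field_derivative_iff
 proof (rule tendstoI)
  fix e :: real assume "0 < e"
  then obtain n where n: "1 / real (Suc n) < e" using nat_approx_posE by blast
  have "\<not> (\<forall>\<delta>>0. \<exists>s\<in>{a..b}. 0 < \<bar>s - t\<bar> \<and> \<bar>s - t\<bar> < \<delta> \<and>
   1 / real (Suc n) * \<bar>s - t\<bar> < \<bar>integral {a..s} f - integral {a..t} f - f t * (s - t)\<bar>)"
   using t unfolding E_def by blast
  then obtain \<delta> where d: "\<delta> > 0" "!!s. s\<in>{a..b} ==> 0 < \<bar>s - t\<bar> ==> \<bar>s - t\<bar> < \<delta> ==>
    \<bar>integral {a..s} f - integral {a..t} f - f t * (s - t)\<bar> <= 1 / real (Suc n) * \<bar>s - t\<bar>"
   by (meson not_less)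
  have "eventually (\<lambda>s. s \<in> {a<..<b}) (at t)" using t by (intro eventually_at_in_open') auto
  moreover have "eventually (\<lambda>s. s \<noteq> t \<and> \<bar>s - t\<bar> < \<delta>) (at t)"
   using d(1) unfolding eventually_at dist_real_def by auto
  ultimately show "\<forall>\<^sub>F s in at t. dist ((integral {a..s} f - integral {a..t} f) / (s - t)) (f t) < e"
  proof eventually_elim
   case (elim s)
   have "dist ((integral {a..s} f - integral {a..t} f) / (s - t)) (f t)
     = \<bar>integral {a..s} f - integral {a..t} f - f t * (s - t)\<bar> / \<bar>s - t\<bar>"
   proof -
    have "(integral {a..s} f - integral {a..t} f) / (s - t) - f t =
      (integral {a..s} f - integral {a..t} f - f t * (s - t)) / (s - t)"
     using elim by (simp add: diff_divide_distrib)
    then show ?thesis by (simp add: dist_real_def abs_divide)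
   qed
   also have "... <= 1 / real (Suc n)" using d(2)[of s] elim by (simp add: field_simps)
   finally show ?case using n by simp
  qed
 qed
 ultimately show ?thesis using that by blast
qed

section \<open>Densities of absolutely continuous functions\<close>

text \<open>The sum of the two Stieltjes measures is made into a measure \<open>N\<close> so that
  uniqueness on the intersection-stable family of half-open intervals applies. It serves to
  recognise \<open>interval_measure F1\<close> as dominated by a measure that has a density.\<close>

lemma emeasure_eq_sum_interval_measures:
 fixes F1 F2 :: "real => real"
 assumes m1: "!!x y. x <= y ==> F1 x <= F1 y" and m2: "!!x y. x <= y ==> F2 x <= F2 y"
  and c1: "!!a. continuous (at_right a) F1" and c2: "!!a. continuous (at_right a) F2"
  and M: "sets M = sets borel"
  and Ioc: "!!a b. a <= b ==> emeasure M {a<..b} = ennreal (F1 b - F1 a + (F2 b - F2 a))"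
  and A: "A \<in> sets borel"
 shows "emeasure M A = emeasure (interval_measure F1) A + emeasure (interval_measure F2) A"
proof -
 let ?\<mu> = "\<lambda>A. emeasure (interval_measure F1) A + emeasure (interval_measure F2) A"
 define N where "N = measure_of UNIV (sets borel) ?\<mu>"
 have sN: "sets N = sets borel"
  unfolding N_def using sets.sigma_sets_eq[of "borel :: real measure"] by simp
 have "countably_additive (sets N) ?\<mu>"
  unfolding countably_additive_def sN
 proof (intro allI impI)
  fix A :: "nat => real set" assume A: "range A \<subseteq> sets borel" "disjoint_family A" "\<Union>(range A) \<in> sets borel"
  have "(\<Sum>i. ?\<mu> (A i)) = (\<Sum>i. emeasure (interval_measure F1) (A i)) + (\<Sum>i. emeasure (interval_measure F2) (A i))"
   by (intro suminf_add[symmetric] summableI)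
  then show "(\<Sum>i. ?\<mu> (A i)) = ?\<mu> (\<Union>(range A))" using A by (simp add: suminf_emeasure)
 qed
 then have em: "emeasure N A = ?\<mu> A" if "A \<in> sets borel" for A
  using emeasure_measure_of[OF N_def] that unfolding sN by (auto simp: positive_def)
 have "M = N"
 proof (rule measure_eqI_generator_eq)
  let ?E = "range (\<lambda>(a,b). {a<..b::real})"
  show "Int_stable ?E" by (auto simp: Int_stable_def image_iff split_beta)
  show "sets M = sigma_sets UNIV ?E" "sets N = sigma_sets UNIV ?E" by (auto simp: sN M borel_sigma_sets_Ioc)
  fix X assume "X \<in> ?E"
  then obtain a b where X: "X = {a<..b}" by auto
  show "emeasure M X = emeasure N X"
  proof (cases "a <= b")
   case True
   then show ?thesis unfolding X Ioc[OF True]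
    by (simp add: em emeasure_interval_measure_Ioc m1 m2 c1 c2 flip: ennreal_plus)
  qed (simp add: X)
 next
  show "(\<Union>n::nat. {-real n<..real n}) = UNIV"
  proof safe
   fix x :: real
   obtain n :: nat where "\<bar>x\<bar> < real n" using reals_Archimedean2 by blast
   then show "x \<in> (\<Union>n::nat. {-real n<..real n})" by (intro UN_I[of n]) auto
  qed auto
  show "emeasure M {-real n<..real n} \<noteq> \<infinity>" for n by (subst Ioc) auto
 qed auto
 then show ?thesis using em[OF A] by simp
qed

lemma nn_integral_Icc_eq_integral:
 fixes h :: "real => real"
 assumes h0: "!!x. 0 <= h x" and h: "h integrable_on {a..b}"
 shows "(\<integral>\<^sup>+x\<in>{a..b}. ennreal (h x) \<partial>lborel) = ennreal (integral {a..b} h)"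
 by (rule nn_integral_has_integral_lebesgue') (use assms in auto)

lemma integrable_on_Icc_if_nn_integral_finite:
 fixes h :: "real => real"
 assumes [measurable]: "h \<in> borel_fun" and h0: "!!x. 0 <= h x"
  and fin: "(\<integral>\<^sup>+x\<in>{a..b}. ennreal (h x) \<partial>lborel) < \<infinity>"
 shows "h integrable_on {a..b}"
proof -
 let ?f = "\<lambda>x. h x * indicator {a..b} x"
 have eq: "(\<integral>\<^sup>+x. ennreal (?f x) \<partial>lborel) = (\<integral>\<^sup>+x\<in>{a..b}. ennreal (h x) \<partial>lborel)"
  by (intro nn_integral_cong) (auto simp: indicator_def)
 obtain r where r: "(\<integral>\<^sup>+x. ennreal (?f x) \<partial>lborel) = ennreal r" "0 <= r"
  using fin unfolding eq[symmetric]
  by (cases "\<integral>\<^sup>+x. ennreal (?f x) \<partial>lborel" rule: ennreal_cases) auto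
 have "(?f has_integral r) UNIV"
  by (rule nn_integral_has_integral) (use r h0 in auto)
 then have "((\<lambda>x. if x \<in> {a..b} then h x else 0) has_integral r) UNIV"
  by (rule has_integral_eq[rotated]) (auto simp: indicator_def)
 then show ?thesis using has_integral_restrict_UNIV[of "{a..b}" h r] by auto
qed

lemma integral_Icc_split:
 fixes h :: "real => real"
 assumes "h integrable_on {a..b}" "a <= s" "s <= t" "t <= b"
 shows "integral {s..t} h = integral {a..t} h - integral {a..s} h"
 using Henstock_Kurzweil_Integration.integral_combine[of a s t h]
  integrable_subinterval_real[OF assms(1), of a t] assms by auto

text \<open>With \<open>G\<close> the integral of \<open>g\<close>, both \<open>G + \<phi>\<close>
  and \<open>G - \<phi>\<close> are increasing, and their Stieltjes measures add up to the measure
  with density \<open>2 * g\<close> on the interval. The first one is therefore absolutely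
  continuous, and its Radon-Nikodym density minus \<open>g\<close> is the density of
  \<open>\<phi>\<close>.\<close>

lemma absolutely_continuous_density:
 fixes \<phi> g :: "real => real"
 assumes g [measurable]: "g \<in> borel_fun" and gi: "g integrable_on {a..b}"
  and g0: "!!x. 0 <= g x" and ab: "a < b"
  and \<phi>: "!!s t. a <= s ==> s <= t ==> t <= b ==> \<bar>\<phi> t - \<phi> s\<bar> <= integral {s..t} g"
 obtains \<psi> where "\<psi> \<in> borel_fun" "\<psi> integrable_on {a..b}"
  "!!s t. a <= s ==> s <= t ==> t <= b ==> \<phi> t - \<phi> s = integral {s..t} \<psi>"
proof -
 \<comment> \<open>Clamping to \<open>{a..b}\<close> extends both monotone functions to the whole
   line, where \<open>interval_measure\<close> lives.\<close>
 define cl where "cl x = max a (min b x)" for x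
 define G where "G x = integral {a..cl x} g" for x
 define F1 where "F1 x = \<phi> (cl x) + G x" for x
 define F2 where "F2 x = G x - \<phi> (cl x)" for x
 have cl: "a <= cl x" "cl x <= b" for x using ab by (auto simp: cl_def)
 have clm: "x <= y ==> cl x <= cl y" for x y by (auto simp: cl_def)
 have Gd: "integral {cl x..cl y} g = G y - G x" if "x <= y" for x y
  unfolding G_def by (rule integral_Icc_split[OF gi]) (use cl clm that in auto)
 have ph: "\<bar>\<phi> (cl y) - \<phi> (cl x)\<bar> <= G y - G x" if "x <= y" for x y
  using \<phi>[of "cl x" "cl y"] cl clm[OF that] Gd[OF that] by auto
 have m1: "F1 x <= F1 y" and m2: "F2 x <= F2 y" if "x <= y" for x y
  using ph[OF that] by (auto simp: F1_def F2_def)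
 have clc: "continuous_on UNIV cl" unfolding cl_def by (intro continuous_intros)
 have "continuous_on {a..b} (\<lambda>x. integral {a..x} g)"
  by (rule indefinite_integral_continuous_1[OF gi])
 then have Gc: "continuous_on UNIV G" unfolding G_def
  by (rule continuous_on_compose2[OF _ clc]) (use cl in auto)
 have pc: "continuous_on UNIV (\<lambda>x. \<phi> (cl x))"
  unfolding continuous_on_def
 proof
  fix x
  have "(G \<longlongrightarrow> G x) (at x)" using Gc by (simp add: continuous_on_def)
  then have L: "((\<lambda>y. \<bar>G y - G x\<bar>) \<longlongrightarrow> 0) (at x)"
   by (intro tendsto_rabs_zero) (rule LIM_zero)
  have H: "norm (\<phi> (cl y) - \<phi> (cl x)) <= \<bar>G y - G x\<bar>" for y
   using ph[of x y] ph[of y x] by (cases "x <= y") auto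
  have "((\<lambda>y. \<phi> (cl y) - \<phi> (cl x)) \<longlongrightarrow> 0) (at x)"
   by (rule Lim_null_comparison[OF always_eventually L]) (rule allI, rule H)
  then show "((\<lambda>x. \<phi> (cl x)) \<longlongrightarrow> \<phi> (cl x)) (at x within UNIV)"
   by (rule LIM_zero_cancel)
 qed
 have c1: "continuous (at_right x) F1" and c2: "continuous (at_right x) F2" for x
  unfolding F1_def F2_def using Gc pc
  by (auto intro!: continuous_intros simp: continuous_on_eq_continuous_at
    intro: continuous_at_imp_continuous_at_within)
 let ?g2 = "\<lambda>x. 2 * g x * indicator {a..b} x"
 have ga: "integral {x..y} (\<lambda>x. 2 * g x * indicator {a..b} x) = 2 * (G y - G x)" if "x <= y" for x y
 proof -
  have "integral {x..y} ?g2 = integral ({x..y} \<inter> {a..b}) (\<lambda>x. 2 * g x)"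
  proof -
   have "integral {x..y} ?g2 = integral {x..y} (\<lambda>t. if t \<in> {a..b} then 2 * g t else 0)"
    by (rule integral_cong) (auto simp: indicator_def)
   also have "... = integral ({x..y} \<inter> {a..b}) (\<lambda>x. 2 * g x)"
    unfolding Int_commute[of "{x..y}"] by (rule Henstock_Kurzweil_Integration.integral_restrict_Int)
   finally show ?thesis .
  qed
  also have "... = 2 * integral ({x..y} \<inter> {a..b}) g" by simp
  also have "integral ({x..y} \<inter> {a..b}) g = integral {cl x..cl y} g"
  proof (cases "{x..y} \<inter> {a..b} = {}")
   case True
   then have "min y b < max x a" by (simp only: Int_atLeastAtMost atLeastatMost_empty_iff not_le)
   then have "cl x = cl y" using that ab unfolding cl_def min_def max_def by (simp split: if_splits)
   then show ?thesis using True by simp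
  next
   case False
   then have "{x..y} \<inter> {a..b} = {cl x..cl y}" using that by (auto simp: cl_def)
   then show ?thesis by (simp only:)
  qed
  finally show ?thesis using Gd[OF that] by simp
 qed
 have nng: "(\<integral>\<^sup>+t. ennreal (?g2 t) * indicator {x<..y} t \<partial>lborel) = ennreal (2 * (G y - G x))" if "x <= y" for x y
 proof -
  have "(\<integral>\<^sup>+t. ennreal (?g2 t) * indicator {x<..y} t \<partial>lborel) = (\<integral>\<^sup>+t\<in>{x..y}. ennreal (?g2 t) \<partial>lborel)"
   by (rule nn_integral_cong_AE) (use AE_lborel_singleton[of x] in \<open>auto elim!: eventually_mono simp: indicator_def\<close>)
  also have "... = ennreal (integral {x..y} ?g2)"
  proof (rule nn_integral_Icc_eq_integral)
   have "(\<lambda>t. if t \<in> {a..b} then 2 * g t else 0) integrable_on UNIV"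
    unfolding integrable_restrict_UNIV using integrable_on_cmult_left[OF gi, of 2] by simp
   then have "?g2 integrable_on UNIV"
    by (rule integrable_eq) (auto simp: indicator_def)
   then show "?g2 integrable_on {x..y}" by (rule integrable_on_subinterval) auto
  qed (auto simp: g0)
  finally show ?thesis by (simp add: ga that)
 qed
 let ?M = "density lborel (\<lambda>t. ennreal (?g2 t))"
 have Ioc: "emeasure ?M {x<..y} = ennreal (F1 y - F1 x + (F2 y - F2 x))" if "x <= y" for x y
 proof -
  have "F1 y - F1 x + (F2 y - F2 x) = 2 * (G y - G x)" by (simp add: F1_def F2_def)
  then show ?thesis using nng[OF that] by (simp add: emeasure_density)
 qed
 have "absolutely_continuous lborel (interval_measure F1)"
  unfolding absolutely_continuous_def
 proof
  fix A assume A: "A \<in> null_sets (lborel :: real measure)"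
  then have Ab: "A \<in> sets borel" by (auto simp: null_sets_def)
  have "A \<in> null_sets ?M"
   using A absolutely_continuousI_density[of "\<lambda>t. ennreal (?g2 t)" lborel]
   unfolding absolutely_continuous_def by auto
  then have "emeasure ?M A = 0" by auto
  with Ab emeasure_eq_sum_interval_measures[of F1 F2 ?M, OF m1 m2 c1 c2 _ Ioc Ab]
  show "A \<in> null_sets (interval_measure F1)" by (auto simp: null_sets_def)
 qed
 then obtain k where k [measurable]: "k \<in> borel_measurable lborel" and kd: "density lborel k = interval_measure F1"
  using sigma_finite_measure.Radon_Nikodym[OF sigma_finite_lborel, of "interval_measure F1"] by auto
 have kioc: "(\<integral>\<^sup>+t. k t * indicator {x<..y} t \<partial>lborel) = ennreal (F1 y - F1 x)" if "x <= y" for x y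
  using emeasure_interval_measure_Ioc[of x y F1] that m1 c1 unfolding kd[symmetric]
  by (simp add: emeasure_density)
 \<comment> \<open>The Radon-Nikodym density is extended-real; it is finite almost everywhere on
   \<open>{a<..b}\<close> because its integral there is finite.\<close>
 define kr where "kr t = enn2real (k t)" for t
 have kr [measurable]: "kr \<in> borel_fun" unfolding kr_def by measurable
 have "AE t in lborel. k t * indicator {a<..b} t \<noteq> \<infinity>"
  by (rule nn_integral_PInf_AE) (use kioc[of a b] ab in auto)
 then have kfin: "AE t in lborel. t \<in> {a<..b} --> ennreal (kr t) = k t"
  by eventually_elim (auto simp: kr_def ennreal_enn2real_if)
 have krI: "(\<integral>\<^sup>+t\<in>{x..y}. ennreal (kr t) \<partial>lborel) = ennreal (F1 y - F1 x)" if "a <= x" "x <= y" "y <= b" for x y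
  unfolding kioc[OF that(2), symmetric]
  by (rule nn_integral_cong_AE)
   ((use AE_lborel_singleton[of x] kfin in eventually_elim), (use that in \<open>auto simp: indicator_def\<close>))
 have kri: "kr integrable_on {a..b}"
  by (rule integrable_on_Icc_if_nn_integral_finite) (use krI[of a b] ab in \<open>auto simp: kr_def\<close>)
 have krint: "integral {x..y} kr = F1 y - F1 x" if "a <= x" "x <= y" "y <= b" for x y
 proof -
  have i: "kr integrable_on {x..y}" using kri that by (auto intro: integrable_subinterval_real)
  have "ennreal (integral {x..y} kr) = ennreal (F1 y - F1 x)"
   using nn_integral_Icc_eq_integral[of kr, OF _ i] krI[OF that] by (simp add: kr_def)
  moreover have "0 <= integral {x..y} kr" using i by (intro integral_nonneg) (auto simp: kr_def)
  ultimately show ?thesis using m1[OF that(2)] by simp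
 qed
 show thesis
 proof (rule that)
  show "(\<lambda>x. kr x - g x) \<in> borel_fun" by measurable
  show "(\<lambda>x. kr x - g x) integrable_on {a..b}" using kri gi by (rule integrable_diff)
  fix s t assume st: "a <= s" "s <= t" "t <= b"
  have "integral {s..t} (\<lambda>x. kr x - g x) = integral {s..t} kr - integral {s..t} g"
   by (rule integral_diff) (use kri gi st in \<open>auto intro: integrable_subinterval_real\<close>)
  also have "... = F1 t - F1 s - (G t - G s)"
   using krint[OF st] Gd[OF st(2)] st by (simp add: cl_def)
  also have "... = \<phi> t - \<phi> s" using st by (simp add: F1_def cl_def)
  finally show "\<phi> t - \<phi> s = integral {s..t} (\<lambda>x. kr x - g x)" by simp
 qed
qed

text \<open>Where both indefinite integrals are differentiable, their difference quotients satisfy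
  the inequality on either side of \<open>t\<close>, and it survives the limit.\<close>

lemma indefinite_integral_derivative_le:
 fixes \<phi> \<psi> g :: "real => real"
 assumes "\<psi> integrable_on {a..b}" "g integrable_on {a..b}"
  and "!!s t. a <= s ==> s <= t ==> t <= b ==> \<bar>integral {s..t} \<psi>\<bar> <= integral {s..t} g"
 obtains N where "negligible N" "!!t. t \<in> {a<..<b} - N ==> \<bar>\<psi> t\<bar> <= g t"
proof -
 obtain N1 where N1: "negligible N1" "!!t. t \<in> {a<..<b} - N1 ==> ((\<lambda>s. integral {a..s} \<psi>) has_real_derivative \<psi> t) (at t)"
  using lebesgue_differentiation[OF assms(1)] by blast
 obtain N2 where N2: "negligible N2" "!!t. t \<in> {a<..<b} - N2 ==> ((\<lambda>s. integral {a..s} g) has_real_derivative g t) (at t)"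
  using lebesgue_differentiation[OF assms(2)] by blast
 show thesis
 proof (rule that[of "N1 \<union> N2"])
  show "negligible (N1 \<union> N2)" using N1 N2 by simp
  fix t assume t: "t \<in> {a<..<b} - (N1 \<union> N2)"
  have "((\<lambda>s. \<bar>(integral {a..s} \<psi> - integral {a..t} \<psi>) / (s - t)\<bar>) \<longlongrightarrow> \<bar>\<psi> t\<bar>) (at t)"
   using N1(2)[of t] t by (intro tendsto_rabs) (simp add: has_field_derivative_iff)
  moreover have "((\<lambda>s. (integral {a..s} g - integral {a..t} g) / (s - t)) \<longlongrightarrow> g t) (at t)"
   using N2(2)[of t] t by (auto simp: has_field_derivative_iff)
  moreover have "eventually (\<lambda>s. s \<in> {a<..<b}) (at t)" using t by (intro eventually_at_in_open') auto
  then have "eventually (\<lambda>s. \<bar>(integral {a..s} \<psi> - integral {a..t} \<psi>) / (s - t)\<bar> <= (integral {a..s} g - integral {a..t} g) / (s - t)) (at t)"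
  proof eventually_elim
   case (elim s)
   have tt: "t \<in> {a<..<b}" using t by simp
   show ?case
   proof (cases "s <= t")
    case True
    then have "\<bar>integral {a..t} \<psi> - integral {a..s} \<psi>\<bar> <= integral {a..t} g - integral {a..s} g"
     using assms(3)[of s t] integral_Icc_split[OF assms(1), of s t] integral_Icc_split[OF assms(2), of s t] elim tt by auto
    moreover have "(integral {a..s} g - integral {a..t} g) / (s - t) = (integral {a..t} g - integral {a..s} g) / (t - s)"
     "(integral {a..s} \<psi> - integral {a..t} \<psi>) / (s - t) = (integral {a..t} \<psi> - integral {a..s} \<psi>) / (t - s)"
     by (metis minus_diff_eq minus_divide_divide)+
    ultimately show ?thesis using True by (simp add: divide_right_mono)
   next
    case False
    then have "\<bar>integral {a..s} \<psi> - integral {a..t} \<psi>\<bar> <= integral {a..s} g - integral {a..t} g"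
     using assms(3)[of t s] integral_Icc_split[OF assms(1), of t s] integral_Icc_split[OF assms(2), of t s] elim tt by auto
    then show ?thesis using False by (simp add: divide_right_mono)
   qed
  qed
  ultimately show "\<bar>\<psi> t\<bar> <= g t"
   using tendsto_le[OF _ \<open>((\<lambda>s. (integral {a..s} g - integral {a..t} g) / (s - t)) \<longlongrightarrow> g t) (at t)\<close>] by simp
 qed
qed

section \<open>Metric speed and test plans\<close>

text \<open>The speed is obtained as the supremum, over a countable dense set of base points
  \<open>y n\<close>, of the derivatives of the distance functions \<open>\<phi> n\<close>. Each
  \<open>\<phi> n\<close> is a real function whose increments are dominated by \<open>g\<close>, so
  it has a density; density of the base points recovers the metric.\<close>

lemma metric_derivative:
 fixes cv :: "real => 'x::{metric_space, second_countable_topology}"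
 assumes g [measurable]: "g \<in> borel_fun" and g0: "!!x. 0 <= g x"
  and gi: "g integrable_on {0..1}"
  and dg: "!!s t. 0 <= s ==> s <= t ==> t <= 1 ==> dist (cv s) (cv t) <= integral {s..t} g"
 obtains m N where "m \<in> borel_fun" "m integrable_on {0..1}" "!!x. 0 <= m x" "!!x. m x <= g x"
  "!!s t. 0 <= s ==> s <= t ==> t <= 1 ==> dist (cv s) (cv t) <= integral {s..t} m"
  "negligible N" "!!t. t \<in> {0<..<1} - N ==> ((\<lambda>s. dist (cv s) (cv t) / \<bar>s - t\<bar>) \<longlongrightarrow> m t) (at t)"
proof -
 obtain D :: "'x set" where D: "countable D" "!!X. open X ==> X \<noteq> {} ==> \<exists>d\<in>D. d \<in> X"
  using countable_dense_setE by blast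
 have Dne: "D \<noteq> {}" using D(2)[of UNIV] by auto
 define y where "y = from_nat_into D"
 have ydense: "\<exists>n. dist x (y n) < e" if "0 < e" for x e
 proof -
  have "ball x e \<noteq> {}" using that by auto
  then obtain d where "d \<in> D" "d \<in> ball x e" using D(2)[of "ball x e"] by auto
  then show ?thesis using from_nat_into_surj[OF D(1), of d] by (auto simp: y_def)
 qed
 define \<phi> where "\<phi> n t = dist (cv t) (y n)" for n t
 have \<phi>d: "\<bar>\<phi> n t - \<phi> n s\<bar> <= dist (cv s) (cv t)" for n s t
  using abs_dist_diff_le[of "cv t" "y n" "cv s"] by (simp add: \<phi>_def dist_commute)
 have "\<exists>\<psi>. \<psi> \<in> borel_fun \<and> \<psi> integrable_on {0..1} \<and>
  (\<forall>s t. 0 <= s --> s <= t --> t <= 1 --> \<phi> n t - \<phi> n s = integral {s..t} \<psi>)" for n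
 proof -
  have *: "\<bar>\<phi> n t - \<phi> n s\<bar> <= integral {s..t} g" if "0 <= s" "s <= t" "t <= 1" for s t
   using dg[OF that] \<phi>d[of n t s] by linarith
  show ?thesis
   by (rule absolutely_continuous_density[OF g gi g0 zero_less_one, of "\<phi> n"]) (erule (2) *, blast)
 qed
 then obtain \<psi> where \<psi> [measurable]: "!!n. \<psi> n \<in> borel_fun"
  and \<psi>i: "!!n. \<psi> n integrable_on {0..1}"
  and \<psi>: "!!n s t. 0 <= s ==> s <= t ==> t <= 1 ==> \<phi> n t - \<phi> n s = integral {s..t} (\<psi> n)"
  by metis
 \<comment> \<open>Capping by \<open>g t\<close> makes the supremum finite at every point; off the
   null sets \<open>N1 n\<close> the cap has no effect.\<close>
 define m where "m t = (SUP n. min \<bar>\<psi> n t\<bar> (g t))" for t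
 have bdd: "bdd_above (range (\<lambda>n. min \<bar>\<psi> n t\<bar> (g t)))" for t
  by (rule bdd_aboveI[of _ "g t"]) auto
 have mb [measurable]: "m \<in> borel_fun"
  unfolding m_def by (rule borel_measurable_cSUP) (auto simp: bdd)
 have up: "min \<bar>\<psi> n t\<bar> (g t) <= m t" for n t
  unfolding m_def by (rule cSUP_upper[OF _ bdd]) simp
 have m0: "0 <= m t" for t using up[of 0 t] g0[of t] by (auto simp: min_def split: if_splits)
 have mg: "m t <= g t" for t unfolding m_def by (rule cSUP_least) auto
 have mi: "m integrable_on {0..1}"
 proof (rule integrable_on_Icc_if_nn_integral_finite[OF mb m0])
  have "(\<integral>\<^sup>+x\<in>{0..1}. ennreal (m x) \<partial>lborel) <= (\<integral>\<^sup>+x\<in>{0..1}. ennreal (g x) \<partial>lborel)"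
   by (intro nn_integral_mono mult_right_mono) (auto simp: mg ennreal_leI)
  also have "... = ennreal (integral {0..1} g)" by (rule nn_integral_Icc_eq_integral[OF g0 gi])
  finally show "(\<integral>\<^sup>+x\<in>{0..1}. ennreal (m x) \<partial>lborel) < \<infinity>" by (simp add: le_less_trans)
 qed
 have "\<exists>N. negligible N \<and> (\<forall>t\<in>{0<..<1} - N. \<bar>\<psi> n t\<bar> <= g t)" for n
 proof -
  have *: "\<bar>integral {s..t} (\<psi> n)\<bar> <= integral {s..t} g" if "0 <= s" "s <= t" "t <= 1" for s t
   using \<psi>[OF that, of n] dg[OF that] \<phi>d[of n t s] by linarith
  show ?thesis
   by (rule indefinite_integral_derivative_le[OF \<psi>i gi, of n]) (erule (2) *, blast)
 qed
 then obtain N1 where N1: "!!n. negligible (N1 n)" "!!n t. t\<in>{0<..<1} - N1 n ==> \<bar>\<psi> n t\<bar> <= g t" by metis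
 have "\<exists>N. negligible N \<and> (\<forall>t\<in>{0<..<1} - N. ((\<lambda>s. integral {0..s} (\<psi> n)) has_real_derivative \<psi> n t) (at t))" for n
  using lebesgue_differentiation[OF \<psi>i[of n]] by metis
 then obtain N2 where N2: "!!n. negligible (N2 n)"
  "!!n t. t\<in>{0<..<1} - N2 n ==> ((\<lambda>s. integral {0..s} (\<psi> n)) has_real_derivative \<psi> n t) (at t)" by metis
 obtain N3 where N3: "negligible N3" "!!t. t\<in>{0<..<1} - N3 ==> ((\<lambda>s. integral {0..s} m) has_real_derivative m t) (at t)"
  using lebesgue_differentiation[OF mi] by blast
 have dm: "dist (cv s) (cv t) <= integral {s..t} m" if st: "0 <= s" "s <= t" "t <= 1" for s t
 proof (rule field_le_epsilon)
  fix e :: real assume "0 < e"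
  \<comment> \<open>A base point close to \<open>cv s\<close> makes
    \<open>dist (cv s) (cv t)\<close> at most \<open>\<phi> n t - \<phi> n s\<close> up to twice the
    distance to it.\<close>
  then obtain n where n: "dist (cv s) (y n) < e / 2" using ydense[of "e/2" "cv s"] by auto
  \<comment> \<open>Replacing \<open>m\<close> by \<open>\<psi> n\<close> on a null set turns an
    almost everywhere bound into a pointwise one without changing the integral.\<close>
  let ?m = "\<lambda>x. if x \<in> N1 n \<union> {0,1} then \<psi> n x else m x"
  have mi': "m integrable_on {s..t}" using mi st by (auto intro: integrable_subinterval_real)
  have neg: "negligible (N1 n \<union> {0,1})" using N1(1) by (simp add: negligible_Un)
  have "integral {s..t} (\<psi> n) <= integral {s..t} ?m"
  proof (rule integral_le)
   show "\<psi> n integrable_on {s..t}" by (rule integrable_subinterval_real[OF \<psi>i]) (use st in auto)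
   show "?m integrable_on {s..t}" by (rule integrable_spike[OF mi' neg]) auto
   show "\<psi> n x <= ?m x" if x: "x \<in> {s..t}" for x
   proof (cases "x \<in> N1 n \<union> {0,1}")
    case False
    then have "\<bar>\<psi> n x\<bar> <= g x" using N1(2)[of x n] x st by auto
    then show ?thesis using up[of n x] False by (simp add: min_def)
   qed simp
  qed
  also have "integral {s..t} ?m = integral {s..t} m" by (rule integral_spike[OF neg]) auto
  finally have "\<phi> n t - \<phi> n s <= integral {s..t} m" using \<psi>[OF st] by simp
  moreover have "dist (cv s) (cv t) <= \<phi> n s + \<phi> n t"
   unfolding \<phi>_def by (metis dist_commute dist_triangle)
  moreover have "\<phi> n s < e / 2" using n by (simp add: \<phi>_def)
  ultimately show "dist (cv s) (cv t) <= integral {s..t} m + e" by linarith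
 qed
 define N where "N = (\<Union>n. N1 n) \<union> (\<Union>n. N2 n) \<union> N3"
 show thesis
 proof (rule that[OF mb mi m0 mg])
  show "dist (cv s) (cv t) <= integral {s..t} m" if "0 <= s" "s <= t" "t <= 1" for s t
   using that by (rule dm)
  show "negligible N" unfolding N_def using N1(1) N2(1) N3(1) by (intro negligible_Un negligible_Union_nat) auto
  fix t assume t: "t \<in> {0<..<1} - N"
  then have t01: "t \<in> {0<..<1}" and tN: "!!n. t \<notin> N1 n" "!!n. t \<notin> N2 n" "t \<notin> N3" by (auto simp: N_def)
  have ev: "eventually (\<lambda>s. s \<in> {0<..<1}) (at t)" using t01 by (intro eventually_at_in_open') auto
  have ev2: "eventually (\<lambda>s. s \<noteq> t) (at t)" by (simp add: eventually_at_filter)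
  show "((\<lambda>s. dist (cv s) (cv t) / \<bar>s - t\<bar>) \<longlongrightarrow> m t) (at t)"
  proof (rule order_tendstoI)
   \<comment> \<open>From below: some \<open>\<bar>\<psi> n t\<bar>\<close> exceeds
     \<open>a\<close>, and the quotients of the 1-Lipschitz image \<open>\<phi> n\<close> of the
     curve are at most those of the curve.\<close>
   fix a assume "a < m t"
   then obtain n where n: "a < \<bar>\<psi> n t\<bar>" unfolding m_def using less_cSUP_iff[OF _ bdd[of t], of a] by auto
   have "((\<lambda>s. (integral {0..s} (\<psi> n) - integral {0..t} (\<psi> n)) / (s - t)) \<longlongrightarrow> \<psi> n t) (at t)"
    using N2(2)[of t n] t01 tN by (simp add: has_field_derivative_iff)
   then have "((\<lambda>s. \<bar>(integral {0..s} (\<psi> n) - integral {0..t} (\<psi> n)) / (s - t)\<bar>) \<longlongrightarrow> \<bar>\<psi> n t\<bar>) (at t)"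
    by (rule tendsto_rabs)
   then have "eventually (\<lambda>s. a < \<bar>(integral {0..s} (\<psi> n) - integral {0..t} (\<psi> n)) / (s - t)\<bar>) (at t)"
    using n by (rule order_tendstoD)
   with ev show "eventually (\<lambda>s. a < dist (cv s) (cv t) / \<bar>s - t\<bar>) (at t)"
   proof eventually_elim
    case (elim s)
    have "integral {0..s} (\<psi> n) - integral {0..t} (\<psi> n) = \<phi> n s - \<phi> n t"
     using \<psi>[of 0 s n] \<psi>[of 0 t n] elim t01 by auto
    moreover have "\<bar>\<phi> n s - \<phi> n t\<bar> / \<bar>s - t\<bar> <= dist (cv s) (cv t) / \<bar>s - t\<bar>"
     using \<phi>d[of n s t] by (intro divide_right_mono) (auto simp: dist_commute)
    ultimately show ?case using elim by (simp add: abs_divide)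
   qed
  next
   \<comment> \<open>From above: the quotients of the curve are at most those of the indefinite
     integral of \<open>m\<close>.\<close>
   fix a assume a: "m t < a"
   have "((\<lambda>s. (integral {0..s} m - integral {0..t} m) / (s - t)) \<longlongrightarrow> m t) (at t)"
    using N3(2)[of t] t01 tN by (simp add: has_field_derivative_iff)
   then have "eventually (\<lambda>s. (integral {0..s} m - integral {0..t} m) / (s - t) < a) (at t)"
    using a by (rule order_tendstoD)
   with ev ev2 show "eventually (\<lambda>s. dist (cv s) (cv t) / \<bar>s - t\<bar> < a) (at t)"
   proof eventually_elim
    case (elim s)
    have "dist (cv s) (cv t) <= \<bar>integral {0..s} m - integral {0..t} m\<bar> \<and>
     (integral {0..s} m - integral {0..t} m) / (s - t) = \<bar>integral {0..s} m - integral {0..t} m\<bar> / \<bar>s - t\<bar>"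
    proof (cases "s < t")
     case True
     have "integral {s..t} m = integral {0..t} m - integral {0..s} m"
      by (rule integral_Icc_split[OF mi]) (use True elim t01 in auto)
     moreover have "0 <= integral {s..t} m"
      using mi elim t01 by (intro integral_nonneg) (auto simp: m0 intro: integrable_subinterval_real)
     ultimately show ?thesis using dm[of s t] True elim t01
      by (auto simp: minus_divide_divide[symmetric, of "integral {0..s} m - integral {0..t} m"])
    next
     case False
     have "integral {t..s} m = integral {0..s} m - integral {0..t} m"
      by (rule integral_Icc_split[OF mi]) (use False elim t01 in auto)
     moreover have "0 <= integral {t..s} m"
      using mi elim t01 by (intro integral_nonneg) (auto simp: m0 intro: integrable_subinterval_real)
     ultimately show ?thesis using dm[of t s] False elim t01 by (auto simp: dist_commute)
    qed
    then have "dist (cv s) (cv t) / \<bar>s - t\<bar> <= (integral {0..s} m - integral {0..t} m) / (s - t)"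
     by (simp add: divide_right_mono)
    then show ?case using elim by linarith
   qed
  qed
 qed
qed

section \<open>A measurable version of the metric speed\<close>

text \<open>Defined by a limit along one sequence, hence jointly measurable in curve and time,
  unlike what the definition of \<open>metric_speed\<close> shows directly. \<open>lim\<close> is
  total, and the absolute value makes the result nonnegative even where the limit fails to exist.
  The times \<open>t + 1 / real (Suc n)\<close> may exceed 1, where curves are still
  defined.\<close>

definition speed :: "(real => 'x::metric_space) => real => real" where
 "speed cv t = \<bar>lim (\<lambda>n. real (Suc n) * dist (cv (t + 1 / real (Suc n))) (cv t))\<bar>"

lemma speed_nonneg [simp]: "0 <= speed cv t"
 by (simp add: speed_def)

lemma borel_measurable_speed:
 fixes cv :: "real => 'x::{metric_space, second_countable_topology}"
 assumes "continuous_on UNIV cv"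
 shows "speed cv \<in> borel_fun"
proof -
 have [measurable]: "cv \<in> borel_fun" using assms by (rule borel_measurable_continuous_onI)
 show ?thesis unfolding speed_def by measurable
qed

lemma eq_metric_speed_if_tendsto:
 assumes t: "t \<in> {0<..<1}" and l: "((\<lambda>s. dist (cv s) (cv t) / \<bar>s - t\<bar>) \<longlongrightarrow> l) (at t)"
 shows "metric_speed cv t = l" "speed cv t = l"
proof -
 have w: "at t within {0..1} = at t" using t by (intro at_within_interior) auto
 have "Lim (at t) (\<lambda>s. dist (cv s) (cv t) / \<bar>s - t\<bar>) = l"
  using l by (intro tendsto_Lim) auto
 then show "metric_speed cv t = l" unfolding metric_speed_def w using l by auto
 have l0: "0 <= l" using l by (rule tendsto_lowerbound) (auto intro!: always_eventually)
 have "(\<lambda>n. t + 1 / real (Suc n)) \<longlonglongrightarrow> t + 0"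
  by (intro tendsto_intros LIMSEQ_Suc lim_1_over_n)
 then have "filterlim (\<lambda>n. t + 1 / real (Suc n)) (at t) sequentially"
  by (intro filterlim_atI) auto
 from filterlim_compose[OF l this]
 have "(\<lambda>n. real (Suc n) * dist (cv (t + 1 / real (Suc n))) (cv t)) \<longlonglongrightarrow> l"
  by (simp add: mult.commute)
 then show "speed cv t = l" using l0 by (simp add: speed_def limI)
qed

lemma le_one_plus_powr:
 fixes x q :: real assumes "0 <= x" "1 <= q" shows "x <= 1 + x powr q"
proof (cases "x <= 1")
 case True then show ?thesis using powr_ge_zero[of x q] by linarith
next
 case False
 then have "x powr 1 <= x powr q" using assms by (intro powr_mono) auto
 then show ?thesis using False by simp
qed

lemma nn_integral_finite_if_powr:
 fixes h :: "real => real"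
 assumes [measurable]: "h \<in> borel_fun" and "!!t. 0 <= h t" and q: "1 <= q"
  and fin: "(\<integral>\<^sup>+t\<in>{0..1}. ennreal (h t powr q) \<partial>lborel) < \<infinity>"
 shows "(\<integral>\<^sup>+t\<in>{0..1}. ennreal (h t) \<partial>lborel) < \<infinity>"
proof -
 have "(\<integral>\<^sup>+t\<in>{0..1}. ennreal (h t) \<partial>lborel) <= (\<integral>\<^sup>+t. indicator {0..1::real} t + ennreal (h t powr q) * indicator {0..1} t \<partial>lborel)"
 proof (rule nn_integral_mono)
  fix t
  have "ennreal (h t) <= ennreal (1 + h t powr q)" using le_one_plus_powr assms by (intro ennreal_leI) auto
  also have "... = 1 + ennreal (h t powr q)" by simp
  finally show "ennreal (h t) * indicator {0..1} t <= indicator {0..1} t + ennreal (h t powr q) * indicator {0..1} t"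
   by (auto simp: indicator_def)
 qed
 also have "... = (\<integral>\<^sup>+t. indicator {0..1::real} t \<partial>lborel) + (\<integral>\<^sup>+t\<in>{0..1}. ennreal (h t powr q) \<partial>lborel)"
  by (rule nn_integral_add) auto
 also have "... < \<infinity>" using fin by (simp add: nn_integral_indicator)
 finally show ?thesis .
qed

text \<open>Any witness \<open>g\<close> of \<open>AC\<close> dominates the metric derivative, which
  is almost everywhere the genuine two-sided limit and so equals both \<open>metric_speed\<close>
  and \<open>speed\<close>. Thus \<open>speed\<close> is itself a witness and \<open>g\<close> can
  be forgotten.\<close>

lemma AC_speed:
 fixes cv :: "real => 'x::{metric_space, second_countable_topology}"
 assumes ac: "AC q cv" and q: "1 <= q" and cont: "continuous_on UNIV cv"
 shows "AE t in lborel. t \<in> {0..1} --> metric_speed cv t = speed cv t"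
  and "(\<integral>\<^sup>+t\<in>{0..1}. ennreal (speed cv t powr q) \<partial>lborel) < \<infinity>"
  and "!!s t. 0 <= s ==> s <= t ==> t <= 1 ==> ennreal (dist (cv s) (cv t)) <= (\<integral>\<^sup>+r\<in>{s..t}. ennreal (speed cv r) \<partial>lborel)"
  and "\<exists>N. negligible N \<and> (\<forall>t\<in>{0<..<1} - N. ((\<lambda>s. dist (cv s) (cv t) / \<bar>s - t\<bar>) \<longlongrightarrow> speed cv t) (at t))"
proof -
 obtain g where g [measurable]: "g \<in> borel_fun" and g0: "!!t. 0 <= g t"
  and gq: "set_integrable lborel {0..1} (\<lambda>t. g t powr q)"
  and dg: "!!s t. 0 <= s ==> s <= t ==> t <= 1 ==> ennreal (dist (cv s) (cv t)) <= (\<integral>\<^sup>+r\<in>{s..t}. ennreal (g r) \<partial>lborel)"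
  using ac unfolding AC_def by blast
 have gfin: "(\<integral>\<^sup>+t\<in>{0..1}. ennreal (g t powr q) \<partial>lborel) < \<infinity>"
 proof -
  have "(\<integral>\<^sup>+t\<in>{0..1}. ennreal (g t powr q) \<partial>lborel) = (\<integral>\<^sup>+t. ennreal (norm (indicator {0..1} t *\<^sub>R g t powr q)) \<partial>lborel)"
   by (intro nn_integral_cong) (auto simp: indicator_def)
  also have "... < \<infinity>" using gq unfolding set_integrable_def integrable_iff_bounded by simp
  finally show ?thesis .
 qed
 have gi: "g integrable_on {0..1}"
  using integrable_on_Icc_if_nn_integral_finite[OF g g0 nn_integral_finite_if_powr[OF g g0 q gfin]] .
 have dg': "dist (cv s) (cv t) <= integral {s..t} g" if "0 <= s" "s <= t" "t <= 1" for s t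
 proof -
  have i: "g integrable_on {s..t}" using gi that by (auto intro: integrable_subinterval_real)
  have "ennreal (dist (cv s) (cv t)) <= ennreal (integral {s..t} g)"
   using dg[OF that] nn_integral_Icc_eq_integral[OF g0 i] by simp
  then show ?thesis using i by (subst (asm) ennreal_le_iff) (auto intro: integral_nonneg g0)
 qed
 obtain m N where m: "m \<in> borel_fun" "m integrable_on {0..1}" "!!x. 0 <= m x" "!!x. m x <= g x"
  "!!s t. 0 <= s ==> s <= t ==> t <= 1 ==> dist (cv s) (cv t) <= integral {s..t} m"
  "negligible N" "!!t. t \<in> {0<..<1} - N ==> ((\<lambda>s. dist (cv s) (cv t) / \<bar>s - t\<bar>) \<longlongrightarrow> m t) (at t)"
  by (rule metric_derivative[OF g g0 gi, of cv]) (erule (2) dg', blast)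
 note [measurable] = m(1) borel_measurable_speed[OF cont]
 have "negligible (N \<union> {0,1})" using m(6) by (simp add: negligible_Un)
 then have "AE t in lebesgue. t \<notin> N \<union> {0,1}"
  using AE_not_in negligible_iff_null_sets by blast
 then have "AE t in lebesgue. t \<in> {0..1} --> metric_speed cv t = m t \<and> speed cv t = m t"
 proof eventually_elim
  case (elim t)
  show ?case
  proof
   assume "t \<in> {0..1}"
   with elim have "t \<in> {0<..<1}" "t \<in> {0<..<1} - N" by (auto simp: less_le)
   then show "metric_speed cv t = m t \<and> speed cv t = m t" using eq_metric_speed_if_tendsto m(7) by blast
  qed
 qed
 then have ae: "AE t in lborel. t \<in> {0..1} --> metric_speed cv t = m t \<and> speed cv t = m t"
  by (simp add: AE_completion_iff)
 from ae show "AE t in lborel. t \<in> {0..1} --> metric_speed cv t = speed cv t" by eventually_elim auto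
 have "(\<integral>\<^sup>+t\<in>{0..1}. ennreal (speed cv t powr q) \<partial>lborel) <= (\<integral>\<^sup>+t\<in>{0..1}. ennreal (g t powr q) \<partial>lborel)"
  by (rule nn_integral_mono_AE) (use ae in \<open>eventually_elim, auto simp: indicator_def m order_trans[OF zero_le_one q] intro!: ennreal_leI powr_mono2\<close>)
 then show "(\<integral>\<^sup>+t\<in>{0..1}. ennreal (speed cv t powr q) \<partial>lborel) < \<infinity>" using gfin by (rule le_less_trans)
 show "\<exists>N. negligible N \<and> (\<forall>t\<in>{0<..<1} - N. ((\<lambda>s. dist (cv s) (cv t) / \<bar>s - t\<bar>) \<longlongrightarrow> speed cv t) (at t))"
 proof (intro exI[of _ N] conjI ballI m(6))
  fix t assume t: "t \<in> {0<..<1} - N"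
  then show "((\<lambda>s. dist (cv s) (cv t) / \<bar>s - t\<bar>) \<longlongrightarrow> speed cv t) (at t)"
   using m(7)[OF t] eq_metric_speed_if_tendsto(2)[of t cv "m t"] by simp
 qed
 fix s t :: real assume st: "0 <= s" "s <= t" "t <= 1"
 have i: "m integrable_on {s..t}" using m(2) st by (auto intro: integrable_subinterval_real)
 have "ennreal (dist (cv s) (cv t)) <= ennreal (integral {s..t} m)" using m(5)[OF st] by (rule ennreal_leI)
 also have "... = (\<integral>\<^sup>+r\<in>{s..t}. ennreal (m r) \<partial>lborel)" using nn_integral_Icc_eq_integral[of m, OF m(3) i] by simp
 also have "... = (\<integral>\<^sup>+r\<in>{s..t}. ennreal (speed cv r) \<partial>lborel)"
  by (rule nn_integral_cong_AE) ((use ae in eventually_elim), (use st in \<open>auto simp: indicator_def\<close>))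
 finally show "ennreal (dist (cv s) (cv t)) <= (\<integral>\<^sup>+r\<in>{s..t}. ennreal (speed cv r) \<partial>lborel)" .
qed

text \<open>A rational approximation from below, monotone in \<open>x\<close> and with countably
  many values for each \<open>n\<close>. Monotonicity lets inequalities on ordered pairs of rational
  times pass to all times; countability reduces evaluation at a variable time to evaluation at fixed
  times.\<close>

definition rat_floor :: "nat => real => real" where
 "rat_floor n x = real_of_int \<lfloor>real (Suc n) * x\<rfloor> / real (Suc n)"

lemma rat_floor:
 shows "rat_floor n x \<in> \<rat>" "rat_floor n x <= x" "x - 1 / real (Suc n) <= rat_floor n x"
  "x <= y ==> rat_floor n x <= rat_floor n y" "0 <= x ==> 0 <= rat_floor n x" "(\<lambda>n. rat_floor n x) \<longlonglongrightarrow> x"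
proof -
 show "rat_floor n x \<in> \<rat>" by (simp add: rat_floor_def)
 have le: "rat_floor n x <= x" for n
 proof -
  have "of_int \<lfloor>real (Suc n) * x\<rfloor> <= real (Suc n) * x" by (rule of_int_floor_le)
  then show ?thesis unfolding rat_floor_def by (simp add: divide_le_eq mult.commute)
 qed
 then show "rat_floor n x <= x" .
 have ge: "x - 1 / real (Suc n) <= rat_floor n x" for n
 proof -
  have "real (Suc n) * x - 1 <= of_int \<lfloor>real (Suc n) * x\<rfloor>" by linarith
  then have "(real (Suc n) * x - 1) / real (Suc n) <= rat_floor n x"
   unfolding rat_floor_def by (rule divide_right_mono) simp
  then show ?thesis by (simp add: diff_divide_distrib)
 qed
 then show "x - 1 / real (Suc n) <= rat_floor n x" .
 show "x <= y ==> rat_floor n x <= rat_floor n y"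
  unfolding rat_floor_def by (intro divide_right_mono) (auto intro!: floor_mono mult_left_mono)
 show "0 <= x ==> 0 <= rat_floor n x" by (simp add: rat_floor_def)
 have "(\<lambda>n. x - 1 / real (Suc n)) \<longlonglongrightarrow> x - 0"
  by (intro tendsto_intros LIMSEQ_Suc lim_1_over_n)
 then show "(\<lambda>n. rat_floor n x) \<longlonglongrightarrow> x"
  using tendsto_sandwich[OF always_eventually always_eventually _ tendsto_const, of "\<lambda>n. x - 1 / real (Suc n)" "\<lambda>n. rat_floor n x" x] le ge
  by simp
qed

text \<open>The witness quantified in \<open>AC\<close> becomes \<open>speed\<close> and the times
  become rational, which leaves countably many conditions; measurability of the set of absolutely
  continuous curves rests on this. Continuity of the curve and of the indefinite integral of
  \<open>speed\<close> recovers all times.\<close>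

lemma AC_iff_speed:
 fixes cv :: "real => 'x::{metric_space, second_countable_topology}"
 assumes q: "1 <= q" and cont: "continuous_on UNIV cv"
 shows "AC q cv \<longleftrightarrow> (\<integral>\<^sup>+t\<in>{0..1}. ennreal (speed cv t powr q) \<partial>lborel) < \<infinity> \<and>
  (\<forall>s\<in>\<rat>. \<forall>t\<in>\<rat>. 0 <= s --> s <= t --> t <= 1 -->
   ennreal (dist (cv s) (cv t)) <= (\<integral>\<^sup>+r\<in>{s..t}. ennreal (speed cv r) \<partial>lborel))" (is "_ \<longleftrightarrow> ?fin \<and> ?le")
proof
 assume "AC q cv" then show "?fin \<and> ?le" using AC_speed[OF _ q cont] by blast
next
 assume H: "?fin \<and> ?le"
 note [measurable] = borel_measurable_speed[OF cont]
 have si: "speed cv integrable_on {0..1}"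
  by (rule integrable_on_Icc_if_nn_integral_finite[OF _ _ nn_integral_finite_if_powr[OF _ _ q]]) (use H in auto)
 define S where "S t = integral {0..t} (speed cv)" for t
 have Sc: "continuous_on {0..1} S" unfolding S_def by (rule indefinite_integral_continuous_1[OF si])
 have nnS: "(\<integral>\<^sup>+r\<in>{s..t}. ennreal (speed cv r) \<partial>lborel) = ennreal (S t - S s)"
  and S_mono: "0 <= S t - S s" if "0 <= s" "s <= t" "t <= 1" for s t
 proof -
  have i: "speed cv integrable_on {s..t}" using si that by (auto intro: integrable_subinterval_real)
  have e: "integral {s..t} (speed cv) = S t - S s" unfolding S_def using si that by (rule integral_Icc_split)
  show "(\<integral>\<^sup>+r\<in>{s..t}. ennreal (speed cv r) \<partial>lborel) = ennreal (S t - S s)"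
   using nn_integral_Icc_eq_integral[OF _ i] e by simp
  show "0 <= S t - S s" using i unfolding e[symmetric] by (intro integral_nonneg) auto
 qed
 have "dist (cv s) (cv t) <= S t - S s" if st: "0 <= s" "s <= t" "t <= 1" for s t
 proof (rule LIMSEQ_le)
  have cvlim: "(\<lambda>n. cv (rat_floor n x)) \<longlonglongrightarrow> cv x" for x
   using cont rat_floor(6) continuous_on_tendsto_compose[OF cont rat_floor(6)] by auto
  have r01: "rat_floor n x \<in> {0..1}" if "0 <= x" "x <= 1" for n x
   using rat_floor(5)[of x n] rat_floor(2)[of n x] that by auto
  have Slim: "(\<lambda>n. S (rat_floor n x)) \<longlonglongrightarrow> S x" if "0 <= x" "x <= 1" for x
   by (rule continuous_on_tendsto_compose[OF Sc rat_floor(6)]) (use that r01 in auto)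
  show "(\<lambda>n. dist (cv (rat_floor n s)) (cv (rat_floor n t))) \<longlonglongrightarrow> dist (cv s) (cv t)"
   by (intro tendsto_dist cvlim)
  show "(\<lambda>n. S (rat_floor n t) - S (rat_floor n s)) \<longlonglongrightarrow> S t - S s"
   by (intro tendsto_diff Slim) (use st in auto)
  show "\<exists>N. \<forall>n\<ge>N. dist (cv (rat_floor n s)) (cv (rat_floor n t)) <= S (rat_floor n t) - S (rat_floor n s)"
  proof (intro exI allI impI)
   fix n
   have a: "0 <= rat_floor n s" "rat_floor n s <= rat_floor n t" "rat_floor n t <= 1"
    using rat_floor(4)[OF st(2)] r01[of s n] r01[of t n] st by auto
   have "ennreal (dist (cv (rat_floor n s)) (cv (rat_floor n t))) <= ennreal (S (rat_floor n t) - S (rat_floor n s))"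
    unfolding nnS[OF a, symmetric] using H a rat_floor(1)[of n s] rat_floor(1)[of n t] by blast
   then show "dist (cv (rat_floor n s)) (cv (rat_floor n t)) <= S (rat_floor n t) - S (rat_floor n s)"
    using S_mono[OF a] by (subst (asm) ennreal_le_iff) auto
  qed
 qed
 then have "ennreal (dist (cv s) (cv t)) <= (\<integral>\<^sup>+r\<in>{s..t}. ennreal (speed cv r) \<partial>lborel)" if "0 <= s" "s <= t" "t <= 1" for s t
  using that nnS[OF that] by (simp add: ennreal_leI)
 moreover have "set_integrable lborel {0..1} (\<lambda>t. speed cv t powr q)"
  unfolding set_integrable_def integrable_iff_bounded
 proof
  have "(\<integral>\<^sup>+t. ennreal (norm (indicator {0..1} t *\<^sub>R speed cv t powr q)) \<partial>lborel) = (\<integral>\<^sup>+t\<in>{0..1}. ennreal (speed cv t powr q) \<partial>lborel)"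
   by (intro nn_integral_cong) (auto simp: indicator_def)
  then show "(\<integral>\<^sup>+t. ennreal (norm (indicator {0..1} t *\<^sub>R speed cv t powr q)) \<partial>lborel) < \<infinity>" using H by simp
 qed measurable
 ultimately show "AC q cv" unfolding AC_def by (intro bexI[of _ "speed cv"]) auto
qed

section \<open>Measurability in curve and time\<close>

abbreviation ev :: "(real \<Rightarrow>\<^sub>C 'x::metric_space) => real => 'x" where
 "ev \<equiv> apply_bcontfun"

abbreviation curve_space :: "(real \<Rightarrow>\<^sub>C 'x::metric_space) measure" where
 "curve_space \<equiv> restrict_space borel curves"

lemma borel_measurable_apply_bcontfun:
 fixes M :: "(real \<Rightarrow>\<^sub>C 'x::polish_space) measure"
 assumes M [measurable_cong]: "sets M = sets curve_space"
 shows "(\<lambda>cv. ev cv t) \<in> borel_measurable M"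
proof -
 have "1-lipschitz_on UNIV (\<lambda>cv::real \<Rightarrow>\<^sub>C 'x. ev cv t)"
  by (intro lipschitz_onI) (auto simp: dist_bounded)
 then have "(\<lambda>cv::real \<Rightarrow>\<^sub>C 'x. ev cv t) \<in> borel_fun"
  by (intro borel_measurable_continuous_onI lipschitz_on_continuous_on)
 then have "(\<lambda>cv::real \<Rightarrow>\<^sub>C 'x. ev cv t) \<in> borel_measurable curve_space"
  by (rule measurable_restrict_space1)
 then show ?thesis by measurable
qed

text \<open>Time is rounded to countably many values, at each of which evaluation is measurable in
  the curve alone; continuity of the curves passes to the limit. No separability of the space of
  curves enters.\<close>

lemma borel_measurable_eval:
 fixes M :: "(real \<Rightarrow>\<^sub>C 'x::polish_space) measure"
 assumes M: "sets M = sets curve_space"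
  and [measurable]: "a \<in> measurable N M" "b \<in> borel_measurable N"
 shows "(\<lambda>x. ev (a x) (b x)) \<in> borel_measurable N"
proof (rule borel_measurable_LIMSEQ_metric)
 note [measurable] = borel_measurable_apply_bcontfun[OF M]
 show "(\<lambda>x. ev (a x) (rat_floor n (b x))) \<in> borel_measurable N" for n
 proof -
  have "(\<lambda>x. (\<lambda>k x. ev (a x) (real_of_int k / real (Suc n))) \<lfloor>real (Suc n) * b x\<rfloor> x) \<in> borel_measurable N"
   by (rule measurable_compose_countable) measurable
  then show ?thesis by (simp add: rat_floor_def)
 qed
 show "(\<lambda>n. ev (a x) (rat_floor n (b x))) \<longlonglongrightarrow> ev (a x) (b x)" for x
  by (rule continuous_on_tendsto_compose[OF continuous_on_apply_bcontfun[of UNIV] rat_floor(6)]) auto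
qed

lemma borel_measurable_speed_eval:
 fixes M :: "(real \<Rightarrow>\<^sub>C 'x::polish_space) measure"
 assumes M: "sets M = sets curve_space"
  and a [measurable]: "a \<in> measurable N M" and b [measurable]: "b \<in> borel_measurable N"
 shows "(\<lambda>x. speed (ev (a x)) (b x)) \<in> borel_measurable N"
proof -
 have [measurable]: "(\<lambda>x. ev (a x) (b x)) \<in> borel_measurable N"
  by (rule borel_measurable_eval[OF M a b])
 have [measurable]: "(\<lambda>x. ev (a x) (b x + 1 / real (Suc n))) \<in> borel_measurable N" for n
  by (rule borel_measurable_eval[OF M a]) measurable
 show ?thesis unfolding speed_def by measurable
qed

text \<open>\<open>ennreal\<close> sends negative numbers to 0, so negative values of
  \<open>G\<close> contribute nothing. \<open>speed\<close> stands in for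
  \<open>metric_speed\<close> for the sake of measurability; over \<open>{0..1}\<close> both give
  the same integral along absolutely continuous curves.\<close>

definition path_int :: "('x::metric_space => real) => (real => 'x) => real => real => ennreal" where
 "path_int G cv s t = (\<integral>\<^sup>+r\<in>{s..t}. ennreal (G (cv r) * speed cv r) \<partial>lborel)"

lemma borel_measurable_path_int:
 fixes M :: "(real \<Rightarrow>\<^sub>C 'x::polish_space) measure"
 assumes M: "sets M = sets curve_space" and [measurable]: "G \<in> borel_fun"
  and a [measurable]: "a \<in> measurable N M" "s \<in> borel_measurable N" "t \<in> borel_measurable N"
 shows "(\<lambda>x. path_int G (ev (a x)) (s x) (t x)) \<in> borel_measurable N"
proof -
 have [measurable]: "(\<lambda>(x, r). ev (a x) r) \<in> borel_measurable (N \<Otimes>\<^sub>M lborel)"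
  unfolding split_beta by (rule borel_measurable_eval[OF M]) measurable
 have [measurable]: "(\<lambda>(x, r). speed (ev (a x)) r) \<in> borel_measurable (N \<Otimes>\<^sub>M lborel)"
  unfolding split_beta by (rule borel_measurable_speed_eval[OF M]) measurable
 have ind: "indicator {s x..t x} r = (if s x <= r \<and> r <= t x then 1 else 0 :: ennreal)" for x r
  by (auto simp: indicator_def)
 show ?thesis unfolding path_int_def ind by measurable
qed

lemma energy_eq:
 fixes cv :: "real \<Rightarrow>\<^sub>C 'x::polish_space"
 assumes q: "1 <= q"
 shows "energy q (ev cv) = (if AC q (ev cv)
  then \<integral>\<^sup>+t\<in>{0..1}. ennreal (speed (ev cv) t powr q) \<partial>lborel else \<infinity>)"
proof (cases "AC q (ev cv)")
 case True
 have "(\<integral>\<^sup>+t\<in>{0..1}. ennreal (metric_speed (ev cv) t powr q) \<partial>lborel) =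
  (\<integral>\<^sup>+t\<in>{0..1}. ennreal (speed (ev cv) t powr q) \<partial>lborel)"
  by (rule nn_integral_cong_AE)
   (use AC_speed(1)[OF True q continuous_on_apply_bcontfun] in \<open>eventually_elim, auto simp: indicator_def\<close>)
 then show ?thesis using True by (simp add: energy_def)
qed (simp add: energy_def)

lemma measurable_AC:
 fixes M :: "(real \<Rightarrow>\<^sub>C 'x::polish_space) measure"
 assumes M: "sets M = sets curve_space" and q: "1 <= q"
 shows "Measurable.pred M (\<lambda>cv. AC q (ev cv))"
proof -
 note [measurable] = borel_measurable_apply_bcontfun[OF M]
 have [measurable]: "(\<lambda>(x, r). speed (ev x) r) \<in> borel_measurable (M \<Otimes>\<^sub>M lborel)"
  unfolding split_beta by (rule borel_measurable_speed_eval[OF M]) measurable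
 show ?thesis
  unfolding AC_iff_speed[OF q continuous_on_apply_bcontfun]
  using countable_rat by (intro pred_intros_logic pred_intros_countable_bounded) measurable
qed

lemma borel_measurable_energy:
 fixes M :: "(real \<Rightarrow>\<^sub>C 'x::polish_space) measure"
 assumes M: "sets M = sets curve_space" and q: "1 <= q"
 shows "(\<lambda>cv. energy q (ev cv)) \<in> borel_measurable M"
proof -
 note [measurable] = measurable_AC[OF M q]
 have [measurable]: "(\<lambda>(x, r). speed (ev x) r) \<in> borel_measurable (M \<Otimes>\<^sub>M lborel)"
  unfolding split_beta by (rule borel_measurable_speed_eval[OF M]) measurable
 show ?thesis unfolding energy_eq[OF q] by measurable
qed

lemma path_int_eq_metric_speed:
 fixes cv :: "real \<Rightarrow>\<^sub>C 'x::polish_space"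
 assumes "AC q (ev cv)" "1 <= q"
 shows "(\<integral>\<^sup>+t\<in>{0..1}. ennreal (G (ev cv t) * metric_speed (ev cv) t) \<partial>lborel)
  = path_int G (ev cv) 0 1"
 unfolding path_int_def
 by (rule nn_integral_cong_AE)
  (use AC_speed(1)[OF assms continuous_on_apply_bcontfun] in \<open>eventually_elim, auto simp: indicator_def\<close>)

text \<open>Young's inequality with constants 1: if \<open>b <= a powr (p - 1)\<close> the product
  is at most \<open>a powr p\<close>, and otherwise solving for \<open>a\<close> bounds it by the
  other summand.\<close>

lemma mult_le_powr_add:
 fixes a b p :: real assumes "0 <= a" "0 <= b" "1 < p"
 shows "a * b <= a powr p + b powr (conj_exp p)"
proof (cases "a = 0 \<or> b = 0")
 case False
 then have ab: "0 < a" "0 < b" using assms by auto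
 show ?thesis
 proof (cases "b <= a powr (p - 1)")
  case True
  then have "a * b <= a powr 1 * a powr (p - 1)" using ab by simp
  also have "... = a powr p" using powr_add[of a 1 "p - 1"] by simp
  finally show ?thesis using powr_ge_zero[of b "conj_exp p"] by linarith
 next
  case False
  then have "(a powr (p - 1)) powr (1 / (p - 1)) <= b powr (1 / (p - 1))"
   using assms by (intro powr_mono2) auto
  then have "a <= b powr (1 / (p - 1))" using ab assms by (simp add: powr_powr)
  then have "a * b <= b powr (1 / (p - 1)) * b powr 1" using ab by simp
  also have "... = b powr (1 / (p - 1) + 1)" by (rule powr_add[symmetric])
  also have "1 / (p - 1) + 1 = conj_exp p" using assms unfolding conj_exp_def by (simp add: field_simps)
  finally show ?thesis using powr_ge_zero[of a p] by linarith
 qed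
qed (use powr_ge_zero in auto)

lemma conj_exp_gt_1: "1 < p ==> 1 < conj_exp p"
 by (simp add: conj_exp_def field_simps)

section \<open>Integral bounds for test plans\<close>

lemma test_plan_AC:
 assumes "test_plan m q \<pi>" and q: "1 <= q"
 shows "AE cv in \<pi>. AC q (ev cv)"
  and "(\<integral>\<^sup>+cv. (\<integral>\<^sup>+t\<in>{0..1}. ennreal (speed (ev cv) t powr q) \<partial>lborel) \<partial>\<pi>) < \<infinity>"
proof -
 have sets: "sets \<pi> = sets curve_space"
  and fin: "(\<integral>\<^sup>+cv. energy q (ev cv) \<partial>\<pi>) < \<infinity>" using assms by (auto simp: test_plan_def)
 have "AE cv in \<pi>. energy q (ev cv) \<noteq> \<infinity>"
  using nn_integral_PInf_AE[OF borel_measurable_energy[OF sets q]] fin by simp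
 then show ac: "AE cv in \<pi>. AC q (ev cv)"
  by eventually_elim (auto simp: energy_def split: if_splits)
 have "(\<integral>\<^sup>+cv. (\<integral>\<^sup>+t\<in>{0..1}. ennreal (speed (ev cv) t powr q) \<partial>lborel) \<partial>\<pi>)
  = (\<integral>\<^sup>+cv. energy q (ev cv) \<partial>\<pi>)"
  by (rule nn_integral_cong_AE) (use ac in \<open>eventually_elim, simp add: energy_eq[OF q]\<close>)
 then show "(\<integral>\<^sup>+cv. (\<integral>\<^sup>+t\<in>{0..1}. ennreal (speed (ev cv) t powr q) \<partial>lborel) \<partial>\<pi>) < \<infinity>"
  using fin by simp
qed

lemma test_plan_bound:
 fixes m :: "'x::polish_space measure"
 assumes "test_plan m q \<pi>" and m: "sets m = sets borel"
 obtains C :: real where "0 < C" "!!t h. t \<in> {0..1} ==> h \<in> borel_fun ==>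
  (\<integral>\<^sup>+cv. h (ev cv t) \<partial>\<pi>) <= ennreal C * (\<integral>\<^sup>+x. h x \<partial>m)"
proof -
 have sets: "sets \<pi> = sets curve_space" using assms by (auto simp: test_plan_def)
 obtain C where C: "C > 0" "!!t B. t\<in>{0..1} ==> B\<in>sets borel ==>
  emeasure (distr \<pi> borel (\<lambda>cv. ev cv t)) B <= ennreal C * emeasure m B"
  using assms by (auto simp: test_plan_def)
 note [measurable] = borel_measurable_apply_bcontfun[OF sets]
 show thesis
 proof (rule that[OF C(1)])
  fix t :: real and h :: "'x => ennreal" assume t: "t \<in> {0..1}" and h [measurable]: "h \<in> borel_fun"
  have "(\<integral>\<^sup>+cv. h (ev cv t) \<partial>\<pi>) = (\<integral>\<^sup>+x. h x \<partial>distr \<pi> borel (\<lambda>cv. ev cv t))"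
   by (simp add: nn_integral_distr)
  also have "... <= (\<integral>\<^sup>+x. h x \<partial>scale_measure (ennreal C) m)"
  proof (rule nn_integral_mono_measure)
   show "sets (distr \<pi> borel (\<lambda>cv. ev cv t)) = sets (scale_measure (ennreal C) m)" using m by simp
   then show "distr \<pi> borel (\<lambda>cv. ev cv t) <= scale_measure (ennreal C) m"
    using C(2)[OF t] by (subst le_measure) auto
  qed
  also have "... = ennreal C * (\<integral>\<^sup>+x. h x \<partial>m)"
   using m by (intro nn_integral_scale_measure) (auto cong: measurable_cong_sets)
  finally show "(\<integral>\<^sup>+cv. h (ev cv t) \<partial>\<pi>) <= ennreal C * (\<integral>\<^sup>+x. h x \<partial>m)" .
 qed
qed

text \<open>Fubini's theorem integrates the compression bound over time.\<close>

lemma test_plan_swap: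
 fixes m :: "'x::polish_space measure"
 assumes tp: "test_plan m q \<pi>" and m: "sets m = sets borel"
 obtains C :: real where "0 < C" "!!h. h \<in> borel_fun ==>
  (\<integral>\<^sup>+cv. (\<integral>\<^sup>+t\<in>{0..1}. h (ev cv t) \<partial>lborel) \<partial>\<pi>) <= ennreal C * (\<integral>\<^sup>+x. h x \<partial>m)"
proof -
 obtain C where C: "0 < C" "!!t h. t \<in> {0..1} ==> h \<in> borel_fun ==>
  (\<integral>\<^sup>+cv. h (ev cv t) \<partial>\<pi>) <= ennreal C * (\<integral>\<^sup>+x. h x \<partial>m)"
  using test_plan_bound[OF tp m] by blast
 have sets: "sets \<pi> = sets curve_space" and "prob_space \<pi>" using tp by (auto simp: test_plan_def)
 then interpret prob_space \<pi> by simp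
 interpret pair_sigma_finite \<pi> lborel ..
 show thesis
 proof (rule that[OF C(1)])
  fix h :: "'x => ennreal" assume h [measurable]: "h \<in> borel_fun"
  have ev [measurable]: "(\<lambda>(x, r). ev x r) \<in> borel_measurable (\<pi> \<Otimes>\<^sub>M lborel)"
   unfolding split_beta by (rule borel_measurable_eval[OF sets]) measurable
  have "(\<integral>\<^sup>+cv. (\<integral>\<^sup>+t\<in>{0..1}. h (ev cv t) \<partial>lborel) \<partial>\<pi>) = (\<integral>\<^sup>+t. (\<integral>\<^sup>+cv. h (ev cv t) * indicator {0..1} t \<partial>\<pi>) \<partial>lborel)"
   by (rule Fubini'[symmetric]) measurable
  also have "... <= (\<integral>\<^sup>+t. ennreal C * (\<integral>\<^sup>+x. h x \<partial>m) * indicator {0..1::real} t \<partial>lborel)"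
  proof (rule nn_integral_mono)
   fix t :: real
   note [measurable] = borel_measurable_apply_bcontfun[OF sets, of t]
   show "(\<integral>\<^sup>+cv. h (ev cv t) * indicator {0..1} t \<partial>\<pi>) <= ennreal C * (\<integral>\<^sup>+x. h x \<partial>m) * indicator {0..1} t"
    using C(2)[of t h] by (auto simp: indicator_def)
  qed
  also have "... = ennreal C * (\<integral>\<^sup>+x. h x \<partial>m)" by (simp add: nn_integral_cmult)
  finally show "(\<integral>\<^sup>+cv. (\<integral>\<^sup>+t\<in>{0..1}. h (ev cv t) \<partial>lborel) \<partial>\<pi>) <= ennreal C * (\<integral>\<^sup>+x. h x \<partial>m)" .
 qed
qed

text \<open>Young's inequality splits the integrand into a power of \<open>G\<close>, controlled by
  the compression bound, and a power of the speed, controlled by the energy.\<close>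

lemma test_plan_path_int_finite:
 fixes m :: "'x::polish_space measure"
 assumes tp: "test_plan m (conj_exp p) \<pi>" and m: "sets m = sets borel" and p: "1 < p"
  and G: "G \<in> Lp_fun m p"
 shows "(\<integral>\<^sup>+cv. path_int G (ev cv) 0 1 \<partial>\<pi>) < \<infinity>"
proof -
 have q: "1 <= conj_exp p" using conj_exp_gt_1[OF p] by simp
 have Gb [measurable]: "G \<in> borel_fun" and Gi: "integrable m (\<lambda>x. \<bar>G x\<bar> powr p)"
  using G by (auto simp: Lp_fun_def)
 have sets: "sets \<pi> = sets curve_space" and "prob_space \<pi>" using tp by (auto simp: test_plan_def)
 then interpret prob_space \<pi> by simp
 have ev [measurable]: "(\<lambda>(x, r). ev x r) \<in> borel_measurable (\<pi> \<Otimes>\<^sub>M lborel)"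
  unfolding split_beta by (rule borel_measurable_eval[OF sets]) measurable
 have [measurable]: "(\<lambda>(x, r). speed (ev x) r) \<in> borel_measurable (\<pi> \<Otimes>\<^sub>M lborel)"
  unfolding split_beta by (rule borel_measurable_speed_eval[OF sets]) measurable
 have [measurable]: "ev cv \<in> borel_fun" "speed (ev cv) \<in> borel_fun" for cv :: "real \<Rightarrow>\<^sub>C 'x"
  using borel_measurable_speed[of "ev cv"] borel_measurable_continuous_onI[of "ev cv"] by auto
 obtain C where C: "0 < C" "!!h. h \<in> borel_fun ==>
  (\<integral>\<^sup>+cv. (\<integral>\<^sup>+t\<in>{0..1}. h (ev cv t) \<partial>lborel) \<partial>\<pi>) <= ennreal C * (\<integral>\<^sup>+x. h x \<partial>m)"
  using test_plan_swap[OF tp m] by blast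
 let ?A = "\<lambda>cv. \<integral>\<^sup>+t\<in>{0..1}. ennreal (\<bar>G (ev cv t)\<bar> powr p) \<partial>lborel"
 let ?B = "\<lambda>cv. \<integral>\<^sup>+t\<in>{0..1}. ennreal (speed (ev cv) t powr conj_exp p) \<partial>lborel"
 have "(\<integral>\<^sup>+cv. path_int G (ev cv) 0 1 \<partial>\<pi>) <= (\<integral>\<^sup>+cv. ?A cv + ?B cv \<partial>\<pi>)"
 proof (rule nn_integral_mono)
  fix cv :: "real \<Rightarrow>\<^sub>C 'x"
  have "path_int G (ev cv) 0 1 <= (\<integral>\<^sup>+t. ennreal (\<bar>G (ev cv t)\<bar> powr p) * indicator {0..1} t
    + ennreal (speed (ev cv) t powr conj_exp p) * indicator {0..1} t \<partial>lborel)"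
   unfolding path_int_def
  proof (rule nn_integral_mono)
   fix t :: real
   have "G (ev cv t) * speed (ev cv) t <= \<bar>G (ev cv t)\<bar> * speed (ev cv) t"
    by (intro mult_right_mono) auto
   also have "... <= \<bar>G (ev cv t)\<bar> powr p + speed (ev cv) t powr conj_exp p"
    by (rule mult_le_powr_add) (use p in auto)
   finally have "ennreal (G (ev cv t) * speed (ev cv) t) <=
     ennreal (\<bar>G (ev cv t)\<bar> powr p) + ennreal (speed (ev cv) t powr conj_exp p)"
    using ennreal_leI by (fastforce simp: ennreal_plus[symmetric] simp del: ennreal_plus)
   then show "ennreal (G (ev cv t) * speed (ev cv) t) * indicator {0..1} t <=
    ennreal (\<bar>G (ev cv t)\<bar> powr p) * indicator {0..1} t + ennreal (speed (ev cv) t powr conj_exp p) * indicator {0..1} t"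
    by (auto simp: indicator_def)
  qed
  also have "... = ?A cv + ?B cv" by (rule nn_integral_add) measurable
  finally show "path_int G (ev cv) 0 1 <= ?A cv + ?B cv" .
 qed
 also have "... = (\<integral>\<^sup>+cv. ?A cv \<partial>\<pi>) + (\<integral>\<^sup>+cv. ?B cv \<partial>\<pi>)" by (rule nn_integral_add) measurable
 also have "... < \<infinity>"
 proof -
  have "(\<integral>\<^sup>+cv. ?A cv \<partial>\<pi>) <= ennreal C * (\<integral>\<^sup>+x. ennreal (\<bar>G x\<bar> powr p) \<partial>m)" by (rule C(2)) measurable
  also have "... < \<infinity>"
   using Gi unfolding integrable_iff_bounded by (simp add: ennreal_mult_less_top)
  finally show ?thesis using test_plan_AC(2)[OF tp q] by simp
 qed
 finally show ?thesis .
qed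

text \<open>The compression bound integrates the indicator of a null set to zero. Upper gradients
  may therefore be changed on \<open>m\<close>-null sets without affecting path integrals along
  almost every curve.\<close>

lemma test_plan_AE_null:
 fixes m :: "'x::polish_space measure"
 assumes tp: "test_plan m q \<pi>" and m: "sets m = sets borel" and ae: "AE x in m. P x"
 shows "AE cv in \<pi>. AE t in lborel. t \<in> {0..1} --> P (ev cv t)"
proof -
 obtain N where N: "N \<in> null_sets m" "!!x. x \<in> space m ==> \<not> P x ==> x \<in> N"
  using ae by (auto elim!: AE_E intro: null_setsI)
 have sp: "space m = UNIV" using sets_eq_imp_space_eq[OF m] by simp
 have Nb [measurable]: "N \<in> sets borel" using N m by auto
 have sets: "sets \<pi> = sets curve_space" and "prob_space \<pi>" using tp by (auto simp: test_plan_def)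
 then interpret prob_space \<pi> by simp
 have ev [measurable]: "(\<lambda>(x, r). ev x r) \<in> borel_measurable (\<pi> \<Otimes>\<^sub>M lborel)"
  unfolding split_beta by (rule borel_measurable_eval[OF sets]) measurable
 have [measurable]: "ev cv \<in> borel_fun" for cv :: "real \<Rightarrow>\<^sub>C 'x"
  using borel_measurable_continuous_onI[of "ev cv"] by auto
 obtain C where C: "0 < C" "!!h. h \<in> borel_fun ==>
  (\<integral>\<^sup>+cv. (\<integral>\<^sup>+t\<in>{0..1}. h (ev cv t) \<partial>lborel) \<partial>\<pi>) <= ennreal C * (\<integral>\<^sup>+x. h x \<partial>m)"
  using test_plan_swap[OF tp m] by blast
 have "(\<integral>\<^sup>+cv. (\<integral>\<^sup>+t\<in>{0..1}. indicator N (ev cv t) \<partial>lborel) \<partial>\<pi>) <= ennreal C * (\<integral>\<^sup>+x. indicator N x \<partial>m)"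
  by (rule C(2)) measurable
 also have "... = 0" using N by (simp add: nn_integral_indicator null_setsD1 null_setsD2)
 finally have "AE cv in \<pi>. (\<integral>\<^sup>+t\<in>{0..1}. indicator N (ev cv t) \<partial>lborel) = 0"
  by (subst (asm) le_zero_eq, subst (asm) nn_integral_0_iff_AE) auto
 then show ?thesis
 proof eventually_elim
  case (elim cv)
  then have "AE t in lborel. indicator N (ev cv t) * indicator {0..1} t = (0::ennreal)"
   by (subst (asm) nn_integral_0_iff_AE) auto
  then show ?case by eventually_elim (use N sp in \<open>auto simp: indicator_def split: if_splits\<close>)
 qed
qed

lemma borel_measurable_apply_bcontfun_time [measurable]:
 fixes cv :: "real \<Rightarrow>\<^sub>C 'x::polish_space"
 shows "ev cv \<in> borel_fun" "speed (ev cv) \<in> borel_fun"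
 using borel_measurable_speed[of "ev cv"] borel_measurable_continuous_onI[of "ev cv"] by auto

section \<open>Conditioning test plans and cutting curves\<close>

text \<open>Conditioning on \<open>A\<close> multiplies the compression constant and the energy by
  at most the inverse of the measure of \<open>A\<close>. Together with the passage to subcurves it
  turns integrated inequalities into inequalities along almost every curve.\<close>

lemma test_plan_density:
 fixes m :: "'x::polish_space measure"
 assumes tp: "test_plan m q \<pi>" and A: "A \<in> sets \<pi>" and pos: "emeasure \<pi> A \<noteq> 0" and q: "1 <= q"
 shows "test_plan m q (density \<pi> (\<lambda>cv. indicator A cv / emeasure \<pi> A))" (is "test_plan m q ?\<rho>")
proof -
 have sets: "sets \<pi> = sets curve_space" and ps: "prob_space \<pi>"
  and en: "(\<integral>\<^sup>+cv. energy q (ev cv) \<partial>\<pi>) < \<infinity>" using tp by (auto simp: test_plan_def)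
 obtain C where C: "C > 0" "!!t B. t\<in>{0..1} ==> B\<in>sets borel ==>
  emeasure (distr \<pi> borel (\<lambda>cv. ev cv t)) B <= ennreal C * emeasure m B"
  using tp by (auto simp: test_plan_def)
 interpret prob_space \<pi> by fact
 note [measurable] = borel_measurable_apply_bcontfun[OF sets] borel_measurable_energy[OF sets q] A
 let ?e = "emeasure \<pi> A"
 have e: "?e \<noteq> 0" "?e \<noteq> \<infinity>" using pos by (auto simp: emeasure_eq_measure)
 define c where "c = 1 / measure \<pi> A"
 have mA: "0 < measure \<pi> A" using pos by (simp add: emeasure_eq_measure zero_less_measure_iff)
 have c: "0 < c" using mA by (simp add: c_def)
 have ec: "1 / ?e = ennreal c" unfolding c_def emeasure_eq_measure
  using mA by (simp add: divide_ennreal flip: ennreal_1)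
 have le: "indicator A cv / ?e <= ennreal c" for cv
  unfolding ec[symmetric] by (intro divide_right_mono_ennreal) (auto simp: indicator_def)
 show ?thesis
  unfolding test_plan_def
 proof (intro conjI exI[of _ "c * C"] ballI)
  show "prob_space ?\<rho>"
  proof
   have "emeasure ?\<rho> (space ?\<rho>) = (\<integral>\<^sup>+cv. indicator A cv / ?e \<partial>\<pi>)"
    by (simp add: emeasure_density cong: nn_integral_cong)
   also have "... = ?e / ?e" by (simp add: nn_integral_divide)
   also have "... = 1" by (rule ennreal_divide_self) (use pos in \<open>auto simp: emeasure_eq_measure\<close>)
   finally show "emeasure ?\<rho> (space ?\<rho>) = 1" .
  qed
  show "sets ?\<rho> = sets curve_space" using sets by simp
  show "0 < c * C" using c C by simp
  fix t :: real and B :: "'x set" assume t: "t \<in> {0..1}" and B [measurable]: "B \<in> sets borel"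
  have "emeasure (distr ?\<rho> borel (\<lambda>cv. ev cv t)) B =
   (\<integral>\<^sup>+cv. indicator A cv / ?e * indicator ((\<lambda>cv. ev cv t) -` B \<inter> space \<pi>) cv \<partial>\<pi>)"
   by (simp add: emeasure_distr emeasure_density)
  also have "... <= (\<integral>\<^sup>+cv. ennreal c * indicator ((\<lambda>cv. ev cv t) -` B \<inter> space \<pi>) cv \<partial>\<pi>)"
   by (intro nn_integral_mono mult_right_mono le) simp
  also have "... = ennreal c * emeasure (distr \<pi> borel (\<lambda>cv. ev cv t)) B"
   by (simp add: nn_integral_cmult_indicator emeasure_distr)
  also have "... <= ennreal c * (ennreal C * emeasure m B)" by (intro mult_left_mono C t B) simp
  also have "... = ennreal (c * C) * emeasure m B" using c C by (simp add: ennreal_mult mult.assoc)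
  finally show "emeasure (distr ?\<rho> borel (\<lambda>cv. ev cv t)) B <= ennreal (c * C) * emeasure m B" .
 next
  have "(\<integral>\<^sup>+cv. energy q (ev cv) \<partial>?\<rho>) = (\<integral>\<^sup>+cv. indicator A cv / ?e * energy q (ev cv) \<partial>\<pi>)"
   by (rule nn_integral_density) measurable
  also have "... <= (\<integral>\<^sup>+cv. ennreal c * energy q (ev cv) \<partial>\<pi>)"
   by (intro nn_integral_mono mult_right_mono le) simp
  also have "... = ennreal c * (\<integral>\<^sup>+cv. energy q (ev cv) \<partial>\<pi>)"
   by (rule nn_integral_cmult) measurable
  also have "... < \<infinity>" using en by (simp add: ennreal_mult_less_top)
  finally show "(\<integral>\<^sup>+cv. energy q (ev cv) \<partial>?\<rho>) < \<infinity>" .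
 qed
qed

text \<open>The part on \<open>[s, t]\<close>, reparametrised to \<open>[0, 1]\<close>; the clamped
  time keeps the curve constant beyond both ends, as membership in \<open>curves\<close>
  demands.\<close>

definition subcurve :: "real => real => (real \<Rightarrow>\<^sub>C 'x::metric_space) => (real \<Rightarrow>\<^sub>C 'x)" where
 "subcurve s t cv = Bcontfun (\<lambda>r. ev cv (s + (t - s) * min 1 (max 0 r)))"

lemma apply_subcurve:
 "ev (subcurve s t cv) r = ev cv (s + (t - s) * min 1 (max 0 r))"
proof -
 have "(\<lambda>r. ev cv (s + (t - s) * min 1 (max 0 r))) \<in> bcontfun"
  unfolding bcontfun_def
 proof
  have "continuous_on UNIV (\<lambda>r. ev cv (s + (t - s) * min 1 (max 0 r)))"
   by (rule continuous_on_compose2[OF continuous_on_apply_bcontfun[of UNIV]]) (auto intro!: continuous_intros)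
  moreover have "bounded (range (\<lambda>r. ev cv (s + (t - s) * min 1 (max 0 r))))"
   by (rule bounded_subset[of "range (ev cv)"]) (use apply_bcontfun[of cv] in \<open>auto simp: bcontfun_def\<close>)
  ultimately show "continuous_on UNIV (\<lambda>r. ev cv (s + (t - s) * min 1 (max 0 r))) \<and>
   bounded (range (\<lambda>r. ev cv (s + (t - s) * min 1 (max 0 r))))" ..
 qed
 then show ?thesis by (simp add: subcurve_def Bcontfun_inverse)
qed

lemma measurable_subcurve:
 "(subcurve s t :: (real \<Rightarrow>\<^sub>C 'x::metric_space) => _) \<in> measurable curve_space curve_space"
proof (rule measurable_restrict_space3)
 have "1-lipschitz_on UNIV (subcurve s t :: (real \<Rightarrow>\<^sub>C 'x) => _)"
  by (intro lipschitz_onI) (auto intro!: dist_bound simp: apply_subcurve dist_bounded)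
 then show "subcurve s t \<in> borel_measurable (borel :: (real \<Rightarrow>\<^sub>C 'x) measure)"
  by (intro borel_measurable_continuous_onI lipschitz_on_continuous_on)
 show "subcurve s t \<in> curves \<rightarrow> curves" by (auto simp: curves_def apply_subcurve)
qed

lemma nn_integral_Icc_affine:
 fixes h :: "real => ennreal"
 assumes [measurable]: "h \<in> borel_fun" and st: "s < t"
 shows "(\<integral>\<^sup>+r\<in>{s + (t - s) * a..s + (t - s) * b}. h r \<partial>lborel) =
  ennreal (t - s) * (\<integral>\<^sup>+r\<in>{a..b}. h (s + (t - s) * r) \<partial>lborel)"
proof -
 have i: "indicator {s + (t - s) * a..s + (t - s) * b} (s + (t - s) * r) = (indicator {a..b} r :: ennreal)" for r
  using st by (auto simp: indicator_def)
 show ?thesis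
  by (subst nn_integral_real_affine[of _ "t - s" s]) (use st in \<open>auto simp: i\<close>)
qed

lemma speed_subcurve:
 fixes cv :: "real \<Rightarrow>\<^sub>C 'x::polish_space"
 assumes ac: "AC q (ev cv)" and q: "1 <= q" and st: "0 <= s" "s < t" "t <= 1"
 shows "AE r in lborel. r \<in> {0..1} -->
  speed (ev (subcurve s t cv)) r = (t - s) * speed (ev cv) (s + (t - s) * r)"
proof -
 let ?cv = "ev cv" and ?\<sigma> = "ev (subcurve s t cv)"
 obtain N where N: "negligible N" "!!t. t\<in>{0<..<1} - N ==> ((\<lambda>s. dist (?cv s) (?cv t) / \<bar>s - t\<bar>) \<longlongrightarrow> speed ?cv t) (at t)"
  using AC_speed(4)[OF ac q continuous_on_apply_bcontfun] by blast
 have "AE x in lebesgue. x \<notin> N" using N(1) AE_not_in negligible_iff_null_sets by blast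
 then have "AE x in lborel. x \<notin> N" by (simp add: AE_completion_iff)
 \<comment> \<open>A Borel null set around \<open>N\<close>, so that the affine change of variable
   can transport the almost everywhere statement.\<close>
 then obtain N' where N': "N' \<in> null_sets lborel" "N \<subseteq> N'" by (auto elim!: AE_E simp: null_sets_def)
 then have [measurable]: "N' \<in> sets borel" by auto
 have "AE x in lborel. s + (t - s) * x \<notin> N'"
  using AE_borel_affine[of "t - s" "\<lambda>x. x \<notin> N'" s] AE_not_in[OF N'(1)] st by simp
 with AE_lborel_singleton[of 0] AE_lborel_singleton[of 1] show ?thesis
 proof eventually_elim
  case (elim r)
  show ?case
  proof
   assume "r \<in> {0..1}"
   with elim have r: "r \<in> {0<..<1}" by auto
   let ?u = "s + (t - s) * r"
   have u: "?u \<in> {0<..<1}"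
   proof -
    have "0 < (t - s) * r" using r st by simp
    moreover have "(t - s) * r < t - s" using mult_strict_left_mono[of r 1 "t - s"] r st by simp
    ultimately have "0 < s + (t - s) * r" "s + (t - s) * r < 1" using st by linarith+
    then show ?thesis by simp
   qed
   then have L: "((\<lambda>v. dist (?cv v) (?cv ?u) / \<bar>v - ?u\<bar>) \<longlongrightarrow> speed ?cv ?u) (at ?u)"
    using N(2)[of ?u] N' elim by auto
   have F: "filterlim (\<lambda>v. s + (t - s) * v) (at ?u) (at r)"
    using st by (intro filterlim_atI) (auto intro!: tendsto_intros simp: eventually_at_filter)
   have "((\<lambda>v. (t - s) * (dist (?cv (s + (t - s) * v)) (?cv ?u) / \<bar>s + (t - s) * v - ?u\<bar>)) \<longlongrightarrow> (t - s) * speed ?cv ?u) (at r)"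
    by (intro tendsto_mult tendsto_const filterlim_compose[OF L F])
   moreover have "eventually (\<lambda>v. v \<in> {0<..<1}) (at r)" using r by (intro eventually_at_in_open') auto
   then have "eventually (\<lambda>v. (t - s) * (dist (?cv (s + (t - s) * v)) (?cv ?u) / \<bar>s + (t - s) * v - ?u\<bar>) =
    dist (?\<sigma> v) (?\<sigma> r) / \<bar>v - r\<bar>) (at r)"
   proof eventually_elim
    case (elim v)
    have "s + (t - s) * v - ?u = (t - s) * (v - r)" by (simp add: algebra_simps)
    then have "\<bar>s + (t - s) * v - ?u\<bar> = (t - s) * \<bar>v - r\<bar>" using st by (simp add: abs_mult)
    then show ?case using elim r st by (simp add: apply_subcurve)
   qed
   ultimately have "((\<lambda>v. dist (?\<sigma> v) (?\<sigma> r) / \<bar>v - r\<bar>) \<longlongrightarrow> (t - s) * speed ?cv ?u) (at r)"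
    by (rule Lim_transform_eventually)
   from eq_metric_speed_if_tendsto(2)[OF r this]
   show "speed ?\<sigma> r = (t - s) * speed ?cv ?u" .
  qed
 qed
qed

lemma path_int_subcurve:
 fixes cv :: "real \<Rightarrow>\<^sub>C 'x::polish_space"
 assumes ac: "AC q (ev cv)" and q: "1 <= q" and st: "0 <= s" "s < t" "t <= 1"
  and [measurable]: "G \<in> borel_fun"
 shows "path_int G (ev (subcurve s t cv)) 0 1 = path_int G (ev cv) s t"
proof -
 let ?cv = "ev cv"
 let ?h = "\<lambda>r. ennreal (G (?cv r) * speed ?cv r)"
 have "path_int G (ev (subcurve s t cv)) 0 1 =
  (\<integral>\<^sup>+r\<in>{0..1}. ennreal (t - s) * ?h (s + (t - s) * r) \<partial>lborel)"
  unfolding path_int_def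
 proof (rule nn_integral_cong_AE)
  from speed_subcurve[OF ac q st]
  show "AE r in lborel. ennreal (G (ev (subcurve s t cv) r) * speed (ev (subcurve s t cv)) r) * indicator {0..1} r =
   ennreal (t - s) * ?h (s + (t - s) * r) * indicator {0..1} r"
  proof eventually_elim
   case (elim r)
   show ?case
   proof (cases "r \<in> {0..1}")
    case True
    then have "ev (subcurve s t cv) r = ?cv (s + (t - s) * r)" by (simp add: apply_subcurve)
    then show ?thesis using elim True st by (simp add: ennreal_mult'[symmetric] mult.left_commute)
   qed simp
  qed
 qed
 also have "... = ennreal (t - s) * (\<integral>\<^sup>+r\<in>{0..1}. ?h (s + (t - s) * r) \<partial>lborel)"
  by (simp add: nn_integral_cmult mult.assoc)
 also have "... = (\<integral>\<^sup>+r\<in>{s + (t - s) * 0..s + (t - s) * 1}. ?h r \<partial>lborel)"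
  by (rule nn_integral_Icc_affine[symmetric]) (use st in auto)
 finally show ?thesis by (simp add: path_int_def)
qed

lemma AC_subcurve:
 fixes cv :: "real \<Rightarrow>\<^sub>C 'x::polish_space"
 assumes ac: "AC q (ev cv)" and q: "1 <= q" and st: "0 <= s" "s < t" "t <= 1"
 shows "AC q (ev (subcurve s t cv))"
  and "energy q (ev (subcurve s t cv)) <= energy q (ev cv)"
proof -
 let ?cv = "ev cv" and ?\<sigma> = "ev (subcurve s t cv)"
 have le1: "(\<integral>\<^sup>+r\<in>{0..1}. ennreal (speed ?\<sigma> r powr q) \<partial>lborel) <= (\<integral>\<^sup>+r\<in>{0..1}. ennreal (speed ?cv r powr q) \<partial>lborel)"
 proof -
  have "(\<integral>\<^sup>+r\<in>{0..1}. ennreal (speed ?\<sigma> r powr q) \<partial>lborel) <=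
   (\<integral>\<^sup>+r\<in>{0..1}. ennreal (t - s) * ennreal (speed ?cv (s + (t - s) * r) powr q) \<partial>lborel)"
  proof (rule nn_integral_mono_AE)
   from speed_subcurve[OF ac q st]
   show "AE r in lborel. ennreal (speed ?\<sigma> r powr q) * indicator {0..1} r <=
    ennreal (t - s) * ennreal (speed ?cv (s + (t - s) * r) powr q) * indicator {0..1} r"
   proof eventually_elim
    case (elim r)
    \<comment> \<open>Holds since \<open>t - s <= 1 <= q\<close>; the one remaining factor
      \<open>t - s\<close> is absorbed by the change of variable, so the energy does not
      increase.\<close>
    have "(t - s) powr q <= (t - s) powr 1" using st q by (intro powr_mono') auto
    then have "(t - s) powr q * speed ?cv (s + (t - s) * r) powr q <= (t - s) * speed ?cv (s + (t - s) * r) powr q"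
     using st by (intro mult_right_mono) auto
    then show ?case using elim st
     by (auto simp: indicator_def powr_mult ennreal_mult'[symmetric] intro!: ennreal_leI)
   qed
  qed
  also have "... = ennreal (t - s) * (\<integral>\<^sup>+r\<in>{0..1}. ennreal (speed ?cv (s + (t - s) * r) powr q) \<partial>lborel)"
   by (simp add: nn_integral_cmult mult.assoc)
  also have "... = (\<integral>\<^sup>+r\<in>{s + (t - s) * 0..s + (t - s) * 1}. ennreal (speed ?cv r powr q) \<partial>lborel)"
   by (rule nn_integral_Icc_affine[symmetric]) (use st in auto)
  also have "... <= (\<integral>\<^sup>+r\<in>{0..1}. ennreal (speed ?cv r powr q) \<partial>lborel)"
   using st by (intro nn_integral_mono) (auto simp: indicator_def)
  finally show ?thesis .
 qed
 show acs: "AC q ?\<sigma>"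
  unfolding AC_iff_speed[OF q continuous_on_apply_bcontfun]
 proof (intro conjI ballI impI)
  show "(\<integral>\<^sup>+r\<in>{0..1}. ennreal (speed ?\<sigma> r powr q) \<partial>lborel) < \<infinity>"
   using le1 AC_speed(2)[OF ac q continuous_on_apply_bcontfun] by (rule le_less_trans)
  fix a b :: real assume ab: "0 <= a" "a <= b" "b <= 1"
  have m: "0 <= s + (t - s) * a" "s + (t - s) * a <= s + (t - s) * b" "s + (t - s) * b <= 1"
  proof -
   show "0 <= s + (t - s) * a" using st ab by simp
   show "s + (t - s) * a <= s + (t - s) * b" using st ab by (simp add: mult_left_mono)
   have "(t - s) * b <= t - s" using mult_left_mono[of b 1 "t - s"] st ab by simp
   then show "s + (t - s) * b <= 1" using st by linarith
  qed
  have "ennreal (dist (?\<sigma> a) (?\<sigma> b)) = ennreal (dist (?cv (s + (t - s) * a)) (?cv (s + (t - s) * b)))"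
   using ab by (simp add: apply_subcurve)
  also have "... <= (\<integral>\<^sup>+r\<in>{s + (t - s) * a..s + (t - s) * b}. ennreal (speed ?cv r) \<partial>lborel)"
   by (rule AC_speed(3)[OF ac q continuous_on_apply_bcontfun m])
  also have "... = ennreal (t - s) * (\<integral>\<^sup>+r\<in>{a..b}. ennreal (speed ?cv (s + (t - s) * r)) \<partial>lborel)"
   by (rule nn_integral_Icc_affine) (use st in auto)
  also have "... = (\<integral>\<^sup>+r\<in>{a..b}. ennreal (t - s) * ennreal (speed ?cv (s + (t - s) * r)) \<partial>lborel)"
   by (simp add: nn_integral_cmult mult.assoc)
  also have "... = (\<integral>\<^sup>+r\<in>{a..b}. ennreal (speed ?\<sigma> r) \<partial>lborel)"
  proof (rule nn_integral_cong_AE)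
   from speed_subcurve[OF ac q st]
   show "AE r in lborel. ennreal (t - s) * ennreal (speed ?cv (s + (t - s) * r)) * indicator {a..b} r = ennreal (speed ?\<sigma> r) * indicator {a..b} r"
    by eventually_elim (use ab st in \<open>auto simp: indicator_def ennreal_mult'\<close>)
  qed
  finally show "ennreal (dist (?\<sigma> a) (?\<sigma> b)) <= (\<integral>\<^sup>+r\<in>{a..b}. ennreal (speed ?\<sigma> r) \<partial>lborel)" .
 qed
 show "energy q ?\<sigma> <= energy q ?cv" using ac acs le1 by (simp add: energy_eq[OF q])
qed

lemma test_plan_subcurve:
 fixes m :: "'x::polish_space measure"
 assumes tp: "test_plan m q \<pi>" and q: "1 <= q" and st: "0 <= s" "s < t" "t <= 1"
 shows "test_plan m q (distr \<pi> curve_space (subcurve s t))" (is "test_plan m q ?\<rho>")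
proof -
 have sets: "sets \<pi> = sets curve_space" and ps: "prob_space \<pi>"
  and en: "(\<integral>\<^sup>+cv. energy q (ev cv) \<partial>\<pi>) < \<infinity>" using tp by (auto simp: test_plan_def)
 obtain C where C: "C > 0" "!!t B. t\<in>{0..1} ==> B\<in>sets borel ==>
  emeasure (distr \<pi> borel (\<lambda>cv. ev cv t)) B <= ennreal C * emeasure m B"
  using tp by (auto simp: test_plan_def)
 interpret prob_space \<pi> by fact
 have sm [measurable]: "subcurve s t \<in> measurable \<pi> curve_space"
  using measurable_subcurve[of s t] measurable_cong_sets[OF sets refl, of curve_space] by auto
 show ?thesis
  unfolding test_plan_def
 proof (intro conjI exI[of _ C] ballI)
  show "prob_space ?\<rho>" by (rule prob_space_distr) (rule sm)
  show "sets ?\<rho> = sets curve_space" by simp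
  show "0 < C" by fact
  fix r :: real and B :: "'x set" assume r: "r \<in> {0..1}" and B: "B \<in> sets borel"
  have "distr ?\<rho> borel (\<lambda>cv. ev cv r) = distr \<pi> borel (\<lambda>cv. ev (subcurve s t cv) r)"
   by (subst distr_distr) (auto simp: comp_def intro!: borel_measurable_apply_bcontfun)
  also have "... = distr \<pi> borel (\<lambda>cv. ev cv (s + (t - s) * r))"
   using r by (simp add: apply_subcurve)
  also have "emeasure ... B <= ennreal C * emeasure m B"
  proof (rule C(2)[OF _ B])
   have "(t - s) * r <= t - s" using mult_left_mono[of r 1 "t - s"] st r by simp
   then have "s + (t - s) * r <= 1" using st by linarith
   moreover have "0 <= (t - s) * r" using st r by auto
   ultimately show "s + (t - s) * r \<in> {0..1}" using st by auto
  qed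
  finally show "emeasure (distr ?\<rho> borel (\<lambda>cv. ev cv r)) B <= ennreal C * emeasure m B" .
 next
  have "(\<integral>\<^sup>+cv. energy q (ev cv) \<partial>?\<rho>) = (\<integral>\<^sup>+cv. energy q (ev (subcurve s t cv)) \<partial>\<pi>)"
   by (rule nn_integral_distr[OF sm]) (use borel_measurable_energy[OF _ q] in auto)
  also have "... <= (\<integral>\<^sup>+cv. energy q (ev cv) \<partial>\<pi>)"
   by (rule nn_integral_mono_AE)
    (use test_plan_AC(1)[OF tp q] in eventually_elim, rule AC_subcurve(2)[OF _ q st])
  finally show "(\<integral>\<^sup>+cv. energy q (ev cv) \<partial>?\<rho>) < \<infinity>" using en by (rule le_less_trans)
 qed
qed

section \<open>Upper gradients along almost every curve\<close>

text \<open>The pathwise form of a weak upper gradient. The null set of curves may depend on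
  \<open>s\<close> and \<open>t\<close>. Finite path integrals take the place of membership of
  \<open>G\<close> in a Lebesgue space, so the exponent enters only through the class of test
  plans.\<close>

definition curve_ug :: "'x::polish_space measure => real => ('x => real) => ('x => real) => bool" where
 "curve_ug m q f G \<longleftrightarrow> G \<in> borel_fun \<and> (\<forall>x. 0 <= G x) \<and>
   (\<forall>\<pi>. test_plan m q \<pi> --> (AE cv in \<pi>. path_int G (ev cv) 0 1 < \<infinity>) \<and>
    (\<forall>s t. 0 <= s --> s <= t --> t <= 1 --> (AE cv in \<pi>.
     ennreal \<bar>f (ev cv t) - f (ev cv s)\<bar> <= path_int G (ev cv) s t)))"

lemma test_plan_AE_path_int_finite:
 assumes tp: "test_plan m (conj_exp p) \<pi>" and m: "sets m = sets borel" and p: "1 < p"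
  and G: "G \<in> Lp_fun m p"
 shows "AE cv in \<pi>. path_int G (ev cv) 0 1 < \<infinity>"
proof -
 have sets: "sets \<pi> = sets curve_space" using tp by (auto simp: test_plan_def)
 have [measurable]: "G \<in> borel_fun" using G by (auto simp: Lp_fun_def)
 have "(\<lambda>cv. path_int G (ev cv) 0 1) \<in> borel_measurable \<pi>"
  by (rule borel_measurable_path_int[OF sets]) measurable
 from nn_integral_PInf_AE[OF this] test_plan_path_int_finite[OF tp m p G]
 show ?thesis by (auto simp: less_top)
qed

text \<open>If the inequality failed on a set of curves of positive measure, conditioning the plan
  on that set and cutting the curves to \<open>[s, t]\<close> would give a test plan violating the
  integrated inequality.\<close>

lemma curve_ug_if_weak_upper_gradient:
 fixes m :: "'x::polish_space measure"
 assumes m: "sets m = sets borel" and p: "1 < p" and f [measurable]: "f \<in> borel_fun"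
  and wug: "weak_upper_gradient m p f G"
 shows "curve_ug m (conj_exp p) f (\<lambda>x. max 0 (G x))"
 unfolding curve_ug_def
proof (intro conjI allI impI)
 have q: "1 <= conj_exp p" using conj_exp_gt_1[OF p] by simp
 have GL: "G \<in> Lp_fun m p" and G0: "AE x in m. 0 <= G x" using wug by (auto simp: weak_upper_gradient_def)
 then have [measurable]: "G \<in> borel_fun" by (auto simp: Lp_fun_def)
 show "(\<lambda>x. max 0 (G x)) \<in> borel_fun" by measurable
 show "0 <= max 0 (G x)" for x by simp
 \<comment> \<open>The speed is nonnegative, so passing to the positive part of \<open>G\<close> is
   invisible under \<open>ennreal\<close>.\<close>
 have max_eq: "path_int (\<lambda>x. max 0 (G x)) cv s t = path_int G cv s t" for cv :: "real => 'x" and s t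
  unfolding path_int_def
  by (intro nn_integral_cong) (auto simp: max_def ennreal_neg mult_nonpos_nonneg)
 fix \<pi> :: "(real \<Rightarrow>\<^sub>C 'x) measure" assume tp: "test_plan m (conj_exp p) \<pi>"
 show fin: "AE cv in \<pi>. path_int (\<lambda>x. max 0 (G x)) (ev cv) 0 1 < \<infinity>"
  unfolding max_eq by (rule test_plan_AE_path_int_finite[OF tp m p GL])
 fix s t :: real assume st': "0 <= s" "s <= t" "t <= 1"
 show "AE cv in \<pi>. ennreal \<bar>f (ev cv t) - f (ev cv s)\<bar> <= path_int (\<lambda>x. max 0 (G x)) (ev cv) s t"
 proof (cases "s = t")
  case False
  then have st: "0 <= s" "s < t" "t <= 1" using st' by auto
  have sets: "sets \<pi> = sets curve_space" using tp by (auto simp: test_plan_def)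
  note [measurable] = borel_measurable_apply_bcontfun[OF sets]
  have [measurable]: "(\<lambda>cv. path_int G (ev cv) s t) \<in> borel_measurable \<pi>"
   by (rule borel_measurable_path_int[OF sets]) measurable
  define A where "A = {cv\<in>space \<pi>. path_int G (ev cv) s t < ennreal \<bar>f (ev cv t) - f (ev cv s)\<bar>}"
  have A [measurable]: "A \<in> sets \<pi>" unfolding A_def by measurable
  have "emeasure \<pi> A = 0"
  proof (rule ccontr)
   assume pos: "emeasure \<pi> A \<noteq> 0"
   let ?d = "\<lambda>cv. indicator A cv / emeasure \<pi> A"
   let ?\<rho> = "density \<pi> ?d"
   let ?\<sigma> = "distr ?\<rho> curve_space (subcurve s t)"
   have tr: "test_plan m (conj_exp p) ?\<rho>" by (rule test_plan_density[OF tp A pos q])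
   have ts: "test_plan m (conj_exp p) ?\<sigma>" by (rule test_plan_subcurve[OF tr q st])
   have setsr: "sets ?\<rho> = sets curve_space" using sets by simp
   have acr: "AE cv in ?\<rho>. AC (conj_exp p) (ev cv)" by (rule test_plan_AC(1)[OF tr q])
   have acs: "AE cv in ?\<sigma>. AC (conj_exp p) (ev cv)" by (rule test_plan_AC(1)[OF ts q])
   have sm: "subcurve s t \<in> measurable ?\<rho> curve_space"
    unfolding measurable_cong_sets[OF setsr refl] by (rule measurable_subcurve)
   have pm: "(\<lambda>cv. path_int G (ev cv) 0 1) \<in> borel_measurable curve_space"
    by (rule borel_measurable_path_int) auto
   have em: "(\<lambda>cv. ennreal \<bar>f (ev cv 1) - f (ev cv 0)\<bar>) \<in> borel_measurable curve_space"
   proof -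
    note [measurable] = borel_measurable_apply_bcontfun[OF refl]
    show ?thesis by measurable
   qed
   have "(\<integral>\<^sup>+cv. ennreal \<bar>f (ev cv t) - f (ev cv s)\<bar> \<partial>?\<rho>)
    = (\<integral>\<^sup>+cv. ennreal \<bar>f (ev cv 1) - f (ev cv 0)\<bar> \<partial>?\<sigma>)"
    by (subst nn_integral_distr[OF sm]) (use em in \<open>simp_all add: apply_subcurve\<close>)
   also have "... <= (\<integral>\<^sup>+cv. (\<integral>\<^sup>+t\<in>{0..1}. ennreal (G (ev cv t) *
      metric_speed (ev cv) t) \<partial>lborel) \<partial>?\<sigma>)"
    using wug ts by (simp add: weak_upper_gradient_def)
   also have "... = (\<integral>\<^sup>+cv. path_int G (ev cv) 0 1 \<partial>?\<sigma>)"
    by (rule nn_integral_cong_AE) (use acs in \<open>eventually_elim, simp add: path_int_eq_metric_speed[OF _ q]\<close>)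
   also have "... = (\<integral>\<^sup>+cv. path_int G (ev (subcurve s t cv)) 0 1 \<partial>?\<rho>)"
    by (rule nn_integral_distr[OF sm]) (use pm in simp)
   also have "... = (\<integral>\<^sup>+cv. path_int G (ev cv) s t \<partial>?\<rho>)"
    by (rule nn_integral_cong_AE) (use acr in \<open>eventually_elim, simp add: path_int_subcurve[OF _ q st]\<close>)
   finally have le: "(\<integral>\<^sup>+cv. ennreal \<bar>f (ev cv t) - f (ev cv s)\<bar> \<partial>?\<rho>) <= (\<integral>\<^sup>+cv. path_int G (ev cv) s t \<partial>?\<rho>)" .
   have "(\<integral>\<^sup>+cv. path_int G (ev cv) s t \<partial>?\<rho>) <= (\<integral>\<^sup>+cv. path_int G (ev cv) 0 1 \<partial>?\<rho>)"
    unfolding path_int_def using st by (intro nn_integral_mono) (auto simp: indicator_def)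
   also have "... < \<infinity>" by (rule test_plan_path_int_finite[OF tr m p GL])
   \<comment> \<open>Finiteness of the smaller integral is what turns strict inequality on the
     curves of \<open>A\<close> into strict inequality of integrals.\<close>
   finally have finr: "(\<integral>\<^sup>+cv. path_int G (ev cv) s t \<partial>?\<rho>) \<noteq> \<infinity>" by simp
   have aeA: "AE cv in ?\<rho>. cv \<in> A"
    by (subst AE_density) (measurable, simp add: indicator_def)
   have "(\<integral>\<^sup>+cv. path_int G (ev cv) s t \<partial>?\<rho>) < (\<integral>\<^sup>+cv. ennreal \<bar>f (ev cv t) - f (ev cv s)\<bar> \<partial>?\<rho>)"
   proof (rule nn_integral_less[OF _ _ finr])
    show "AE cv in ?\<rho>. path_int G (ev cv) s t <= ennreal \<bar>f (ev cv t) - f (ev cv s)\<bar>"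
     using aeA by eventually_elim (auto simp: A_def)
    interpret r: prob_space ?\<rho> using tr by (simp add: test_plan_def)
    show "\<not> (AE cv in ?\<rho>. ennreal \<bar>f (ev cv t) - f (ev cv s)\<bar> <= path_int G (ev cv) s t)"
    proof
     assume "AE cv in ?\<rho>. ennreal \<bar>f (ev cv t) - f (ev cv s)\<bar> <= path_int G (ev cv) s t"
     with aeA have "AE cv in ?\<rho>. False" by eventually_elim (auto simp: A_def not_less[symmetric])
     then show False by simp
    qed
   qed measurable
   with le show False by (simp add: not_less[symmetric])
  qed
  then have "AE cv in \<pi>. cv \<notin> A" by (intro AE_not_in) auto
  then show ?thesis unfolding max_eq using AE_space by eventually_elim (auto simp: A_def)
 qed simp
qed

lemma weak_upper_gradient_if_curve_ug:
 fixes m :: "'x::polish_space measure"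
 assumes p: "1 < p" and ug: "curve_ug m (conj_exp p) f G" and GL: "G \<in> Lp_fun m p"
 shows "weak_upper_gradient m p f G"
 unfolding weak_upper_gradient_def
proof (intro conjI allI impI GL)
 have q: "1 <= conj_exp p" using conj_exp_gt_1[OF p] by simp
 show "AE x in m. 0 <= G x" using ug by (simp add: curve_ug_def)
 fix \<pi> :: "(real \<Rightarrow>\<^sub>C 'x) measure" assume tp: "test_plan m (conj_exp p) \<pi>"
 have "(\<integral>\<^sup>+cv. (\<integral>\<^sup>+t\<in>{0..1}. ennreal (G (ev cv t) *
      metric_speed (ev cv) t) \<partial>lborel) \<partial>\<pi>) = (\<integral>\<^sup>+cv. path_int G (ev cv) 0 1 \<partial>\<pi>)"
  by (rule nn_integral_cong_AE) (use test_plan_AC(1)[OF tp q] in \<open>eventually_elim, simp add: path_int_eq_metric_speed[OF _ q]\<close>)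
 moreover have "AE cv in \<pi>. ennreal \<bar>f (ev cv 1) - f (ev cv 0)\<bar> <= path_int G (ev cv) 0 1"
  using ug tp by (auto simp: curve_ug_def)
 then have "(\<integral>\<^sup>+cv. ennreal \<bar>f (ev cv 1) - f (ev cv 0)\<bar> \<partial>\<pi>) <= (\<integral>\<^sup>+cv. path_int G (ev cv) 0 1 \<partial>\<pi>)"
  by (rule nn_integral_mono_AE)
 ultimately show "(\<integral>\<^sup>+cv. ennreal \<bar>f (ev cv 1) - f (ev cv 0)\<bar> \<partial>\<pi>) <=
  (\<integral>\<^sup>+cv. (\<integral>\<^sup>+t\<in>{0..1}. ennreal (G (ev cv t) * metric_speed (ev cv) t) \<partial>lborel) \<partial>\<pi>)" by simp
qed

section \<open>Upper gradients along curves\<close>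

text \<open>Only the times in \<open>D\<close> are controlled and \<open>u\<close> need not be
  continuous. On \<open>D\<close> it is uniformly continuous, and its continuous extension
  \<open>U\<close> to \<open>[s, t]\<close> is absolutely continuous with a density bounded almost
  everywhere by \<open>h1\<close> and by \<open>h2\<close>, hence by their minimum.\<close>

lemma abs_increment_le_integral_min:
 fixes u h1 h2 :: "real => real"
 assumes st: "s < t" and h1 [measurable]: "h1 \<in> borel_fun" and h2 [measurable]: "h2 \<in> borel_fun"
  and nn: "!!x. 0 <= h1 x" "!!x. 0 <= h2 x"
  and i1: "h1 integrable_on {s..t}" and i2: "h2 integrable_on {s..t}"
  and D: "D = (\<rat> \<inter> {s..t}) \<union> {s, t}"
  and le: "!!a b. a \<in> D ==> b \<in> D ==> a <= b ==> \<bar>u b - u a\<bar> <= integral {a..b} h1"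
   "!!a b. a \<in> D ==> b \<in> D ==> a <= b ==> \<bar>u b - u a\<bar> <= integral {a..b} h2"
 shows "(\<lambda>x. min (h1 x) (h2 x)) integrable_on {s..t}" "\<bar>u t - u s\<bar> <= integral {s..t} (\<lambda>x. min (h1 x) (h2 x))"
proof -
 have Dsub: "D \<subseteq> {s..t}" using st D by auto
 \<comment> \<open>Approximation from within \<open>D\<close>: a rational that falls below
   \<open>s\<close> is replaced by \<open>s\<close>, which belongs to \<open>D\<close>.\<close>
 define d where "d n x = max s (rat_floor n x)" for n x
 have dD: "d n x \<in> D" if "x \<in> {s..t}" for n x
  using rat_floor(1)[of n x] rat_floor(2)[of n x] that st by (auto simp: d_def D max_def)
 have dmono: "d n x <= d n y" if "x <= y" for n x y using rat_floor(4)[OF that, of n] by (auto simp: d_def max_def)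
 have dlim: "(\<lambda>n. d n x) \<longlonglongrightarrow> x" if "x \<in> {s..t}" for x
 proof -
  have "(\<lambda>n. max s (rat_floor n x)) \<longlonglongrightarrow> max s x" by (intro tendsto_max tendsto_const rat_floor(6))
  then show ?thesis using that by (simp add: d_def)
 qed
 have clD: "closure D = {s..t}"
 proof
  show "closure D \<subseteq> {s..t}" using Dsub by (intro closure_minimal) auto
  show "{s..t} \<subseteq> closure D"
  proof
   fix x assume x: "x \<in> {s..t}"
   show "x \<in> closure D" unfolding closure_sequential using dD[OF x] dlim[OF x] by (intro exI[of _ "\<lambda>n. d n x"]) auto
  qed
 qed
 define H where "H x = integral {s..x} h1" for x
 have Hc: "continuous_on {s..t} H" unfolding H_def by (rule indefinite_integral_continuous_1[OF i1])
 have Hd: "integral {a..b} h1 = H b - H a" if "a \<in> {s..t}" "b \<in> {s..t}" "a <= b" for a b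
  unfolding H_def by (rule integral_Icc_split[OF i1]) (use that in auto)
 have "uniformly_continuous_on {s..t} H" using Hc by (rule compact_uniformly_continuous) simp
 then have Hu: "uniformly_continuous_on D H" using Dsub unfolding uniformly_continuous_on_def by (meson subsetD)
 have ule: "\<bar>u b - u a\<bar> <= \<bar>H b - H a\<bar>" if "a \<in> D" "b \<in> D" for a b
 proof -
  have m: "a \<in> {s..t}" "b \<in> {s..t}" using that Dsub by auto
  show ?thesis
  proof (cases "a <= b")
   case True
   then show ?thesis using le(1)[OF that True] Hd[OF m True] by linarith
  next
   case False
   then have "b <= a" by simp
   then show ?thesis using le(1)[OF that(2,1)] Hd[OF m(2,1)] by linarith
  qed
 qed
 have uu: "uniformly_continuous_on D u"
  unfolding uniformly_continuous_on_def
 proof (intro allI impI)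
  fix e :: real assume "0 < e"
  then obtain r where r: "r > 0" "!!x x'. x\<in>D ==> x'\<in>D ==> dist x' x < r ==> dist (H x') (H x) < e"
   using Hu unfolding uniformly_continuous_on_def by blast
  have "dist (u x') (u x) < e" if "x\<in>D" "x'\<in>D" "dist x' x < r" for x x'
   using r(2)[OF that] ule[OF that(1,2)] by (simp add: dist_real_def)
  then show "\<exists>d>0. \<forall>x\<in>D. \<forall>x'\<in>D. dist x' x < d --> dist (u x') (u x) < e" using r(1) by blast
 qed
 obtain U where U: "uniformly_continuous_on (closure D) U" "!!x. x \<in> D ==> u x = U x"
  by (rule uniformly_continuous_on_extension_on_closure[OF uu]) (rule that)
 have Uc: "continuous_on {s..t} U" using uniformly_continuous_imp_continuous[OF U(1)] clD by simp
 \<comment> \<open>Inequalities on \<open>D\<close> pass to \<open>U\<close> at all times,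
   approximating both ends in an order-preserving way.\<close>
 have Ule: "\<bar>U b - U a\<bar> <= integral {a..b} h"
  if hi: "h integrable_on {s..t}"
   and hle: "!!a b. a \<in> D ==> b \<in> D ==> a <= b ==> \<bar>u b - u a\<bar> <= integral {a..b} h"
   and ab: "s <= a" "a <= b" "b <= t" for a b h
 proof -
  have hc: "continuous_on {s..t} (\<lambda>x. integral {s..x} h)" by (rule indefinite_integral_continuous_1[OF hi])
  have mem: "a \<in> {s..t}" "b \<in> {s..t}" using ab by auto
  have lim: "(\<lambda>n. k (d n x)) \<longlonglongrightarrow> k x" if "continuous_on {s..t} k" "x \<in> {s..t}" for k :: "real => real" and x
  proof -
   have "d n x \<in> {s..t}" for n using dD[OF that(2)] Dsub by blast
   then have "eventually (\<lambda>n. d n x \<in> {s..t}) sequentially" by (intro always_eventually allI)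
   then show ?thesis by (rule continuous_on_tendsto_compose[OF that(1) dlim[OF that(2)] that(2)])
  qed
  have "\<bar>U b - U a\<bar> <= integral {s..b} h - integral {s..a} h"
  proof (rule LIMSEQ_le)
   show "(\<lambda>n. \<bar>U (d n b) - U (d n a)\<bar>) \<longlonglongrightarrow> \<bar>U b - U a\<bar>"
    by (intro tendsto_rabs tendsto_diff lim[OF Uc] mem)
   show "(\<lambda>n. integral {s..d n b} h - integral {s..d n a} h) \<longlonglongrightarrow> integral {s..b} h - integral {s..a} h"
    by (intro tendsto_diff lim[OF hc] mem)
   show "\<exists>N. \<forall>n\<ge>N. \<bar>U (d n b) - U (d n a)\<bar> <= integral {s..d n b} h - integral {s..d n a} h"
   proof (intro exI allI impI)
    fix n
    have "integral {d n a..d n b} h = integral {s..d n b} h - integral {s..d n a} h"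
     by (rule integral_Icc_split[OF hi]) (use subsetD[OF Dsub dD[OF mem(1), of n]] subsetD[OF Dsub dD[OF mem(2), of n]] dmono[OF ab(2)] in auto)
    then show "\<bar>U (d n b) - U (d n a)\<bar> <= integral {s..d n b} h - integral {s..d n a} h"
     using hle[OF dD[OF mem(1)] dD[OF mem(2)] dmono[OF ab(2)], of n] U(2) dD mem by simp
   qed
  qed
  also have "... = integral {a..b} h" using integral_Icc_split[OF hi ab] by simp
  finally show ?thesis .
 qed
 obtain \<psi> where \<psi>: "\<psi> integrable_on {s..t}" "!!a b. s <= a ==> a <= b ==> b <= t ==> U b - U a = integral {a..b} \<psi>"
  by (rule absolutely_continuous_density[OF h1 i1 nn(1) st, of U]) (rule Ule[OF i1 le(1)], assumption+, blast)
 obtain N1 where N1: "negligible N1" "!!x. x \<in> {s<..<t} - N1 ==> \<bar>\<psi> x\<bar> <= h1 x"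
 proof (rule indefinite_integral_derivative_le[OF \<psi>(1) i1])
  fix a b assume ab: "s <= a" "a <= b" "b <= t"
  show "\<bar>integral {a..b} \<psi>\<bar> <= integral {a..b} h1" using Ule[OF i1 le(1) ab] \<psi>(2)[OF ab] by simp
 qed blast
 obtain N2 where N2: "negligible N2" "!!x. x \<in> {s<..<t} - N2 ==> \<bar>\<psi> x\<bar> <= h2 x"
 proof (rule indefinite_integral_derivative_le[OF \<psi>(1) i2])
  fix a b assume ab: "s <= a" "a <= b" "b <= t"
  show "\<bar>integral {a..b} \<psi>\<bar> <= integral {a..b} h2" using Ule[OF i2 le(2) ab] \<psi>(2)[OF ab] by simp
 qed blast
 show mi: "(\<lambda>x. min (h1 x) (h2 x)) integrable_on {s..t}"
 proof (rule integrable_on_Icc_if_nn_integral_finite)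
  have "(\<integral>\<^sup>+x\<in>{s..t}. ennreal (min (h1 x) (h2 x)) \<partial>lborel) <= (\<integral>\<^sup>+x\<in>{s..t}. ennreal (h1 x) \<partial>lborel)"
   by (intro nn_integral_mono mult_right_mono) (auto intro: ennreal_leI)
  also have "... = ennreal (integral {s..t} h1)" by (rule nn_integral_Icc_eq_integral[OF nn(1) i1])
  finally show "(\<integral>\<^sup>+x\<in>{s..t}. ennreal (min (h1 x) (h2 x)) \<partial>lborel) < \<infinity>" by (simp add: le_less_trans)
 qed (use nn in auto)
 let ?N = "N1 \<union> N2 \<union> {s, t}"
 let ?k = "\<lambda>x. if x \<in> ?N then \<bar>\<psi> x\<bar> else min (h1 x) (h2 x)"
 have neg: "negligible ?N" using N1(1) N2(1) by (simp add: negligible_Un)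
 have "\<bar>u t - u s\<bar> = norm (integral {s..t} \<psi>)"
  using \<psi>(2)[of s t] U(2)[of s] U(2)[of t] st D by simp
 also have "... <= integral {s..t} ?k"
 proof (rule integral_norm_bound_integral[OF \<psi>(1)])
  show "?k integrable_on {s..t}" by (rule integrable_spike[OF mi neg]) auto
  fix x assume "x \<in> {s..t}"
  then show "norm (\<psi> x) <= ?k x" using N1(2)[of x] N2(2)[of x] by auto
 qed
 also have "... = integral {s..t} (\<lambda>x. min (h1 x) (h2 x))" by (rule integral_spike[OF neg]) auto
 finally show "\<bar>u t - u s\<bar> <= integral {s..t} (\<lambda>x. min (h1 x) (h2 x))" .
qed

text \<open>Let \<open>Z\<close> be the zeros of \<open>u\<close> among the controlled times. From
  \<open>s\<close> to \<open>Inf Z\<close> and from \<open>Sup Z\<close> to \<open>t\<close> almost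
  no zeros are met, and these two pieces already bound \<open>\<bar>u s\<bar>\<close> and
  \<open>\<bar>u t\<bar>\<close>; everything in between is dropped.\<close>

lemma abs_increment_le_integral_off_zeros:
 fixes u h :: "real => real"
 assumes st: "s < t" and h [measurable]: "h \<in> borel_fun" and nn: "!!x. 0 <= h x"
  and hi: "h integrable_on {s..t}" and u [measurable]: "u \<in> borel_fun"
  and T: "T \<subseteq> {s..t}" "s \<in> T" "t \<in> T" and ae: "AE r in lborel. r \<in> {s..t} --> r \<in> T"
  and le: "!!a b. a \<in> T ==> b \<in> T ==> a <= b ==> \<bar>u b - u a\<bar> <= integral {a..b} h"
 shows "ennreal \<bar>u t - u s\<bar> <= (\<integral>\<^sup>+r\<in>{s..t}. ennreal (if u r = 0 then 0 else h r) \<partial>lborel)"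
proof -
 define Z where "Z = {r \<in> T. u r = 0}"
 let ?v = "\<lambda>r. ennreal (if u r = 0 then 0 else h r)"
 have nv: "ennreal (integral {a..b} h) = (\<integral>\<^sup>+r\<in>{a..b}. ?v r \<partial>lborel)"
  if ab: "s <= a" "a <= b" "b <= t" and no: "Z \<inter> {a<..<b} = {}" for a b
 proof -
  have "h integrable_on {a..b}" using hi ab by (auto intro: integrable_subinterval_real)
  then have "ennreal (integral {a..b} h) = (\<integral>\<^sup>+r\<in>{a..b}. ennreal (h r) \<partial>lborel)"
   using nn_integral_Icc_eq_integral[OF nn] by simp
  also have "... = (\<integral>\<^sup>+r\<in>{a..b}. ?v r \<partial>lborel)"
  proof (rule nn_integral_cong_AE)
   from ae AE_lborel_singleton[of a] AE_lborel_singleton[of b]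
   show "AE r in lborel. ennreal (h r) * indicator {a..b} r = ?v r * indicator {a..b} r"
   proof eventually_elim
    case (elim r)
    show ?case
    proof (cases "r \<in> {a..b}")
     case True
     with elim have "r \<in> {a<..<b}" "r \<in> T" using ab by auto
     then have "u r \<noteq> 0" using no by (auto simp: Z_def)
     then show ?thesis by simp
    qed simp
   qed
  qed
  finally show ?thesis .
 qed
 show ?thesis
 proof (cases "Z = {}")
  case True
  have "ennreal \<bar>u t - u s\<bar> <= ennreal (integral {s..t} h)" using le[of s t] T st by (intro ennreal_leI) auto
  also have "... = (\<integral>\<^sup>+r\<in>{s..t}. ?v r \<partial>lborel)" using nv[of s t] True st by simp
  finally show ?thesis .
 next
  case False
  define a where "a = Inf Z"
  define b where "b = Sup Z"
  have Zst: "Z \<subseteq> {s..t}" using T by (auto simp: Z_def)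
  then have bdd: "bdd_below Z" "bdd_above Z" by (meson bdd_below_mono bdd_below_Icc, meson bdd_above_mono bdd_above_Icc)
  have aZ: "a <= z" "z <= b" if "z \<in> Z" for z using that bdd by (auto simp: a_def b_def intro: cInf_lower cSup_upper)
  obtain z0 where z0: "z0 \<in> Z" using False by auto
  have ab: "s <= a" "a <= b" "b <= t"
  proof -
   show "s <= a" unfolding a_def using False Zst by (intro cInf_greatest) auto
   show "b <= t" unfolding b_def using False Zst by (intro cSup_least) auto
   show "a <= b" using aZ[OF z0] by simp
  qed
  have Hc: "continuous_on {s..t} (\<lambda>x. integral {s..x} h)" by (rule indefinite_integral_continuous_1[OF hi])
  \<comment> \<open>The infimum \<open>a\<close> need not be attained, so zeros close to
    \<open>a\<close> are used together with continuity of the indefinite integral.\<close>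
  have us: "\<bar>u s\<bar> <= integral {s..a} h"
  proof (rule ccontr)
   assume "\<not> ?thesis"
   then have pos: "0 < \<bar>u s\<bar> - integral {s..a} h" by simp
   obtain d where d: "d > 0" "!!x. x \<in> {s..t} ==> dist x a < d ==> dist (integral {s..x} h) (integral {s..a} h) < \<bar>u s\<bar> - integral {s..a} h"
    using Hc[unfolded continuous_on_iff] ab pos by (metis atLeastAtMost_iff order_trans)
   obtain z where z: "z \<in> Z" "z < a + d" using cInf_lessD[OF False, of "a + d"] d(1) by (auto simp: a_def)
   then have "dist z a < d" using aZ(1)[OF z(1)] by (simp add: dist_real_def)
   then have "integral {s..z} h < \<bar>u s\<bar>" using d(2)[of z] z Zst by (auto simp: dist_real_def)
   moreover have "\<bar>u z - u s\<bar> <= integral {s..z} h" using le[of s z] z T Zst by (auto simp: Z_def)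
   ultimately show False using z by (simp add: Z_def)
  qed
  have ut: "\<bar>u t\<bar> <= integral {b..t} h"
  proof (rule ccontr)
   assume "\<not> ?thesis"
   then have pos: "0 < \<bar>u t\<bar> - integral {b..t} h" by simp
   obtain d where d: "d > 0" "!!x. x \<in> {s..t} ==> dist x b < d ==> dist (integral {s..x} h) (integral {s..b} h) < \<bar>u t\<bar> - integral {b..t} h"
    using Hc[unfolded continuous_on_iff] ab pos by (metis atLeastAtMost_iff order_trans)
   obtain z where z: "z \<in> Z" "b - d < z" using less_cSupD[OF False, of "b - d"] d(1) by (auto simp: b_def)
   then have "dist z b < d" using aZ(2)[OF z(1)] by (simp add: dist_real_def)
   then have "dist (integral {s..z} h) (integral {s..b} h) < \<bar>u t\<bar> - integral {b..t} h" using d(2)[of z] z Zst by auto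
   moreover have "integral {z..t} h = integral {s..t} h - integral {s..z} h" "integral {b..t} h = integral {s..t} h - integral {s..b} h"
    using z Zst ab by (auto intro!: integral_Icc_split[OF hi])
   ultimately have "integral {z..t} h < \<bar>u t\<bar>" by (auto simp: dist_real_def)
   moreover have "\<bar>u t - u z\<bar> <= integral {z..t} h" using le[of z t] z T Zst by (auto simp: Z_def)
   ultimately show False using z by (simp add: Z_def)
  qed
  have "ennreal \<bar>u t - u s\<bar> <= ennreal (integral {s..a} h + integral {b..t} h)"
   using us ut by (intro ennreal_leI) linarith
  also have "... = ennreal (integral {s..a} h) + ennreal (integral {b..t} h)"
   using us ut by (intro ennreal_plus) linarith+
  also have "... = (\<integral>\<^sup>+r\<in>{s..a}. ?v r \<partial>lborel) + (\<integral>\<^sup>+r\<in>{b..t}. ?v r \<partial>lborel)"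
   using nv[of s a] nv[of b t] aZ ab by force
  also have "... = (\<integral>\<^sup>+r. ?v r * indicator {s..a} r + ?v r * indicator {b..t} r \<partial>lborel)"
   by (rule nn_integral_add[symmetric]) auto
  also have "... <= (\<integral>\<^sup>+r\<in>{s..t}. ?v r \<partial>lborel)"
   by (rule nn_integral_mono_AE)
    ((use AE_lborel_singleton[of a] in eventually_elim), (use ab in \<open>auto simp: indicator_def\<close>))
  finally show ?thesis .
 qed
qed

lemma integrable_on_cmult_real:
 fixes h :: "real => real"
 shows "h integrable_on S ==> (\<lambda>x. c * h x) integrable_on S"
 using integrable_on_cmult_left[of h S c] by simp

text \<open>On a short interval the product rule freezes \<open>w\<close> at the left end and
  \<open>u\<close> at the right end; uniform continuity of \<open>w\<close> makes the resulting
  error at most \<open>eps\<close> times the integral of \<open>h\<close>. Adding up short steps and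
  letting \<open>eps\<close> tend to 0 gives the bound.\<close>

lemma abs_increment_mult_le_integral:
 fixes u w h k :: "real => real"
 assumes st: "s < t" and w: "continuous_on {s..t} w" and K: "!!x. \<bar>u x\<bar> <= K"
  and nn: "!!x. 0 <= h x" "!!x. 0 <= k x"
  and hi: "h integrable_on {s..t}" and ki: "k integrable_on {s..t}" and whi: "(\<lambda>x. \<bar>w x\<bar> * h x) integrable_on {s..t}"
  and D: "D = (\<rat> \<inter> {s..t}) \<union> {s, t}"
  and le: "!!a b. a \<in> D ==> b \<in> D ==> a <= b ==> \<bar>u b - u a\<bar> <= integral {a..b} h"
   "!!a b. a \<in> D ==> b \<in> D ==> a <= b ==> \<bar>w b - w a\<bar> <= integral {a..b} k"
 shows "\<bar>w t * u t - w s * u s\<bar> <= integral {s..t} (\<lambda>x. \<bar>w x\<bar> * h x + K * k x)"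
proof -
 have Dsub: "D \<subseteq> {s..t}" using st D by auto
 have K0: "0 <= K" using K[of 0] by linarith
 have "\<bar>w t * u t - w s * u s\<bar> <= integral {s..t} (\<lambda>x. \<bar>w x\<bar> * h x + K * k x) + eps * integral {s..t} h" if e: "0 < eps" for eps
 proof -
  let ?g = "\<lambda>x. \<bar>w x\<bar> * h x + K * k x + eps * h x"
  have gi: "?g integrable_on {s..t}"
   by (intro integrable_add whi integrable_on_cmult_real hi ki)
  have "uniformly_continuous_on {s..t} w" using w by (rule compact_uniformly_continuous) simp
  then obtain \<delta> where d: "\<delta> > 0" "!!x y. x \<in> {s..t} ==> y \<in> {s..t} ==> dist y x < \<delta> ==> dist (w y) (w x) < eps"
   unfolding uniformly_continuous_on_def using e by blast
  have small: "\<bar>w b * u b - w a * u a\<bar> <= integral {a..b} ?g" if ab: "a \<in> D" "b \<in> D" "a <= b" "b - a < \<delta>" for a b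
  proof -
   have abst: "a \<in> {s..t}" "b \<in> {s..t}" using ab Dsub by auto
   then have sub: "{a..b} \<subseteq> {s..t}" by auto
   have "w b * u b - w a * u a = w a * (u b - u a) + u b * (w b - w a)" by (simp add: algebra_simps)
   then have "\<bar>w b * u b - w a * u a\<bar> <= \<bar>w a\<bar> * \<bar>u b - u a\<bar> + \<bar>u b\<bar> * \<bar>w b - w a\<bar>"
    by (metis abs_mult abs_triangle_ineq)
   also have "... <= \<bar>w a\<bar> * integral {a..b} h + K * integral {a..b} k"
    using le[OF ab(1-3)] K[of b] K0 by (intro add_mono mult_mono) auto
   also have "... = integral {a..b} (\<lambda>x. \<bar>w a\<bar> * h x + K * k x)"
    using hi ki sub by (subst integral_add) (auto intro!: integrable_on_cmult_real intro: integrable_subinterval_real)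
   also have "... <= integral {a..b} ?g"
   proof (rule integral_le)
    have "h integrable_on {a..b}" "k integrable_on {a..b}" using hi ki sub by (auto intro: integrable_subinterval_real)
    then show "(\<lambda>x. \<bar>w a\<bar> * h x + K * k x) integrable_on {a..b}"
     by (intro integrable_add integrable_on_cmult_real)
    show "?g integrable_on {a..b}" using gi sub by (rule integrable_subinterval_real)
    fix x assume x: "x \<in> {a..b}"
    then have "dist (w x) (w a) < eps" using d(2)[of a x] sub abst ab by (auto simp: dist_real_def)
    then have "\<bar>w a\<bar> <= \<bar>w x\<bar> + eps" by (simp add: dist_real_def)
    then have "\<bar>w a\<bar> * h x <= (\<bar>w x\<bar> + eps) * h x" using nn by (intro mult_right_mono) auto
    then show "\<bar>w a\<bar> * h x + K * k x <= ?g x" by (simp add: algebra_simps)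
   qed
   finally show ?thesis .
  qed
  \<comment> \<open>Induction on the number of steps of length below
    \<open>\<delta>\<close>.\<close>
  have "\<forall>x\<in>D. x - s < real (Suc n) * \<delta> --> \<bar>w x * u x - w s * u s\<bar> <= integral {s..x} ?g" for n
  proof (induction n)
   case 0
   show ?case using small[of s] D Dsub by auto
  next
   case (Suc n)
   show ?case
   proof (intro ballI impI)
    fix x assume x: "x \<in> D" "x - s < real (Suc (Suc n)) * \<delta>"
    show "\<bar>w x * u x - w s * u s\<bar> <= integral {s..x} ?g"
    proof (cases "x - s < \<delta>")
     case True
     then show ?thesis using small[of s x] D Dsub x by auto
    next
     case False
     \<comment> \<open>An intermediate time less than \<open>\<delta>\<close> before
       \<open>x\<close> and within reach of the induction hypothesis; taking it rational puts it
       into \<open>D\<close>.\<close>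
     have "x - \<delta> < min x (s + real (Suc n) * \<delta>)" using x d by (simp add: algebra_simps)
     then obtain y where y: "y \<in> \<rat>" "x - \<delta> < y" "y < min x (s + real (Suc n) * \<delta>)"
      using Rats_dense_in_real by blast
     have yD: "y \<in> D" using y False x Dsub by (auto simp: D)
     have 1: "\<bar>w y * u y - w s * u s\<bar> <= integral {s..y} ?g" using Suc yD y by auto
     have 2: "\<bar>w x * u x - w y * u y\<bar> <= integral {y..x} ?g" using small[of y x] yD x y by auto
     have "integral {y..x} ?g = integral {s..x} ?g - integral {s..y} ?g"
      by (rule integral_Icc_split[OF gi]) (use yD x y Dsub in auto)
     then show ?thesis using 1 2 by linarith
    qed
   qed
  qed
  moreover obtain n where "t - s < real (Suc n) * \<delta>"
   using reals_Archimedean3[OF d(1)] by (metis less_eq_real_def lessI of_nat_less_iff mult_less_cancel_right_pos d(1) order_less_trans)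
  ultimately have "\<bar>w t * u t - w s * u s\<bar> <= integral {s..t} ?g" using D by blast
  also have "... = integral {s..t} (\<lambda>x. \<bar>w x\<bar> * h x + K * k x) + integral {s..t} (\<lambda>x. eps * h x)"
   by (rule integral_add) (intro integrable_add whi integrable_on_cmult_real hi ki)+
  finally show ?thesis by simp
 qed
 note * = this
 show ?thesis
 proof (rule field_le_epsilon)
  fix e :: real assume e: "0 < e"
  have h0: "0 <= integral {s..t} h" using hi nn by (intro integral_nonneg) auto
  \<comment> \<open>This value of \<open>eps\<close> makes the error at most \<open>e\<close>; the
    summand 1 guards against a vanishing integral.\<close>
  have "e / (1 + integral {s..t} h) * integral {s..t} h <= e"
   using e h0 by (simp add: field_simps)
  then show "\<bar>w t * u t - w s * u s\<bar> <= integral {s..t} (\<lambda>x. \<bar>w x\<bar> * h x + K * k x) + e"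
   using *[of "e / (1 + integral {s..t} h)"] e h0 by (smt (verit) divide_pos_pos)
 qed
qed

section \<open>Calculus of upper gradients along curves\<close>

lemma curve_ugI:
 assumes "G \<in> borel_fun" "!!x. 0 <= G x"
  and "!!\<pi>. test_plan m q \<pi> ==> AE cv in \<pi>. path_int G (ev cv) 0 1 < \<infinity>"
  and "!!\<pi> s t. test_plan m q \<pi> ==> 0 <= s ==> s < t ==> t <= 1 ==> AE cv in \<pi>.
     ennreal \<bar>f (ev cv t) - f (ev cv s)\<bar> <= path_int G (ev cv) s t"
 shows "curve_ug m q f G"
 unfolding curve_ug_def
proof (intro conjI allI impI)
 fix \<pi> s t assume "test_plan m q \<pi>" "0 <= s" "s <= t" "t <= (1::real)"
 then show "AE cv in \<pi>. ennreal \<bar>f (ev cv t) - f (ev cv s)\<bar> <= path_int G (ev cv) s t"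
  by (cases "s = t") (auto intro: assms(4))
qed (use assms in auto)

lemma curve_ugD:
 assumes "curve_ug m q f G"
 shows "G \<in> borel_fun" "0 <= G x"
  and "test_plan m q \<pi> ==> AE cv in \<pi>. path_int G (ev cv) 0 1 < \<infinity>"
  and "test_plan m q \<pi> ==> 0 <= s ==> s <= t ==> t <= 1 ==> AE cv in \<pi>.
     ennreal \<bar>f (ev cv t) - f (ev cv s)\<bar> <= path_int G (ev cv) s t"
 using assms unfolding curve_ug_def by auto

lemma path_int_mono_interval:
 "s <= s' ==> t' <= t ==> path_int G cv s' t' <= path_int G cv s t"
 unfolding path_int_def by (intro nn_integral_mono mult_left_mono) (auto simp: indicator_def)

lemma path_int_eq_integral:
 fixes cv :: "real \<Rightarrow>\<^sub>C 'x::polish_space"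
 assumes [measurable]: "G \<in> borel_fun" and G0: "!!x. 0 <= G x"
  and fin: "path_int G (ev cv) 0 1 < \<infinity>" and st: "0 <= s" "s <= t" "t <= 1"
 shows "(\<lambda>r. G (ev cv r) * speed (ev cv) r) integrable_on {s..t}"
  and "path_int G (ev cv) s t = ennreal (integral {s..t} (\<lambda>r. G (ev cv r) * speed (ev cv) r))"
proof -
 let ?h = "\<lambda>r. G (ev cv r) * speed (ev cv) r"
 have "path_int G (ev cv) s t < \<infinity>" using path_int_mono_interval[OF st(1,3)] fin by (rule le_less_trans)
 then show i: "?h integrable_on {s..t}"
  unfolding path_int_def by (intro integrable_on_Icc_if_nn_integral_finite) (auto simp: G0)
 show "path_int G (ev cv) s t = ennreal (integral {s..t} ?h)"
  unfolding path_int_def by (rule nn_integral_Icc_eq_integral[OF _ i]) (simp add: G0)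
qed

lemma path_int_add:
 fixes cv :: "real \<Rightarrow>\<^sub>C 'x::polish_space"
 assumes [measurable]: "F \<in> borel_fun" "G \<in> borel_fun"
  and nn: "!!x. 0 <= F x" "!!x. 0 <= G x" and ab: "0 <= a" "0 <= b"
 shows "path_int (\<lambda>x. a * F x + b * G x) (ev cv) s t =
  ennreal a * path_int F (ev cv) s t + ennreal b * path_int G (ev cv) s t"
proof -
 have "path_int (\<lambda>x. a * F x + b * G x) (ev cv) s t = (\<integral>\<^sup>+r.
  ennreal a * (ennreal (F (ev cv r) * speed (ev cv) r) * indicator {s..t} r)
  + ennreal b * (ennreal (G (ev cv r) * speed (ev cv) r) * indicator {s..t} r) \<partial>lborel)"
  unfolding path_int_def
  by (intro nn_integral_cong)
   (auto simp: indicator_def nn ab distrib_right mult.assoc ennreal_mult'[symmetric] simp flip: ennreal_plus)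
 also have "... = ennreal a * path_int F (ev cv) s t + ennreal b * path_int G (ev cv) s t"
  unfolding path_int_def by (subst nn_integral_add) (auto simp: nn_integral_cmult)
 finally show ?thesis .
qed

lemma curve_ug_lincomb:
 fixes f g :: "'x::polish_space => real"
 assumes f: "curve_ug m q f F" and g: "curve_ug m q g G"
 shows "curve_ug m q (\<lambda>x. a * f x + b * g x) (\<lambda>x. \<bar>a\<bar> * F x + \<bar>b\<bar> * G x)"
proof (rule curve_ugI)
 note D = curve_ugD[OF f] curve_ugD[OF g]
 have [measurable]: "F \<in> borel_fun" "G \<in> borel_fun" using D by auto
 have nn: "0 <= F x" "0 <= G x" for x using D by auto
 note pa = path_int_add[of F G "\<bar>a\<bar>" "\<bar>b\<bar>", simplified]
 show "(\<lambda>x. \<bar>a\<bar> * F x + \<bar>b\<bar> * G x) \<in> borel_fun" by measurable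
 show "0 <= \<bar>a\<bar> * F x + \<bar>b\<bar> * G x" for x using nn by simp
 fix \<pi> :: "(real \<Rightarrow>\<^sub>C 'x) measure" assume tp: "test_plan m q \<pi>"
 show "AE cv in \<pi>. path_int (\<lambda>x. \<bar>a\<bar> * F x + \<bar>b\<bar> * G x) (ev cv) 0 1 < \<infinity>"
  using curve_ugD(3)[OF f tp] curve_ugD(3)[OF g tp]
  by eventually_elim (simp add: path_int_add nn ennreal_mult_less_top)
 fix s t :: real assume st: "0 <= s" "s < t" "t <= 1"
 have st': "s <= t" using st by simp
 show "AE cv in \<pi>. ennreal \<bar>(a * f (ev cv t) + b * g (ev cv t)) - (a * f (ev cv s) + b * g (ev cv s))\<bar>
   <= path_int (\<lambda>x. \<bar>a\<bar> * F x + \<bar>b\<bar> * G x) (ev cv) s t"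
  using curve_ugD(4)[OF f tp st(1) st' st(3)] curve_ugD(4)[OF g tp st(1) st' st(3)]
 proof eventually_elim
  case (elim cv)
  let ?f = "f (ev cv t) - f (ev cv s)" and ?g = "g (ev cv t) - g (ev cv s)"
  have "\<bar>(a * f (ev cv t) + b * g (ev cv t)) - (a * f (ev cv s) + b * g (ev cv s))\<bar>
   = \<bar>a * ?f + b * ?g\<bar>" by (simp add: algebra_simps)
  also have "... <= \<bar>a\<bar> * \<bar>?f\<bar> + \<bar>b\<bar> * \<bar>?g\<bar>" by (metis abs_mult abs_triangle_ineq)
  finally have "ennreal \<bar>(a * f (ev cv t) + b * g (ev cv t)) - (a * f (ev cv s) + b * g (ev cv s))\<bar>
   <= ennreal (\<bar>a\<bar> * \<bar>?f\<bar> + \<bar>b\<bar> * \<bar>?g\<bar>)" by (rule ennreal_leI)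
  also have "... = ennreal \<bar>a\<bar> * ennreal \<bar>?f\<bar> + ennreal \<bar>b\<bar> * ennreal \<bar>?g\<bar>" by (simp add: ennreal_mult)
  also have "... <= ennreal \<bar>a\<bar> * path_int F (ev cv) s t + ennreal \<bar>b\<bar> * path_int G (ev cv) s t"
   using elim by (intro add_mono mult_left_mono) auto
  also have "... = path_int (\<lambda>x. \<bar>a\<bar> * F x + \<bar>b\<bar> * G x) (ev cv) s t"
   by (rule path_int_add[symmetric]) (auto simp: nn)
  finally show ?case .
 qed
qed

text \<open>Covers truncation and the addition of constants, which do not enlarge
  increments.\<close>

lemma curve_ug_contraction:
 assumes f: "curve_ug m q f G" and le: "!!x y. \<bar>g x - g y\<bar> <= \<bar>f x - f y\<bar>"
 shows "curve_ug m q g G"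
proof (rule curve_ugI)
 fix \<pi> s t assume tp: "test_plan m q \<pi>" and st: "0 <= s" "s < t" "t <= (1::real)"
 have st': "s <= t" using st by simp
 show "AE cv in \<pi>. ennreal \<bar>g (ev cv t) - g (ev cv s)\<bar> <= path_int G (ev cv) s t"
  using curve_ugD(4)[OF f tp st(1) st' st(3)]
 proof eventually_elim
  case (elim cv)
  have "ennreal \<bar>g (ev cv t) - g (ev cv s)\<bar> <= ennreal \<bar>f (ev cv t) - f (ev cv s)\<bar>"
   by (intro ennreal_leI le)
  then show ?case using elim by (rule order_trans)
 qed
qed (use curve_ugD[OF f] in auto)

lemma path_int_mono_AE:
 assumes "AE r in lborel. r \<in> {0..1} --> G (cv r) <= G' (cv r)" "0 <= s" "t <= 1"
 shows "path_int G cv s t <= path_int G' cv s t"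
 unfolding path_int_def
 by (rule nn_integral_mono_AE)
  ((use assms(1) in eventually_elim), (use assms(2,3) in \<open>auto simp: indicator_def intro!: ennreal_leI mult_right_mono\<close>))

lemma curve_ug_mono_AE:
 assumes m: "sets m = sets borel" and f: "curve_ug m q f G" and G': "G' \<in> borel_fun" "!!x. 0 <= G' x"
  and le: "AE x in m. G x <= G' x"
  and fin: "!!\<pi>. test_plan m q \<pi> ==> AE cv in \<pi>. path_int G' (ev cv) 0 1 < \<infinity>"
 shows "curve_ug m q f G'"
proof (rule curve_ugI[OF G' fin])
 fix \<pi> s t assume tp: "test_plan m q \<pi>" and st: "0 <= s" "s < t" "t <= (1::real)"
 have st': "s <= t" using st by simp
 show "AE cv in \<pi>. ennreal \<bar>f (ev cv t) - f (ev cv s)\<bar> <= path_int G' (ev cv) s t"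
  using curve_ugD(4)[OF f tp st(1) st' st(3)] test_plan_AE_null[OF tp m le]
 proof eventually_elim
  case (elim cv)
  from path_int_mono_AE[of G "ev cv" G', OF elim(2) st(1,3)] elim(1) show ?case by (rule order_trans[rotated])
 qed
qed

text \<open>The bound \<open>G\<close> is common to all \<open>f n\<close>, so along almost every
  curve all their inequalities hold at once and pass to the limit.\<close>

lemma curve_ug_limit:
 assumes f: "!!n::nat. curve_ug m q (f n) G" and lim: "!!x. (\<lambda>n. f n x) \<longlonglongrightarrow> g x"
 shows "curve_ug m q g G"
proof (rule curve_ugI)
 fix \<pi> s t assume tp: "test_plan m q \<pi>" and st: "0 <= s" "s < t" "t <= (1::real)"
 have st': "s <= t" using st by simp
 have "AE cv in \<pi>. \<forall>n. ennreal \<bar>f n (ev cv t) - f n (ev cv s)\<bar> <= path_int G (ev cv) s t"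
  unfolding AE_all_countable using curve_ugD(4)[OF f tp st(1) st' st(3)] by auto
 then show "AE cv in \<pi>. ennreal \<bar>g (ev cv t) - g (ev cv s)\<bar> <= path_int G (ev cv) s t"
 proof eventually_elim
  case (elim cv)
  have "(\<lambda>n. ennreal \<bar>f n (ev cv t) - f n (ev cv s)\<bar>) \<longlonglongrightarrow> ennreal \<bar>g (ev cv t) - g (ev cv s)\<bar>"
   by (intro tendsto_ennrealI tendsto_rabs tendsto_diff lim)
  then show ?case by (rule LIMSEQ_le_const2) (use elim in auto)
 qed
qed (use curve_ugD[OF f] in auto)

text \<open>Monotone convergence from above applies because the path integral of \<open>G 0\<close>
  is finite along almost every curve. It provides the limit of a decreasing minimising
  sequence.\<close>

lemma curve_ug_decreasing_limit:
 assumes f: "!!n::nat. curve_ug m q f (G n)" and dec: "!!n x. G (Suc n) x <= G n x"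
  and lim: "!!x. (\<lambda>n. G n x) \<longlonglongrightarrow> H x"
 shows "curve_ug m q f H"
proof (rule curve_ugI)
 have [measurable]: "G n \<in> borel_fun" for n using curve_ugD(1)[OF f] .
 show H [measurable]: "H \<in> borel_fun"
  by (rule borel_measurable_LIMSEQ_metric[of G]) (use lim in auto)
 have decseq: "decseq (\<lambda>n. G n x)" for x using dec by (intro decseq_SucI)
 have HG: "H x <= G n x" for n x using decseq_ge[OF decseq lim] .
 show "0 <= H x" for x by (rule LIMSEQ_le_const[OF lim]) (use curve_ugD(2)[OF f] in auto)
 fix \<pi> assume tp: "test_plan m q \<pi>"
 have HI: "path_int H (ev cv) a b <= path_int (G n) (ev cv) a b" for cv a b n
  unfolding path_int_def using HG by (intro nn_integral_mono mult_right_mono ennreal_leI) auto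
 show "AE cv in \<pi>. path_int H (ev cv) 0 1 < \<infinity>"
  using curve_ugD(3)[OF f[of 0] tp] by eventually_elim (rule le_less_trans[OF HI])
 fix s t :: real assume st: "0 <= s" "s < t" "t <= (1::real)"
 have st': "s <= t" using st by simp
 have "AE cv in \<pi>. \<forall>n. ennreal \<bar>f (ev cv t) - f (ev cv s)\<bar> <= path_int (G n) (ev cv) s t"
  unfolding AE_all_countable using curve_ugD(4)[OF f tp st(1) st' st(3)] by auto
 with curve_ugD(3)[OF f[of 0] tp]
 show "AE cv in \<pi>. ennreal \<bar>f (ev cv t) - f (ev cv s)\<bar> <= path_int H (ev cv) s t"
 proof eventually_elim
  case (elim cv)
  let ?i = "\<lambda>G r. ennreal (G (ev cv r) * speed (ev cv) r) * indicator {s..t} r"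
  have fin: "path_int (G 0) (ev cv) s t < \<infinity>"
   using path_int_mono_interval[OF st(1,3)] elim(1) by (rule le_less_trans)
  have "?i H r = (INF n. ?i (G n) r)" for r
  proof (rule LIMSEQ_unique)
   show "(\<lambda>n. ?i (G n) r) \<longlonglongrightarrow> ?i H r"
   proof (cases "r \<in> {s..t}")
    case True
    have "(\<lambda>n. ennreal (G n (ev cv r) * speed (ev cv) r)) \<longlonglongrightarrow> ennreal (H (ev cv r) * speed (ev cv) r)"
     by (intro tendsto_ennrealI tendsto_mult lim tendsto_const)
    then show ?thesis using True by simp
   qed simp
   show "(\<lambda>n. ?i (G n) r) \<longlonglongrightarrow> (INF n. ?i (G n) r)"
    by (rule LIMSEQ_INF) (auto intro!: decseq_SucI mult_right_mono ennreal_leI dec)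
  qed
  then have "path_int H (ev cv) s t = (\<integral>\<^sup>+r. (INF n. ?i (G n) r) \<partial>lborel)"
   unfolding path_int_def by simp
  also have "... = (INF n. \<integral>\<^sup>+r. ?i (G n) r \<partial>lborel)"
  proof (rule nn_integral_monotone_convergence_INF_decseq[where i=0])
   show "decseq (\<lambda>n. ?i (G n))"
    by (intro decseq_SucI le_funI mult_right_mono ennreal_leI dec) auto
   show "(\<integral>\<^sup>+r. ?i (G 0) r \<partial>lborel) < \<infinity>" using fin by (simp add: path_int_def)
  qed measurable
  finally have "path_int H (ev cv) s t = (INF n. path_int (G n) (ev cv) s t)"
   by (simp add: path_int_def)
  then show ?case using elim(2) by (simp add: INF_greatest)
 qed
qed

text \<open>Countability of \<open>D\<close> lets one null set of curves serve all pairs of times,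
  and finiteness of the path integral turns extended integrals into real ones; in this form the
  estimates on the line apply.\<close>

lemma curve_ug_AE_integral:
 assumes f: "curve_ug m q f G" and tp: "test_plan m q \<pi>" and D: "countable D" "D \<subseteq> {0..1}"
 shows "AE cv in \<pi>. path_int G (ev cv) 0 1 < \<infinity> \<and> (\<forall>a\<in>D. \<forall>b\<in>D. a <= b -->
  \<bar>f (ev cv b) - f (ev cv a)\<bar> <= integral {a..b} (\<lambda>r. G (ev cv r) * speed (ev cv) r))"
proof -
 have "AE cv in \<pi>. \<forall>a\<in>D. \<forall>b\<in>D. a <= b -->
  ennreal \<bar>f (ev cv b) - f (ev cv a)\<bar> <= path_int G (ev cv) a b"
  unfolding AE_ball_countable[OF D(1)]
 proof (intro ballI)
  fix a b assume ab: "a \<in> D" "b \<in> D"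
  show "AE cv in \<pi>. a <= b --> ennreal \<bar>f (ev cv b) - f (ev cv a)\<bar> <= path_int G (ev cv) a b"
  proof (cases "a <= b")
   case True
   have "a \<in> {0..1}" "b \<in> {0..1}" using ab D(2) by blast+
   then show ?thesis using curve_ugD(4)[OF f tp, of a b] True by simp
  qed simp
 qed
 with curve_ugD(3)[OF f tp] show ?thesis
 proof eventually_elim
  case (elim cv)
  have "\<bar>f (ev cv b) - f (ev cv a)\<bar> <= integral {a..b} (\<lambda>r. G (ev cv r) * speed (ev cv) r)"
   if ab: "a \<in> D" "b \<in> D" "a <= b" for a b
  proof -
   have ab': "0 <= a" "b <= 1" using ab D by auto
   note P = path_int_eq_integral[OF curve_ugD(1,2)[OF f] elim(1) ab'(1) ab(3) ab'(2)]
   have "0 <= integral {a..b} (\<lambda>r. G (ev cv r) * speed (ev cv) r)"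
    by (rule integral_nonneg[OF P(1)]) (use curve_ugD(2)[OF f] in auto)
   moreover have "ennreal \<bar>f (ev cv b) - f (ev cv a)\<bar> <= ennreal (integral {a..b} (\<lambda>r. G (ev cv r) * speed (ev cv) r))"
    unfolding P(2)[symmetric] using elim(2) ab by blast
   ultimately show ?thesis by (simp add: ennreal_le_iff)
  qed
  with elim(1) show ?case by blast
 qed
qed

lemma countable_rational_grid: "countable ((\<rat> \<inter> {s..t}) \<union> {s, t :: real})"
 by (intro countable_Un countable_Int1 countable_rat) auto

text \<open>Along a curve the increments of \<open>f\<close> come from a density dominated by both
  gradients, hence by their minimum.\<close>

lemma curve_ug_min:
 assumes f: "curve_ug m q f F" and g: "curve_ug m q f G"
 shows "curve_ug m q f (\<lambda>x. min (F x) (G x))"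
proof (rule curve_ugI)
 have [measurable]: "F \<in> borel_fun" "G \<in> borel_fun" and nn: "!!x. 0 <= F x" "!!x. 0 <= G x"
  using curve_ugD[OF f] curve_ugD[OF g] by auto
 show "(\<lambda>x. min (F x) (G x)) \<in> borel_fun" by measurable
 show "0 <= min (F x) (G x)" for x using nn by simp
 fix \<pi> assume tp: "test_plan m q \<pi>"
 have le: "path_int (\<lambda>x. min (F x) (G x)) (ev cv) a b <= path_int F (ev cv) a b" for cv a b
  unfolding path_int_def by (intro nn_integral_mono mult_right_mono ennreal_leI) auto
 show fin: "AE cv in \<pi>. path_int (\<lambda>x. min (F x) (G x)) (ev cv) 0 1 < \<infinity>"
  using curve_ugD(3)[OF f tp] by eventually_elim (rule le_less_trans[OF le])
 fix s t :: real assume st: "0 <= s" "s < t" "t <= (1::real)"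
 have st': "s <= t" using st by simp
 let ?D = "(\<rat> \<inter> {s..t}) \<union> {s, t}"
 have D01: "?D \<subseteq> {0..1}" using st by auto
 show "AE cv in \<pi>. ennreal \<bar>f (ev cv t) - f (ev cv s)\<bar> <= path_int (\<lambda>x. min (F x) (G x)) (ev cv) s t"
  using curve_ug_AE_integral[OF f tp countable_rational_grid D01] curve_ug_AE_integral[OF g tp countable_rational_grid D01]
 proof eventually_elim
  case (elim cv)
  let ?h1 = "\<lambda>r. F (ev cv r) * speed (ev cv) r"
  let ?h2 = "\<lambda>r. G (ev cv r) * speed (ev cv) r"
  have i1: "?h1 integrable_on {s..t}"
   by (rule path_int_eq_integral(1)[OF _ nn(1) _ st(1) st' st(3)]) (measurable, use elim in blast)
  have i2: "?h2 integrable_on {s..t}"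
   by (rule path_int_eq_integral(1)[OF _ nn(2) _ st(1) st' st(3)]) (measurable, use elim in blast)
  have meq: "min (?h1 r) (?h2 r) = min (F (ev cv r)) (G (ev cv r)) * speed (ev cv) r" for r
   by (simp add: min_mult_distrib_right)
  have "\<bar>f (ev cv t) - f (ev cv s)\<bar> <= integral {s..t} (\<lambda>r. min (?h1 r) (?h2 r))"
  proof (rule abs_increment_le_integral_min(2)[OF st(2) _ _ _ _ i1 i2 refl, where u="\<lambda>r. f (ev cv r)"])
   show "?h1 \<in> borel_fun" "?h2 \<in> borel_fun" by measurable
   show "0 <= ?h1 r" "0 <= ?h2 r" for r using nn by simp_all
   fix a b assume ab: "a \<in> ?D" "b \<in> ?D" "a <= b"
   show "\<bar>f (ev cv b) - f (ev cv a)\<bar> <= integral {a..b} ?h1" using elim(1) ab by blast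
   show "\<bar>f (ev cv b) - f (ev cv a)\<bar> <= integral {a..b} ?h2" using elim(2) ab by blast
  qed
  moreover have "path_int (\<lambda>x. min (F x) (G x)) (ev cv) 0 1 < \<infinity>"
   using elim le by (blast intro: le_less_trans)
  ultimately show ?case
   using path_int_eq_integral(2)[of "\<lambda>x. min (F x) (G x)" cv, OF _ _ _ st(1) st' st(3)] nn
   by (simp add: meq ennreal_leI)
 qed
qed

text \<open>The Leibniz rule along curves. Continuity of \<open>eta\<close> is what allows freezing
  it on short time intervals; \<open>f\<close> itself may be discontinuous along the curve.\<close>

lemma curve_ug_mult:
 fixes m :: "'x::polish_space measure"
 assumes f: "curve_ug m q f F" and K: "!!x. \<bar>f x\<bar> <= K"
  and g: "curve_ug m q eta E" and eta: "continuous_on UNIV eta" "!!x. \<bar>eta x\<bar> <= B"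
 shows "curve_ug m q (\<lambda>x. eta x * f x) (\<lambda>x. \<bar>eta x\<bar> * F x + K * E x)"
proof (rule curve_ugI)
 have [measurable]: "F \<in> borel_fun" "E \<in> borel_fun" "eta \<in> borel_fun"
  and nn: "!!x. 0 <= F x" "!!x. 0 <= E x"
  using curve_ugD[OF f] curve_ugD[OF g] borel_measurable_continuous_onI[OF eta(1)] by auto
 have K0: "0 <= K" using order_trans[OF abs_ge_zero K] .
 have B0: "0 <= B" using order_trans[OF abs_ge_zero eta(2)] .
 show [measurable]: "(\<lambda>x. \<bar>eta x\<bar> * F x + K * E x) \<in> borel_fun" by measurable
 show pos: "0 <= \<bar>eta x\<bar> * F x + K * E x" for x using nn K0 by simp
 fix \<pi> assume tp: "test_plan m q \<pi>"
 have le: "path_int (\<lambda>x. \<bar>eta x\<bar> * F x + K * E x) (ev cv) a b <=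
  ennreal B * path_int F (ev cv) a b + ennreal K * path_int E (ev cv) a b" for cv :: "real \<Rightarrow>\<^sub>C 'x" and a b
 proof -
  have "path_int (\<lambda>x. \<bar>eta x\<bar> * F x + K * E x) (ev cv) a b <= path_int (\<lambda>x. B * F x + K * E x) (ev cv) a b"
   unfolding path_int_def using eta(2) nn by (intro nn_integral_mono mult_right_mono ennreal_leI add_mono) auto
  also have "... = ennreal B * path_int F (ev cv) a b + ennreal K * path_int E (ev cv) a b"
   by (rule path_int_add) (use nn K0 B0 in auto)
  finally show ?thesis .
 qed
 have fin': "path_int (\<lambda>x. \<bar>eta x\<bar> * F x + K * E x) (ev cv) 0 1 < \<infinity>"
  if "path_int F (ev cv) 0 1 < \<infinity>" "path_int E (ev cv) 0 1 < \<infinity>" for cv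
  using le by (rule le_less_trans) (use that in \<open>simp add: ennreal_mult_less_top\<close>)
 show "AE cv in \<pi>. path_int (\<lambda>x. \<bar>eta x\<bar> * F x + K * E x) (ev cv) 0 1 < \<infinity>"
  using curve_ugD(3)[OF f tp] curve_ugD(3)[OF g tp] by eventually_elim (rule fin')
 fix s t :: real assume st: "0 <= s" "s < t" "t <= (1::real)"
 have st': "s <= t" using st by simp
 let ?D = "(\<rat> \<inter> {s..t}) \<union> {s, t}"
 have D01: "?D \<subseteq> {0..1}" using st by auto
 show "AE cv in \<pi>. ennreal \<bar>eta (ev cv t) * f (ev cv t) - eta (ev cv s) * f (ev cv s)\<bar>
  <= path_int (\<lambda>x. \<bar>eta x\<bar> * F x + K * E x) (ev cv) s t"
  using curve_ug_AE_integral[OF f tp countable_rational_grid D01] curve_ug_AE_integral[OF g tp countable_rational_grid D01]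
 proof eventually_elim
  case (elim cv)
  let ?h = "\<lambda>r. F (ev cv r) * speed (ev cv) r"
  let ?k = "\<lambda>r. E (ev cv r) * speed (ev cv) r"
  let ?w = "\<lambda>r. eta (ev cv r)"
  have i1: "?h integrable_on {s..t}"
   by (rule path_int_eq_integral(1)[OF _ nn(1) _ st(1) st' st(3)]) (measurable, use elim in blast)
  have i2: "?k integrable_on {s..t}"
   by (rule path_int_eq_integral(1)[OF _ nn(2) _ st(1) st' st(3)]) (measurable, use elim in blast)
  have "path_int (\<lambda>x. \<bar>eta x\<bar> * F x) (ev cv) 0 1 <= path_int (\<lambda>x. \<bar>eta x\<bar> * F x + K * E x) (ev cv) 0 1"
   unfolding path_int_def using nn K0 by (intro nn_integral_mono mult_right_mono ennreal_leI) auto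
  then have "path_int (\<lambda>x. \<bar>eta x\<bar> * F x) (ev cv) 0 1 < \<infinity>"
   by (rule le_less_trans) (use fin' elim in auto)
  then have i3: "(\<lambda>r. \<bar>?w r\<bar> * ?h r) integrable_on {s..t}"
   using path_int_eq_integral(1)[of "\<lambda>x. \<bar>eta x\<bar> * F x" cv, OF _ _ _ st(1) st' st(3)] nn by (simp add: mult.assoc)
  have "\<bar>?w t * f (ev cv t) - ?w s * f (ev cv s)\<bar> <= integral {s..t} (\<lambda>r. \<bar>?w r\<bar> * ?h r + K * ?k r)"
  proof (rule abs_increment_mult_le_integral[OF st(2) _ _ _ _ i1 i2 i3 refl, where u="\<lambda>r. f (ev cv r)"])
   show "continuous_on {s..t} ?w"
    by (rule continuous_on_compose2[OF eta(1) continuous_on_apply_bcontfun]) auto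
   show "\<bar>f (ev cv r)\<bar> <= K" for r by (rule K)
   show "0 <= ?h r" "0 <= ?k r" for r using nn by simp_all
   fix a b assume ab: "a \<in> ?D" "b \<in> ?D" "a <= b"
   show "\<bar>f (ev cv b) - f (ev cv a)\<bar> <= integral {a..b} ?h" using elim(1) ab by blast
   show "\<bar>?w b - ?w a\<bar> <= integral {a..b} ?k" using elim(2) ab by blast
  qed
  then show ?case
   using path_int_eq_integral(2)[of "\<lambda>x. \<bar>eta x\<bar> * F x + K * E x" cv, OF _ pos _ st(1) st' st(3)] fin'[of cv] elim
   by (simp add: distrib_right mult.assoc ennreal_leI)
 qed
qed

lemma curve_ug_lipschitz:
 fixes m :: "'x::polish_space measure"
 assumes q: "1 <= q" and L: "L-lipschitz_on UNIV f"
 shows "curve_ug m q f (\<lambda>_. L)"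
proof (rule curve_ugI)
 have L0: "0 <= L" using L by (rule lipschitz_on_nonneg)
 then show "(\<lambda>_. L) \<in> borel_fun" "0 <= L" by auto
 fix \<pi> assume tp: "test_plan m q \<pi>"
 have pi: "path_int (\<lambda>_. L) (ev cv) a b = ennreal L * (\<integral>\<^sup>+r\<in>{a..b}. ennreal (speed (ev cv) r) \<partial>lborel)" for cv :: "real \<Rightarrow>\<^sub>C 'x" and a b
  unfolding path_int_def using L0 by (simp add: ennreal_mult mult.assoc nn_integral_cmult)
 show "AE cv in \<pi>. path_int (\<lambda>_. L) (ev cv) 0 1 < \<infinity>"
  using test_plan_AC(1)[OF tp q]
 proof eventually_elim
  case (elim cv)
  have "(\<integral>\<^sup>+r\<in>{0..1}. ennreal (speed (ev cv) r) \<partial>lborel) < \<infinity>"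
   by (rule nn_integral_finite_if_powr[OF _ _ q AC_speed(2)[OF elim q]]) auto
  then show ?case unfolding pi by (simp add: ennreal_mult_less_top)
 qed
 fix s t :: real assume st: "0 <= s" "s < t" "t <= (1::real)"
 have st': "s <= t" using st by simp
 show "AE cv in \<pi>. ennreal \<bar>f (ev cv t) - f (ev cv s)\<bar> <= path_int (\<lambda>_. L) (ev cv) s t"
  using test_plan_AC(1)[OF tp q]
 proof eventually_elim
  case (elim cv)
  have "\<bar>f (ev cv t) - f (ev cv s)\<bar> <= L * dist (ev cv s) (ev cv t)"
   using lipschitz_onD[OF L, of "ev cv t" "ev cv s"] by (simp add: dist_real_def dist_commute)
  then have "ennreal \<bar>f (ev cv t) - f (ev cv s)\<bar> <= ennreal L * ennreal (dist (ev cv s) (ev cv t))"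
   using L0 by (simp add: ennreal_leI flip: ennreal_mult)
  also have "... <= path_int (\<lambda>_. L) (ev cv) s t"
   unfolding pi by (intro mult_left_mono AC_speed(3)[OF elim q _ st(1) st' st(3)]) auto
  finally show ?case .
 qed
qed

text \<open>The source of locality. Zeros of \<open>f\<close> along a curve must be found among
  almost all times, not only rational ones. Fubini's theorem provides, on almost every curve, a set
  \<open>T\<close> of times of full measure, each of which is comparable with every time in
  \<open>D\<close>.\<close>

lemma curve_ug_off_zeros:
 fixes m :: "'x::polish_space measure"
 assumes f: "curve_ug m q f G" and fm [measurable]: "f \<in> borel_fun"
 shows "curve_ug m q f (\<lambda>x. if f x = 0 then 0 else G x)"
proof (rule curve_ugI)
 have [measurable]: "G \<in> borel_fun" and nn: "!!x. 0 <= G x" using curve_ugD[OF f] by auto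
 let ?G = "\<lambda>x. if f x = 0 then 0 else G x"
 show "?G \<in> borel_fun" by measurable
 show "0 <= ?G x" for x using nn by simp
 fix \<pi> :: "(real \<Rightarrow>\<^sub>C 'x) measure" assume tp: "test_plan m q \<pi>"
 have le: "path_int ?G (ev cv) a b <= path_int G (ev cv) a b" for cv a b
  unfolding path_int_def using nn by (intro nn_integral_mono mult_right_mono ennreal_leI) auto
 show fin: "AE cv in \<pi>. path_int ?G (ev cv) 0 1 < \<infinity>"
  using curve_ugD(3)[OF f tp] by eventually_elim (rule le_less_trans[OF le])
 fix s t :: real assume st: "0 <= s" "s < t" "t <= (1::real)"
 have st': "s <= t" using st by simp
 define D where "D = (\<rat> \<inter> {s..t}) \<union> {s, t}"
 have cD: "countable D" unfolding D_def by (rule countable_rational_grid)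
 have D01: "D \<subseteq> {0..1}" and Dst: "D \<subseteq> {s..t}" using st by (auto simp: D_def)
 \<comment> \<open>Writing the countable quantifier as one over natural numbers makes measurability
   of \<open>P\<close> automatic.\<close>
 have D_enum: "(\<forall>d\<in>D. Q d) \<longleftrightarrow> (\<forall>n. Q (from_nat_into D n))" for Q
 proof -
  have "D = range (from_nat_into D)" using cD by (intro range_from_nat_into[symmetric]) (auto simp: D_def)
  then show ?thesis by (metis rangeE rangeI)
 qed
 have sets: "sets \<pi> = sets curve_space" and "prob_space \<pi>" using tp by (auto simp: test_plan_def)
 then interpret prob_space \<pi> by simp
 interpret pair_sigma_finite \<pi> lborel ..
 \<comment> \<open>\<open>min\<close> and \<open>max\<close> treat both orders of \<open>r\<close>
   and \<open>d\<close> at once.\<close>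
 define P where "P cv r \<longleftrightarrow> (\<forall>d\<in>D. r \<in> {s..t} --> ennreal \<bar>f (ev cv (max r d)) - f (ev cv (min r d))\<bar> <= path_int G (ev cv) (min r d) (max r d))" for cv r
 have "AE r in lborel. AE cv in \<pi>. P cv r"
 proof (rule AE_I2)
  fix r :: real
  show "AE cv in \<pi>. P cv r"
   unfolding P_def AE_ball_countable[OF cD]
  proof
   fix d assume "d \<in> D"
   then have d: "d \<in> {s..t}" using Dst by blast
   show "AE cv in \<pi>. r \<in> {s..t} --> ennreal \<bar>f (ev cv (max r d)) - f (ev cv (min r d))\<bar> <= path_int G (ev cv) (min r d) (max r d)"
   proof (cases "r \<in> {s..t}")
    case True
    have "0 <= min r d" "min r d <= max r d" "max r d <= 1" using True d st by auto
    then show ?thesis using curve_ugD(4)[OF f tp] True by simp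
   qed auto
  qed
 qed
 moreover have "{x \<in> space (\<pi> \<Otimes>\<^sub>M lborel). P (fst x) (snd x)} \<in> sets (\<pi> \<Otimes>\<^sub>M lborel)"
 proof -
  have 1 [measurable]: "(\<lambda>x. ev (fst x) (max (snd x) d)) \<in> borel_measurable (\<pi> \<Otimes>\<^sub>M lborel)" for d
   by (rule borel_measurable_eval[OF sets]) measurable
  have 2 [measurable]: "(\<lambda>x. ev (fst x) (min (snd x) d)) \<in> borel_measurable (\<pi> \<Otimes>\<^sub>M lborel)" for d
   by (rule borel_measurable_eval[OF sets]) measurable
  have 3 [measurable]: "(\<lambda>x. path_int G (ev (fst x)) (min (snd x) d) (max (snd x) d)) \<in> borel_measurable (\<pi> \<Otimes>\<^sub>M lborel)" for d
   by (rule borel_measurable_path_int[OF sets]) measurable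
  have "Measurable.pred (\<pi> \<Otimes>\<^sub>M lborel) (\<lambda>x. P (fst x) (snd x))"
   unfolding P_def D_enum by measurable
  then show ?thesis by (simp add: pred_def)
 qed
 \<comment> \<open>The exchange of the two almost everywhere quantifiers needs the joint
   measurability just shown.\<close>
 ultimately have "AE cv in \<pi>. AE r in lborel. P cv r" by (subst AE_commute)
 with curve_ug_AE_integral[OF f tp cD D01]
 show "AE cv in \<pi>. ennreal \<bar>f (ev cv t) - f (ev cv s)\<bar> <= path_int ?G (ev cv) s t"
 proof eventually_elim
  case (elim cv)
  let ?h = "\<lambda>r. G (ev cv r) * speed (ev cv) r"
  let ?u = "\<lambda>r. f (ev cv r)"
  define T where "T = {r \<in> {s..t}. \<forall>d\<in>D. \<bar>?u (max r d) - ?u (min r d)\<bar> <= integral {min r d..max r d} ?h}"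
  have fin: "path_int G (ev cv) 0 1 < \<infinity>" using elim(1) by blast
  note PI = path_int_eq_integral[OF curve_ugD(1,2)[OF f] fin]
  have hi: "?h integrable_on {s..t}" by (rule PI(1)[OF st(1) st' st(3)])
  have ends: "\<bar>?u (max s d) - ?u (min s d)\<bar> <= integral {min s d..max s d} ?h"
   "\<bar>?u (max t d) - ?u (min t d)\<bar> <= integral {min t d..max t d} ?h" if d: "d \<in> D" for d
  proof -
   have "d \<in> {s..t}" using d Dst by blast
   then have m: "max s d = d" "min s d = s" "max t d = t" "min t d = d" "s <= d" "d <= t" by auto
   have "s \<in> D" "t \<in> D" by (auto simp: D_def)
   then show "\<bar>?u (max s d) - ?u (min s d)\<bar> <= integral {min s d..max s d} ?h"
    "\<bar>?u (max t d) - ?u (min t d)\<bar> <= integral {min t d..max t d} ?h"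
    unfolding m(1-4) using elim(1) d m(5,6) by blast+
  qed
  have mem: "s \<in> {s..t}" "t \<in> {s..t}" using st' by auto
  have inT: "s \<in> T" "t \<in> T"
   unfolding T_def using ends mem by blast+
  have ae: "AE r in lborel. r \<in> {s..t} --> r \<in> T"
   using elim(2)
  proof eventually_elim
   case (elim r)
   show ?case
   proof
    assume r: "r \<in> {s..t}"
    have "\<bar>?u (max r d) - ?u (min r d)\<bar> <= integral {min r d..max r d} ?h" if d: "d \<in> D" for d
    proof -
     have "d \<in> {s..t}" using d Dst by blast
     then have m: "0 <= min r d" "min r d <= max r d" "max r d <= 1" using r st by auto
     have "0 <= integral {min r d..max r d} ?h"
      by (rule integral_nonneg[OF PI(1)[OF m]]) (simp add: nn)
     moreover have "ennreal \<bar>?u (max r d) - ?u (min r d)\<bar> <= ennreal (integral {min r d..max r d} ?h)"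
      unfolding PI(2)[OF m, symmetric] using elim r d unfolding P_def by blast
     ultimately show ?thesis by (simp add: ennreal_le_iff)
    qed
    then show "r \<in> T" using r by (simp add: T_def)
   qed
  qed
  have "ennreal \<bar>?u t - ?u s\<bar> <= (\<integral>\<^sup>+r\<in>{s..t}. ennreal (if ?u r = 0 then 0 else ?h r) \<partial>lborel)"
  proof (rule abs_increment_le_integral_off_zeros[OF st(2) _ _ hi _ _ inT ae])
   show "?h \<in> borel_fun" "?u \<in> borel_fun" by measurable
   show "0 <= ?h r" for r using nn by simp
   show "T \<subseteq> {s..t}" by (auto simp: T_def)
   fix a b assume ab: "a \<in> T" "b \<in> T" "a <= b"
   show "\<bar>?u b - ?u a\<bar> <= integral {a..b} ?h"
   proof (cases "a = b")
    case False
    \<comment> \<open>Two points of \<open>T\<close> are compared through a rational time between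
      them.\<close>
    then obtain d where d: "d \<in> \<rat>" "a < d" "d < b" using ab Rats_dense_in_real[of a b] by auto
    then have "d \<in> D" using ab by (auto simp: D_def T_def)
    then have "\<bar>?u (max a d) - ?u (min a d)\<bar> <= integral {min a d..max a d} ?h"
     "\<bar>?u (max b d) - ?u (min b d)\<bar> <= integral {min b d..max b d} ?h" using ab by (auto simp: T_def)
    moreover have "max a d = d" "min a d = a" "max b d = b" "min b d = d" using d by auto
    ultimately have "\<bar>?u d - ?u a\<bar> <= integral {a..d} ?h" "\<bar>?u b - ?u d\<bar> <= integral {d..b} ?h" by simp_all
    moreover have "integral {d..b} ?h = integral {a..b} ?h - integral {a..d} ?h"
     by (rule integral_Icc_split[OF integrable_subinterval_real[OF hi]]) (use ab d in \<open>auto simp: T_def\<close>)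
    ultimately show ?thesis by linarith
   qed simp
  qed
  also have "... = path_int ?G (ev cv) s t"
   unfolding path_int_def by (intro nn_integral_cong) auto
  finally show ?case .
 qed
qed

section \<open>Change of exponent and integrability\<close>

text \<open>Curves and times together carry a probability measure, so the bound
  \<open>x powr q <= 1 + x powr q'\<close> controls the lower energy by the higher one.\<close>

lemma test_plan_mono_exponent:
 fixes m :: "'x::polish_space measure"
 assumes q: "1 <= q" "q <= q'" and tp: "test_plan m q' \<pi>"
 shows "test_plan m q \<pi>"
proof -
 have sets: "sets \<pi> = sets curve_space" and ps: "prob_space \<pi>"
  and en: "(\<integral>\<^sup>+cv. energy q' (ev cv) \<partial>\<pi>) < \<infinity>" using tp by (auto simp: test_plan_def)
 interpret prob_space \<pi> by fact
 have q': "1 <= q'" using q by simp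
 have pw: "x powr q <= 1 + x powr q'" if "0 <= x" for x :: real
 proof (cases "x <= 1")
  case True
  then have "x powr q <= 1" using that q by (intro powr_le1) auto
  then show ?thesis using powr_ge_zero[of x q'] by linarith
 next
  case False
  then have "x powr q <= x powr q'" using q by (intro powr_mono) auto
  then show ?thesis by simp
 qed
 have le: "energy q (ev cv) <= 1 + energy q' (ev cv)" for cv :: "real \<Rightarrow>\<^sub>C 'x"
 proof (cases "AC q' (ev cv)")
  case True
  have "(\<integral>\<^sup>+t\<in>{0..1}. ennreal (speed (ev cv) t powr q) \<partial>lborel) <=
   (\<integral>\<^sup>+t. indicator {0..1::real} t + ennreal (speed (ev cv) t powr q') * indicator {0..1} t \<partial>lborel)"
  proof (rule nn_integral_mono)
   fix t :: real
   have "ennreal (speed (ev cv) t powr q) <= ennreal (1 + speed (ev cv) t powr q')"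
    by (intro ennreal_leI pw) simp
   also have "... = 1 + ennreal (speed (ev cv) t powr q')" by simp
   finally show "ennreal (speed (ev cv) t powr q) * indicator {0..1} t <=
    indicator {0..1::real} t + ennreal (speed (ev cv) t powr q') * indicator {0..1} t"
    by (auto simp: indicator_def)
  qed
  also have "... = (\<integral>\<^sup>+t. indicator {0..1::real} t \<partial>lborel) + (\<integral>\<^sup>+t\<in>{0..1}. ennreal (speed (ev cv) t powr q') \<partial>lborel)"
   by (rule nn_integral_add) auto
  also have "... = 1 + (\<integral>\<^sup>+t\<in>{0..1}. ennreal (speed (ev cv) t powr q') \<partial>lborel)" by simp
  finally have le: "(\<integral>\<^sup>+t\<in>{0..1}. ennreal (speed (ev cv) t powr q) \<partial>lborel) <=
   1 + (\<integral>\<^sup>+t\<in>{0..1}. ennreal (speed (ev cv) t powr q') \<partial>lborel)" .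
  have "AC q (ev cv)"
   unfolding AC_iff_speed[OF q(1) continuous_on_apply_bcontfun]
  proof (intro conjI ballI impI)
   show "(\<integral>\<^sup>+t\<in>{0..1}. ennreal (speed (ev cv) t powr q) \<partial>lborel) < \<infinity>"
    using AC_speed(2)[OF True q' continuous_on_apply_bcontfun] by (intro le_less_trans[OF le]) simp
  qed (rule AC_speed(3)[OF True q' continuous_on_apply_bcontfun])
  then show ?thesis using True le by (simp add: energy_eq[OF q(1)] energy_eq[OF q'])
 qed (simp add: energy_def)
 have "(\<integral>\<^sup>+cv. energy q (ev cv) \<partial>\<pi>) <= (\<integral>\<^sup>+cv. 1 + energy q' (ev cv) \<partial>\<pi>)"
  by (intro nn_integral_mono le)
 also have "... = (\<integral>\<^sup>+cv. 1 \<partial>\<pi>) + (\<integral>\<^sup>+cv. energy q' (ev cv) \<partial>\<pi>)"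
  by (rule nn_integral_add) (use borel_measurable_energy[OF sets q'] in auto)
 also have "... < \<infinity>" using en by (simp add: emeasure_space_1)
 finally show ?thesis using tp by (simp add: test_plan_def)
qed

text \<open>A larger exponent leaves fewer test plans to check.\<close>

lemma curve_ug_mono_exponent:
 assumes "1 <= q" "q <= q'" "curve_ug m q f G"
 shows "curve_ug m q' f G"
 using assms(3) test_plan_mono_exponent[OF assms(1,2)] unfolding curve_ug_def by blast

lemma Lp_fun_dominated:
 assumes m: "sets m = sets borel" and f: "f \<in> Lp_fun m p" and g: "g \<in> borel_fun" and p: "0 <= p"
  and le: "AE x in m. \<bar>g x\<bar> <= \<bar>f x\<bar>"
 shows "g \<in> Lp_fun m p"
proof -
 note [measurable_cong] = m
 note [measurable] = g
 have "integrable m (\<lambda>x. \<bar>g x\<bar> powr p)"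
 proof (rule Bochner_Integration.integrable_bound)
  show "integrable m (\<lambda>x. \<bar>f x\<bar> powr p)" using f by (simp add: Lp_fun_def)
  show "AE x in m. norm (\<bar>g x\<bar> powr p) <= norm (\<bar>f x\<bar> powr p)"
   using le by eventually_elim (auto intro: powr_mono2 p)
 qed measurable
 then show ?thesis using g by (simp add: Lp_fun_def)
qed

lemma Lp_fun_lincomb:
 assumes m: "sets m = sets borel" and f: "f \<in> Lp_fun m p" and g: "g \<in> Lp_fun m p" and p: "0 <= p"
 shows "(\<lambda>x. a * f x + b * g x) \<in> Lp_fun m p"
proof -
 note [measurable_cong] = m
 have [measurable]: "f \<in> borel_fun" "g \<in> borel_fun"
  and i: "integrable m (\<lambda>x. \<bar>f x\<bar> powr p)" "integrable m (\<lambda>x. \<bar>g x\<bar> powr p)"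
  using f g by (auto simp: Lp_fun_def)
 have "integrable m (\<lambda>x. \<bar>a * f x + b * g x\<bar> powr p)"
 proof (rule Bochner_Integration.integrable_bound)
  show "integrable m (\<lambda>x. (2 * \<bar>a\<bar>) powr p * (\<bar>f x\<bar> powr p) + (2 * \<bar>b\<bar>) powr p * (\<bar>g x\<bar> powr p))"
   using i by auto
  show "AE x in m. norm (\<bar>a * f x + b * g x\<bar> powr p) <= norm ((2 * \<bar>a\<bar>) powr p * (\<bar>f x\<bar> powr p) + (2 * \<bar>b\<bar>) powr p * (\<bar>g x\<bar> powr p))"
  proof (rule AE_I2)
   fix x
   let ?A = "\<bar>a\<bar> * \<bar>f x\<bar>" and ?B = "\<bar>b\<bar> * \<bar>g x\<bar>"
   have "\<bar>a * f x + b * g x\<bar> <= ?A + ?B" by (metis abs_mult abs_triangle_ineq)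
   also have "... <= 2 * max ?A ?B" by linarith
   finally have "\<bar>a * f x + b * g x\<bar> powr p <= (2 * max ?A ?B) powr p" using p by (intro powr_mono2) auto
   also have "... <= (2 * ?A) powr p + (2 * ?B) powr p" by (auto simp: max_def)
   finally show "norm (\<bar>a * f x + b * g x\<bar> powr p) <= norm ((2 * \<bar>a\<bar>) powr p * (\<bar>f x\<bar> powr p) + (2 * \<bar>b\<bar>) powr p * (\<bar>g x\<bar> powr p))"
    by (simp add: powr_mult mult.assoc)
  qed
 qed measurable
 then show ?thesis by (simp add: Lp_fun_def)
qed

section \<open>Minimal weak upper gradients\<close>

lemma metric_speed_nonneg:
 assumes t: "t \<in> {0..1}"
 shows "0 <= metric_speed cv t"
proof (cases "\<exists>l. ((\<lambda>s. dist (cv s) (cv t) / \<bar>s - t\<bar>) \<longlongrightarrow> l) (at t within {0..1})")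
 case True
 then obtain l where l: "((\<lambda>s. dist (cv s) (cv t) / \<bar>s - t\<bar>) \<longlongrightarrow> l) (at t within {0..1})" by blast
 have nb: "at t within {0..1} \<noteq> bot" using t by (simp add: trivial_limit_within islimpt_Icc)
 have "0 <= l" by (rule tendsto_lowerbound[OF l _ nb]) simp
 moreover have "Lim (at t within {0..1}) (\<lambda>s. dist (cv s) (cv t) / \<bar>s - t\<bar>) = l" by (rule tendsto_Lim[OF nb l])
 ultimately show ?thesis using True by (simp add: metric_speed_def)
qed (simp add: metric_speed_def)

text \<open>From here on the integrated definition can be replaced by the pathwise one. The positive
  part accounts for \<open>G\<close> being nonnegative only almost everywhere; under the integral it
  disappears because the metric speed is nonnegative.\<close>

lemma weak_upper_gradient_iff:
 fixes m :: "'x::polish_space measure"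
 assumes m: "sets m = sets borel" and p: "1 < p" and f: "f \<in> borel_fun"
 shows "weak_upper_gradient m p f G \<longleftrightarrow> G \<in> Lp_fun m p \<and> (AE x in m. 0 <= G x) \<and>
  curve_ug m (conj_exp p) f (\<lambda>x. max 0 (G x))"
proof
 assume w: "weak_upper_gradient m p f G"
 then show "G \<in> Lp_fun m p \<and> (AE x in m. 0 <= G x) \<and> curve_ug m (conj_exp p) f (\<lambda>x. max 0 (G x))"
  using curve_ug_if_weak_upper_gradient[OF m p f w] by (simp add: weak_upper_gradient_def)
next
 assume H: "G \<in> Lp_fun m p \<and> (AE x in m. 0 <= G x) \<and> curve_ug m (conj_exp p) f (\<lambda>x. max 0 (G x))"
 have "(\<lambda>x. max 0 (G x)) \<in> Lp_fun m p"
  by (rule Lp_fun_dominated[OF m conjunct1[OF H]]) (use H p in \<open>auto simp: Lp_fun_def\<close>)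
 with H have w: "weak_upper_gradient m p f (\<lambda>x. max 0 (G x))" by (intro weak_upper_gradient_if_curve_ug p) auto
 have "(\<integral>\<^sup>+t\<in>{0..1}. ennreal (max 0 (G (c t)) * metric_speed c t) \<partial>lborel) =
  (\<integral>\<^sup>+t\<in>{0..1}. ennreal (G (c t) * metric_speed c t) \<partial>lborel)" for c :: "real => 'x"
 proof (rule nn_integral_cong)
  fix t :: real
  show "ennreal (max 0 (G (c t)) * metric_speed c t) * indicator {0..1} t = ennreal (G (c t) * metric_speed c t) * indicator {0..1} t"
   using metric_speed_nonneg[of t c]
   by (cases "t \<in> {0..1}"; cases "0 <= G (c t)") (auto simp: max_def ennreal_neg mult_nonpos_nonneg)
 qed
 then show "weak_upper_gradient m p f G" using H w unfolding weak_upper_gradient_def by simp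
qed

lemma weak_upper_gradient_lincomb:
 assumes m: "sets m = sets borel" and p: "1 < p" and fg: "f \<in> borel_fun" "g \<in> borel_fun"
  and wf: "weak_upper_gradient m p f F" and wg: "weak_upper_gradient m p g G"
 shows "weak_upper_gradient m p (\<lambda>x. a * f x + b * g x) (\<lambda>x. \<bar>a\<bar> * max 0 (F x) + \<bar>b\<bar> * max 0 (G x))"
proof (rule weak_upper_gradient_if_curve_ug[OF p])
 have F: "F \<in> Lp_fun m p" "curve_ug m (conj_exp p) f (\<lambda>x. max 0 (F x))"
  and G: "G \<in> Lp_fun m p" "curve_ug m (conj_exp p) g (\<lambda>x. max 0 (G x))"
  using wf wg weak_upper_gradient_iff[OF m p] fg by auto
 show "curve_ug m (conj_exp p) (\<lambda>x. a * f x + b * g x) (\<lambda>x. \<bar>a\<bar> * max 0 (F x) + \<bar>b\<bar> * max 0 (G x))"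
  using F(2) G(2) by (rule curve_ug_lincomb)
 have "(\<lambda>x. max 0 (F x)) \<in> Lp_fun m p" "(\<lambda>x. max 0 (G x)) \<in> Lp_fun m p"
  using Lp_fun_dominated[OF m F(1), of "\<lambda>x. max 0 (F x)"] Lp_fun_dominated[OF m G(1), of "\<lambda>x. max 0 (G x)"] F(1) G(1) p
  by (auto simp: Lp_fun_def)
 then show "(\<lambda>x. \<bar>a\<bar> * max 0 (F x) + \<bar>b\<bar> * max 0 (G x)) \<in> Lp_fun m p"
  by (rule Lp_fun_lincomb[OF m]) (use p in simp)
qed

lemma weak_upper_gradient_mono:
 assumes m: "sets m = sets borel" and p: "1 < p" and f: "f \<in> borel_fun"
  and w: "weak_upper_gradient m p f G" and G': "G' \<in> Lp_fun m p" and le: "AE x in m. G x <= G' x"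
 shows "weak_upper_gradient m p f G'"
proof -
 have c: "curve_ug m (conj_exp p) f (\<lambda>x. max 0 (G x))" and G0: "AE x in m. 0 <= G x"
  using w weak_upper_gradient_iff[OF m p f] by auto
 have G'b: "G' \<in> borel_fun" using G' by (simp add: Lp_fun_def)
 have mG': "(\<lambda>x. max 0 (G' x)) \<in> Lp_fun m p"
  by (rule Lp_fun_dominated[OF m G']) (use G'b p in auto)
 have "curve_ug m (conj_exp p) f (\<lambda>x. max 0 (G' x))"
 proof (rule curve_ug_mono_AE[OF m c])
  show "AE x in m. max 0 (G x) <= max 0 (G' x)" using le by eventually_elim auto
  show "AE cv in \<pi>. path_int (\<lambda>x. max 0 (G' x)) (ev cv) 0 1 < \<infinity>" if "test_plan m (conj_exp p) \<pi>" for \<pi>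
   by (rule test_plan_AE_path_int_finite[OF that m p mG'])
 qed (use G'b in auto)
 moreover have "AE x in m. 0 <= G' x" using le G0 by eventually_elim auto
 ultimately show ?thesis using weak_upper_gradient_iff[OF m p f] G' by blast
qed

lemma weak_upper_gradient_min:
 assumes m: "sets m = sets borel" and p: "1 < p" and f: "f \<in> borel_fun"
  and w: "weak_upper_gradient m p f F" "weak_upper_gradient m p f G"
 shows "weak_upper_gradient m p f (\<lambda>x. min (max 0 (F x)) (max 0 (G x)))"
proof (rule weak_upper_gradient_if_curve_ug[OF p])
 have c: "curve_ug m (conj_exp p) f (\<lambda>x. max 0 (F x))" "curve_ug m (conj_exp p) f (\<lambda>x. max 0 (G x))"
  and F: "F \<in> Lp_fun m p" using w weak_upper_gradient_iff[OF m p f] by auto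
 show c': "curve_ug m (conj_exp p) f (\<lambda>x. min (max 0 (F x)) (max 0 (G x)))" using c by (rule curve_ug_min)
 show "(\<lambda>x. min (max 0 (F x)) (max 0 (G x))) \<in> Lp_fun m p"
  by (rule Lp_fun_dominated[OF m F]) (use curve_ugD(1)[OF c'] p in auto)
qed

text \<open>A minimising sequence for the integral of the \<open>p\<close>-th power becomes
  decreasing after taking running minima, and its limit \<open>K\<close> attains the infimum. If
  another upper gradient were smaller than \<open>K\<close> on a set of positive measure, its
  minimum with \<open>K\<close> would have a smaller integral.\<close>

lemma ex_minimal_weak_upper_gradient:
 fixes m :: "'x::polish_space measure"
 assumes m: "sets m = sets borel" and p: "1 < p" and f: "f \<in> Sob m p"
 shows "\<exists>G. weak_upper_gradient m p f G \<and> (\<forall>G'. weak_upper_gradient m p f G' --> (AE x in m. G x <= G' x))"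
proof -
 have fb: "f \<in> borel_fun" using f by (simp add: Sob_def)
 define S where "S = {G. weak_upper_gradient m p f G \<and> (\<forall>x. 0 <= G x)}"
 define N where "N G = (\<integral>x. \<bar>G x\<bar> powr p \<partial>m)" for G :: "'x => real"
 have toS: "(\<lambda>x. max 0 (G x)) \<in> S" if "weak_upper_gradient m p f G" for G
  using weak_upper_gradient_min[OF m p fb that that] by (simp add: S_def)
 have minS: "(\<lambda>x. min (F x) (G x)) \<in> S" if "F \<in> S" "G \<in> S" for F G
  using weak_upper_gradient_min[OF m p fb, of F G] that by (simp add: S_def max_def)
 have SL: "G \<in> borel_fun" "integrable m (\<lambda>x. \<bar>G x\<bar> powr p)" "curve_ug m (conj_exp p) f G" "0 <= G x"
  if "G \<in> S" for G x
  using that weak_upper_gradient_iff[OF m p fb, of G] by (auto simp: S_def Lp_fun_def max_def)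
 have Sne: "S \<noteq> {}" using f toS by (auto simp: Sob_def)
 define I where "I = Inf (N ` S)"
 have N0: "0 <= N G" for G unfolding N_def by (intro integral_nonneg_AE) auto
 have bdd: "bdd_below (N ` S)" by (rule bdd_belowI[of _ 0]) (auto simp: N0)
 have ILow: "I <= N G" if "G \<in> S" for G unfolding I_def using that bdd by (intro cInf_lower) auto
 have "\<exists>G\<in>S. N G < I + 1 / real (Suc n)" for n
 proof -
  have "Inf (N ` S) < I + 1 / real (Suc n)" by (simp add: I_def)
  from cInf_lessD[OF _ this] Sne show ?thesis by auto
 qed
 then obtain G where G: "!!n. G n \<in> S" "!!n. N (G n) < I + 1 / real (Suc n)" by metis
 \<comment> \<open>Running minima of the sequence \<open>G\<close>; the lattice property keeps them
   in \<open>S\<close>.\<close>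
 define H where "H = rec_nat (G 0) (\<lambda>n h x. min (h x) (G (Suc n) x))"
 have H0: "H 0 = G 0" and HS: "H (Suc n) = (\<lambda>x. min (H n x) (G (Suc n) x))" for n by (auto simp: H_def)
 have HinS: "H n \<in> S" for n by (induction n) (auto simp: H0 HS G intro: minS)
 have HG: "H n x <= G n x" for n x by (cases n) (auto simp: H0 HS)
 have Hdec: "H (Suc n) x <= H n x" for n x by (simp add: HS)
 have dH: "decseq (\<lambda>n. H n x)" for x using Hdec by (intro decseq_SucI)
 have "\<exists>L. (\<lambda>n. H n x) \<longlonglongrightarrow> L" for x
  by (rule decseq_convergent[OF dH, of 0]) (use SL(4)[OF HinS] in auto)
 then obtain K where K: "!!x. (\<lambda>n. H n x) \<longlonglongrightarrow> K x" by metis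
 have KH: "K x <= H n x" for n x using decseq_ge[OF dH K] .
 have Kc: "curve_ug m (conj_exp p) f K"
  by (rule curve_ug_decreasing_limit[of _ _ _ H]) (use SL(3)[OF HinS] Hdec K in auto)
 have K0: "0 <= K x" for x using curve_ugD(2)[OF Kc] .
 have KL: "K \<in> Lp_fun m p"
  by (rule Lp_fun_dominated[OF m, of "H 0"])
   (use SL(1,2)[OF HinS] SL(4)[OF HinS] curve_ugD(1)[OF Kc] K0 KH p in \<open>auto simp: Lp_fun_def\<close>)
 have Kw: "weak_upper_gradient m p f K" by (rule weak_upper_gradient_if_curve_ug[OF p Kc KL])
 have KS: "K \<in> S" using Kw K0 by (simp add: S_def)
 note [measurable_cong] = m
 have NK: "N K <= I"
 proof (rule field_le_epsilon)
  fix e :: real assume "0 < e"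
  then obtain n where n: "1 / real (Suc n) < e" using nat_approx_posE by blast
  have "\<bar>K x\<bar> powr p <= \<bar>G n x\<bar> powr p" for x
   using order_trans[OF KH HG, of x n] K0[of x] p by (intro powr_mono2) auto
  then have "N K <= N (G n)" unfolding N_def
   by (intro integral_mono SL(2)[OF KS] SL(2)[OF G(1)])
  then show "N K <= I + e" using G(2)[of n] n by linarith
 qed
 show ?thesis
 proof (intro exI[of _ K] conjI Kw allI impI)
  fix G' assume w: "weak_upper_gradient m p f G'"
  define M where "M x = min (K x) (max 0 (G' x))" for x
  have MS: "M \<in> S" unfolding M_def using KS toS[OF w] by (rule minS)
  have le: "M x powr p <= K x powr p" for x
   using SL(4)[OF MS] p by (intro powr_mono2) (auto simp: M_def)
  have "I <= N M" using MS by (rule ILow)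
  moreover have i: "integrable m (\<lambda>x. K x powr p)" "integrable m (\<lambda>x. M x powr p)"
   using SL(2)[OF KS] SL(2)[OF MS] SL(4)[OF MS] K0 by auto
  then have "(\<integral>x. K x powr p - M x powr p \<partial>m) = N K - N M"
   unfolding N_def using SL(4)[OF MS] K0 by (subst Bochner_Integration.integral_diff) auto
  ultimately have "(\<integral>x. K x powr p - M x powr p \<partial>m) <= 0" using NK by linarith
  moreover have "0 <= (\<integral>x. K x powr p - M x powr p \<partial>m)" by (rule integral_nonneg_AE) (use le in auto)
  ultimately have "(\<integral>x. K x powr p - M x powr p \<partial>m) = 0" by linarith
  then have "AE x in m. K x powr p - M x powr p = 0"
   by (subst (asm) integral_nonneg_eq_0_iff_AE) (use i le in auto)
  moreover have "AE x in m. 0 <= G' x" using w by (simp add: weak_upper_gradient_def)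
  ultimately show "AE x in m. K x <= G' x"
  proof eventually_elim
   case (elim x)
   show ?case
   proof (rule ccontr)
    assume "\<not> K x <= G' x"
    then have "M x < K x" using elim(2) by (simp add: M_def)
    then have "M x powr p < K x powr p" using SL(4)[OF MS] p by (intro powr_less_mono2) auto
    then show False using elim by simp
   qed
  qed
 qed
qed

section \<open>Calculus of minimal weak upper gradients\<close>

locale metric_measure_space =
 fixes m :: "'x::polish_space measure"
 assumes metric_measure: "metric_measure m"
begin

lemma sets_m [measurable_cong]: "sets m = sets borel"
 using metric_measure by (simp add: metric_measure_def)

lemma space_m [simp]: "space m = UNIV"
 using sets_eq_imp_space_eq[OF sets_m] by simp

lemma emeasure_bounded: "B \<in> sets borel ==> bounded B ==> emeasure m B < \<infinity>"
 using metric_measure by (simp add: metric_measure_def)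

lemma min_wug:
 assumes p: "1 < p" and f: "f \<in> Sob m p"
 shows "weak_upper_gradient m p f (min_wug m p f)"
  and "weak_upper_gradient m p f G ==> AE x in m. min_wug m p f x <= G x"
  and "min_wug m p f \<in> Lp_fun m p" and "min_wug m p f \<in> borel_fun"
  and "AE x in m. 0 <= min_wug m p f x"
proof -
 have H: "weak_upper_gradient m p f (min_wug m p f) \<and>
  (\<forall>G'. weak_upper_gradient m p f G' --> (AE x in m. min_wug m p f x <= G' x))"
  unfolding min_wug_def by (rule someI_ex[OF ex_minimal_weak_upper_gradient[OF sets_m p f]])
 then show w: "weak_upper_gradient m p f (min_wug m p f)" by blast
 show "weak_upper_gradient m p f G ==> AE x in m. min_wug m p f x <= G x" using H by blast
 show "min_wug m p f \<in> Lp_fun m p" "AE x in m. 0 <= min_wug m p f x" "min_wug m p f \<in> borel_fun"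
  using w by (auto simp: weak_upper_gradient_def Lp_fun_def)
qed

lemma SobD: "f \<in> Sob m p ==> f \<in> borel_fun"
 by (simp add: Sob_def)

lemma Sob_lincomb:
 assumes p: "1 < p" and f: "f \<in> Sob m p" and g: "g \<in> Sob m p"
 shows "(\<lambda>x. a * f x + b * g x) \<in> Sob m p"
  and "AE x in m. min_wug m p (\<lambda>x. a * f x + b * g x) x <= \<bar>a\<bar> * min_wug m p f x + \<bar>b\<bar> * min_wug m p g x"
proof -
 note [measurable] = SobD[OF f] SobD[OF g]
 have w: "weak_upper_gradient m p (\<lambda>x. a * f x + b * g x) (\<lambda>x. \<bar>a\<bar> * max 0 (min_wug m p f x) + \<bar>b\<bar> * max 0 (min_wug m p g x))"
  by (rule weak_upper_gradient_lincomb[OF sets_m p SobD[OF f] SobD[OF g] min_wug(1)[OF p f] min_wug(1)[OF p g]])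
 have "(\<lambda>x. a * f x + b * g x) \<in> borel_fun" by measurable
 then show S: "(\<lambda>x. a * f x + b * g x) \<in> Sob m p" using w by (auto simp: Sob_def)
 show "AE x in m. min_wug m p (\<lambda>x. a * f x + b * g x) x <= \<bar>a\<bar> * min_wug m p f x + \<bar>b\<bar> * min_wug m p g x"
  using min_wug(2)[OF p S w] min_wug(5)[OF p f] min_wug(5)[OF p g] by eventually_elim (simp add: max_def)
qed

lemma weak_upper_gradient_contraction:
 assumes p: "1 < p" and f: "f \<in> borel_fun" and w: "weak_upper_gradient m p f G"
  and g: "g \<in> borel_fun" and le: "!!x y. \<bar>g x - g y\<bar> <= \<bar>f x - f y\<bar>"
 shows "weak_upper_gradient m p g G"
 using w unfolding weak_upper_gradient_iff[OF sets_m p f] weak_upper_gradient_iff[OF sets_m p g]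
 by (elim conjE, intro conjI curve_ug_contraction[OF _ le])

lemma truncate_at_contraction: "\<bar>truncate_at k f x - truncate_at k f y\<bar> <= \<bar>f x - f y\<bar>"
 by (auto simp: truncate_at_def min_def max_def)

lemma abs_truncate_at: "0 < k ==> \<bar>truncate_at k f x\<bar> <= k"
 by (auto simp: truncate_at_def min_def max_def)

lemma truncate_at_eq: "\<bar>f x\<bar> <= k ==> truncate_at k f x = f x"
 by (auto simp: truncate_at_def min_def max_def)

lemma borel_measurable_truncate_at [measurable]:
 "f \<in> borel_measurable M ==> truncate_at k f \<in> borel_measurable M"
 unfolding truncate_at_def[abs_def]
 by (intro borel_measurable_min borel_measurable_max borel_measurable_const)

lemma Sob_truncate_at:
 assumes p: "1 < p" and f: "f \<in> Sob m p"
 shows "truncate_at k f \<in> Sob m p" and "AE x in m. min_wug m p (truncate_at k f) x <= min_wug m p f x"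
proof -
 have b: "truncate_at k f \<in> borel_fun" using SobD[OF f] by measurable
 have w: "weak_upper_gradient m p (truncate_at k f) (min_wug m p f)"
  by (rule weak_upper_gradient_contraction[OF p SobD[OF f] min_wug(1)[OF p f] b truncate_at_contraction])
 then show S: "truncate_at k f \<in> Sob m p" using b by (auto simp: Sob_def)
 show "AE x in m. min_wug m p (truncate_at k f) x <= min_wug m p f x" by (rule min_wug(2)[OF p S w])
qed

text \<open>Setting the minimal gradient to 0 on the zeros of \<open>f\<close> leaves an upper
  gradient, so minimality forces it to vanish there already.\<close>

lemma min_wug_zero:
 assumes p: "1 < p" and f: "f \<in> Sob m p"
 shows "AE x in m. f x = 0 --> min_wug m p f x = 0"
proof -
 note [measurable] = SobD[OF f] min_wug(4)[OF p f]
 let ?G = "\<lambda>x. if f x = 0 then 0 else max 0 (min_wug m p f x)"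
 have "curve_ug m (conj_exp p) f (\<lambda>x. max 0 (min_wug m p f x))"
  using min_wug(1)[OF p f] weak_upper_gradient_iff[OF sets_m p SobD[OF f]] by blast
 then have "curve_ug m (conj_exp p) f ?G" by (rule curve_ug_off_zeros) measurable
 moreover have "?G \<in> Lp_fun m p"
  by (rule Lp_fun_dominated[OF sets_m min_wug(3)[OF p f]]) (use p in auto)
 ultimately have "weak_upper_gradient m p f ?G" by (intro weak_upper_gradient_if_curve_ug[OF p])
 from min_wug(2)[OF p f this] min_wug(5)[OF p f] show ?thesis by eventually_elim (simp split: if_splits)
qed

text \<open>The gradient of the difference \<open>?h\<close> vanishes where \<open>f = g\<close>,
  and the triangle inequality for \<open>f = ?h + g\<close> and \<open>g = f - ?h\<close> gives the
  two inequalities.\<close>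

lemma min_wug_local:
 assumes p: "1 < p" and f: "f \<in> Sob m p" and g: "g \<in> Sob m p"
 shows "AE x in m. f x = g x --> min_wug m p f x = min_wug m p g x"
proof -
 let ?h = "\<lambda>x. 1 * f x + (-1) * g x"
 have h: "?h \<in> Sob m p" by (rule Sob_lincomb(1)[OF p f g])
 have ef: "(\<lambda>x. 1 * ?h x + 1 * g x) = f" and eg: "(\<lambda>x. (-1) * ?h x + 1 * f x) = g" by auto
 from Sob_lincomb(2)[OF p h g, of 1 1] Sob_lincomb(2)[OF p h f, of "-1" 1] min_wug_zero[OF p h]
 show ?thesis unfolding ef eg by eventually_elim auto
qed

definition lip_const :: "('x => real) => real" where
 "lip_const eta = (SOME C. C-lipschitz_on UNIV eta)"

text \<open>A gradient of a cutoff function that vanishes where the function is 0 or 1. Vanishing at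
  the value 0 gives bounded support and hence integrability; vanishing at the value 1 removes the
  extra Leibniz term on \<open>{eta = 1}\<close>.\<close>

definition cutoff_ug :: "('x => real) => 'x => real" where
 "cutoff_ug eta x = (if eta x = 1 then 0 else if eta x = 0 then 0 else lip_const eta)"

lemma Lip_bsD:
 assumes "eta \<in> Lip_bs"
 shows "(lip_const eta)-lipschitz_on UNIV eta" and "continuous_on UNIV eta" and "eta \<in> borel_fun"
  and "bounded {x. eta x \<noteq> 0}" and "\<exists>B. \<forall>x. \<bar>eta x\<bar> <= B"
proof -
 show L: "(lip_const eta)-lipschitz_on UNIV eta" unfolding lip_const_def using assms by (auto simp: Lip_bs_def intro: someI_ex)
 show c: "continuous_on UNIV eta" using L by (rule lipschitz_on_continuous_on)
 show "eta \<in> borel_fun" using c by (rule borel_measurable_continuous_onI)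
 show b: "bounded {x. eta x \<noteq> 0}" using assms by (simp add: Lip_bs_def)
 show "\<exists>B. \<forall>x. \<bar>eta x\<bar> <= B"
 proof (cases "\<exists>z. eta z \<noteq> 0")
  case True
  then obtain z where z: "eta z \<noteq> 0" by blast
  obtain R where R: "!!x. eta x \<noteq> 0 ==> dist z x <= R" using b bounded_any_center[of _ z] by auto
  have L0: "0 <= lip_const eta" using L by (rule lipschitz_on_nonneg)
  have R0: "0 <= R" using R[OF z] by simp
  have "\<bar>eta x\<bar> <= \<bar>eta z\<bar> + lip_const eta * R" for x
  proof (cases "eta x = 0")
   case False
   have "dist (eta x) (eta z) <= lip_const eta * dist x z" by (rule lipschitz_onD[OF L]) auto
   also have "... <= lip_const eta * R" using R[OF False] L0 by (intro mult_left_mono) (auto simp: dist_commute)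
   finally show ?thesis by (simp add: dist_real_def)
  qed (use L0 R0 in simp)
  then show ?thesis by blast
 qed auto
qed

lemma Lp_fun_bounded_support:
 assumes [measurable]: "f \<in> borel_fun" and B: "!!x. \<bar>f x\<bar> <= B" and s: "bounded {x. f x \<noteq> 0}" and p: "0 < p"
 shows "f \<in> Lp_fun m p"
proof -
 have S [measurable]: "{x. f x \<noteq> 0} \<in> sets borel" by measurable
 have "integrable m (\<lambda>x. \<bar>f x\<bar> powr p)"
 proof (rule Bochner_Integration.integrable_bound)
  show "integrable m (\<lambda>x. indicator {x. f x \<noteq> 0} x * B powr p)"
   using emeasure_bounded[OF S s] by (intro integrable_mult_left integrable_real_indicator) auto
  show "AE x in m. norm (\<bar>f x\<bar> powr p) <= norm (indicator {x. f x \<noteq> 0} x * B powr p)"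
   using B p by (intro AE_I2) (auto simp: indicator_def intro: powr_mono2)
 qed measurable
 then show ?thesis using assms by (simp add: Lp_fun_def)
qed

lemma cutoff_ug:
 assumes eta: "eta \<in> Lip_bs" and p: "1 < p"
 shows "curve_ug m (conj_exp p) eta (cutoff_ug eta)" and "cutoff_ug eta \<in> Lp_fun m p"
proof -
 note [measurable] = Lip_bsD(3)[OF eta]
 have q: "1 <= conj_exp p" using conj_exp_gt_1[OF p] by simp
 have "curve_ug m (conj_exp p) eta (\<lambda>x. lip_const eta)" by (rule curve_ug_lipschitz[OF q Lip_bsD(1)[OF eta]])
 then have "curve_ug m (conj_exp p) eta (\<lambda>x. if eta x = 0 then 0 else lip_const eta)" by (rule curve_ug_off_zeros) measurable
 \<comment> \<open>Subtracting 1 keeps the increments, and the zeros of \<open>eta - 1\<close> are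
   the points where \<open>eta\<close> is 1; locality is then used a second time.\<close>
 then have "curve_ug m (conj_exp p) (\<lambda>x. eta x - 1) (\<lambda>x. if eta x = 0 then 0 else lip_const eta)" by (rule curve_ug_contraction) simp
 then have "curve_ug m (conj_exp p) (\<lambda>x. eta x - 1) (\<lambda>x. if eta x - 1 = 0 then 0 else if eta x = 0 then 0 else lip_const eta)"
  by (rule curve_ug_off_zeros) measurable
 then have "curve_ug m (conj_exp p) eta (\<lambda>x. if eta x - 1 = 0 then 0 else if eta x = 0 then 0 else lip_const eta)"
  by (rule curve_ug_contraction) simp
 then show c: "curve_ug m (conj_exp p) eta (cutoff_ug eta)" by (simp add: cutoff_ug_def[abs_def])
 have L0: "0 <= lip_const eta" using Lip_bsD(1)[OF eta] by (rule lipschitz_on_nonneg)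
 show "cutoff_ug eta \<in> Lp_fun m p"
 proof (rule Lp_fun_bounded_support)
  show "cutoff_ug eta \<in> borel_fun" by (rule curve_ugD(1)[OF c])
  show "\<bar>cutoff_ug eta x\<bar> <= lip_const eta" for x using L0 by (simp add: cutoff_ug_def)
  show "bounded {x. cutoff_ug eta x \<noteq> 0}"
   by (rule bounded_subset[OF Lip_bsD(4)[OF eta]]) (auto simp: cutoff_ug_def)
 qed (use p in simp)
qed

text \<open>The Leibniz rule for a function bounded by \<open>k\<close>. The term with
  \<open>cutoff_ug\<close> disappears on \<open>{eta = 1}\<close>, which is where the definition of
  the local class asks for an estimate.\<close>

lemma Sob_mult_cutoff:
 assumes p: "1 < p" and h: "h \<in> Sob m p" and k: "!!x. \<bar>h x\<bar> <= k" and eta: "eta \<in> Lip_bs"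
 shows "(\<lambda>x. eta x * h x) \<in> Sob m p"
  and "AE x in m. min_wug m p (\<lambda>x. eta x * h x) x <= \<bar>eta x\<bar> * min_wug m p h x + k * cutoff_ug eta x"
proof -
 note [measurable] = SobD[OF h] Lip_bsD(3)[OF eta]
 obtain B where B: "!!x. \<bar>eta x\<bar> <= B" using Lip_bsD(5)[OF eta] by blast
 have B0: "0 <= B" using order_trans[OF abs_ge_zero B] .
 let ?H = "\<lambda>x. \<bar>eta x\<bar> * max 0 (min_wug m p h x) + k * cutoff_ug eta x"
 have ch: "curve_ug m (conj_exp p) h (\<lambda>x. max 0 (min_wug m p h x))"
  using min_wug(1)[OF p h] weak_upper_gradient_iff[OF sets_m p SobD[OF h]] by blast
 have c: "curve_ug m (conj_exp p) (\<lambda>x. eta x * h x) ?H"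
  by (rule curve_ug_mult[OF ch k cutoff_ug(1)[OF eta p] Lip_bsD(2)[OF eta] B])
 have maxL: "(\<lambda>x. max 0 (min_wug m p h x)) \<in> Lp_fun m p"
  by (rule Lp_fun_dominated[OF sets_m min_wug(3)[OF p h]]) (use curve_ugD(1)[OF ch] p in auto)
 have "?H \<in> Lp_fun m p"
 proof (rule Lp_fun_dominated[OF sets_m Lp_fun_lincomb[OF sets_m maxL cutoff_ug(2)[OF eta p], of B k]])
  show "?H \<in> borel_fun" by (rule curve_ugD(1)[OF c])
  show "AE x in m. \<bar>?H x\<bar> <= \<bar>B * max 0 (min_wug m p h x) + k * cutoff_ug eta x\<bar>"
  proof (rule AE_I2)
   fix x
   have "0 <= ?H x" by (rule curve_ugD(2)[OF c])
   moreover have "?H x <= B * max 0 (min_wug m p h x) + k * cutoff_ug eta x"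
    using B by (intro add_right_mono mult_right_mono) auto
   ultimately show "\<bar>?H x\<bar> <= \<bar>B * max 0 (min_wug m p h x) + k * cutoff_ug eta x\<bar>" by linarith
  qed
 qed (use p in simp_all)
 then have w: "weak_upper_gradient m p (\<lambda>x. eta x * h x) ?H" using c by (intro weak_upper_gradient_if_curve_ug[OF p])
 have "(\<lambda>x. eta x * h x) \<in> borel_fun" by measurable
 then show S: "(\<lambda>x. eta x * h x) \<in> Sob m p" using w by (auto simp: Sob_def)
 from min_wug(2)[OF p S w] min_wug(5)[OF p h]
 show "AE x in m. min_wug m p (\<lambda>x. eta x * h x) x <= \<bar>eta x\<bar> * min_wug m p h x + k * cutoff_ug eta x"
  by eventually_elim (simp add: max_def)
qed

section \<open>Localisation by cutoff and truncation\<close>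

text \<open>A 1-Lipschitz bump adapted to balls around \<open>undefined\<close>, which serves as an
  arbitrary base point.\<close>

definition cutoff :: "nat => 'x => real" where
 "cutoff n x = max 0 (min 1 (real n + 1 - dist undefined x))"

lemma cutoff:
 shows "cutoff n \<in> Lip_bs" "dist undefined x <= real n ==> cutoff n x = 1"
proof -
 have "1-lipschitz_on UNIV (cutoff n)"
 proof (rule lipschitz_onI)
  fix x y :: 'x
  have "\<bar>dist undefined x - dist undefined y\<bar> <= dist x y"
   using abs_dist_diff_le[of x undefined y] by (simp add: dist_commute)
  then show "dist (cutoff n x) (cutoff n y) <= 1 * dist x y"
   by (auto simp: cutoff_def dist_real_def max_def min_def)
 qed simp
 moreover have "bounded {x. cutoff n x \<noteq> 0}"
  by (rule bounded_subset[of "cball undefined (real n + 1)"]) (auto simp: cutoff_def)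
 ultimately show "cutoff n \<in> Lip_bs" unfolding Lip_bs_def by blast
 show "dist undefined x <= real n ==> cutoff n x = 1" by (simp add: cutoff_def)
qed

text \<open>Countably many global approximants, each point of the space seeing \<open>f\<close>
  itself from some index on. By locality, almost everywhere statements about local gradients are
  read off from them.\<close>

definition loc_approx :: "nat => ('x => real) => 'x => real" where
 "loc_approx n f x = cutoff n x * truncate_at (real n) f x"

lemma loc_approx_eq:
 assumes "dist undefined x <= real n" "\<bar>f x\<bar> <= real n"
 shows "loc_approx n f x = f x"
 using assms by (simp add: loc_approx_def cutoff(2) truncate_at_eq)

lemma loc_approx_eventually:
 obtains N where "!!n. N <= n ==> dist undefined x <= real n \<and> \<bar>f x\<bar> < real n \<and> \<bar>g x\<bar> < real n \<and> 0 < n"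
proof -
 obtain N where "max (dist undefined x) (max \<bar>f x\<bar> \<bar>g x\<bar>) < real N" using reals_Archimedean2 by blast
 then show thesis by (intro that[of N]) (auto intro: less_le_trans)
qed

lemma W1_cutoff:
 assumes p: "1 < p" and k: "0 < k" and eta: "eta \<in> Lip_bs" and f: "(\<lambda>x. eta x * truncate_at k f x) \<in> Sob m p"
 shows "(\<lambda>x. eta x * truncate_at k f x) \<in> W1 m p"
proof -
 obtain B where B: "!!x. \<bar>eta x\<bar> <= B" using Lip_bsD(5)[OF eta] by blast
 have "(\<lambda>x. eta x * truncate_at k f x) \<in> Lp_fun m p"
 proof (rule Lp_fun_bounded_support[OF SobD[OF f]])
  show "\<bar>eta x * truncate_at k f x\<bar> <= B * k" for x
   unfolding abs_mult using B[of x] abs_truncate_at[OF k, of f x] by (intro mult_mono) auto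
  show "bounded {x. eta x * truncate_at k f x \<noteq> 0}"
   by (rule bounded_subset[OF Lip_bsD(4)[OF eta]]) auto
 qed (use p in simp)
 then show ?thesis using f by (simp add: W1_def)
qed

lemma Sob_locD:
 assumes "f \<in> Sob_loc m p" "0 < k" "eta \<in> Lip_bs"
 shows "f \<in> borel_fun" "(\<lambda>x. eta x * truncate_at k f x) \<in> Sob m p"
 using assms unfolding Sob_loc_def by auto

lemma Sob_loc_borel: "f \<in> Sob_loc m p ==> f \<in> borel_fun"
 unfolding Sob_loc_def by auto

lemma loc_approx_Sob:
 assumes "f \<in> Sob_loc m p" "0 < n"
 shows "loc_approx n f \<in> Sob m p"
 using Sob_locD(2)[OF assms(1) _ cutoff(1), of "real n"] assms(2) unfolding loc_approx_def[abs_def] by simp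

lemma loc_approx_W1:
 assumes p: "1 < p" and "f \<in> Sob_loc m p" "0 < n"
 shows "loc_approx n f \<in> W1 m p"
 using W1_cutoff[OF p _ cutoff(1) Sob_locD(2)[OF assms(2) _ cutoff(1)], of "real n" n] assms unfolding loc_approx_def[abs_def] by simp

text \<open>Truncation does not increase the gradient and the Leibniz term vanishes on
  \<open>{eta = 1}\<close>, so the global minimal gradient serves as the bound
  \<open>G\<close>.\<close>

lemma Sob_subset_Sob_loc:
 assumes p: "1 < p"
 shows "Sob m p \<subseteq> Sob_loc m p"
proof
 fix f assume f: "f \<in> Sob m p"
 note [measurable] = SobD[OF f] min_wug(4)[OF p f]
 show "f \<in> Sob_loc m p"
  unfolding Sob_loc_def
 proof (intro CollectI conjI bexI[of _ "min_wug m p f"] allI ballI impI)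
  show "f \<in> borel_fun" "AE x in m. 0 <= min_wug m p f x" by (rule SobD[OF f], rule min_wug(5)[OF p f])
  fix k :: real and eta :: "'x => real" assume k: "0 < k" and eta: "eta \<in> Lip_bs"
  note M = Sob_mult_cutoff[OF p Sob_truncate_at(1)[OF p f] abs_truncate_at[OF k] eta]
  show "(\<lambda>x. eta x * truncate_at k f x) \<in> Sob m p" by (rule M(1))
  show "AE x in m. eta x = 1 --> min_wug m p (\<lambda>x. eta x * truncate_at k f x) x <= \<bar>eta x\<bar> * min_wug m p f x"
   using M(2) Sob_truncate_at(2)[OF p f, of k] by eventually_elim (auto simp: cutoff_ug_def)
 next
  have i: "integrable m (\<lambda>x. \<bar>min_wug m p f x\<bar> powr p)" using min_wug(3)[OF p f] by (simp add: Lp_fun_def)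
  have "set_integrable m B (\<lambda>x. \<bar>min_wug m p f x\<bar> powr p)" if "B \<in> sets borel" for B
   unfolding set_integrable_def using that i by (intro integrable_mult_indicator) (auto simp: sets_m)
  then show "min_wug m p f \<in> Lp_loc_fun m p" by (auto simp: Lp_loc_fun_def)
 qed
qed

text \<open>The choice in \<open>min_wug_loc\<close> is justified by gluing: at \<open>x\<close> the
  gradient of \<open>loc_approx n f\<close> is taken for the first index \<open>n = N x\<close> at
  which the approximant is exact. Locality makes this agree with every other cutoff and
  truncation.\<close>

lemma min_wug_loc:
 assumes p: "1 < p" and f: "f \<in> Sob_loc m p"
 shows "min_wug_loc m p f \<in> borel_fun"
  and "0 < k ==> eta \<in> Lip_bs ==> AE x in m. eta x = 1 \<and> \<bar>f x\<bar> < k -->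
    min_wug_loc m p f x = min_wug m p (\<lambda>x. eta x * truncate_at k f x) x"
proof -
 note [measurable] = Sob_loc_borel[OF f]
 define Q where "Q x n \<longleftrightarrow> dist undefined x <= real n \<and> \<bar>f x\<bar> < real n" for x n
 define N where "N x = (LEAST n. Q x n)" for x
 have QN: "Q x (N x)" for x
 proof -
  obtain n where "max (dist undefined x) \<bar>f x\<bar> < real n" using reals_Archimedean2 by blast
  then have "Q x n" by (auto simp: Q_def)
  then show ?thesis unfolding N_def by (rule LeastI)
 qed
 have N0: "0 < N x" for x using QN[of x] by (auto simp: Q_def intro: Nat.gr0I)
 define G where "G x = (if N x = 0 then 0 else min_wug m p (loc_approx (N x) f) x)" for x
 have [measurable]: "N \<in> measurable borel (count_space UNIV)" unfolding N_def Q_def by measurable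
 have Gb: "G \<in> borel_fun"
  unfolding G_def[abs_def]
 proof (rule measurable_compose_countable[where g=N])
  fix n show "(\<lambda>x. if n = 0 then 0 else min_wug m p (loc_approx n f) x) \<in> borel_fun"
   using min_wug(4)[OF p loc_approx_Sob[OF f]] by (cases "n = 0") auto
 qed measurable
 have ex: "\<exists>G. G \<in> borel_fun \<and>
   (\<forall>k>0. \<forall>eta\<in>Lip_bs. AE x in m. eta x = 1 \<and> \<bar>f x\<bar> < k -->
    G x = min_wug m p (\<lambda>x. eta x * truncate_at k f x) x)"
 proof (intro exI[of _ G] conjI Gb allI impI ballI)
  fix k :: real and eta :: "'x => real" assume k: "0 < k" and eta: "eta \<in> Lip_bs"
  \<comment> \<open>The index \<open>N x\<close> varies with the point, so one null set has to serve
    all indices.\<close>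
  have "AE x in m. \<forall>n. 0 < n --> loc_approx n f x = eta x * truncate_at k f x -->
   min_wug m p (loc_approx n f) x = min_wug m p (\<lambda>x. eta x * truncate_at k f x) x"
   unfolding AE_all_countable
  proof
   fix n show "AE x in m. 0 < n --> loc_approx n f x = eta x * truncate_at k f x -->
    min_wug m p (loc_approx n f) x = min_wug m p (\<lambda>x. eta x * truncate_at k f x) x"
    using min_wug_local[OF p loc_approx_Sob[OF f] Sob_locD(2)[OF f k eta]] by (cases "0 < n") auto
  qed
  then show "AE x in m. eta x = 1 \<and> \<bar>f x\<bar> < k --> G x = min_wug m p (\<lambda>x. eta x * truncate_at k f x) x"
  proof eventually_elim
   case (elim x)
   show ?case
   proof
    assume x: "eta x = 1 \<and> \<bar>f x\<bar> < k"
    have "loc_approx (N x) f x = f x" using QN[of x] by (intro loc_approx_eq) (auto simp: Q_def)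
    then have "loc_approx (N x) f x = eta x * truncate_at k f x" using x by (simp add: truncate_at_eq)
    then show "G x = min_wug m p (\<lambda>x. eta x * truncate_at k f x) x" using elim N0[of x] by (simp add: G_def)
   qed
  qed
 qed
 from someI_ex[OF ex, folded min_wug_loc_def]
 show "min_wug_loc m p f \<in> borel_fun"
  "0 < k ==> eta \<in> Lip_bs ==> AE x in m. eta x = 1 \<and> \<bar>f x\<bar> < k -->
    min_wug_loc m p f x = min_wug m p (\<lambda>x. eta x * truncate_at k f x) x" by auto
qed

text \<open>The null set does not depend on \<open>n\<close>, so an argument at a fixed point may
  choose \<open>n\<close> as large as it likes.\<close>

lemma min_wug_loc_eq_loc_approx:
 assumes p: "1 < p" and f: "f \<in> Sob_loc m p"
 shows "AE x in m. \<forall>n. 0 < n \<and> dist undefined x <= real n \<and> \<bar>f x\<bar> < real n -->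
  min_wug_loc m p f x = min_wug m p (loc_approx n f) x"
 unfolding AE_all_countable
proof
 fix n
 show "AE x in m. 0 < n \<and> dist undefined x <= real n \<and> \<bar>f x\<bar> < real n --> min_wug_loc m p f x = min_wug m p (loc_approx n f) x"
 proof (cases "0 < n")
  case True
  show ?thesis using min_wug_loc(2)[OF p f _ cutoff(1), of "real n" n] True
   unfolding loc_approx_def[abs_def] by (auto simp: cutoff(2) elim!: eventually_mono)
 qed simp
qed

text \<open>At almost every point \<open>f\<close> may be replaced by an exact approximant, to which
  locality in the global class applies.\<close>

lemma min_wug_loc_local_Sob:
 assumes p: "1 < p" and f: "f \<in> Sob_loc m p" and h: "h \<in> Sob m p"
 shows "AE x in m. f x = h x --> min_wug_loc m p f x = min_wug m p h x"
proof -
 have "AE x in m. \<forall>n. 0 < n --> loc_approx n f x = h x --> min_wug m p (loc_approx n f) x = min_wug m p h x"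
  unfolding AE_all_countable
 proof
  fix n show "AE x in m. 0 < n --> loc_approx n f x = h x --> min_wug m p (loc_approx n f) x = min_wug m p h x"
   using min_wug_local[OF p loc_approx_Sob[OF f] h] by (cases "0 < n") auto
 qed
 with min_wug_loc_eq_loc_approx[OF p f] show ?thesis
 proof eventually_elim
  case (elim x)
  obtain N where N: "dist undefined x <= real N" "\<bar>f x\<bar> < real N" "0 < N"
   using loc_approx_eventually[of x f f] by blast
  then have "loc_approx N f x = f x" by (intro loc_approx_eq) auto
  then show ?case using elim N by auto
 qed
qed

lemma min_wug_loc_eq_min_wug:
 assumes p: "1 < p" and f: "f \<in> Sob m p"
 shows "AE x in m. min_wug_loc m p f x = min_wug m p f x"
 using min_wug_loc_local_Sob[OF p subsetD[OF Sob_subset_Sob_loc[OF p] f] f] by simp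

lemma min_wug_loc_nonneg:
 assumes p: "1 < p" and f: "f \<in> Sob_loc m p"
 shows "AE x in m. 0 <= min_wug_loc m p f x"
proof -
 have "AE x in m. \<forall>n. 0 < n --> 0 <= min_wug m p (loc_approx n f) x"
  unfolding AE_all_countable
 proof
  fix n show "AE x in m. 0 < n --> 0 <= min_wug m p (loc_approx n f) x"
   using min_wug(5)[OF p loc_approx_Sob[OF f]] by (cases "0 < n") auto
 qed
 with min_wug_loc_eq_loc_approx[OF p f] show ?thesis
 proof eventually_elim
  case (elim x)
  obtain N where N: "dist undefined x <= real N" "\<bar>f x\<bar> < real N" "0 < N"
   using loc_approx_eventually[of x f f] by blast
  then show ?case using elim by auto
 qed
qed

end

section \<open>Linear structure of the local classes\<close>

context metric_measure_space
begin

lemma Lp_loc_fun_iff: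
 assumes p: "0 < p"
 shows "G \<in> Lp_loc_fun m p \<longleftrightarrow> G \<in> borel_fun \<and>
  (\<forall>B\<in>sets borel. bounded B --> (\<lambda>x. indicator B x * G x) \<in> Lp_fun m p)"
proof -
 have "(\<lambda>x. \<bar>indicator B x * G x\<bar> powr p) = (\<lambda>x. indicator B x *\<^sub>R \<bar>G x\<bar> powr p)" for B :: "'x set"
  using p by (auto simp: indicator_def)
 then have "(\<lambda>x. indicator B x * G x) \<in> Lp_fun m p \<longleftrightarrow> set_integrable m B (\<lambda>x. \<bar>G x\<bar> powr p)"
  if "B \<in> sets borel" "G \<in> borel_fun" for B
  using that unfolding Lp_fun_def set_integrable_def by simp
 then show ?thesis unfolding Lp_loc_fun_def by blast
qed

lemma Lp_loc_fun_lincomb: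
 assumes p: "0 < p" and F: "F \<in> Lp_loc_fun m p" and G: "G \<in> Lp_loc_fun m p"
 shows "(\<lambda>x. a * F x + b * G x) \<in> Lp_loc_fun m p"
 unfolding Lp_loc_fun_iff[OF p]
proof (intro conjI ballI impI)
 note [measurable] = conjunct1[OF F[unfolded Lp_loc_fun_iff[OF p]]] conjunct1[OF G[unfolded Lp_loc_fun_iff[OF p]]]
 show "(\<lambda>x. a * F x + b * G x) \<in> borel_fun" by measurable
 fix B :: "'x set" assume B: "B \<in> sets borel" "bounded B"
 have "(\<lambda>x. a * (indicator B x * F x) + b * (indicator B x * G x)) \<in> Lp_fun m p"
  using F G B p unfolding Lp_loc_fun_iff[OF p] by (intro Lp_fun_lincomb[OF sets_m]) auto
 then show "(\<lambda>x. indicator B x * (a * F x + b * G x)) \<in> Lp_fun m p" by (simp add: algebra_simps)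
qed

text \<open>The truncation of a sum is not the sum of truncations. Hence \<open>f\<close> and
  \<open>g\<close> are first truncated at the level \<open>Suc j\<close>, combined, and only then
  truncated at \<open>k\<close>; after the cutoff these functions have the upper gradient
  \<open>H\<close> in common, independent of \<open>j\<close>, and it is kept in the limit.\<close>

lemma Sob_loc_lincomb:
 assumes p: "1 < p" and f: "f \<in> Sob_loc m p" and g: "g \<in> Sob_loc m p"
 shows "(\<lambda>x. a * f x + b * g x) \<in> Sob_loc m p"
proof -
 let ?h = "\<lambda>x. a * f x + b * g x"
 note [measurable] = Sob_loc_borel[OF f] Sob_loc_borel[OF g]
 obtain Gf where Gf: "Gf \<in> Lp_loc_fun m p" "AE x in m. 0 <= Gf x"
  "!!k eta. 0 < k ==> eta\<in>Lip_bs ==> AE x in m. eta x = 1 --> min_wug m p (\<lambda>x. eta x * truncate_at k f x) x <= \<bar>eta x\<bar> * Gf x"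
  using f unfolding Sob_loc_def by blast
 obtain Gg where Gg: "Gg \<in> Lp_loc_fun m p" "AE x in m. 0 <= Gg x"
  "!!k eta. 0 < k ==> eta\<in>Lip_bs ==> AE x in m. eta x = 1 --> min_wug m p (\<lambda>x. eta x * truncate_at k g x) x <= \<bar>eta x\<bar> * Gg x"
  using g unfolding Sob_loc_def by blast
 define G where "G x = \<bar>a\<bar> * Gf x + \<bar>b\<bar> * Gg x" for x
 have GL: "G \<in> Lp_loc_fun m p" unfolding G_def[abs_def] using p by (intro Lp_loc_fun_lincomb Gf Gg) simp
 have [measurable]: "G \<in> borel_fun" using GL by (simp add: Lp_loc_fun_def)
 have hb: "?h \<in> borel_fun" by measurable
 have main: "(\<lambda>x. eta x * truncate_at k ?h x) \<in> Sob m p \<and>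
    (AE x in m. eta x = 1 --> min_wug m p (\<lambda>x. eta x * truncate_at k ?h x) x <= \<bar>eta x\<bar> * G x)"
  if k: "0 < k" and eta: "eta \<in> Lip_bs" for k and eta :: "'x => real"
 proof -
  note [measurable] = Lip_bsD(3)[OF eta]
  obtain R where R: "!!x. eta x \<noteq> 0 ==> dist undefined x <= R" using Lip_bsD(4)[OF eta] unfolding bounded_any_center[where a=undefined] by auto
  \<comment> \<open>Large enough for \<open>cutoff n\<close> to be 1 wherever \<open>eta\<close>
    does not vanish, so that the inner cutoff is harmless there.\<close>
  obtain n where n: "R <= real n" using real_arch_simple by blast
  have n1: "cutoff n x = 1" if "eta x \<noteq> 0" for x using R[OF that] n by (intro cutoff(2)) simp
  obtain B where B: "!!x. \<bar>eta x\<bar> <= B" using Lip_bsD(5)[OF eta] by blast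
  define F where "F j f x = cutoff n x * truncate_at (real (Suc j)) f x" for j f x
  \<comment> \<open>The Leibniz bound for a function bounded by \<open>k\<close> whose gradient is
    at most \<open>G\<close> on the support of \<open>eta\<close>.\<close>
  define H where "H x = \<bar>eta x\<bar> * G x + k * cutoff_ug eta x" for x
  have FS: "F j f \<in> Sob m p" "F j g \<in> Sob m p" for j
   unfolding F_def[abs_def] using Sob_locD(2)[OF f _ cutoff(1)] Sob_locD(2)[OF g _ cutoff(1)] by auto
  define hj where "hj j = truncate_at k (\<lambda>x. a * F j f x + b * F j g x)" for j
  have cS: "(\<lambda>x. a * F j f x + b * F j g x) \<in> Sob m p" for j by (rule Sob_lincomb(1)[OF p FS])
  have hS: "hj j \<in> Sob m p" for j unfolding hj_def by (rule Sob_truncate_at(1)[OF p cS])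
  have hk: "\<bar>hj j x\<bar> <= k" for j x unfolding hj_def by (rule abs_truncate_at[OF k])
  have HL: "H \<in> Lp_fun m p"
  proof -
   have S: "{x. eta x \<noteq> 0} \<in> sets borel" by measurable
   have "(\<lambda>x. indicator {x. eta x \<noteq> 0} x * G x) \<in> Lp_fun m p"
    using GL S Lip_bsD(4)[OF eta] p unfolding Lp_loc_fun_iff[OF less_trans[OF zero_less_one p]] by blast
   then have BG: "(\<lambda>x. B * (indicator {x. eta x \<noteq> 0} x * G x) + 0 * (indicator {x. eta x \<noteq> 0} x * G x)) \<in> Lp_fun m p"
    using p by (intro Lp_fun_lincomb[OF sets_m]) auto
   have "(\<lambda>x. \<bar>eta x\<bar> * G x) \<in> Lp_fun m p"
   proof (rule Lp_fun_dominated[OF sets_m BG])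
    show "AE x in m. \<bar>\<bar>eta x\<bar> * G x\<bar> <= \<bar>B * (indicator {x. eta x \<noteq> 0} x * G x) + 0 * (indicator {x. eta x \<noteq> 0} x * G x)\<bar>"
    proof (rule AE_I2)
     fix x
     have "\<bar>eta x\<bar> <= \<bar>B\<bar>" using B[of x] by linarith
     then show "\<bar>\<bar>eta x\<bar> * G x\<bar> <= \<bar>B * (indicator {x. eta x \<noteq> 0} x * G x) + 0 * (indicator {x. eta x \<noteq> 0} x * G x)\<bar>"
      by (cases "eta x = 0") (auto simp: abs_mult intro: mult_right_mono)
    qed
   qed (use p in auto)
   from Lp_fun_lincomb[OF sets_m this cutoff_ug(2)[OF eta p], of 1 k] p show ?thesis by (simp add: H_def[abs_def])
  qed
  have wj: "weak_upper_gradient m p (\<lambda>x. eta x * hj j x) H" for j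
  proof (rule weak_upper_gradient_mono[OF sets_m p _ min_wug(1)[OF p Sob_mult_cutoff(1)[OF p hS hk eta]] HL])
   show "(\<lambda>x. eta x * hj j x) \<in> borel_fun" by (rule SobD[OF Sob_mult_cutoff(1)[OF p hS hk eta]])
   have "AE x in m. cutoff n x = 1 --> min_wug m p (F j f) x <= \<bar>cutoff n x\<bar> * Gf x"
    unfolding F_def[abs_def] by (rule Gf(3)[OF _ cutoff(1)]) simp
   moreover have "AE x in m. cutoff n x = 1 --> min_wug m p (F j g) x <= \<bar>cutoff n x\<bar> * Gg x"
    unfolding F_def[abs_def] by (rule Gg(3)[OF _ cutoff(1)]) simp
   moreover note Sob_mult_cutoff(2)[OF p hS hk eta, of j] Sob_truncate_at(2)[OF p cS[of j], of k, folded hj_def]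
    Sob_lincomb(2)[OF p FS[of j], of a b]
   ultimately show "AE x in m. min_wug m p (\<lambda>x. eta x * hj j x) x <= H x"
   proof eventually_elim
    case (elim x)
    have "\<bar>eta x\<bar> * min_wug m p (hj j) x <= \<bar>eta x\<bar> * G x"
    proof (cases "eta x = 0")
     case False
     then have "min_wug m p (F j f) x <= Gf x" "min_wug m p (F j g) x <= Gg x" using elim(1,2) n1[of x] by auto
     then have "\<bar>a\<bar> * min_wug m p (F j f) x + \<bar>b\<bar> * min_wug m p (F j g) x <= G x"
      unfolding G_def by (intro add_mono mult_left_mono) auto
     then have "min_wug m p (hj j) x <= G x" using elim(4,5) by linarith
     then show ?thesis by (intro mult_left_mono) auto
    qed simp
    then show ?case using elim(3) by (simp add: H_def)
   qed
  qed
  have bm: "(\<lambda>x. eta x * truncate_at k ?h x) \<in> borel_fun" by measurable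
  have "curve_ug m (conj_exp p) (\<lambda>x. eta x * truncate_at k ?h x) (\<lambda>x. max 0 (H x))"
  proof (rule curve_ug_limit[of m "conj_exp p" "\<lambda>j x. eta x * hj j x"])
   show "curve_ug m (conj_exp p) (\<lambda>x. eta x * hj j x) (\<lambda>x. max 0 (H x))" for j
    using wj[of j] weak_upper_gradient_iff[OF sets_m p SobD[OF Sob_mult_cutoff(1)[OF p hS hk eta]]] by blast
   fix x
   show "(\<lambda>j. eta x * hj j x) \<longlonglongrightarrow> eta x * truncate_at k ?h x"
   proof (cases "eta x = 0")
    case False
    obtain N where N: "max \<bar>f x\<bar> \<bar>g x\<bar> <= real N" using real_arch_simple by blast
    have "hj j x = truncate_at k ?h x" if "N <= j" for j
    proof -
     have "\<bar>f x\<bar> <= real (Suc j)" "\<bar>g x\<bar> <= real (Suc j)" using that N by auto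
     then have "F j f x = f x" "F j g x = g x" using n1[OF False] by (auto simp: F_def truncate_at_eq)
     then show ?thesis by (simp add: hj_def truncate_at_def)
    qed
    then have "eventually (\<lambda>j. eta x * truncate_at k ?h x = eta x * hj j x) sequentially"
     by (intro eventually_sequentiallyI[of N]) simp
    then show ?thesis by (rule Lim_transform_eventually[OF tendsto_const])
   qed simp
  qed
  moreover have "AE x in m. 0 <= H x" using wj[of 0] by (simp add: weak_upper_gradient_def)
  ultimately have w: "weak_upper_gradient m p (\<lambda>x. eta x * truncate_at k ?h x) H"
   using HL weak_upper_gradient_iff[OF sets_m p bm] by blast
  then have S: "(\<lambda>x. eta x * truncate_at k ?h x) \<in> Sob m p" using bm by (auto simp: Sob_def)
  have "AE x in m. eta x = 1 --> min_wug m p (\<lambda>x. eta x * truncate_at k ?h x) x <= \<bar>eta x\<bar> * G x"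
   using min_wug(2)[OF p S w] by eventually_elim (auto simp: H_def cutoff_ug_def)
  with S show ?thesis by blast
 qed
 have G0: "AE x in m. 0 <= G x" using Gf(2) Gg(2) by eventually_elim (simp add: G_def)
 show ?thesis unfolding Sob_loc_def using hb GL G0 main by blast
qed

text \<open>At almost every point all functions involved coincide with their approximants of large
  index, and the inequality is the one for the global class.\<close>

lemma min_wug_loc_lincomb:
 assumes p: "1 < p" and f: "f \<in> Sob_loc m p" and g: "g \<in> Sob_loc m p"
 shows "AE x in m. min_wug_loc m p (\<lambda>x. a * f x + b * g x) x <= \<bar>a\<bar> * min_wug_loc m p f x + \<bar>b\<bar> * min_wug_loc m p g x"
proof -
 let ?c = "\<lambda>n x. a * loc_approx n f x + b * loc_approx n g x"
 have "AE x in m. \<forall>n. 0 < n --> (a * f x + b * g x = ?c n x -->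
   min_wug_loc m p (\<lambda>x. a * f x + b * g x) x = min_wug m p (?c n) x) \<and>
   min_wug m p (?c n) x <= \<bar>a\<bar> * min_wug m p (loc_approx n f) x + \<bar>b\<bar> * min_wug m p (loc_approx n g) x"
  unfolding AE_all_countable
 proof
  fix n
  show "AE x in m. 0 < n --> (a * f x + b * g x = ?c n x -->
   min_wug_loc m p (\<lambda>x. a * f x + b * g x) x = min_wug m p (?c n) x) \<and>
   min_wug m p (?c n) x <= \<bar>a\<bar> * min_wug m p (loc_approx n f) x + \<bar>b\<bar> * min_wug m p (loc_approx n g) x"
  proof (cases "0 < n")
   case True
   note S = loc_approx_Sob[OF f True] loc_approx_Sob[OF g True]
   from min_wug_loc_local_Sob[OF p Sob_loc_lincomb[OF p f g] Sob_lincomb(1)[OF p S], of a b a b] Sob_lincomb(2)[OF p S, of a b]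
   show ?thesis by eventually_elim simp
  qed simp
 qed
 with min_wug_loc_eq_loc_approx[OF p f] min_wug_loc_eq_loc_approx[OF p g] show ?thesis
 proof eventually_elim
  case (elim x)
  obtain N where N: "dist undefined x <= real N" "\<bar>f x\<bar> < real N" "\<bar>g x\<bar> < real N" "0 < N"
   using loc_approx_eventually[of x f g] by blast
  then have "loc_approx N f x = f x" "loc_approx N g x = g x" by (auto intro: loc_approx_eq)
  then show ?case using elim N by auto
 qed
qed

section \<open>Dependence on the exponent\<close>

lemma conj_exp_antimono: "1 < r ==> r <= p ==> conj_exp p <= conj_exp r"
 by (simp add: conj_exp_def field_simps)

text \<open>The gradient may be taken to vanish off the support, which has finite measure, so
  integrability passes from \<open>p\<close> to the smaller \<open>r\<close>. Lowering the exponent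
  raises the conjugate one, which leaves fewer test plans.\<close>

lemma Sob_mono_bounded_support:
 assumes r: "1 < r" "r <= p" and u: "u \<in> Sob m p" and s: "bounded {x. u x \<noteq> 0}"
 shows "u \<in> Sob m r" and "AE x in m. min_wug m r u x <= min_wug m p u x"
proof -
 have p: "1 < p" using r by simp
 note [measurable] = SobD[OF u] min_wug(4)[OF p u]
 let ?V = "\<lambda>x. if u x = 0 then 0 else max 0 (min_wug m p u x)"
 have S [measurable]: "{x. u x \<noteq> 0} \<in> sets borel" by measurable
 have "curve_ug m (conj_exp p) u (\<lambda>x. max 0 (min_wug m p u x))"
  using min_wug(1)[OF p u] weak_upper_gradient_iff[OF sets_m p SobD[OF u]] by blast
 then have "curve_ug m (conj_exp p) u ?V" by (rule curve_ug_off_zeros) measurable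
 then have c: "curve_ug m (conj_exp r) u ?V"
  using conj_exp_gt_1[OF p] by (intro curve_ug_mono_exponent[OF _ conj_exp_antimono[OF r]]) auto
 have "integrable m (\<lambda>x. \<bar>?V x\<bar> powr r)"
 proof (rule Bochner_Integration.integrable_bound)
  show "integrable m (\<lambda>x. indicator {x. u x \<noteq> 0} x + \<bar>min_wug m p u x\<bar> powr p)"
   using emeasure_bounded[OF S s] min_wug(3)[OF p u]
   by (intro Bochner_Integration.integrable_add integrable_real_indicator) (auto simp: Lp_fun_def)
  show "AE x in m. norm (\<bar>?V x\<bar> powr r) <= norm (indicator {x. u x \<noteq> 0} x + \<bar>min_wug m p u x\<bar> powr p)"
  proof (rule AE_I2)
   fix x
   show "norm (\<bar>?V x\<bar> powr r) <= norm (indicator {x. u x \<noteq> 0} x + \<bar>min_wug m p u x\<bar> powr p)"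
   proof (cases "u x = 0")
    case False
    have "\<bar>?V x\<bar> powr r <= \<bar>min_wug m p u x\<bar> powr r" using r by (intro powr_mono2) auto
    also have "... <= 1 + \<bar>min_wug m p u x\<bar> powr p"
    proof (cases "\<bar>min_wug m p u x\<bar> <= 1")
     case True
     then have "\<bar>min_wug m p u x\<bar> powr r <= 1" using r by (intro powr_le1) auto
     then show ?thesis using powr_ge_zero[of "\<bar>min_wug m p u x\<bar>" p] by linarith
    next
     case F: False
     then have "\<bar>min_wug m p u x\<bar> powr r <= \<bar>min_wug m p u x\<bar> powr p" using r by (intro powr_mono) auto
     then show ?thesis by simp
    qed
    finally show ?thesis using False by simp
   qed (use r in simp)
  qed
 qed measurable
 then have "?V \<in> Lp_fun m r" by (simp add: Lp_fun_def)
 then have w: "weak_upper_gradient m r u ?V" using c by (intro weak_upper_gradient_if_curve_ug[OF r(1)])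
 show Sr: "u \<in> Sob m r" using w SobD[OF u] by (auto simp: Sob_def)
 from min_wug(2)[OF r(1) Sr w] min_wug(5)[OF p u]
 show "AE x in m. min_wug m r u x <= min_wug m p u x" by eventually_elim (auto split: if_splits)
qed

lemma Lp_loc_fun_mono:
 assumes r: "1 < r" "r <= p" and G: "G \<in> Lp_loc_fun m p"
 shows "G \<in> Lp_loc_fun m r"
proof -
 have [measurable]: "G \<in> borel_fun" using G by (simp add: Lp_loc_fun_def)
 have "set_integrable m B (\<lambda>x. \<bar>G x\<bar> powr r)" if B [measurable]: "B \<in> sets borel" and bB: "bounded B" for B
  unfolding set_integrable_def
 proof (rule Bochner_Integration.integrable_bound)
  have "set_integrable m B (\<lambda>x. \<bar>G x\<bar> powr p)" using G B bB by (simp add: Lp_loc_fun_def)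
  then show "integrable m (\<lambda>x. indicator B x + indicator B x *\<^sub>R \<bar>G x\<bar> powr p)"
   using emeasure_bounded[OF B bB] unfolding set_integrable_def
   by (intro Bochner_Integration.integrable_add integrable_real_indicator) (auto simp: sets_m)
  show "AE x in m. norm (indicator B x *\<^sub>R \<bar>G x\<bar> powr r) <= norm (indicator B x + indicator B x *\<^sub>R \<bar>G x\<bar> powr p)"
  proof (rule AE_I2)
   fix x
   have "\<bar>G x\<bar> powr r <= 1 + \<bar>G x\<bar> powr p"
   proof (cases "\<bar>G x\<bar> <= 1")
    case True
    then have "\<bar>G x\<bar> powr r <= 1" using r by (intro powr_le1) auto
    then show ?thesis using powr_ge_zero[of "\<bar>G x\<bar>" p] by linarith
   next
    case F: False
    then have "\<bar>G x\<bar> powr r <= \<bar>G x\<bar> powr p" using r by (intro powr_mono) auto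
    then show ?thesis by simp
   qed
   then show "norm (indicator B x *\<^sub>R \<bar>G x\<bar> powr r) <= norm (indicator B x + indicator B x *\<^sub>R \<bar>G x\<bar> powr p)"
    by (simp add: indicator_def)
  qed
 qed measurable
 then show ?thesis by (simp add: Lp_loc_fun_def)
qed

lemma bounded_support_cutoff:
 assumes "eta \<in> Lip_bs"
 shows "bounded {x :: 'x. eta x * (h x :: real) \<noteq> 0}"
 by (rule bounded_subset[OF Lip_bsD(4)[OF assms]]) auto

text \<open>Cutoffs have bounded support, so passing from \<open>p\<close> to \<open>r\<close> does
  not increase gradients and the bound \<open>G\<close> for \<open>p\<close> also works for
  \<open>r\<close>.\<close>

lemma Sob_loc_mono:
 assumes r: "1 < r" "r <= p"
 shows "Sob_loc m p \<subseteq> Sob_loc m r"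
proof
 fix f assume f: "f \<in> Sob_loc m p"
 obtain G where G: "G \<in> Lp_loc_fun m p" "AE x in m. 0 <= G x"
  "!!k eta. 0 < k ==> eta\<in>Lip_bs ==> AE x in m. eta x = 1 --> min_wug m p (\<lambda>x. eta x * truncate_at k f x) x <= \<bar>eta x\<bar> * G x"
  using f unfolding Sob_loc_def by blast
 show "f \<in> Sob_loc m r"
  unfolding Sob_loc_def
 proof (intro CollectI conjI bexI[of _ G] allI ballI impI)
  show "f \<in> borel_fun" by (rule Sob_loc_borel[OF f])
  show "AE x in m. 0 <= G x" by (rule G(2))
  show "G \<in> Lp_loc_fun m r" by (rule Lp_loc_fun_mono[OF r G(1)])
  fix k :: real and eta :: "'x => real" assume k: "0 < k" and eta: "eta \<in> Lip_bs"
  note M = Sob_mono_bounded_support[OF r Sob_locD(2)[OF f k eta] bounded_support_cutoff[OF eta]]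
  show "(\<lambda>x. eta x * truncate_at k f x) \<in> Sob m r" by (rule M(1))
  show "AE x in m. eta x = 1 --> min_wug m r (\<lambda>x. eta x * truncate_at k f x) x <= \<bar>eta x\<bar> * G x"
   using M(2) G(3)[OF k eta] by eventually_elim auto
 qed
qed

text \<open>Independence is assumed on the intersection of two Sobolev spaces. The approximants
  \<open>loc_approx n f\<close> lie in both and carry it over to the local class.\<close>

lemma min_wug_loc_independent:
 assumes pi: "p_independent_wug m" and r: "1 < r" "r <= p" and f: "f \<in> Sob_loc m p"
 shows "AE x in m. min_wug_loc m r f x = min_wug_loc m p f x"
proof -
 have p: "1 < p" using r by simp
 have fr: "f \<in> Sob_loc m r" using Sob_loc_mono[OF r] f by blast
 have "AE x in m. \<forall>n. 0 < n --> min_wug m r (loc_approx n f) x = min_wug m p (loc_approx n f) x"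
  unfolding AE_all_countable
 proof
  fix n
  show "AE x in m. 0 < n --> min_wug m r (loc_approx n f) x = min_wug m p (loc_approx n f) x"
  proof (cases "0 < n")
   case True
   have "loc_approx n f \<in> W1 m r \<inter> W1 m p" using loc_approx_W1[OF p f True] loc_approx_W1[OF r(1) fr True] by blast
   then show ?thesis using pi p r(1) unfolding p_independent_wug_def by auto
  qed simp
 qed
 with min_wug_loc_eq_loc_approx[OF p f] min_wug_loc_eq_loc_approx[OF r(1) fr] show ?thesis
 proof eventually_elim
  case (elim x)
  obtain N where N: "dist undefined x <= real N" "\<bar>f x\<bar> < real N" "0 < N"
   using loc_approx_eventually[of x f f] by blast
  then show ?case using elim by auto
 qed
qed

section \<open>Density of the Sobolev spaces in the local classes\<close>

text \<open>The series of the \<open>p\<close>-th powers has a finite integral, so it converges at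
  almost every point and its terms tend to 0 there.\<close>

lemma AE_tendsto_zero_if_powr_summable:
 assumes p: "0 < p" and h: "!!n. h n \<in> borel_measurable m" "!!n. integrable m (\<lambda>x. \<bar>h n x\<bar> powr p)"
  and le: "!!n. (\<integral>x. \<bar>h n x\<bar> powr p \<partial>m) <= (1 / 2) ^ n"
 shows "AE x in m. (\<lambda>n. h n x) \<longlonglongrightarrow> (0 :: real)"
proof -
 note [measurable] = h(1)
 have "(\<integral>\<^sup>+x. (\<Sum>n. ennreal (\<bar>h n x\<bar> powr p)) \<partial>m) = (\<Sum>n. \<integral>\<^sup>+x. ennreal (\<bar>h n x\<bar> powr p) \<partial>m)"
  by (rule nn_integral_suminf) measurable
 also have "... <= (\<Sum>n. ennreal ((1 / 2) ^ n))"
  by (intro suminf_le summableI) (auto simp: nn_integral_eq_integral[OF h(2)] intro: ennreal_leI le)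
 also have "... = ennreal (\<Sum>n. (1 / 2) ^ n)" by (intro suminf_ennreal2) auto
 finally have "(\<integral>\<^sup>+x. (\<Sum>n. ennreal (\<bar>h n x\<bar> powr p)) \<partial>m) \<noteq> \<infinity>" by (auto simp: top_unique)
 then have "AE x in m. (\<Sum>n. ennreal (\<bar>h n x\<bar> powr p)) \<noteq> \<infinity>"
  by (intro nn_integral_PInf_AE) measurable
 then show ?thesis
 proof eventually_elim
  case (elim x)
  then have "summable (\<lambda>n. \<bar>h n x\<bar> powr p)" by (intro summable_suminf_not_top) auto
  then have lim: "(\<lambda>n. \<bar>h n x\<bar> powr p) \<longlonglongrightarrow> 0" by (rule summable_LIMSEQ_zero)
  show ?case
  proof (rule tendstoI)
   fix e :: real assume e: "0 < e"
   have "eventually (\<lambda>n. \<bar>h n x\<bar> powr p < e powr p) sequentially"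
    using lim e by (intro order_tendstoD(2)[OF lim]) simp
   then show "eventually (\<lambda>n. dist (h n x) 0 < e) sequentially"
   proof eventually_elim
    case (elim n)
    show ?case
    proof (rule ccontr)
     assume "\<not> dist (h n x) 0 < e"
     then have "e powr p <= \<bar>h n x\<bar> powr p" using e p by (intro powr_mono2) (auto simp: dist_real_def)
     then show False using elim by simp
    qed
   qed
  qed
 qed
qed

text \<open>The approximant \<open>F n\<close> is eventually equal to \<open>f\<close> at each
  point, and by assumption some \<open>g n\<close> in both Sobolev spaces is within
  \<open>(1 / 2) ^ n\<close> of it. The gradient of \<open>f - g n\<close> is at most the sum of the
  gradients of \<open>f - F n\<close>, eventually 0 at almost every point, and of
  \<open>F n - g n\<close>, which tends to 0 almost everywhere.\<close>

lemma W1_dense_Sob_loc: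
 assumes pi: "p_independent_wug m" and p: "1 < p" and p': "1 < p'" and f: "f \<in> Sob_loc m p'"
 obtains g where "!!n. g n \<in> W1 m p" "!!n. g n \<in> W1 m p'" "AE x in m. (\<lambda>n. min_wug_loc m p' (\<lambda>x. f x - g n x) x) \<longlonglongrightarrow> 0"
proof -
 define F where "F n = loc_approx (Suc n) f" for n
 have FW: "F n \<in> W1 m p'" for n unfolding F_def by (rule loc_approx_W1[OF p' f]) simp
 have "\<exists>g\<in>W1 m p \<inter> W1 m p'. W1_norm m p' (\<lambda>x. F n x - g x) < (1 / 2) ^ n" for n
  using pi p p' FW[of n] unfolding p_independent_wug_def by (metis Int_commute half_gt_zero_iff zero_less_one zero_less_power)
 then obtain g where g: "!!n. g n \<in> W1 m p" "!!n. g n \<in> W1 m p'" "!!n. W1_norm m p' (\<lambda>x. F n x - g n x) < (1 / 2) ^ n"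
  by (metis IntE)
 have FS: "F n \<in> Sob m p'" and gS: "g n \<in> Sob m p'" for n using FW g(2) by (auto simp: W1_def)
 have dS: "(\<lambda>x. F n x - g n x) \<in> Sob m p'" for n using Sob_lincomb(1)[OF p' FS gS, of 1 n "-1" n] by simp
 have conv: "AE x in m. (\<lambda>n. min_wug m p' (\<lambda>x. F n x - g n x) x) \<longlonglongrightarrow> 0"
 proof (rule AE_tendsto_zero_if_powr_summable[of p'])
  show "0 < p'" using p' by simp
  fix n
  show "min_wug m p' (\<lambda>x. F n x - g n x) \<in> borel_measurable m"
   using min_wug(4)[OF p' dS] by (simp add: measurable_cong_sets[OF sets_m refl])
  show "integrable m (\<lambda>x. \<bar>min_wug m p' (\<lambda>x. F n x - g n x) x\<bar> powr p')"
   using min_wug(3)[OF p' dS] by (simp add: Lp_fun_def)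
  let ?A = "\<integral>x. \<bar>F n x - g n x\<bar> powr p' \<partial>m" and ?B = "\<integral>x. \<bar>min_wug m p' (\<lambda>x. F n x - g n x) x\<bar> powr p' \<partial>m"
  have A0: "0 <= ?A" and B0: "0 <= ?B" by (intro integral_nonneg_AE; simp)+
  have "?B <= ?A + ?B" using A0 by simp
  also have "... = ((?A + ?B) powr (1 / p')) powr p'" using A0 B0 p' by (simp add: powr_powr)
  also have "... <= ((1 / 2) ^ n) powr p'"
   using g(3)[of n] p' unfolding W1_norm_def by (intro powr_mono2) auto
  \<comment> \<open>The base is at most 1 and the exponent \<open>p'\<close> at least 1.\<close>
  also have "... <= ((1 / 2) ^ n) powr 1" using p' by (intro powr_mono') (auto intro: power_le_one)
  finally show "?B <= (1 / 2) ^ n" by simp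
 qed
 have gl: "g n \<in> Sob_loc m p'" and Fl: "F n \<in> Sob_loc m p'" for n using gS FS Sob_subset_Sob_loc[OF p'] by auto
 have fF: "(\<lambda>x. f x - F n x) \<in> Sob_loc m p'" and Fg: "(\<lambda>x. F n x - g n x) \<in> Sob_loc m p'"
  and fg: "(\<lambda>x. f x - g n x) \<in> Sob_loc m p'" for n
  using Sob_loc_lincomb[OF p' f Fl, of 1 "-1" n] Sob_loc_lincomb[OF p' Fl gl, of 1 n "-1" n] Sob_loc_lincomb[OF p' f gl, of 1 "-1" n] by auto
 have zero: "(\<lambda>_. 0) \<in> Sob m p'" using Sob_lincomb(1)[OF p' FS FS, of 0 0 0 0] by simp
 have "AE x in m. \<forall>n. (f x - F n x = 0 --> min_wug_loc m p' (\<lambda>x. f x - F n x) x = min_wug m p' (\<lambda>_. 0) x)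
   \<and> min_wug_loc m p' (\<lambda>x. F n x - g n x) x = min_wug m p' (\<lambda>x. F n x - g n x) x
   \<and> min_wug_loc m p' (\<lambda>x. f x - g n x) x <= min_wug_loc m p' (\<lambda>x. f x - F n x) x + min_wug_loc m p' (\<lambda>x. F n x - g n x) x
   \<and> 0 <= min_wug_loc m p' (\<lambda>x. f x - g n x) x"
  unfolding AE_all_countable
 proof
  fix n
  from min_wug_loc_local_Sob[OF p' fF zero, of n] min_wug_loc_eq_min_wug[OF p' dS, of n]
   min_wug_loc_lincomb[OF p' fF Fg, of 1 n 1 n] min_wug_loc_nonneg[OF p' fg, of n]
  show "AE x in m. (f x - F n x = 0 --> min_wug_loc m p' (\<lambda>x. f x - F n x) x = min_wug m p' (\<lambda>_. 0) x)
   \<and> min_wug_loc m p' (\<lambda>x. F n x - g n x) x = min_wug m p' (\<lambda>x. F n x - g n x) x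
   \<and> min_wug_loc m p' (\<lambda>x. f x - g n x) x <= min_wug_loc m p' (\<lambda>x. f x - F n x) x + min_wug_loc m p' (\<lambda>x. F n x - g n x) x
   \<and> 0 <= min_wug_loc m p' (\<lambda>x. f x - g n x) x"
   by eventually_elim simp
 qed
 with conv min_wug_zero[OF p' zero]
 have "AE x in m. (\<lambda>n. min_wug_loc m p' (\<lambda>x. f x - g n x) x) \<longlonglongrightarrow> 0"
 proof eventually_elim
  case (elim x)
  obtain N where N: "!!n. N <= n ==> dist undefined x <= real n \<and> \<bar>f x\<bar> < real n \<and> \<bar>f x\<bar> < real n \<and> 0 < n"
   using loc_approx_eventually[of x f f] by blast
  have le: "norm (min_wug_loc m p' (\<lambda>x. f x - g n x) x) <= min_wug m p' (\<lambda>x. F n x - g n x) x" if "N <= n" for n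
  proof -
   have "F n x = f x" unfolding F_def using N[of "Suc n"] that by (intro loc_approx_eq) auto
   then have "min_wug_loc m p' (\<lambda>x. f x - F n x) x = 0" using elim(2,3) by simp
   then show ?thesis using elim(3)[rule_format, of n] by simp
  qed
  then show ?case
   by (intro Lim_null_comparison[OF _ elim(1)]) (auto simp: eventually_sequentially)
 qed
 with g(1,2) show thesis by (rule that)
qed

end

section \<open>Normed modules\<close>

lemma L0_class_self: "f \<in> borel_measurable m ==> f \<in> L0_class m f"
 by (simp add: L0_class_def)

lemma L0_class_eq_iff:
 assumes "f \<in> borel_measurable m" "g \<in> borel_measurable m"
 shows "L0_class m f = L0_class m g \<longleftrightarrow> (AE x in m. f x = g x)"
proof
 assume "L0_class m f = L0_class m g"
 then have "f \<in> L0_class m g" using L0_class_self[OF assms(1)] by simp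
 then show "AE x in m. f x = g x" by (simp add: L0_class_def)
next
 assume H: "AE x in m. f x = g x"
 have "(AE x in m. h x = f x) \<longleftrightarrow> (AE x in m. h x = g x)" for h
 proof
  assume "AE x in m. h x = f x" with H show "AE x in m. h x = g x" by eventually_elim simp
 next
  assume "AE x in m. h x = g x" with H show "AE x in m. h x = f x" by eventually_elim simp
 qed
 then show "L0_class m f = L0_class m g" by (simp add: L0_class_def)
qed

lemma L0_class_eqI:
 "f \<in> borel_measurable m ==> g \<in> borel_measurable m ==> AE x in m. f x = g x ==> L0_class m f = L0_class m g"
 by (simp add: L0_class_eq_iff)

lemma carrier_L0: "carrier (L0 m) = L0_class m ` borel_measurable m"
 by (simp add: L0_def)

lemma L0_class_carrier [simp, intro]: "f \<in> borel_measurable m ==> L0_class m f \<in> carrier (L0 m)"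
 by (simp add: carrier_L0)

lemma L0_rep_class:
 assumes "f \<in> borel_measurable m"
 shows "L0_rep (L0_class m f) \<in> borel_measurable m" "AE x in m. L0_rep (L0_class m f) x = f x"
proof -
 have "L0_rep (L0_class m f) \<in> L0_class m f"
  unfolding L0_rep_def by (rule someI[of _ f]) (rule L0_class_self[OF assms])
 then show "L0_rep (L0_class m f) \<in> borel_measurable m" "AE x in m. L0_rep (L0_class m f) x = f x"
  by (auto simp: L0_class_def)
qed

lemma L0_rep:
 assumes "F \<in> carrier (L0 m)"
 shows "L0_rep F \<in> borel_measurable m" "L0_class m (L0_rep F) = F"
proof -
 obtain f where f: "f \<in> borel_measurable m" "F = L0_class m f" using assms by (auto simp: carrier_L0)
 note R = L0_rep_class[OF f(1), folded f(2)]
 show "L0_rep F \<in> borel_measurable m" by (rule R)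
 show "L0_class m (L0_rep F) = F" using R f by (subst f(2)) (simp add: L0_class_eq_iff)
qed

lemma L0_lift2_class:
 assumes "f \<in> borel_measurable m" "g \<in> borel_measurable m"
 shows "L0_lift2 m c (L0_class m f) (L0_class m g) = L0_class m (\<lambda>x. c (f x) (g x))"
proof -
 have "(\<exists>f'\<in>L0_class m f. \<exists>g'\<in>L0_class m g. AE x in m. h x = c (f' x) (g' x)) \<longleftrightarrow> (AE x in m. h x = c (f x) (g x))" for h
 proof
  assume "\<exists>f'\<in>L0_class m f. \<exists>g'\<in>L0_class m g. AE x in m. h x = c (f' x) (g' x)"
  then obtain f' g' where "AE x in m. f' x = f x" "AE x in m. g' x = g x" "AE x in m. h x = c (f' x) (g' x)"
   by (auto simp: L0_class_def)
  then show "AE x in m. h x = c (f x) (g x)" by eventually_elim simp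
 qed (use L0_class_self assms in blast)
 then show ?thesis by (simp add: L0_lift2_def L0_class_def)
qed

lemma L0_mult_class [simp]:
 "f \<in> borel_measurable m ==> g \<in> borel_measurable m ==>
  L0_class m f \<otimes>\<^bsub>L0 m\<^esub> L0_class m g = L0_class m (\<lambda>x. f x * g x)"
 by (simp add: L0_def L0_lift2_class)

lemma L0_add_class [simp]:
 "f \<in> borel_measurable m ==> g \<in> borel_measurable m ==>
  L0_class m f \<oplus>\<^bsub>L0 m\<^esub> L0_class m g = L0_class m (\<lambda>x. f x + g x)"
 by (simp add: L0_def L0_lift2_class)

lemma L0_zero_class: "\<zero>\<^bsub>L0 m\<^esub> = L0_class m (\<lambda>_. 0)"
 by (simp add: L0_def)

lemma L0_one_class: "\<one>\<^bsub>L0 m\<^esub> = L0_class m (\<lambda>_. 1)"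
 by (simp add: L0_def)

lemma L0_abs_class [simp]:
 assumes "f \<in> borel_measurable m"
 shows "L0_abs m (L0_class m f) = L0_class m (\<lambda>x. \<bar>f x\<bar>)"
proof -
 have "(\<exists>f'\<in>L0_class m f. AE x in m. h x = \<bar>f' x\<bar>) \<longleftrightarrow> (AE x in m. h x = \<bar>f x\<bar>)" for h
 proof
  assume "\<exists>f'\<in>L0_class m f. AE x in m. h x = \<bar>f' x\<bar>"
  then obtain f' where "AE x in m. f' x = f x" "AE x in m. h x = \<bar>f' x\<bar>" by (auto simp: L0_class_def)
  then show "AE x in m. h x = \<bar>f x\<bar>" by eventually_elim simp
 qed (use L0_class_self assms in blast)
 then show ?thesis by (simp add: L0_abs_def L0_class_def)
qed

lemma L0_le_class [simp]:
 assumes "f \<in> borel_measurable m" "g \<in> borel_measurable m"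
 shows "L0_le m (L0_class m f) (L0_class m g) \<longleftrightarrow> (AE x in m. f x <= g x)"
proof
 assume "L0_le m (L0_class m f) (L0_class m g)"
 then show "AE x in m. f x <= g x" using L0_class_self assms by (auto simp: L0_le_def)
next
 assume H: "AE x in m. f x <= g x"
 show "L0_le m (L0_class m f) (L0_class m g)"
  unfolding L0_le_def
 proof (intro ballI)
  fix f' g' assume "f' \<in> L0_class m f" "g' \<in> L0_class m g"
  then have "AE x in m. f' x = f x" "AE x in m. g' x = g x" by (auto simp: L0_class_def)
  with H show "AE x in m. f' x <= g' x" by eventually_elim simp
 qed
qed

lemma L0_cases:
 assumes "F \<in> carrier (L0 m)"
 obtains f where "f \<in> borel_measurable m" "F = L0_class m f"
 using assms by (auto simp: carrier_L0)

lemma cring_L0: "cring (L0 m)"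
proof (rule cringI)
 show "abelian_group (L0 m)"
 proof (rule abelian_groupI)
  fix F assume F: "F \<in> carrier (L0 m)"
  then obtain f where f [measurable]: "f \<in> borel_measurable m" and "F = L0_class m f" by (rule L0_cases)
  then show "\<exists>G\<in>carrier (L0 m). G \<oplus>\<^bsub>L0 m\<^esub> F = \<zero>\<^bsub>L0 m\<^esub>"
   by (intro bexI[of _ "L0_class m (\<lambda>x. - f x)"]) (auto simp: L0_zero_class)
 qed (auto elim!: L0_cases simp: L0_zero_class algebra_simps)
 show "comm_monoid (L0 m)"
  by (rule comm_monoidI) (auto elim!: L0_cases simp: L0_one_class algebra_simps)
qed (auto elim!: L0_cases simp: algebra_simps)

lemma L0_uminus_class:
 assumes [measurable]: "f \<in> borel_measurable m"
 shows "\<ominus>\<^bsub>L0 m\<^esub> L0_class m f = L0_class m (\<lambda>x. - f x)"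
proof -
 interpret cring "L0 m" by (rule cring_L0)
 show ?thesis by (rule minus_equality) (auto simp: L0_zero_class)
qed

section \<open>Integration against the reference measure\<close>

text \<open>Mutual absolute continuity means equal null sets, so the finite measure can be used for
  integration and \<open>m\<close> for all almost everywhere statements.\<close>

lemma reference_measure_AE:
 assumes r: "reference_measure m m'" and s: "sets m = sets borel"
 shows "(AE x in m'. P x) \<longleftrightarrow> (AE x in m. P x)"
proof -
 have s': "sets m' = sets m" using r s by (simp add: reference_measure_def)
 have "null_sets m = null_sets m'"
  using r unfolding reference_measure_def absolutely_continuous_def by auto
 then show ?thesis using sets_eq_imp_space_eq[OF s'] by (simp add: eventually_ae_filter)
qed

locale L0_setting =
 fixes m m' :: "'x::polish_space measure"
 assumes ref: "reference_measure m m'" and sets_m [measurable_cong]: "sets m = sets borel"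
begin

lemma sets_m' [measurable_cong]: "sets m' = sets borel"
 using ref by (simp add: reference_measure_def)

lemma finite_measure_m': "finite_measure m'"
 using ref by (simp add: reference_measure_def)

sublocale m': finite_measure m' by (rule finite_measure_m')

lemma AE_m' [simp]: "(AE x in m'. P x) \<longleftrightarrow> (AE x in m. P x)"
 by (rule reference_measure_AE[OF ref sets_m])

lemma borel_measurable_m' [simp]: "borel_measurable m' = borel_fun"
 by (rule measurable_cong_sets) (auto simp: sets_m')

lemma borel_measurable_m [simp]: "borel_measurable m = borel_fun"
 by (rule measurable_cong_sets) (auto simp: sets_m)

text \<open>Applied to a pointwise norm this is the distance of a module; it measures convergence in
  measure with respect to the finite measure \<open>m'\<close>.\<close>

definition trunc_int :: "('x => real) => real" where
 "trunc_int h = (\<integral>x. min (h x) 1 \<partial>m')"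

lemma integrable_trunc:
 fixes h :: "'x => real"
 assumes [measurable]: "h \<in> borel_fun" and "AE x in m. 0 <= h x"
 shows "integrable m' (\<lambda>x. min (h x) 1)"
proof (rule finite_measure.integrable_const_bound[OF finite_measure_m'])
 show "AE x in m'. norm (min (h x) 1) <= 1" unfolding AE_m' using assms(2) by eventually_elim auto
qed measurable

lemma trunc_int_nonneg: "AE x in m. 0 <= h x ==> 0 <= trunc_int h"
 unfolding trunc_int_def by (rule integral_nonneg_AE) (auto elim!: eventually_mono)

lemma trunc_int_mono:
 assumes "h \<in> borel_fun" "k \<in> borel_fun" "AE x in m. 0 <= h x" "AE x in m. h x <= k x"
 shows "trunc_int h <= trunc_int k"
proof -
 have "AE x in m. 0 <= k x" using assms(3,4) by eventually_elim simp
 moreover have "AE x in m'. min (h x) 1 <= min (k x) 1" unfolding AE_m' using assms(4) by eventually_elim auto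
 ultimately show ?thesis unfolding trunc_int_def
  by (intro integral_mono_AE integrable_trunc assms)
qed

lemma trunc_int_cong_AE:
 assumes "h \<in> borel_fun" "k \<in> borel_fun" "AE x in m. h x = k x"
 shows "trunc_int h = trunc_int k"
 unfolding trunc_int_def by (rule integral_cong_AE) (use assms in \<open>auto elim!: eventually_mono\<close>)

lemma trunc_int_add:
 assumes [measurable]: "h \<in> borel_fun" "k \<in> borel_fun"
  and nn: "AE x in m. 0 <= h x" "AE x in m. 0 <= k x"
 shows "trunc_int (\<lambda>x. h x + k x) <= trunc_int h + trunc_int k"
proof -
 have "AE x in m. 0 <= h x + k x" using nn by eventually_elim simp
 then have "trunc_int (\<lambda>x. h x + k x) <= (\<integral>x. min (h x) 1 + min (k x) 1 \<partial>m')"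
  unfolding trunc_int_def
  by (intro integral_mono_AE Bochner_Integration.integrable_add integrable_trunc nn)
   (use nn in \<open>auto elim!: eventually_elim2\<close>)
 also have "... = trunc_int h + trunc_int k"
  unfolding trunc_int_def by (intro Bochner_Integration.integral_add integrable_trunc nn) auto
 finally show ?thesis .
qed

lemma trunc_int_zero_iff:
 assumes [measurable]: "h \<in> borel_fun" and nn: "AE x in m. 0 <= h x"
 shows "trunc_int h = 0 \<longleftrightarrow> (AE x in m. h x = 0)"
proof -
 have "trunc_int h = 0 \<longleftrightarrow> (AE x in m'. min (h x) 1 = 0)"
  unfolding trunc_int_def by (rule integral_nonneg_eq_0_iff_AE[OF integrable_trunc[OF _ nn]]) (use nn in \<open>auto elim!: eventually_mono\<close>)
 also have "... \<longleftrightarrow> (AE x in m. h x = 0)"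
  unfolding AE_m' by (intro iffI; erule eventually_mono) (auto simp: min_def split: if_splits)
 finally show ?thesis .
qed

text \<open>Dominated convergence, with the constant 1 as majorant, integrable since
  \<open>m'\<close> is finite.\<close>

lemma trunc_int_tendsto_zero:
 assumes h: "!!n. h n \<in> borel_fun" "!!n. AE x in m. 0 <= h n x"
  and lim: "AE x in m. (\<lambda>n. h n x) \<longlonglongrightarrow> 0"
 shows "(\<lambda>n. trunc_int (h n)) \<longlonglongrightarrow> 0"
proof -
 note [measurable] = h(1)
 have "(\<lambda>n. \<integral>x. min (h n x) 1 \<partial>m') \<longlonglongrightarrow> (\<integral>x. 0 \<partial>m')"
 proof (rule integral_dominated_convergence[where w="\<lambda>_. 1"])
  show "AE x in m'. (\<lambda>n. min (h n x) 1) \<longlonglongrightarrow> 0"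
   unfolding AE_m' using lim
  proof eventually_elim
   case (elim x)
   then have "(\<lambda>n. min (h n x) 1) \<longlonglongrightarrow> min 0 1" by (intro tendsto_min tendsto_const)
   then show ?case by simp
  qed
  show "AE x in m'. norm (min (h n x) 1) <= 1" for n
   unfolding AE_m' using h(2)[of n] by eventually_elim auto
 qed auto
 then show ?thesis by (simp add: trunc_int_def)
qed

text \<open>\<open>f\<close> may be unbounded. Where \<open>\<bar>f x\<bar>\<close> is at most
  \<open>c\<close> a constant factor comes out; the remaining set has small
  \<open>m'\<close>-measure and, thanks to the truncation, contributes no more than that
  measure.\<close>

lemma trunc_int_mult_tendsto_zero:
 assumes h: "!!n. h n \<in> borel_fun" "!!n. AE x in m. 0 <= h n x"
  and lim: "(\<lambda>n. trunc_int (h n)) \<longlonglongrightarrow> 0" and f [measurable]: "f \<in> borel_fun"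
 shows "(\<lambda>n. trunc_int (\<lambda>x. \<bar>f x\<bar> * h n x)) \<longlonglongrightarrow> 0"
proof (rule tendstoI)
 fix e :: real assume e: "0 < e"
 note [measurable] = h(1)
 have "(\<lambda>c. measure m' {x\<in>space m'. real c < \<bar>f x\<bar>}) \<longlonglongrightarrow> measure m' (\<Inter>c. {x\<in>space m'. real c < \<bar>f x\<bar>})"
  by (rule m'.finite_Lim_measure_decseq) (auto simp: decseq_def)
 moreover have "(\<Inter>c. {x\<in>space m'. real c < \<bar>f x\<bar>}) = {}"
 proof -
  have "\<exists>c. \<not> real c < \<bar>f x\<bar>" for x using reals_Archimedean2[of "\<bar>f x\<bar>"] by (auto simp: not_less intro: less_imp_le)
  then show ?thesis by blast
 qed
 ultimately have "(\<lambda>c. measure m' {x\<in>space m'. real c < \<bar>f x\<bar>}) \<longlonglongrightarrow> 0" by simp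
 then have "eventually (\<lambda>c. measure m' {x\<in>space m'. real c < \<bar>f x\<bar>} < e / 2) sequentially"
  using e by (intro order_tendstoD(2)) auto
 then obtain c where c: "measure m' {x\<in>space m'. real c < \<bar>f x\<bar>} < e / 2"
  by (auto simp: eventually_sequentially)
 \<comment> \<open>\<open>C\<close> is at least 1, so \<open>C * min (h n x) 1\<close> still
   dominates the truncated product where \<open>h n x\<close> exceeds 1.\<close>
 define C where "C = real c + 1"
 have C: "1 <= C" "real c <= C" by (auto simp: C_def)
 have bound: "trunc_int (\<lambda>x. \<bar>f x\<bar> * h n x) <= C * trunc_int (h n) + measure m' {x\<in>space m'. real c < \<bar>f x\<bar>}" for n
 proof -
  have pw: "AE x in m'. min (\<bar>f x\<bar> * h n x) 1 <= C * min (h n x) 1 + indicator {x\<in>space m'. real c < \<bar>f x\<bar>} x"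
   unfolding AE_m' using h(2)[of n]
  proof eventually_elim
   case (elim x)
   show ?case
   proof (cases "real c < \<bar>f x\<bar>")
    case True
    have "x \<in> space m'" using sets_eq_imp_space_eq[OF sets_m'] by simp
    then show ?thesis using True elim C by (auto simp: min_le_iff_disj)
   next
    case False
    then have "\<bar>f x\<bar> <= C" using C by simp
    then have 1: "\<bar>f x\<bar> * h n x <= C * h n x" using elim by (rule mult_right_mono)
    show ?thesis
    proof (cases "h n x <= 1")
     case True
     have "min (\<bar>f x\<bar> * h n x) 1 <= C * h n x" using 1 by (rule min.coboundedI1)
     then show ?thesis using True False by simp
    next
     case F: False
     have "min (\<bar>f x\<bar> * h n x) 1 <= 1" by simp
     then show ?thesis using F False C by simp
    qed
   qed
  qed
  have i: "integrable m' (\<lambda>x. C * min (h n x) 1)" using integrable_trunc[OF h(1,2)] by simp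
  have i2: "integrable m' (indicator {x\<in>space m'. real c < \<bar>f x\<bar>} :: _ => real)"
   by (rule integrable_real_indicator) (auto simp: m'.emeasure_eq_measure)
  have nn: "AE x in m. 0 <= \<bar>f x\<bar> * h n x" using h(2)[of n] by eventually_elim simp
  have "trunc_int (\<lambda>x. \<bar>f x\<bar> * h n x) <= (\<integral>x. C * min (h n x) 1 + indicator {x\<in>space m'. real c < \<bar>f x\<bar>} x \<partial>m')"
   unfolding trunc_int_def
   by (rule integral_mono_AE[OF integrable_trunc[OF _ nn] Bochner_Integration.integrable_add[OF i i2] pw]) measurable
  also have "... = C * trunc_int (h n) + measure m' {x\<in>space m'. real c < \<bar>f x\<bar>}"
   unfolding trunc_int_def using i i2 by (subst Bochner_Integration.integral_add) auto
  finally show ?thesis .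
 qed
 have "(\<lambda>n. C * trunc_int (h n)) \<longlonglongrightarrow> C * 0" by (intro tendsto_mult tendsto_const lim)
 then have "eventually (\<lambda>n. C * trunc_int (h n) < e / 2) sequentially" using e by (intro order_tendstoD(2)) auto
 then show "eventually (\<lambda>n. dist (trunc_int (\<lambda>x. \<bar>f x\<bar> * h n x)) 0 < e) sequentially"
 proof eventually_elim
  case (elim n)
  have "0 <= trunc_int (\<lambda>x. \<bar>f x\<bar> * h n x)"
   by (rule trunc_int_nonneg) (use h(2)[of n] in \<open>eventually_elim, simp\<close>)
  then show ?case using bound[of n] c elim by (simp add: dist_real_def)
 qed
qed

end

section \<open>Pointwise norms and distance in a normed module\<close>

locale L0_module = L0_setting m m' for m m' :: "'x::polish_space measure" +
 fixes M :: "('x, 'v) normed_module" (structure)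
 assumes L0_normed_module: "L0_normed_module m m' M"
begin

sublocale Module.module "L0 m" M
 using L0_normed_module by (simp add: L0_normed_module_def)

sublocale MS: Metric_space "carrier M" "mod_dist m' M"
 using L0_normed_module by (simp add: L0_normed_module_def)

definition pn :: "'v => 'x => real" where
 "pn v = L0_rep (pnorm M v)"

lemma pnorm_closed: "v \<in> carrier M ==> pnorm M v \<in> carrier (L0 m)"
 using L0_normed_module by (auto simp: L0_normed_module_def)

lemma pn:
 assumes "v \<in> carrier M"
 shows "pn v \<in> borel_fun" and "pnorm M v = L0_class m (pn v)"
 using L0_rep[OF pnorm_closed[OF assms]] by (auto simp: pn_def)

lemma pn_eqI:
 assumes "v \<in> carrier M" "f \<in> borel_fun" "pnorm M v = L0_class m f"
 shows "AE x in m. pn v x = f x"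
 using L0_rep_class(2)[of f m] assms by (simp add: pn_def)

lemma pn_nonneg: "v \<in> carrier M ==> AE x in m. 0 <= pn v x"
 using L0_normed_module pn[of v] by (auto simp: L0_normed_module_def L0_zero_class)

lemma pn_smult:
 assumes "f \<in> borel_fun" "v \<in> carrier M"
 shows "AE x in m. pn (L0_class m f \<odot> v) x = \<bar>f x\<bar> * pn v x"
proof (rule pn_eqI)
 have "pnorm M (L0_class m f \<odot> v) = L0_abs m (L0_class m f) \<otimes>\<^bsub>L0 m\<^esub> pnorm M v"
  using L0_normed_module assms unfolding L0_normed_module_def by (metis L0_class_carrier borel_measurable_m)
 then show "pnorm M (L0_class m f \<odot> v) = L0_class m (\<lambda>x. \<bar>f x\<bar> * pn v x)"
  using assms pn[OF assms(2)] by (simp add: borel_measurable_abs)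
 show "L0_class m f \<odot> v \<in> carrier M" using assms by simp
 show "(\<lambda>x. \<bar>f x\<bar> * pn v x) \<in> borel_fun" using assms pn by measurable
qed

lemma mod_dist_eq: "v \<in> carrier M ==> w \<in> carrier M ==> mod_dist m' M v w = trunc_int (pn (v \<ominus> w))"
 by (simp add: mod_dist_def trunc_int_def pn_def)

lemma smult_zero_class: "v \<in> carrier M ==> L0_class m (\<lambda>_. 0) \<odot> v = \<zero>"
 using smult_l_null[of v] by (simp add: L0_zero_class)

lemma smult_one_class: "v \<in> carrier M ==> L0_class m (\<lambda>_. 1) \<odot> v = v"
 using smult_one[of v] by (simp add: L0_one_class)

lemma smult_minus_one: "v \<in> carrier M ==> L0_class m (\<lambda>_. -1) \<odot> v = \<ominus> v"
proof -
 assume v: "v \<in> carrier M"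
 have "\<ominus>\<^bsub>L0 m\<^esub> L0_class m (\<lambda>_. 1) = L0_class m (\<lambda>_. -1)" by (subst L0_uminus_class) auto
 then show ?thesis using smult_l_minus[of "L0_class m (\<lambda>_. 1)" v] v by (simp add: smult_one_class)
qed

lemma pn_zero: "AE x in m. pn \<zero> x = 0"
 using pn_smult[of "\<lambda>_. 0" \<zero>] by (simp add: smult_zero_class)

lemma pn_uminus: "v \<in> carrier M ==> AE x in m. pn (\<ominus> v) x = pn v x"
 using pn_smult[of "\<lambda>_. -1" v] by (simp add: smult_minus_one)

text \<open>The triangle inequality is only assumed for the integrated distance; it is localised by
 multiplying with functions \<open>\<kappa>\<close> that are supported on an arbitrary set and so small that the
 truncation at \<open>1\<close> has no effect.\<close>

lemma pn_add:
 assumes v: "v \<in> carrier M" and w: "w \<in> carrier M"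
 shows "AE x in m. pn (v \<oplus> w) x <= pn v x + pn w x"
proof -
 let ?u = "v \<oplus> w"
 have u: "?u \<in> carrier M" using v w by simp
 note [measurable] = pn(1)[OF v] pn(1)[OF w] pn(1)[OF u]
 define A where "A = {x. pn v x + pn w x < pn ?u x}"
 have [measurable]: "A \<in> sets borel" unfolding A_def by measurable
 define \<kappa> where "\<kappa> x = indicator A x * (1 / (1 + \<bar>pn v x\<bar> + \<bar>pn w x\<bar> + \<bar>pn ?u x\<bar>))" for x
 have \<kappa> [measurable]: "\<kappa> \<in> borel_fun" unfolding \<kappa>_def by measurable
 have \<kappa>0: "0 <= \<kappa> x" for x by (simp add: \<kappa>_def)
 have small: "\<kappa> x * \<bar>c\<bar> <= 1" if "\<bar>c\<bar> <= \<bar>pn v x\<bar> + \<bar>pn w x\<bar> + \<bar>pn ?u x\<bar>" for c x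
  using that by (auto simp: \<kappa>_def indicator_def field_simps)
 let ?c = "L0_class m \<kappa>"
 let ?a = "?c \<odot> v" and ?b = "\<ominus> (?c \<odot> w)"
 have cc: "?c \<in> carrier (L0 m)" using \<kappa> by simp
 have ab: "?a \<in> carrier M" "?b \<in> carrier M" "?c \<odot> w \<in> carrier M" using v w cc by simp_all
 have e1: "?a \<ominus> ?b = ?c \<odot> ?u" using v w cc by (simp add: a_minus_def smult_r_distr M.minus_minus)
 have e2: "?a \<ominus> \<zero> = ?a" using ab by (simp add: a_minus_def)
 have e3: "\<zero> \<ominus> ?b = ?c \<odot> w" using ab w cc by (simp add: a_minus_def M.minus_minus)
 have "mod_dist m' M ?a ?b <= mod_dist m' M ?a \<zero> + mod_dist m' M \<zero> ?b"
  by (rule MS.triangle) (use ab in auto)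
 then have le: "trunc_int (pn (?c \<odot> ?u)) <= trunc_int (pn (?c \<odot> v)) + trunc_int (pn (?c \<odot> w))"
  using ab by (simp add: mod_dist_eq e1 e2 e3)
 have eq: "trunc_int (pn (?c \<odot> z)) = (\<integral>x. \<kappa> x * pn z x \<partial>m')" "integrable m' (\<lambda>x. \<kappa> x * pn z x)"
  if z: "z \<in> carrier M" and bd: "!!x. \<bar>pn z x\<bar> <= \<bar>pn v x\<bar> + \<bar>pn w x\<bar> + \<bar>pn ?u x\<bar>" for z
 proof -
  note [measurable] = pn(1)[OF z] pn(1)[OF smult_closed[OF cc z]]
  have b1: "\<bar>\<kappa> x * pn z x\<bar> <= 1" for x using small[OF bd] \<kappa>0 by (simp add: abs_mult)
  show "trunc_int (pn (?c \<odot> z)) = (\<integral>x. \<kappa> x * pn z x \<partial>m')"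
   unfolding trunc_int_def
  proof (rule integral_cong_AE)
   show "AE x in m'. min (pn (?c \<odot> z) x) 1 = \<kappa> x * pn z x"
    unfolding AE_m' using pn_smult[OF \<kappa> z]
   proof eventually_elim
    case (elim x)
    then show ?case using b1[of x] \<kappa>0[of x] by (simp add: abs_le_iff)
   qed
  qed measurable
  show "integrable m' (\<lambda>x. \<kappa> x * pn z x)"
   by (rule m'.integrable_const_bound[where B=1]) (use b1 in auto)
 qed
 note Eu = eq[OF u] and Ev = eq[OF v] and Ew = eq[OF w]
 have "(\<integral>x. \<kappa> x * pn ?u x - (\<kappa> x * pn v x + \<kappa> x * pn w x) \<partial>m') <= 0"
  using le Eu Ev Ew by (simp add: Bochner_Integration.integral_diff Bochner_Integration.integral_add)
 moreover have nn: "0 <= \<kappa> x * pn ?u x - (\<kappa> x * pn v x + \<kappa> x * pn w x)" for x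
 proof (cases "x \<in> A")
  case True
  then have "\<kappa> x * (pn v x + pn w x) <= \<kappa> x * pn ?u x" using \<kappa>0 by (intro mult_left_mono) (auto simp: A_def)
  then show ?thesis by (simp add: distrib_left)
 qed (simp add: \<kappa>_def)
 moreover have i: "integrable m' (\<lambda>x. \<kappa> x * pn ?u x - (\<kappa> x * pn v x + \<kappa> x * pn w x))"
  using Eu Ev Ew by auto
 ultimately have "(\<integral>x. \<kappa> x * pn ?u x - (\<kappa> x * pn v x + \<kappa> x * pn w x) \<partial>m') = 0"
  by (intro antisym integral_nonneg_AE) auto
 then have "AE x in m'. \<kappa> x * pn ?u x - (\<kappa> x * pn v x + \<kappa> x * pn w x) = 0"
  using integral_nonneg_eq_0_iff_AE[OF i] nn by simp
 then show ?thesis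
  unfolding AE_m'
 proof eventually_elim
  case (elim x)
  show ?case
  proof (rule ccontr)
   assume "\<not> ?thesis"
   then have x: "x \<in> A" by (simp add: A_def)
   then have "0 < \<kappa> x" by (simp add: \<kappa>_def add_pos_nonneg)
   moreover have "\<kappa> x * (pn ?u x - (pn v x + pn w x)) = 0" using elim by (simp add: algebra_simps)
   ultimately show False using x by (simp add: A_def)
  qed
 qed
qed

lemma minus_trans:
 assumes "u \<in> carrier M" "v \<in> carrier M" "w \<in> carrier M"
 shows "(u \<ominus> v) \<oplus> (v \<ominus> w) = u \<ominus> w"
proof -
 have "(u \<ominus> v) \<oplus> (v \<ominus> w) = u \<oplus> ((\<ominus> v \<oplus> v) \<oplus> \<ominus> w)"
  using assms by (simp add: a_minus_def M.a_assoc)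
 then show ?thesis using assms by (simp add: M.l_neg a_minus_def)
qed

lemma add_minus_add:
 assumes "v \<in> carrier M" "w \<in> carrier M" "v' \<in> carrier M" "w' \<in> carrier M"
 shows "(v \<oplus> v') \<ominus> (w \<oplus> w') = (v \<ominus> w) \<oplus> (v' \<ominus> w')"
 using assms by (simp add: a_minus_def M.minus_add M.a_ac)

lemma smult_minus:
 assumes "F \<in> carrier (L0 m)" "v \<in> carrier M" "w \<in> carrier M"
 shows "F \<odot> v \<ominus> F \<odot> w = F \<odot> (v \<ominus> w)"
 using assms by (simp add: a_minus_def smult_r_distr smult_r_minus)

lemma pn_minus_triangle:
 assumes "u \<in> carrier M" "v \<in> carrier M" "w \<in> carrier M"
 shows "AE x in m. pn (u \<ominus> w) x <= pn (u \<ominus> v) x + pn (v \<ominus> w) x"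
 using pn_add[of "u \<ominus> v" "v \<ominus> w"] assms by (simp add: minus_trans)

lemma pn_minus_commute:
 assumes "v \<in> carrier M" "w \<in> carrier M"
 shows "AE x in m. pn (v \<ominus> w) x = pn (w \<ominus> v) x"
proof -
 have "\<ominus> (w \<ominus> v) = v \<ominus> w" using assms by (simp add: a_minus_def M.minus_add M.minus_minus M.a_comm)
 then show ?thesis using pn_uminus[of "w \<ominus> v"] assms by simp
qed

text \<open>The pointwise triangle inequality \<open>pn_add\<close>, used in both orders.\<close>

lemma pn_abs_diff:
 assumes v: "v \<in> carrier M" and w: "w \<in> carrier M"
 shows "AE x in m. \<bar>pn v x - pn w x\<bar> <= pn (v \<ominus> w) x"
proof -
 have e: "v \<ominus> \<zero> = v" "w \<ominus> \<zero> = w" using v w by (simp_all add: a_minus_def)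
 have "AE x in m. pn v x <= pn (v \<ominus> w) x + pn w x" "AE x in m. pn w x <= pn (w \<ominus> v) x + pn v x"
  using pn_minus_triangle[OF v w, of \<zero>] pn_minus_triangle[OF w v, of \<zero>] by (simp_all add: e)
 with pn_minus_commute[OF v w] show ?thesis by eventually_elim linarith
qed

lemma mod_dist_add:
 assumes c: "v \<in> carrier M" "w \<in> carrier M" "v' \<in> carrier M" "w' \<in> carrier M"
 shows "mod_dist m' M (v \<oplus> v') (w \<oplus> w') <= mod_dist m' M v w + mod_dist m' M v' w'"
proof -
 have d: "v \<ominus> w \<in> carrier M" "v' \<ominus> w' \<in> carrier M" using c by simp_all
 note [measurable] = pn(1)[OF d(1)] pn(1)[OF d(2)]
 have "mod_dist m' M (v \<oplus> v') (w \<oplus> w') = trunc_int (pn ((v \<ominus> w) \<oplus> (v' \<ominus> w')))"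
  using c by (simp add: mod_dist_eq add_minus_add)
 also have "... <= trunc_int (\<lambda>x. pn (v \<ominus> w) x + pn (v' \<ominus> w') x)"
  by (intro trunc_int_mono pn_add pn_nonneg d pn(1)) (use d in auto)
 also have "... <= trunc_int (pn (v \<ominus> w)) + trunc_int (pn (v' \<ominus> w'))"
  by (intro trunc_int_add pn_nonneg d pn(1))
 finally show ?thesis using c by (simp add: mod_dist_eq)
qed

text \<open>The scalar may be unbounded, so continuity of the multiplication comes from splitting
  off a set of small measure rather than from a Lipschitz estimate.\<close>

lemma mod_dist_smult_tendsto:
 assumes F: "F \<in> carrier (L0 m)" and s: "!!n. s n \<in> carrier M" and v: "v \<in> carrier M"
  and lim: "(\<lambda>n. mod_dist m' M (s n) v) \<longlonglongrightarrow> 0"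
 shows "(\<lambda>n. mod_dist m' M (F \<odot> s n) (F \<odot> v)) \<longlonglongrightarrow> 0"
proof -
 obtain f where f: "f \<in> borel_fun" "F = L0_class m f" using F by (auto elim: L0_cases)
 have d: "s n \<ominus> v \<in> carrier M" for n using s v by simp
 have "mod_dist m' M (F \<odot> s n) (F \<odot> v) = trunc_int (\<lambda>x. \<bar>f x\<bar> * pn (s n \<ominus> v) x)" for n
 proof -
  have "mod_dist m' M (F \<odot> s n) (F \<odot> v) = trunc_int (pn (F \<odot> (s n \<ominus> v)))"
   using F s v by (simp add: mod_dist_eq smult_minus)
  also have "... = trunc_int (\<lambda>x. \<bar>f x\<bar> * pn (s n \<ominus> v) x)"
   unfolding f(2) by (rule trunc_int_cong_AE[OF _ _ pn_smult[OF f(1) d]])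
    (use f(1) F[unfolded f(2)] d pn(1) in auto)
  finally show ?thesis .
 qed
 moreover have "(\<lambda>n. trunc_int (\<lambda>x. \<bar>f x\<bar> * pn (s n \<ominus> v) x)) \<longlonglongrightarrow> 0"
  by (rule trunc_int_mult_tendsto_zero) (use lim s v d pn pn_nonneg f in \<open>auto simp: mod_dist_eq\<close>)
 ultimately show ?thesis by simp
qed

lemma mod_closure_iff:
 assumes "S \<subseteq> carrier M"
 shows "v \<in> mod_topology m' M closure_of S \<longleftrightarrow> v \<in> carrier M \<and> (\<forall>eps>0. \<exists>s\<in>S. mod_dist m' M v s < eps)"
 using assms unfolding MS.metric_closure_of by (auto simp: MS.in_mball) blast+

lemma mod_complete:
 assumes s: "!!n::nat. s n \<in> carrier M"
  and C: "!!eps. 0 < eps ==> \<exists>N. \<forall>i\<ge>N. \<forall>j\<ge>N. mod_dist m' M (s i) (s j) < eps"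
 obtains w where "w \<in> carrier M" "(\<lambda>n. mod_dist m' M (s n) w) \<longlonglongrightarrow> 0"
proof -
 have "MS.MCauchy s" unfolding MS.MCauchy_def using s C by auto
 then obtain w where w: "limitin MS.mtopology s w sequentially"
  using L0_normed_module unfolding L0_normed_module_def MS.mcomplete_def by blast
 then have "w \<in> carrier M" and "!!eps. 0 < eps ==> \<exists>N. \<forall>n\<ge>N. mod_dist m' M (s n) w < eps"
  unfolding MS.limit_metric_sequentially by (simp, meson)
 then show thesis
  by (intro that[of w]) (auto intro!: tendstoI simp: eventually_sequentially)
qed

end

section \<open>The pointwise norm of formal sums\<close>

text \<open>Collects the repeated occurrences of a function in a coded sum, so that estimates over
  the finite set of distinct functions apply.\<close>

lemma sum_list_regroup:
 fixes h :: "'f => real"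
 assumes "finite S" "snd ` set q \<subseteq> S"
 shows "(\<Sum>(c, f)\<leftarrow>q. c * h f) = (\<Sum>f\<in>S. (\<Sum>(c, f')\<leftarrow>q. if f' = f then c else 0) * h f)"
 using assms(2)
proof (induction q)
 case (Cons p q)
 obtain c f0 where p: "p = (c, f0)" by (cases p)
 have "f0 \<in> S" using Cons.prems by (simp add: p)
 have "(\<Sum>f\<in>S. (\<Sum>(c, f')\<leftarrow>p # q. if f' = f then c else 0) * h f) =
  (\<Sum>f\<in>S. (if f0 = f then c * h f else 0) + (\<Sum>(c, f')\<leftarrow>q. if f' = f then c else 0) * h f)"
  by (rule sum.cong) (auto simp: p distrib_right)
 also have "... = c * h f0 + (\<Sum>(c, f)\<leftarrow>q. c * h f)"
  using Cons assms(1) \<open>f0 \<in> S\<close> by (simp add: sum.distrib)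
 finally show ?case by (simp add: p)
qed simp

text \<open>Three successive comparisons lead from \<open>z\<close> to \<open>t\<close>, and their
  errors add up to less than three quarters of \<open>D\<close>.\<close>

lemma abs_chain_contradiction:
 fixes u v p q s t z D :: real
 assumes "u + v <= D / 4" "\<bar>p - q\<bar> <= v" "\<bar>q - t\<bar> <= s" "\<bar>z - p\<bar> <= s + u" "s < D / 4" "D = \<bar>z - t\<bar>" "0 < D"
 shows False
 using assms by argo

type_synonym 'x form = "(('x => real) \<times> ('x => real)) list"

text \<open>Abstracts a class of functions with its minimal gradients to a vector space with an
  almost everywhere seminorm. It is used for one class \<open>Sob_loc m p\<close> with its own
  gradient and for the union over all exponents with a common gradient.\<close>

locale seminormed_functions = L0_setting m m' for m m' :: "'x::polish_space measure" +
 fixes U :: "('x => real) set" and W :: "('x => real) => 'x => real"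
 assumes U_lincomb: "!!f g a b. f \<in> U ==> g \<in> U ==> (\<lambda>x. a * f x + b * g x) \<in> U"
  and U_nonempty: "U \<noteq> {}"
  and W_measurable: "!!f. f \<in> U ==> W f \<in> borel_fun"
  and W_nonneg: "!!f. f \<in> U ==> AE x in m. 0 <= W f x"
  and W_lincomb: "!!f g a b. f \<in> U ==> g \<in> U ==>
   AE x in m. W (\<lambda>x. a * f x + b * g x) x <= \<bar>a\<bar> * W f x + \<bar>b\<bar> * W g x"
begin

lemma U_zero: "(\<lambda>_. 0) \<in> U"
proof -
 obtain f where "f \<in> U" using U_nonempty by blast
 from U_lincomb[OF this this, of 0 0] show ?thesis by simp
qed

lemma U_scale: "f \<in> U ==> (\<lambda>x. a * f x) \<in> U"
 using U_lincomb[of f f a 0] by simp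

lemma W_zero: "AE x in m. W (\<lambda>_. 0) x = 0"
proof -
 have "AE x in m. W (\<lambda>_. 0) x <= 0" using W_lincomb[OF U_zero U_zero, of 0 0] by simp
 with W_nonneg[OF U_zero] show ?thesis by eventually_elim simp
qed

lemma W_add: "f \<in> U ==> g \<in> U ==> AE x in m. W (\<lambda>x. f x + g x) x <= W f x + W g x"
 using W_lincomb[of f g 1 1] by simp

lemma W_scale:
 assumes f: "f \<in> U"
 shows "AE x in m. W (\<lambda>x. a * f x) x = \<bar>a\<bar> * W f x"
proof (cases "a = 0")
 case True
 then show ?thesis using W_zero by simp
next
 case False
 have 1: "AE x in m. W (\<lambda>x. a * f x) x <= \<bar>a\<bar> * W f x" using W_lincomb[OF f f, of a 0] by simp
 have "AE x in m. W f x <= \<bar>1 / a\<bar> * W (\<lambda>x. a * f x) x"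
  using W_lincomb[OF U_scale[OF f, of a] f, of "1 / a" 0] False by simp
 with 1 show ?thesis
 proof eventually_elim
  case (elim x)
  have "\<bar>a\<bar> * W f x <= \<bar>a\<bar> * (\<bar>1 / a\<bar> * W (\<lambda>x. a * f x) x)" using elim(2) by (intro mult_left_mono) auto
  then show ?case using elim(1) False by simp
 qed
qed

lemma W_sum:
 assumes "finite S" "S \<subseteq> U"
 shows "(\<lambda>y. \<Sum>f\<in>S. c f * f y) \<in> U \<and> (AE x in m. W (\<lambda>y. \<Sum>f\<in>S. c f * f y) x <= (\<Sum>f\<in>S. \<bar>c f\<bar> * W f x))"
 using assms
proof (induction S)
 case empty
 have "AE x in m. W (\<lambda>_. 0) x <= 0" using W_zero by eventually_elim simp
 then show ?case using U_zero by simp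
next
 case (insert f S)
 have f: "f \<in> U" and S: "(\<lambda>y. \<Sum>f\<in>S. c f * f y) \<in> U"
  "AE x in m. W (\<lambda>y. \<Sum>f\<in>S. c f * f y) x <= (\<Sum>f\<in>S. \<bar>c f\<bar> * W f x)" using insert by auto
 have e: "(\<lambda>y. \<Sum>f\<in>insert f S. c f * f y) = (\<lambda>y. c f * f y + 1 * (\<Sum>f\<in>S. c f * f y))" using insert by simp
 have "AE x in m. W (\<lambda>y. c f * f y + 1 * (\<Sum>f\<in>S. c f * f y)) x <= (\<Sum>f\<in>insert f S. \<bar>c f\<bar> * W f x)"
  using W_lincomb[OF f S(1), of "c f" 1] S(2) by eventually_elim (use insert in simp)
 then show ?case unfolding e using U_lincomb[OF f S(1), of "c f" 1] by simp
qed

section \<open>Coded formal sums and their approximation by constant combinations\<close>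

definition forms :: "'x form set" where
 "forms = {l. \<forall>(g, f)\<in>set l. g \<in> borel_fun \<and> f \<in> U}"

lemma forms_simps [simp]:
 "[] \<in> forms" "((g, f) # l) \<in> forms \<longleftrightarrow> g \<in> borel_fun \<and> f \<in> U \<and> l \<in> forms"
 "l @ l' \<in> forms \<longleftrightarrow> l \<in> forms \<and> l' \<in> forms"
 by (auto simp: forms_def)

text \<open>Rational coefficient tuples are countable, so one null set serves all seminorm
  inequalities among them.\<close>

definition rats :: "'x form => real list set" where
 "rats l = {a. length a = length l \<and> set a \<subseteq> \<rat>}"

lemma countable_rats: "countable (rats l)"
 by (rule countable_subset[of _ "lists \<rat>"]) (auto simp: rats_def countable_rat intro: countable_lists)

lemma rats_simps:
 "rats [] = {[]}" "r # a \<in> rats (p # l) \<longleftrightarrow> r \<in> \<rat> \<and> a \<in> rats l"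
 "a \<in> rats l ==> b \<in> rats l' ==> a @ b \<in> rats (l @ l')"
 by (auto simp: rats_def)

definition lc :: "real list => 'x form => 'x => real" where
 "lc a l y = (\<Sum>(c, (g, f))\<leftarrow>zip a l. c * f y)"

text \<open>In a module with a differential \<open>d\<close> this bounds the pointwise norm of the
  difference between the coded sum and \<open>d (lc a l)\<close>.\<close>

definition err :: "real list => 'x form => 'x => real" where
 "err a l x = (\<Sum>(c, (g, f))\<leftarrow>zip a l. \<bar>c - g x\<bar> * W f x)"

text \<open>By the triangle inequality \<open>W (lc a l) x + err a l x\<close> has to bound the norm
  of the coded sum at \<open>x\<close>, and the bound becomes sharp as \<open>a\<close> approaches
  the values of the coefficients. \<open>max 0\<close> keeps the infimum bounded below also on null
  sets.\<close>

definition fnorm :: "'x form => 'x => real" where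
 "fnorm l x = (INF a\<in>rats l. max 0 (W (lc a l) x + err a l x))"

text \<open>The total coefficient of \<open>f\<close> at \<open>x\<close>. Up to null sets
  \<open>fnorm\<close> sees a form only through these numbers, so they serve to compare different
  codings of one formal sum.\<close>

definition coef :: "'x form => 'x => ('x => real) => real" where
 "coef l x f = (\<Sum>(g, f')\<leftarrow>l. if f' = f then g x else 0)"

definition scale :: "('x => real) => 'x form => 'x form" where
 "scale \<phi> l = map (\<lambda>(g, f). (\<lambda>x. \<phi> x * g x, f)) l"

lemma lc_Nil: "lc a [] = (\<lambda>_. 0)" and lc_Cons: "lc (c # a) ((g, f) # l) = (\<lambda>y. c * f y + lc a l y)"
 by (auto simp: lc_def)

lemma err_Nil: "err a [] x = 0" and err_Cons: "err (c # a) ((g, f) # l) x = \<bar>c - g x\<bar> * W f x + err a l x"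
 by (auto simp: err_def)

lemma lc_append: "length a = length l ==> lc (a @ b) (l @ l') = (\<lambda>y. lc a l y + lc b l' y)"
 by (simp add: lc_def fun_eq_iff)

lemma err_append: "length a = length l ==> err (a @ b) (l @ l') x = err a l x + err b l' x"
 by (simp add: err_def)

lemma coef_append [simp]: "coef (l @ l') x f = coef l x f + coef l' x f"
 by (simp add: coef_def)

lemma coef_Nil [simp]: "coef [] x f = 0"
 by (simp add: coef_def)

lemma coef_scale [simp]: "coef (scale \<phi> l) x f = \<phi> x * coef l x f"
 unfolding coef_def scale_def by (induction l) (auto simp: distrib_left)

lemma scale_forms [simp]: "\<phi> \<in> borel_fun ==> l \<in> forms ==> scale \<phi> l \<in> forms"
 by (induction l) (auto simp: scale_def)

lemma length_scale [simp]: "length (scale \<phi> l) = length l"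
 by (simp add: scale_def)

lemma lc_U: "l \<in> forms ==> lc a l \<in> U"
proof (induction l arbitrary: a)
 case Nil then show ?case by (simp add: lc_Nil U_zero)
next
 case (Cons p l)
 obtain g f where p: "p = (g, f)" by (cases p)
 show ?case
 proof (cases a)
  case Nil then show ?thesis by (simp add: lc_def U_zero)
 next
  case (Cons c a')
  have "(\<lambda>y. c * f y + 1 * lc a' l y) \<in> U" using Cons.IH[of a'] Cons.prems p by (intro U_lincomb) auto
  then show ?thesis by (simp add: Cons p lc_Cons)
 qed
qed

lemma AE_W_forms: "l \<in> forms ==> AE x in m. \<forall>p\<in>set l. 0 <= W (snd p) x"
proof (induction l)
 case (Cons p l)
 obtain g f where p: "p = (g, f)" by (cases p)
 have "AE x in m. 0 <= W f x" "AE x in m. \<forall>p\<in>set l. 0 <= W (snd p) x" using Cons p W_nonneg by auto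
 then show ?case by eventually_elim (simp add: p)
qed simp

lemma err_nonneg: "\<forall>p\<in>set l. 0 <= W (snd p) x ==> 0 <= err a l x"
 unfolding err_def by (rule sum_list_nonneg) (auto dest!: set_zip_rightD)

text \<open>The difference of the two combinations has coefficients \<open>a - b\<close>, and each
  of these is bounded by the sum of the distances of its two terms from the value of the coefficient
  function.\<close>

lemma W_lc_diff:
 assumes l: "l \<in> forms"
 shows "AE x in m. \<forall>a\<in>rats l. \<forall>b\<in>rats l. W (lc a l) x <= W (lc b l) x + (err a l x + err b l x)"
 using l
proof (induction l)
 case Nil then show ?case by (simp add: rats_simps lc_Nil err_Nil)
next
 case (Cons p l)
 obtain g f where p: "p = (g, f)" by (cases p)
 have f: "f \<in> U" and l: "l \<in> forms" using Cons.prems p by auto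
 have gen: "AE x in m. \<forall>k\<in>{k. length k = length l}. True" by simp
 have key: "AE x in m. W (lc a (p # l)) x <= W (lc b (p # l)) x + (err a (p # l) x + err b (p # l) x)"
  if a: "a \<in> rats (p # l)" and b: "b \<in> rats (p # l)" for a b
 proof -
  define d where "d = map (\<lambda>(x, y). x - y) (zip a b)"
  have "!!l'. l' \<in> forms ==> length a = length l' ==> length b = length l' ==>
   (lc a l' = (\<lambda>y. lc b l' y + lc (map (\<lambda>(x, y). x - y) (zip a b)) l' y)) \<and>
   (AE x in m. W (lc (map (\<lambda>(x, y). x - y) (zip a b)) l') x <= err a l' x + err b l' x)"
  proof (induction a arbitrary: b)
   case Nil then show ?case by (auto simp: lc_Nil err_Nil W_zero[THEN AE_mp] intro: eventually_mono[OF W_zero])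
  next
   case (Cons a0 a)
   obtain b0 b' where b: "b = b0 # b'" using Cons.prems by (cases b) auto
   obtain g f l'' where l': "l' = (g, f) # l''" using Cons.prems by (cases l') auto
   have l'': "l'' \<in> forms" "f \<in> U" "length a = length l''" "length b' = length l''" using Cons.prems l' b by auto
   note IH = Cons.IH[OF l''(1,3,4)]
   let ?d = "map (\<lambda>(x, y). x - y) (zip a b')"
   have 1: "lc (a0 # a) l' = (\<lambda>y. lc b l' y + lc (map (\<lambda>(x, y). x - y) (zip (a0 # a) b)) l' y)"
    unfolding b l' using conjunct1[OF IH] by (simp add: lc_Cons algebra_simps)
   have "AE x in m. W (\<lambda>y. (a0 - b0) * f y + 1 * lc ?d l'' y) x <= \<bar>a0 - b0\<bar> * W f x + \<bar>1\<bar> * W (lc ?d l'') x"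
    by (rule W_lincomb[OF l''(2) lc_U[OF l''(1)]])
   with conjunct2[OF IH] W_nonneg[OF l''(2)]
   have "AE x in m. W (lc (map (\<lambda>(x, y). x - y) (zip (a0 # a) b)) l') x <= err (a0 # a) l' x + err b l' x"
   proof eventually_elim
    case (elim x)
    have "\<bar>a0 - b0\<bar> * W f x <= (\<bar>a0 - g x\<bar> + \<bar>b0 - g x\<bar>) * W f x" using elim by (intro mult_right_mono) auto
    then show ?case using elim unfolding b l' by (simp add: lc_Cons err_Cons algebra_simps)
   qed
   with 1 show ?case by blast
  qed
  from this[of "p # l"] have H: "lc a (p # l) = (\<lambda>y. lc b (p # l) y + lc d (p # l) y)"
   "AE x in m. W (lc d (p # l)) x <= err a (p # l) x + err b (p # l) x"
   using Cons.prems a b unfolding d_def by (auto simp: rats_def)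
  from W_add[OF lc_U[OF Cons.prems] lc_U[OF Cons.prems], of b d] H(2)
  show ?thesis unfolding H(1)[symmetric] by eventually_elim simp
 qed
 show ?case unfolding AE_ball_countable[OF countable_rats] using key by blast
qed

lemma err_small:
 assumes "\<forall>p\<in>set l. 0 <= W (snd p) x" "0 < e"
 shows "\<exists>a\<in>rats l. err a l x < e"
 using assms
proof (induction l arbitrary: e)
 case Nil then show ?case by (simp add: rats_simps err_Nil)
next
 case (Cons p l)
 obtain g f where p: "p = (g, f)" by (cases p)
 obtain a where a: "a \<in> rats l" "err a l x < e / 2" using Cons.IH[of "e / 2"] Cons.prems by auto
 have Wf: "0 <= W f x" using Cons.prems p by simp
 \<comment> \<open>The summand 1 avoids division by zero where \<open>W f x\<close>
   vanishes.\<close>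
 define d where "d = e / 2 / (1 + W f x)"
 have d: "0 < d" using Wf Cons.prems by (simp add: d_def)
 obtain c where c: "c \<in> \<rat>" "g x - d < c" "c < g x + d" using Rats_dense_in_real[of "g x - d" "g x + d"] d by auto
 have "\<bar>c - g x\<bar> * W f x <= d * (1 + W f x)" using c Wf by (intro mult_mono) auto
 also have "... = e / 2"
  using d_def Wf nonzero_eq_divide_eq[of "1 + W f x" d "e / 2"] by linarith
 finally have "err (c # a) (p # l) x < e" using a by (simp add: p err_Cons)
 then show ?case using a c by (intro bexI[of _ "c # a"]) (auto simp: rats_simps)
qed

text \<open>Collects the countably many almost everywhere inequalities once; afterwards the
  arguments are pointwise.\<close>

definition good :: "'x form => 'x => bool" where
 "good l x \<longleftrightarrow> (\<forall>p\<in>set l. 0 <= W (snd p) x) \<and> (\<forall>a\<in>rats l. 0 <= W (lc a l) x) \<and>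
  (\<forall>a\<in>rats l. \<forall>b\<in>rats l. W (lc a l) x <= W (lc b l) x + (err a l x + err b l x))"

lemma AE_good: "l \<in> forms ==> AE x in m. good l x"
proof -
 assume l: "l \<in> forms"
 have "AE x in m. \<forall>a\<in>rats l. 0 <= W (lc a l) x"
  unfolding AE_ball_countable[OF countable_rats] using W_nonneg lc_U[OF l] by blast
 with AE_W_forms[OF l] W_lc_diff[OF l] show ?thesis by eventually_elim (simp add: good_def)
qed

text \<open>The upper estimate is the infimum, the lower one compares \<open>a\<close> with every
  competitor \<open>b\<close>. Since \<open>err\<close> can be made small, this determines
  \<open>fnorm\<close> at good points.\<close>

lemma fnorm_near:
 assumes g: "good l x" and a: "a \<in> rats l"
 shows "\<bar>fnorm l x - W (lc a l) x\<bar> <= err a l x"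
proof -
 have e: "0 <= err b l x" for b using g by (intro err_nonneg) (simp add: good_def)
 have bdd: "bdd_below ((\<lambda>a. max 0 (W (lc a l) x + err a l x)) ` rats l)"
  by (rule bdd_belowI[of _ 0]) auto
 have mx: "max 0 (W (lc b l) x + err b l x) = W (lc b l) x + err b l x" if "b \<in> rats l" for b
  using g e[of b] that by (simp add: good_def)
 have "fnorm l x <= max 0 (W (lc a l) x + err a l x)" unfolding fnorm_def by (rule cINF_lower[OF bdd a])
 then have "fnorm l x <= W (lc a l) x + err a l x" unfolding mx[OF a] .
 moreover have "W (lc a l) x - err a l x <= fnorm l x"
  unfolding fnorm_def
 proof (rule cINF_greatest)
  show "rats l \<noteq> {}" using a by blast
  fix b assume b: "b \<in> rats l"
  then have "W (lc a l) x <= W (lc b l) x + (err a l x + err b l x)" using g a unfolding good_def by blast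
  then show "W (lc a l) x - err a l x <= max 0 (W (lc b l) x + err b l x)" unfolding mx[OF b] by linarith
 qed
 ultimately show ?thesis by linarith
qed

text \<open>Whatever is approximated like \<open>fnorm\<close> equals it, because
  \<open>err a l x\<close> can be made arbitrarily small. This is how the norm in an arbitrary
  module is identified.\<close>

lemma fnorm_eqI:
 assumes g: "good l x" and K: "!!a. a \<in> rats l ==> \<bar>c - W (lc a l) x\<bar> <= K * err a l x"
 shows "fnorm l x = c"
proof (rule ccontr)
 assume "fnorm l x \<noteq> c"
 then have pos: "0 < \<bar>fnorm l x - c\<bar> / (1 + \<bar>K\<bar>)" by simp
 obtain a where a: "a \<in> rats l" "err a l x < \<bar>fnorm l x - c\<bar> / (1 + \<bar>K\<bar>)"
  using err_small[OF _ pos, of l x] g by (auto simp: good_def)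
 have e: "0 <= err a l x" using g by (intro err_nonneg) (simp add: good_def)
 have "K * err a l x <= \<bar>K\<bar> * err a l x" using e by (intro mult_right_mono) auto
 then have "\<bar>fnorm l x - c\<bar> <= (1 + \<bar>K\<bar>) * err a l x"
  using fnorm_near[OF g a(1)] K[OF a(1)] by (simp add: distrib_right)
 then show False using a(2) by (simp add: field_simps)
qed

lemma fnorm_measurable:
 assumes l: "l \<in> forms"
 shows "fnorm l \<in> borel_fun"
proof -
 have e: "err a l \<in> borel_fun" for a
  using l
 proof (induction l arbitrary: a)
  case Nil then show ?case by (simp add: err_def[abs_def])
 next
  case (Cons p l)
  obtain g f where p: "p = (g, f)" by (cases p)
  show ?case
  proof (cases a)
   case Nil then show ?thesis by (simp add: err_def[abs_def])
  next
   case (Cons c a')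
   note [measurable] = Cons.IH[of a']
   have [measurable]: "g \<in> borel_fun" "W f \<in> borel_fun" "err a' l \<in> borel_fun"
    using Cons.prems p W_measurable Cons.IH by auto
   have "err a (p # l) = (\<lambda>x. \<bar>c - g x\<bar> * W f x + err a' l x)" by (simp add: Cons p err_Cons fun_eq_iff)
   then show ?thesis by simp
  qed
 qed
 have [measurable]: "W (lc a l) \<in> borel_fun" for a by (rule W_measurable[OF lc_U[OF l]])
 note [measurable] = e
 show ?thesis
  unfolding fnorm_def[abs_def]
 proof (rule borel_measurable_cINF[OF countable_rats])
  show "(\<lambda>x. max 0 (W (lc a l) x + err a l x)) \<in> borel_fun" for a by measurable
  show "bdd_below ((\<lambda>a. max 0 (W (lc a l) x + err a l x)) ` rats l)" for x
   by (rule bdd_belowI[of _ 0]) auto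
 qed
qed

lemma fnorm_nonneg: "0 <= fnorm l x"
proof -
 have "replicate (length l) 0 \<in> rats l" by (auto simp: rats_def)
 then show ?thesis unfolding fnorm_def by (intro cINF_greatest) auto
qed

section \<open>Independence of the coding and compatibility with the operations\<close>

text \<open>If the coefficients of each function cancel at \<open>x\<close>, the constants attached
  to that function sum to the sum of their deviations \<open>c - g x\<close>. Regrouping by function
  before applying the seminorm inequality therefore gives the bound \<open>err\<close>.\<close>

lemma err_bound_coef:
 assumes l: "l \<in> forms"
 shows "AE x in m. (\<forall>f. coef l x f = 0) --> (\<forall>a\<in>rats l. W (lc a l) x <= err a l x)"
proof -
 define S where "S = set (map snd l)"
 have S: "finite S" "S \<subseteq> U" using l by (auto simp: S_def forms_def)
 define q where "q a = map (\<lambda>(c, (g, f)). (c, f)) (zip a l)" for a :: "real list"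
 have qS: "snd ` set (q a) \<subseteq> S" for a by (auto simp: q_def S_def dest!: set_zip_rightD) force
 \<comment> \<open>The merged constant in front of \<open>f\<close> after regrouping.\<close>
 define ms where "ms a f = (\<Sum>(c, f')\<leftarrow>q a. if f' = f then c else 0)" for a f
 have ms: "ms a f = (\<Sum>(c, (g, f'))\<leftarrow>zip a l. if f' = f then c else 0)" for a f
  unfolding ms_def q_def by (induction a l rule: list_induct2') auto
 have lc: "lc a l = (\<lambda>y. \<Sum>f\<in>S. ms a f * f y)" for a
 proof
  fix y
  have "lc a l y = (\<Sum>(c, f)\<leftarrow>q a. c * f y)"
   by (simp add: lc_def q_def comp_def case_prod_unfold)
  also have "... = (\<Sum>f\<in>S. ms a f * f y)"
   unfolding ms_def by (rule sum_list_regroup[OF S(1) qS, of "\<lambda>f. f y"])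
  finally show "lc a l y = (\<Sum>f\<in>S. ms a f * f y)" .
 qed
 have "AE x in m. \<forall>a\<in>rats l. W (lc a l) x <= (\<Sum>f\<in>S. \<bar>ms a f\<bar> * W f x)"
  unfolding AE_ball_countable[OF countable_rats] lc using W_sum[OF S] by blast
 with AE_W_forms[OF l] show ?thesis
 proof eventually_elim
  case (elim x)
  show ?case
  proof (intro impI ballI)
   fix a assume c0: "\<forall>f. coef l x f = 0" and a: "a \<in> rats l"
   have len: "length a = length l" using a by (simp add: rats_def)
   define e where "e f = (\<Sum>(c, (g, f'))\<leftarrow>zip a l. if f' = f then \<bar>c - g x\<bar> else 0)" for f
   have ms_le: "\<bar>ms a f\<bar> <= e f" for f
   proof -
    have "\<bar>(\<Sum>(c, (g, f'))\<leftarrow>zip a l. if f' = f then c else 0) - coef l x f\<bar> <= (\<Sum>(c, (g, f'))\<leftarrow>zip a l. if f' = f then \<bar>c - g x\<bar> else 0)"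
     using len by (induction a l rule: list_induct2) (auto simp: coef_def)
    then show ?thesis using c0 by (simp add: ms e_def)
   qed
   have "W (lc a l) x <= (\<Sum>f\<in>S. \<bar>ms a f\<bar> * W f x)" using elim(2) a by blast
   also have "... <= (\<Sum>f\<in>S. e f * W f x)"
    using ms_le elim(1) by (intro sum_mono mult_right_mono) (auto simp: S_def)
   also have "... = err a l x"
   proof -
    let ?q = "map (\<lambda>(c, (g, f)). (\<bar>c - g x\<bar>, f)) (zip a l)"
    have "snd ` set ?q \<subseteq> S" by (auto simp: S_def dest!: set_zip_rightD) force
    note sum_list_regroup[OF S(1) this, of "\<lambda>f. W f x"]
    moreover have "e f = (\<Sum>(c, f')\<leftarrow>?q. if f' = f then c else 0)" for f
     unfolding e_def by (induction a l rule: list_induct2') auto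
    moreover have "err a l x = (\<Sum>(c, f)\<leftarrow>?q. c * W f x)"
     unfolding err_def by (induction a l rule: list_induct2') auto
    ultimately show ?thesis by simp
   qed
   finally show "W (lc a l) x <= err a l x" .
  qed
 qed
qed

text \<open>Appending the negative of \<open>l'\<close> to \<open>l\<close> gives a form with
  vanishing coefficients, whose constant combinations have seminorm at most \<open>err\<close>. This
  bounds the difference between the seminorms of \<open>lc a l\<close> and \<open>lc b l'\<close>,
  which approximate the two norms.\<close>

lemma fnorm_cong:
 assumes l: "l \<in> forms" and l': "l' \<in> forms"
  and eq: "AE x in m. \<forall>f. coef l x f = coef l' x f"
 shows "AE x in m. fnorm l x = fnorm l' x"
proof -
 define n where "n = scale (\<lambda>_. -1) l'"
 have n: "n \<in> forms" using l' by (simp add: n_def)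
 have ln: "l @ n \<in> forms" using l n by simp
 have le: "AE x in m. \<forall>a\<in>rats l. \<forall>b\<in>rats l'. W (lc b l') x = W (lc (map uminus b) n) x \<and> err (map uminus b) n x = err b l' x
  \<and> W (lc a l) x <= W (lc (a @ map uminus b) (l @ n)) x + W (lc b l') x
  \<and> W (lc b l') x <= W (lc (a @ map uminus b) (l @ n)) x + W (lc a l) x"
  unfolding AE_ball_countable[OF countable_rats]
 proof (intro ballI)
  fix a b assume a: "a \<in> rats l" and b: "b \<in> rats l'"
  have len: "length a = length l" "length b = length l'" using a b by (auto simp: rats_def)
  have neg: "lc (map uminus b) n = (\<lambda>y. -1 * lc b l' y)"
   unfolding n_def using len(2)
   by (induction b l' rule: list_induct2) (auto simp: lc_Nil lc_Cons scale_def fun_eq_iff)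
  have er: "err (map uminus b) n x = err b l' x" for x
   unfolding n_def using len(2)
   by (induction b l' rule: list_induct2) (auto simp: err_Nil err_Cons scale_def fun_eq_iff abs_minus_commute)
  have ap: "lc (a @ map uminus b) (l @ n) = (\<lambda>y. lc a l y + -1 * lc b l' y)"
   using len by (simp add: lc_append neg)
  let ?d = "\<lambda>y. lc a l y + -1 * lc b l' y"
  have d: "?d \<in> U" using U_lincomb[OF lc_U[OF l] lc_U[OF l'], of 1 a "-1" b] by simp
  have e1: "(\<lambda>y. ?d y + lc b l' y) = lc a l" and e2: "(\<lambda>y. -1 * ?d y + 1 * lc a l y) = lc b l'" by (auto simp: fun_eq_iff)
  show "AE x in m. W (lc b l') x = W (lc (map uminus b) n) x \<and> err (map uminus b) n x = err b l' x
  \<and> W (lc a l) x <= W (lc (a @ map uminus b) (l @ n)) x + W (lc b l') x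
  \<and> W (lc b l') x <= W (lc (a @ map uminus b) (l @ n)) x + W (lc a l) x"
   using W_add[OF d lc_U[OF l'], of b] W_lincomb[OF d lc_U[OF l], of "-1" 1 a] W_scale[OF lc_U[OF l'], of "-1" b]
   unfolding e1 e2 ap neg er by eventually_elim simp
 qed
 from le eq AE_good[OF l] AE_good[OF l'] err_bound_coef[OF ln] AE_good[OF ln] show ?thesis
 proof eventually_elim
  case (elim x)
  have c0: "\<forall>f. coef (l @ n) x f = 0" using elim(2) by (simp add: n_def)
  have pos: "0 <= err a l x" "0 <= err b l' x" for a b
   using elim(3,4) by (auto intro: err_nonneg simp: good_def)
  show ?case
  proof (rule ccontr)
   assume "fnorm l x \<noteq> fnorm l' x"
   then have p: "0 < \<bar>fnorm l x - fnorm l' x\<bar> / 4" by simp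
   obtain a where a: "a \<in> rats l" "err a l x < \<bar>fnorm l x - fnorm l' x\<bar> / 4"
    using err_small[OF _ p, of l x] elim(3) by (auto simp: good_def)
   obtain b where b: "b \<in> rats l'" "err b l' x < \<bar>fnorm l x - fnorm l' x\<bar> / 4"
    using err_small[OF _ p, of l' x] elim(4) by (auto simp: good_def)
   have len: "length a = length l" "length b = length l'" using a b by (auto simp: rats_def)
   have E: "W (lc b l') x = W (lc (map uminus b) n) x" "err (map uminus b) n x = err b l' x"
    "W (lc a l) x <= W (lc (a @ map uminus b) (l @ n)) x + W (lc b l') x"
    "W (lc b l') x <= W (lc (a @ map uminus b) (l @ n)) x + W (lc a l) x"
    using elim(1) a(1) b(1) by blast+
   have "map uminus b \<in> rats n" using b(1) by (auto simp: rats_def n_def)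
   then have "a @ map uminus b \<in> rats (l @ n)" by (rule rats_simps(3)[OF a(1)])
   then have "W (lc (a @ map uminus b) (l @ n)) x <= err (a @ map uminus b) (l @ n) x" using elim(5) c0 by blast
   also have "... = err a l x + err b l' x" using err_append[OF len(1)] E(2) by simp
   finally have "\<bar>W (lc a l) x - W (lc b l') x\<bar> <= err a l x + err b l' x" using E(3,4) by linarith
   then show False using fnorm_near[OF elim(3) a(1)] fnorm_near[OF elim(4) b(1)] a(2) b(2)
    by argo
  qed
 qed
qed

text \<open>Concatenated tuples approximate the concatenated form, and errors add; subadditivity of
  \<open>W\<close> does the rest.\<close>

lemma fnorm_append:
 assumes l: "l \<in> forms" and l': "l' \<in> forms"
 shows "AE x in m. fnorm (l @ l') x <= fnorm l x + fnorm l' x"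
proof -
 have ll: "l @ l' \<in> forms" using l l' by simp
 have "AE x in m. \<forall>a\<in>rats l. \<forall>b\<in>rats l'. W (lc (a @ b) (l @ l')) x <= W (lc a l) x + W (lc b l') x"
  unfolding AE_ball_countable[OF countable_rats]
 proof (intro ballI)
  fix a b assume "a \<in> rats l" "b \<in> rats l'"
  then have "lc (a @ b) (l @ l') = (\<lambda>y. lc a l y + lc b l' y)" by (simp add: lc_append rats_def)
  then show "AE x in m. W (lc (a @ b) (l @ l')) x <= W (lc a l) x + W (lc b l') x"
   using W_add[OF lc_U[OF l] lc_U[OF l'], of a b] by simp
 qed
 with AE_good[OF l] AE_good[OF l'] AE_good[OF ll] show ?thesis
 proof eventually_elim
  case (elim x)
  show ?case
  proof (rule ccontr)
   assume "\<not> ?thesis"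
   then have p: "0 < (fnorm (l @ l') x - (fnorm l x + fnorm l' x)) / 4" by simp
   obtain a where a: "a \<in> rats l" "err a l x < (fnorm (l @ l') x - (fnorm l x + fnorm l' x)) / 4"
    using err_small[OF _ p, of l x] elim(1) by (auto simp: good_def)
   obtain b where b: "b \<in> rats l'" "err b l' x < (fnorm (l @ l') x - (fnorm l x + fnorm l' x)) / 4"
    using err_small[OF _ p, of l' x] elim(2) by (auto simp: good_def)
   have "err (a @ b) (l @ l') x = err a l x + err b l' x" using a(1) by (simp add: err_append rats_def)
   moreover have "W (lc (a @ b) (l @ l')) x <= W (lc a l) x + W (lc b l') x" using elim(4) a(1) b(1) by blast
   ultimately show False
    using fnorm_near[OF elim(1) a(1)] fnorm_near[OF elim(2) b(1)] fnorm_near[OF elim(3) rats_simps(3)[OF a(1) b(1)]] a(2) b(2)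
    by argo
  qed
 qed
qed

text \<open>Two approximations are nested: a tuple \<open>a\<close> for the coefficients of
  \<open>l\<close> and a rational \<open>r\<close> for \<open>\<phi> x\<close>. Their product
  approximates the coefficients of the scaled form.\<close>

lemma fnorm_scale:
 assumes l: "l \<in> forms" and \<phi>: "\<phi> \<in> borel_fun"
 shows "AE x in m. fnorm (scale \<phi> l) x = \<bar>\<phi> x\<bar> * fnorm l x"
proof -
 have sl: "scale \<phi> l \<in> forms" using l \<phi> by simp
 have "AE x in m. \<forall>a\<in>rats l. \<forall>r\<in>\<rat>. W (lc (map (times r) a) (scale \<phi> l)) x = \<bar>r\<bar> * W (lc a l) x"
  unfolding AE_ball_countable[OF countable_rats] AE_ball_countable[OF countable_rat]
 proof (intro ballI)
  fix a r assume "a \<in> rats l"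
  then have "length a = length l" by (simp add: rats_def)
  then have "lc (map (times r) a) (scale \<phi> l) = (\<lambda>y. r * lc a l y)"
   by (induction a l rule: list_induct2) (auto simp: lc_Nil lc_Cons scale_def fun_eq_iff distrib_left)
  then show "AE x in m. W (lc (map (times r) a) (scale \<phi> l)) x = \<bar>r\<bar> * W (lc a l) x"
   using W_scale[OF lc_U[OF l], of r a] by simp
 qed
 with AE_good[OF l] AE_good[OF sl] AE_W_forms[OF l] show ?thesis
 proof eventually_elim
  case (elim x)
  define F where "F a = (\<Sum>(c, (g, f))\<leftarrow>zip a l. \<bar>c\<bar> * W f x)" for a :: "real list"
  have er: "err (map (times r) a) (scale \<phi> l) x <= \<bar>\<phi> x\<bar> * err a l x + \<bar>r - \<phi> x\<bar> * F a" if "a \<in> rats l" for a r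
  proof -
   have "length a = length l" using that by (simp add: rats_def)
   then show ?thesis using elim(3) unfolding F_def
   proof (induction a l rule: list_induct2)
    case (Cons c a p l)
    obtain g f where p: "p = (g, f)" by (cases p)
    have Wf: "0 <= W f x" using Cons.prems p by simp
    have "r * c - \<phi> x * g x = \<phi> x * (c - g x) + (r - \<phi> x) * c" by (simp add: algebra_simps)
    then have "\<bar>r * c - \<phi> x * g x\<bar> <= \<bar>\<phi> x\<bar> * \<bar>c - g x\<bar> + \<bar>r - \<phi> x\<bar> * \<bar>c\<bar>"
     by (metis abs_mult abs_triangle_ineq)
    then have "\<bar>r * c - \<phi> x * g x\<bar> * W f x <= (\<bar>\<phi> x\<bar> * \<bar>c - g x\<bar> + \<bar>r - \<phi> x\<bar> * \<bar>c\<bar>) * W f x"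
     using Wf by (rule mult_right_mono)
    then show ?case using Cons.IH Cons.prems
     by (simp add: p scale_def err_Cons algebra_simps)
   qed (simp add: scale_def err_Nil)
  qed
  show ?case
  proof (rule ccontr)
   assume "\<not> ?thesis"
   then have p: "0 < \<bar>fnorm (scale \<phi> l) x - \<bar>\<phi> x\<bar> * fnorm l x\<bar>" (is "0 < ?D") by simp
   have p': "0 < ?D / 4 / (1 + \<bar>\<phi> x\<bar>)" using p by simp
   obtain a where a: "a \<in> rats l" "err a l x < ?D / 4 / (1 + \<bar>\<phi> x\<bar>)"
    using err_small[OF elim(3) p'] by blast
   have e0: "0 <= err a l x" using elim(3) by (rule err_nonneg)
   have F0: "0 <= F a" unfolding F_def by (rule sum_list_nonneg) (use elim(3) in \<open>auto dest!: set_zip_rightD\<close>)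
   have w0: "0 <= W (lc a l) x" using elim(1) a(1) by (simp add: good_def)
   have ea: "\<bar>\<phi> x\<bar> * err a l x < ?D / 4"
   proof -
    have "(1 + \<bar>\<phi> x\<bar>) * err a l x < ?D / 4" using a(2) by (simp add: field_simps)
    then show ?thesis using e0 by (simp add: distrib_right)
   qed
   \<comment> \<open>The precision of \<open>r\<close> is fixed after \<open>a\<close>, because its
     error gets multiplied by \<open>F a\<close> and by \<open>W (lc a l) x\<close>.\<close>
   define d where "d = ?D / 4 / (1 + F a + W (lc a l) x)"
   have d: "0 < d" using p F0 w0 by (simp add: d_def)
   obtain r where r: "r \<in> \<rat>" "\<phi> x - d < r" "r < \<phi> x + d" using Rats_dense_in_real[of "\<phi> x - d" "\<phi> x + d"] d by auto
   have rd: "\<bar>r - \<phi> x\<bar> * (F a + W (lc a l) x) <= ?D / 4"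
   proof -
    have "\<bar>r - \<phi> x\<bar> * (F a + W (lc a l) x) <= d * (1 + F a + W (lc a l) x)"
     using r F0 w0 by (intro mult_mono) auto
    also have "... = ?D / 4"
     using d_def F0 w0 nonzero_eq_divide_eq[of "1 + F a + W (lc a l) x" d "?D / 4"] by linarith
    finally show ?thesis .
   qed
   have mem: "map (times r) a \<in> rats (scale \<phi> l)" using a(1) r(1) by (auto simp: rats_def)
   have W1: "W (lc (map (times r) a) (scale \<phi> l)) x = \<bar>r\<bar> * W (lc a l) x" using elim(4) a(1) r(1) by blast
   have "\<bar>\<bar>r\<bar> - \<bar>\<phi> x\<bar>\<bar> * W (lc a l) x <= \<bar>r - \<phi> x\<bar> * W (lc a l) x" using w0 by (intro mult_right_mono) auto
   then have 1: "\<bar>\<bar>r\<bar> * W (lc a l) x - \<bar>\<phi> x\<bar> * W (lc a l) x\<bar> <= \<bar>r - \<phi> x\<bar> * W (lc a l) x"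
    using w0 by (metis abs_mult abs_of_nonneg left_diff_distrib)
   have "\<bar>\<phi> x\<bar> * \<bar>fnorm l x - W (lc a l) x\<bar> <= \<bar>\<phi> x\<bar> * err a l x"
    using fnorm_near[OF elim(1) a(1)] by (intro mult_left_mono) auto
   then have 2: "\<bar>\<bar>\<phi> x\<bar> * W (lc a l) x - \<bar>\<phi> x\<bar> * fnorm l x\<bar> <= \<bar>\<phi> x\<bar> * err a l x"
    by (metis abs_abs abs_minus_commute abs_mult right_diff_distrib)
   have 3: "\<bar>fnorm (scale \<phi> l) x - \<bar>r\<bar> * W (lc a l) x\<bar> <= \<bar>\<phi> x\<bar> * err a l x + \<bar>r - \<phi> x\<bar> * F a"
    using fnorm_near[OF elim(2) mem] er[OF a(1), of r] W1 by linarith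
   have "\<bar>r - \<phi> x\<bar> * F a + \<bar>r - \<phi> x\<bar> * W (lc a l) x <= ?D / 4" using rd by (simp add: distrib_left)
   then show False
    using abs_chain_contradiction[of "\<bar>r - \<phi> x\<bar> * F a" "\<bar>r - \<phi> x\<bar> * W (lc a l) x", OF _ 1 2 3 ea refl p] by blast
  qed
 qed
qed

lemma fnorm_single:
 assumes f: "f \<in> U"
 shows "AE x in m. fnorm [(\<lambda>_. 1, f)] x = W f x"
proof -
 have l: "[(\<lambda>_. 1, f)] \<in> forms" using f by simp
 \<comment> \<open>For the exact coefficient 1 the error vanishes.\<close>
 have "[1] \<in> rats [(\<lambda>_. 1 :: real, f)]" by (auto simp: rats_def)
 from fnorm_near[OF _ this] AE_good[OF l] show ?thesis
  by (auto simp: lc_Cons lc_Nil err_Cons err_Nil elim!: eventually_mono)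
qed

lemma fnorm_Nil: "AE x in m. fnorm [] x = 0"
 using AE_good[of "[]"] fnorm_near[of "[]" _ "[]"] W_zero
 by (auto simp: rats_simps lc_Nil err_Nil elim!: eventually_elim2)

lemma fnorm_null:
 assumes l: "l \<in> forms" and c: "AE x in m. \<forall>f. coef l x f = 0"
 shows "AE x in m. fnorm l x = 0"
proof -
 have "AE x in m. fnorm l x = fnorm [] x" by (rule fnorm_cong[OF l]) (use c in simp_all)
 with fnorm_Nil show ?thesis by eventually_elim simp
qed

text \<open>Linearity of the formal differential. The three functions are distinct in general, so no
  coefficients cancel; the norm is computed from \<open>lc [1, r, s]\<close> with rational
  \<open>r\<close> and \<open>s\<close> close to \<open>-a\<close> and \<open>-b\<close>.\<close>

lemma fnorm_lincomb:
 assumes f: "f \<in> U" and g: "g \<in> U"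
 shows "AE x in m. fnorm [(\<lambda>_. 1, \<lambda>x. a * f x + b * g x), (\<lambda>_. -a, f), (\<lambda>_. -b, g)] x = 0"
proof -
 let ?h = "\<lambda>x. a * f x + b * g x"
 let ?l = "[(\<lambda>_. 1, ?h), (\<lambda>_. -a, f), (\<lambda>_. -b, g)]"
 have h: "?h \<in> U" by (rule U_lincomb[OF f g])
 have l: "?l \<in> forms" using f g h by simp
 have "AE x in m. \<forall>r\<in>\<rat>. \<forall>s\<in>\<rat>. W (lc [1, r, s] ?l) x <= \<bar>a + r\<bar> * W f x + \<bar>b + s\<bar> * W g x"
  unfolding AE_ball_countable[OF countable_rat]
 proof (intro ballI)
  fix r s
  have "lc [1, r, s] ?l = (\<lambda>x. (a + r) * f x + (b + s) * g x)" by (auto simp: lc_def fun_eq_iff algebra_simps)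
  then show "AE x in m. W (lc [1, r, s] ?l) x <= \<bar>a + r\<bar> * W f x + \<bar>b + s\<bar> * W g x"
   using W_lincomb[OF f g, of "a + r" "b + s"] by simp
 qed
 with AE_good[OF l] W_nonneg[OF f] W_nonneg[OF g] show ?thesis
 proof eventually_elim
  case (elim x)
  show ?case
  proof (rule ccontr)
   assume "\<not> ?thesis"
   then have p: "0 < fnorm ?l x" using fnorm_nonneg[of ?l x] by simp
   define d where "d = fnorm ?l x / 4 / (1 + W f x + W g x)"
   have d: "0 < d" using p elim by (simp add: d_def)
   obtain r where r: "r \<in> \<rat>" "-a - d < r" "r < -a + d" using Rats_dense_in_real[of "-a - d" "-a + d"] d by auto
   obtain s where s: "s \<in> \<rat>" "-b - d < s" "s < -b + d" using Rats_dense_in_real[of "-b - d" "-b + d"] d by auto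
   have "[1, r, s] \<in> rats ?l" using r s by (auto simp: rats_def)
   from fnorm_near[OF elim(1) this] have "fnorm ?l x <= W (lc [1, r, s] ?l) x + (\<bar>r + a\<bar> * W f x + \<bar>s + b\<bar> * W g x)"
    by (simp add: err_def)
   also have "W (lc [1, r, s] ?l) x <= \<bar>a + r\<bar> * W f x + \<bar>b + s\<bar> * W g x" using elim(4) r s by blast
   finally have "fnorm ?l x <= 2 * (\<bar>a + r\<bar> * W f x + \<bar>b + s\<bar> * W g x)" by (simp add: algebra_simps)
   also have "... <= 2 * (d * W f x + d * W g x)" using r s elim by (intro mult_left_mono add_mono mult_right_mono) auto
   also have "... <= 2 * (d * (1 + W f x + W g x))" using d by (simp add: algebra_simps)
   also have "d * (1 + W f x + W g x) = fnorm ?l x / 4"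
    using d_def elim nonzero_eq_divide_eq[of "1 + W f x + W g x" d "fnorm ?l x / 4"] by linarith
   finally show False using p by simp
  qed
 qed
qed

end

section \<open>Uniqueness\<close>

context L0_module
begin

lemma smult_diff_class:
 assumes "g \<in> borel_fun" "h \<in> borel_fun" "v \<in> carrier M"
 shows "L0_class m g \<odot> v \<ominus> L0_class m h \<odot> v = L0_class m (\<lambda>x. g x - h x) \<odot> v"
proof -
 have "L0_class m (\<lambda>x. g x - h x) = L0_class m g \<oplus>\<^bsub>L0 m\<^esub> (\<ominus>\<^bsub>L0 m\<^esub> L0_class m h)"
  using assms by (simp add: L0_uminus_class)
 then show ?thesis using assms by (simp add: a_minus_def smult_l_distr smult_l_minus)
qed

lemma L0_combinations_closed:
 assumes V: "V \<subseteq> carrier M"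
 shows "L0_combinations m M V \<subseteq> carrier M"
proof
 fix s assume "s \<in> L0_combinations m M V"
 then obtain n :: nat and f v where s: "s = (\<Oplus>i\<in>{..<n}. f i \<odot> v i)"
  and fv: "f \<in> {..<n} \<rightarrow> carrier (L0 m)" "v \<in> {..<n} \<rightarrow> V" unfolding L0_combinations_def by blast
 show "s \<in> carrier M" unfolding s by (rule M.finsum_closed) (use fv V in \<open>auto intro!: smult_closed\<close>)
qed

lemma generates_iff:
 assumes V: "V \<subseteq> carrier M"
 shows "generates m m' M V \<longleftrightarrow> (\<forall>v\<in>carrier M. \<forall>eps>0. \<exists>s\<in>L0_combinations m M V. mod_dist m' M v s < eps)"
 unfolding generates_def using V mod_closure_iff[OF L0_combinations_closed[OF V]] by blast

lemma mod_dist_triangle: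
 "u \<in> carrier M ==> v \<in> carrier M ==> w \<in> carrier M ==> mod_dist m' M u w <= mod_dist m' M u v + mod_dist m' M v w"
 by (rule MS.triangle)

end

definition form_comb :: "'x measure => ('x, 'v) normed_module => (('x => real) => 'v) => 'x form => 'v" where
 "form_comb m M d l = foldr (\<lambda>(g, f) v. L0_class m g \<odot>\<^bsub>M\<^esub> d f \<oplus>\<^bsub>M\<^esub> v) l \<zero>\<^bsub>M\<^esub>"

lemma form_comb_simps:
 "form_comb m M d [] = \<zero>\<^bsub>M\<^esub>"
 "form_comb m M d ((g, f) # l) = L0_class m g \<odot>\<^bsub>M\<^esub> d f \<oplus>\<^bsub>M\<^esub> form_comb m M d l"
 by (simp_all add: form_comb_def)

section \<open>Formal sums inside a module with a differential\<close>

locale module_differential = seminormed_functions m m' U W + L0_module m m' M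
 for m m' :: "'x::polish_space measure" and U W and M :: "('x, 'v) normed_module" (structure) +
 fixes d :: "('x => real) => 'v"
 assumes d_closed: "!!f. f \<in> U ==> d f \<in> carrier M"
  and d_lincomb: "!!f g a b. f \<in> U ==> g \<in> U ==>
   d (\<lambda>x. a * f x + b * g x) = L0_class m (\<lambda>_. a) \<odot> d f \<oplus> L0_class m (\<lambda>_. b) \<odot> d g"
  and d_norm: "!!f. f \<in> U ==> pnorm M (d f) = L0_class m (W f)"
begin

abbreviation "comb \<equiv> form_comb m M d"

lemma comb_closed [simp]: "l \<in> forms ==> comb l \<in> carrier M"
 by (induction l) (auto simp: form_comb_simps d_closed)

lemma comb_append: "l \<in> forms ==> l' \<in> forms ==> comb (l @ l') = comb l \<oplus> comb l'"
 by (induction l) (auto simp: form_comb_simps d_closed M.a_assoc)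

lemma comb_scale:
 assumes "\<phi> \<in> borel_fun" "l \<in> forms"
 shows "comb (scale \<phi> l) = L0_class m \<phi> \<odot> comb l"
 using assms(2)
proof (induction l)
 case Nil
 then show ?case using assms by (simp add: scale_def form_comb_simps smult_r_null)
next
 case (Cons p l)
 obtain g f where p: "p = (g, f)" by (cases p)
 have gf: "g \<in> borel_fun" "f \<in> U" "l \<in> forms" using Cons.prems p by auto
 have "comb (scale \<phi> (p # l)) = L0_class m (\<lambda>x. \<phi> x * g x) \<odot> d f \<oplus> comb (scale \<phi> l)"
  by (simp add: p scale_def form_comb_simps)
 also have "... = L0_class m \<phi> \<odot> (L0_class m g \<odot> d f) \<oplus> L0_class m \<phi> \<odot> comb l"
  using Cons.IH[OF gf(3)] gf assms d_closed smult_assoc1[of "L0_class m \<phi>" "L0_class m g" "d f"] by simp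
 also have "... = L0_class m \<phi> \<odot> comb (p # l)"
  using gf assms d_closed by (simp add: p form_comb_simps smult_r_distr)
 finally show ?case .
qed

lemma comb_minus:
 assumes "l \<in> forms" "l' \<in> forms"
 shows "comb l \<ominus> comb l' = comb (l @ scale (\<lambda>_. -1) l')"
 using assms by (simp add: comb_append comb_scale smult_minus_one a_minus_def)

lemma comb_single: "f \<in> U ==> comb [(\<lambda>_. 1, f)] = d f"
 by (simp add: form_comb_simps smult_one_class d_closed)

lemma pn_d: "f \<in> U ==> AE x in m. pn (d f) x = W f x"
 by (rule pn_eqI[OF d_closed W_measurable d_norm])

text \<open>Replacing a coefficient \<open>g\<close> by a constant \<open>c\<close> costs at most
  \<open>\<bar>c - g x\<bar> * W f x\<close>, and a combination with constant coefficients is itself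
  a differential by linearity.\<close>

lemma pn_comb_minus_lc:
 assumes "length a = length l" "l \<in> forms"
 shows "AE x in m. pn (comb l \<ominus> d (lc a l)) x <= err a l x"
 using assms
proof (induction a l rule: list_induct2)
 case Nil
 have "d (\<lambda>_. 0) = \<zero>" using d_lincomb[OF U_zero U_zero, of 0 0] by (simp add: smult_zero_class d_closed U_zero)
 then have "comb [] \<ominus> d (lc [] []) = \<zero>" by (simp add: form_comb_simps lc_Nil a_minus_def)
 then show ?case using pn_zero by (auto simp: err_Nil elim!: eventually_mono)
next
 case (Cons c a p l)
 obtain g f where p: "p = (g, f)" by (cases p)
 have gf: "g \<in> borel_fun" "f \<in> U" "l \<in> forms" using Cons.prems p by auto
 have lu: "lc a l \<in> U" by (rule lc_U[OF gf(3)])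
 have "d (lc (c # a) (p # l)) = d (\<lambda>y. c * f y + 1 * lc a l y)" by (simp add: p lc_Cons)
 also have "... = L0_class m (\<lambda>_. c) \<odot> d f \<oplus> d (lc a l)"
  using d_lincomb[OF gf(2) lu, of c 1] d_closed[OF lu] by (simp add: smult_one_class)
 finally have "comb (p # l) \<ominus> d (lc (c # a) (p # l)) =
   (L0_class m g \<odot> d f \<ominus> L0_class m (\<lambda>_. c) \<odot> d f) \<oplus> (comb l \<ominus> d (lc a l))"
  using gf d_closed lu by (simp add: p form_comb_simps add_minus_add)
 also have "... = L0_class m (\<lambda>x. g x - c) \<odot> d f \<oplus> (comb l \<ominus> d (lc a l))"
  using gf d_closed by (simp add: smult_diff_class)
 finally have e: "comb (p # l) \<ominus> d (lc (c # a) (p # l)) = L0_class m (\<lambda>x. g x - c) \<odot> d f \<oplus> (comb l \<ominus> d (lc a l))" .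
 have b: "(\<lambda>x. g x - c) \<in> borel_fun" using gf by measurable
 have c1: "L0_class m (\<lambda>x. g x - c) \<odot> d f \<in> carrier M" "comb l \<ominus> d (lc a l) \<in> carrier M"
  using b gf d_closed lu by simp_all
 from pn_add[OF c1] pn_smult[OF b d_closed[OF gf(2)]] pn_d[OF gf(2)] Cons.IH[OF gf(3)]
 show ?case unfolding e by eventually_elim (simp add: p err_Cons abs_minus_commute)
qed

text \<open>The norm is forced by the norms of differentials: for every rational \<open>a\<close> it
  lies within \<open>err a l x\<close> of \<open>W (lc a l) x\<close>.\<close>

lemma pn_comb:
 assumes l: "l \<in> forms"
 shows "AE x in m. pn (comb l) x = fnorm l x"
proof -
 have "AE x in m. \<forall>a\<in>rats l. \<bar>pn (comb l) x - W (lc a l) x\<bar> <= err a l x"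
  unfolding AE_ball_countable[OF countable_rats]
 proof
  fix a assume "a \<in> rats l"
  then have len: "length a = length l" by (simp add: rats_def)
  from pn_comb_minus_lc[OF len l] pn_abs_diff[OF comb_closed[OF l] d_closed[OF lc_U[OF l, of a]]] pn_d[OF lc_U[OF l, of a]]
  show "AE x in m. \<bar>pn (comb l) x - W (lc a l) x\<bar> <= err a l x" by eventually_elim simp
 qed
 with AE_good[OF l] show ?thesis
 proof eventually_elim
  case (elim x)
  from fnorm_eqI[OF elim(1), of "pn (comb l) x" 1] elim(2) show ?case by simp
 qed
qed

text \<open>The right-hand side does not mention the module, so all modules with a differential
  contain the same metric space of formal sums.\<close>

lemma mod_dist_comb:
 assumes l: "l \<in> forms" and l': "l' \<in> forms"
 shows "mod_dist m' M (comb l) (comb l') = trunc_int (fnorm (l @ scale (\<lambda>_. -1) l'))"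
proof -
 have ll: "l @ scale (\<lambda>_. -1) l' \<in> forms" using l l' by simp
 show ?thesis
  unfolding mod_dist_eq[OF comb_closed[OF l] comb_closed[OF l']] comb_minus[OF l l']
  by (rule trunc_int_cong_AE[OF pn(1)[OF comb_closed[OF ll]] fnorm_measurable[OF ll] pn_comb[OF ll]])
qed

text \<open>Generation is defined by indexed sums, while norms are computed for coded lists; this
  lemma and its converse \<open>comb_is_L0_combination\<close> translate between the two.\<close>

lemma L0_combination_is_comb:
 assumes V: "V \<subseteq> U" and s: "s \<in> L0_combinations m M (d ` V)"
 shows "\<exists>l\<in>forms. s = comb l"
proof -
 obtain n :: nat and f v where s: "s = (\<Oplus>i\<in>{..<n}. f i \<odot> v i)"
  and f: "f \<in> {..<n} \<rightarrow> carrier (L0 m)" and v: "v \<in> {..<n} \<rightarrow> d ` V" using s unfolding L0_combinations_def by blast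
 have "k <= n ==> \<exists>l\<in>forms. (\<Oplus>i\<in>{..<k}. f i \<odot> v i) = comb l" for k
 proof (induction k)
  case 0 then show ?case by (intro bexI[of _ "[]"]) (auto simp: form_comb_simps)
 next
  case (Suc k)
  then obtain l where l: "l \<in> forms" "(\<Oplus>i\<in>{..<k}. f i \<odot> v i) = comb l" by auto
  have "k \<in> {..<n}" using Suc by simp
  then have fk: "f k \<in> carrier (L0 m)" and vk: "v k \<in> d ` V" using f v by (blast dest: funcset_mem)+
  obtain u where u: "u \<in> V" "v k = d u" using vk by blast
  obtain g where g: "g \<in> borel_fun" "f k = L0_class m g" using fk by (auto elim: L0_cases)
  have "d ` V \<subseteq> carrier M" using V d_closed by auto
  then have vc: "v i \<in> carrier M" if "i < n" for i using funcset_mem[OF v, of i] that by auto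
  have "(\<Oplus>i\<in>{..<Suc k}. f i \<odot> v i) = f k \<odot> v k \<oplus> (\<Oplus>i\<in>{..<k}. f i \<odot> v i)"
   unfolding lessThan_Suc by (rule M.finsum_insert) (use f vc Suc.prems in \<open>auto intro!: smult_closed\<close>)
  also have "... = comb ((g, u) # l)" using l g u by (simp add: form_comb_simps)
  finally show ?case using l g u V by (intro bexI[of _ "(g, u) # l"]) auto
 qed
 from this[of n] s show ?thesis by auto
qed

lemma comb_is_L0_combination:
 assumes "V \<subseteq> U" "\<forall>(g, f)\<in>set l. g \<in> borel_fun \<and> f \<in> V"
 shows "comb l \<in> L0_combinations m M (d ` V)"
 using assms(2)
proof (induction l)
 case Nil
 show ?case unfolding L0_combinations_def
  by (intro CollectI exI[of _ "0::nat"] exI[of _ "\<lambda>_. undefined"]) (auto simp: form_comb_simps)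
next
 case (Cons p l)
 obtain g f where p: "p = (g, f)" by (cases p)
 have gf: "g \<in> borel_fun" "f \<in> V" using Cons.prems p by auto
 have "comb l \<in> L0_combinations m M (d ` V)" using Cons by auto
 then obtain n :: nat and F v where s: "comb l = (\<Oplus>i\<in>{..<n}. F i \<odot> v i)"
  and F: "F \<in> {..<n} \<rightarrow> carrier (L0 m)" and v: "v \<in> {..<n} \<rightarrow> d ` V" unfolding L0_combinations_def by blast
 have "d ` V \<subseteq> carrier M" using assms(1) d_closed by auto
 then have vc: "v i \<in> carrier M" if "i < n" for i using funcset_mem[OF v, of i] that by auto
 let ?F = "F(n := L0_class m g)" and ?v = "v(n := d f)"
 have "(\<Oplus>i\<in>{..<Suc n}. ?F i \<odot> ?v i) = ?F n \<odot> ?v n \<oplus> (\<Oplus>i\<in>{..<n}. ?F i \<odot> ?v i)"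
  unfolding lessThan_Suc
  by (rule M.finsum_insert) (use F vc gf assms(1) d_closed in \<open>auto intro!: smult_closed\<close>)
 also have "(\<Oplus>i\<in>{..<n}. ?F i \<odot> ?v i) = (\<Oplus>i\<in>{..<n}. F i \<odot> v i)"
  by (rule M.finsum_cong') (use F vc in \<open>auto intro!: smult_closed\<close>)
 finally have "comb (p # l) = (\<Oplus>i\<in>{..<Suc n}. ?F i \<odot> ?v i)" by (simp add: p form_comb_simps s)
 moreover have "?F \<in> {..<Suc n} \<rightarrow> carrier (L0 m)" "?v \<in> {..<Suc n} \<rightarrow> d ` V"
  using F gf funcset_mem[OF v] by (auto simp: less_Suc_eq Pi_iff)
 ultimately show ?case unfolding L0_combinations_def by blast
qed

lemma comb_dense:
 assumes V: "V \<subseteq> U" and gen: "generates m m' M (d ` V)" and v: "v \<in> carrier M" and e: "0 < eps"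
 shows "\<exists>l\<in>forms. mod_dist m' M v (comb l) < eps"
proof -
 have "d ` V \<subseteq> carrier M" using V d_closed by auto
 from generates_iff[OF this] gen v e obtain s where "s \<in> L0_combinations m M (d ` V)" "mod_dist m' M v s < eps" by blast
 then show ?thesis using L0_combination_is_comb[OF V] by blast
qed

end

lemma module_iso_dist:
 assumes N: "L0_module m m' N" and M: "L0_module m m' M" and I: "\<Phi> \<in> module_iso m N M"
  and c: "v \<in> carrier N" "w \<in> carrier N"
 shows "mod_dist m' M (\<Phi> v) (\<Phi> w) = mod_dist m' N v w"
proof -
 interpret N: L0_module m m' N by (rule N)
 interpret M: L0_module m m' M by (rule M)
 have cl: "!!z. z \<in> carrier N ==> \<Phi> z \<in> carrier M" using I by (auto simp: module_iso_def)
 have "\<Phi> (\<ominus>\<^bsub>N\<^esub> w) = \<Phi> (L0_class m (\<lambda>_. -1) \<odot>\<^bsub>N\<^esub> w)" using c by (simp add: N.smult_minus_one)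
 also have "... = L0_class m (\<lambda>_. -1) \<odot>\<^bsub>M\<^esub> \<Phi> w" using I c by (simp add: module_iso_def)
 also have "... = \<ominus>\<^bsub>M\<^esub> \<Phi> w" using cl c by (simp add: M.smult_minus_one)
 finally have "\<Phi> (v \<ominus>\<^bsub>N\<^esub> w) = \<Phi> v \<ominus>\<^bsub>M\<^esub> \<Phi> w" using I c by (simp add: module_iso_def a_minus_def)
 moreover have "pnorm M (\<Phi> (v \<ominus>\<^bsub>N\<^esub> w)) = pnorm N (v \<ominus>\<^bsub>N\<^esub> w)" using I c by (simp add: module_iso_def)
 ultimately show ?thesis using c cl by (simp add: mod_dist_def)
qed

section \<open>The isomorphism through common formal sums\<close>

context seminormed_functions
begin

text \<open>The graph of the isomorphism: both elements are approximated by the same formal sums.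
  The relation is symmetric in the two modules, so existence and uniqueness of partners in one
  direction also give surjectivity and injectivity.\<close>

definition same_limit where
 "same_limit N e M d v w \<longleftrightarrow> v \<in> carrier N \<and> w \<in> carrier M \<and>
   (\<forall>eps>0. \<exists>l\<in>forms. mod_dist m' N v (form_comb m N e l) < eps \<and> mod_dist m' M w (form_comb m M d l) < eps)"

lemma same_limit_sym: "same_limit N e M d v w ==> same_limit M d N e w v"
 unfolding same_limit_def by blast

lemma same_limit_sequence:
 assumes "same_limit N e M d v w"
 obtains l where "!!n::nat. l n \<in> forms" "!!n. mod_dist m' N v (form_comb m N e (l n)) < 1 / real (Suc n)"
  "!!n. mod_dist m' M w (form_comb m M d (l n)) < 1 / real (Suc n)"
proof -
 have "\<forall>n. \<exists>l\<in>forms. mod_dist m' N v (form_comb m N e l) < 1 / real (Suc n) \<and> mod_dist m' M w (form_comb m M d l) < 1 / real (Suc n)"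
  using assms unfolding same_limit_def by simp
 then show thesis using that by metis
qed

text \<open>Formal sums tending to \<open>v\<close> form a Cauchy sequence, their copies in
  \<open>M\<close> have the same mutual distances, and completeness of \<open>M\<close> provides the
  limit.\<close>

lemma same_limit_exists:
 assumes N: "module_differential m m' U W N e" and M: "module_differential m m' U W M d"
  and V: "V \<subseteq> U" and gen: "generates m m' N (e ` V)" and v: "v \<in> carrier N"
 shows "\<exists>w. same_limit N e M d v w"
proof -
 interpret N: module_differential m m' U W N e by (rule N)
 interpret M: module_differential m m' U W M d by (rule M)
 have "\<forall>n::nat. \<exists>l\<in>forms. mod_dist m' N v (N.comb l) < 1 / real (Suc n)"
  using N.comb_dense[OF V gen v] by simp
 then obtain l where l: "!!n. l n \<in> forms" "!!n. mod_dist m' N v (N.comb (l n)) < 1 / real (Suc n)" by metis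
 have Nc: "N.comb (l n) \<in> carrier N" "M.comb (l n) \<in> carrier M" for n using l by auto
 have "\<exists>K. \<forall>i\<ge>K. \<forall>j\<ge>K. mod_dist m' M (M.comb (l i)) (M.comb (l j)) < eps" if e: "0 < eps" for eps :: real
 proof -
  obtain K where K: "1 / real (Suc K) < eps / 2" using nat_approx_posE[of "eps / 2"] e by auto
  have "mod_dist m' M (M.comb (l i)) (M.comb (l j)) < eps" if "K <= i" "K <= j" for i j
  proof -
   have s: "1 / real (Suc i) <= 1 / real (Suc K)" "1 / real (Suc j) <= 1 / real (Suc K)" using that by (auto intro!: divide_left_mono)
   have "mod_dist m' M (M.comb (l i)) (M.comb (l j)) = mod_dist m' N (N.comb (l i)) (N.comb (l j))"
    using l by (simp add: M.mod_dist_comb N.mod_dist_comb)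
   also have "... <= mod_dist m' N (N.comb (l i)) v + mod_dist m' N v (N.comb (l j))"
    by (rule N.mod_dist_triangle[OF Nc(1) v Nc(1)])
   also have "... < eps" using l(2)[of i] l(2)[of j] s K N.MS.commute[of "N.comb (l i)" v] by linarith
   finally show ?thesis .
  qed
  then show ?thesis by blast
 qed
 then obtain w where w: "w \<in> carrier M" "(\<lambda>n. mod_dist m' M (M.comb (l n)) w) \<longlonglongrightarrow> 0"
  using M.mod_complete[of "\<lambda>n. M.comb (l n)"] Nc by blast
 have "\<exists>k\<in>forms. mod_dist m' N v (N.comb k) < eps \<and> mod_dist m' M w (M.comb k) < eps" if e: "0 < eps" for eps :: real
 proof -
  have "eventually (\<lambda>n. mod_dist m' M (M.comb (l n)) w < eps) sequentially" using w(2) e by (rule order_tendstoD)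
  then obtain K1 where K1: "!!n. K1 <= n ==> mod_dist m' M (M.comb (l n)) w < eps" by (auto simp: eventually_sequentially)
  obtain K where K: "1 / real (Suc K) < eps" using nat_approx_posE[OF e] by auto
  let ?n = "max K K1"
  have "1 / real (Suc ?n) <= 1 / real (Suc K)" by (auto intro!: divide_left_mono)
  then have "mod_dist m' N v (N.comb (l ?n)) < eps" using l(2)[of ?n] K by linarith
  moreover have "mod_dist m' M w (M.comb (l ?n)) < eps" using K1[of ?n] M.MS.commute[of w] by simp
  ultimately show ?thesis using l(1) by blast
 qed
 then show ?thesis using v w(1) unfolding same_limit_def by blast
qed

text \<open>Both pairs are replaced by nearby formal sums, whose distances agree in the two modules.
  The opposite inequality is the same statement with the modules exchanged.\<close>

lemma same_limit_dist_le:
 assumes N: "module_differential m m' U W N e" and M: "module_differential m m' U W M d"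
  and r: "same_limit N e M d v w" "same_limit N e M d v' w'"
 shows "mod_dist m' N v v' <= mod_dist m' M w w'"
proof (rule field_le_epsilon)
 interpret N: module_differential m m' U W N e by (rule N)
 interpret M: module_differential m m' U W M d by (rule M)
 fix eps :: real assume e: "0 < eps"
 have c: "v \<in> carrier N" "v' \<in> carrier N" "w \<in> carrier M" "w' \<in> carrier M" using r by (auto simp: same_limit_def)
 \<comment> \<open>Four approximation errors occur, two in each module.\<close>
 have e4: "0 < eps / 4" using e by simp
 obtain l where l: "l \<in> forms" "mod_dist m' N v (N.comb l) < eps / 4" "mod_dist m' M w (M.comb l) < eps / 4"
  using r(1) e4 unfolding same_limit_def by blast
 obtain l' where l': "l' \<in> forms" "mod_dist m' N v' (N.comb l') < eps / 4" "mod_dist m' M w' (M.comb l') < eps / 4"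
  using r(2) e4 unfolding same_limit_def by blast
 have cl: "N.comb l \<in> carrier N" "N.comb l' \<in> carrier N" "M.comb l \<in> carrier M" "M.comb l' \<in> carrier M" using l l' by auto
 have "mod_dist m' N v v' <= mod_dist m' N v (N.comb l) + (mod_dist m' N (N.comb l) (N.comb l') + mod_dist m' N (N.comb l') v')"
  using N.mod_dist_triangle[OF c(1) cl(1) c(2)] N.mod_dist_triangle[OF cl(1) cl(2) c(2)] by linarith
 moreover have "mod_dist m' N (N.comb l) (N.comb l') = mod_dist m' M (M.comb l) (M.comb l')"
  using l l' by (simp add: M.mod_dist_comb N.mod_dist_comb)
 moreover have "mod_dist m' M (M.comb l) (M.comb l') <= mod_dist m' M (M.comb l) w + (mod_dist m' M w w' + mod_dist m' M w' (M.comb l'))"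
  using M.mod_dist_triangle[OF cl(3) c(3) cl(4)] M.mod_dist_triangle[OF c(3) c(4) cl(4)] by linarith
 ultimately show "mod_dist m' N v v' <= mod_dist m' M w w' + eps"
  using l l' N.MS.commute[of "N.comb l'" v'] M.MS.commute[of "M.comb l" w] by linarith
qed

lemma same_limit_comb:
 assumes N: "module_differential m m' U W N e" and M: "module_differential m m' U W M d" and l: "l \<in> forms"
 shows "same_limit N e M d (form_comb m N e l) (form_comb m M d l)"
proof -
 interpret N: module_differential m m' U W N e by (rule N)
 interpret M: module_differential m m' U W M d by (rule M)
 have "mod_dist m' N (N.comb l) (N.comb l) = 0" "mod_dist m' M (M.comb l) (M.comb l) = 0"
  using l N.MS.zero[of "N.comb l" "N.comb l"] M.MS.zero[of "M.comb l" "M.comb l"] by auto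
 then show ?thesis using l N.comb_closed[OF l] M.comb_closed[OF l]
  unfolding same_limit_def by (intro conjI allI impI bexI[of _ l]) auto
qed

lemma same_limit_unique:
 assumes N: "module_differential m m' U W N e" and M: "module_differential m m' U W M d"
  and r: "same_limit N e M d v w" "same_limit N e M d v w'"
 shows "w = w'"
proof -
 interpret N: module_differential m m' U W N e by (rule N)
 interpret M: module_differential m m' U W M d by (rule M)
 have c: "v \<in> carrier N" "w \<in> carrier M" "w' \<in> carrier M" using r by (auto simp: same_limit_def)
 have "mod_dist m' M w w' <= mod_dist m' N v v"
  by (rule same_limit_dist_le[OF M N same_limit_sym[OF r(1)] same_limit_sym[OF r(2)]])
 then have "mod_dist m' M w w' = 0" using N.MS.zero[of v v] c M.MS.nonneg[of w w'] by auto
 then show ?thesis using M.MS.zero[of w w'] c by simp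
qed

lemma same_limit_add:
 assumes N: "module_differential m m' U W N e" and M: "module_differential m m' U W M d"
  and r: "same_limit N e M d v w" "same_limit N e M d v' w'"
 shows "same_limit N e M d (v \<oplus>\<^bsub>N\<^esub> v') (w \<oplus>\<^bsub>M\<^esub> w')"
proof -
 interpret N: module_differential m m' U W N e by (rule N)
 interpret M: module_differential m m' U W M d by (rule M)
 have c: "v \<in> carrier N" "v' \<in> carrier N" "w \<in> carrier M" "w' \<in> carrier M" using r by (auto simp: same_limit_def)
 have "\<exists>k\<in>forms. mod_dist m' N (v \<oplus>\<^bsub>N\<^esub> v') (N.comb k) < eps \<and> mod_dist m' M (w \<oplus>\<^bsub>M\<^esub> w') (M.comb k) < eps" if e: "0 < eps" for eps :: real
 proof -
  have e2: "0 < eps / 2" using e by simp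
  obtain l where l: "l \<in> forms" "mod_dist m' N v (N.comb l) < eps / 2" "mod_dist m' M w (M.comb l) < eps / 2"
   using r(1) e2 unfolding same_limit_def by blast
  obtain l' where l': "l' \<in> forms" "mod_dist m' N v' (N.comb l') < eps / 2" "mod_dist m' M w' (M.comb l') < eps / 2"
   using r(2) e2 unfolding same_limit_def by blast
  have "mod_dist m' N (v \<oplus>\<^bsub>N\<^esub> v') (N.comb (l @ l')) < eps"
   using N.mod_dist_add[of v "N.comb l" v' "N.comb l'"] l l' c by (simp add: N.comb_append)
  moreover have "mod_dist m' M (w \<oplus>\<^bsub>M\<^esub> w') (M.comb (l @ l')) < eps"
   using M.mod_dist_add[of w "M.comb l" w' "M.comb l'"] l l' c by (simp add: M.comb_append)
  ultimately show ?thesis using l l' by (intro bexI[of _ "l @ l'"]) auto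
 qed
 then show ?thesis unfolding same_limit_def using c by simp
qed

text \<open>A sequence of common formal sums is multiplied term by term; continuity of
  multiplication is available in sequential form.\<close>

lemma same_limit_smult:
 assumes N: "module_differential m m' U W N e" and M: "module_differential m m' U W M d"
  and r: "same_limit N e M d v w" and F: "F \<in> carrier (L0 m)"
 shows "same_limit N e M d (F \<odot>\<^bsub>N\<^esub> v) (F \<odot>\<^bsub>M\<^esub> w)"
proof -
 interpret N: module_differential m m' U W N e by (rule N)
 interpret M: module_differential m m' U W M d by (rule M)
 have c: "v \<in> carrier N" "w \<in> carrier M" using r by (auto simp: same_limit_def)
 obtain \<phi> where \<phi>: "\<phi> \<in> borel_fun" "F = L0_class m \<phi>" using F by (auto elim: L0_cases)
 obtain l where l: "!!n::nat. l n \<in> forms" "!!n. mod_dist m' N v (N.comb (l n)) < 1 / real (Suc n)"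
  "!!n. mod_dist m' M w (M.comb (l n)) < 1 / real (Suc n)"
  using same_limit_sequence[OF r] by blast
 have z: "(\<lambda>n. 1 / real (Suc n)) \<longlonglongrightarrow> 0" by (intro LIMSEQ_Suc lim_1_over_n)
 have "(\<lambda>n. mod_dist m' N (N.comb (l n)) v) \<longlonglongrightarrow> 0"
  by (rule tendsto_sandwich[OF always_eventually always_eventually tendsto_const z])
   (use l(2) N.MS.commute[of _ v] in \<open>auto intro: less_imp_le\<close>)
 from N.mod_dist_smult_tendsto[OF F _ c(1) this] l(1)
 have 1: "(\<lambda>n. mod_dist m' N (F \<odot>\<^bsub>N\<^esub> N.comb (l n)) (F \<odot>\<^bsub>N\<^esub> v)) \<longlonglongrightarrow> 0" by simp
 have "(\<lambda>n. mod_dist m' M (M.comb (l n)) w) \<longlonglongrightarrow> 0"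
  by (rule tendsto_sandwich[OF always_eventually always_eventually tendsto_const z])
   (use l(3) M.MS.commute[of _ w] in \<open>auto intro: less_imp_le\<close>)
 from M.mod_dist_smult_tendsto[OF F _ c(2) this] l(1)
 have 2: "(\<lambda>n. mod_dist m' M (F \<odot>\<^bsub>M\<^esub> M.comb (l n)) (F \<odot>\<^bsub>M\<^esub> w)) \<longlonglongrightarrow> 0" by simp
 have "\<exists>k\<in>forms. mod_dist m' N (F \<odot>\<^bsub>N\<^esub> v) (N.comb k) < eps \<and> mod_dist m' M (F \<odot>\<^bsub>M\<^esub> w) (M.comb k) < eps" if e: "0 < eps" for eps :: real
 proof -
  have "eventually (\<lambda>n. mod_dist m' N (F \<odot>\<^bsub>N\<^esub> N.comb (l n)) (F \<odot>\<^bsub>N\<^esub> v) < eps \<and> mod_dist m' M (F \<odot>\<^bsub>M\<^esub> M.comb (l n)) (F \<odot>\<^bsub>M\<^esub> w) < eps) sequentially"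
   using order_tendstoD(2)[OF 1 e] order_tendstoD(2)[OF 2 e] by (rule eventually_conj)
  then obtain n where n: "mod_dist m' N (F \<odot>\<^bsub>N\<^esub> N.comb (l n)) (F \<odot>\<^bsub>N\<^esub> v) < eps" "mod_dist m' M (F \<odot>\<^bsub>M\<^esub> M.comb (l n)) (F \<odot>\<^bsub>M\<^esub> w) < eps"
   by (auto simp: eventually_sequentially)
  have "N.comb (scale \<phi> (l n)) = F \<odot>\<^bsub>N\<^esub> N.comb (l n)" "M.comb (scale \<phi> (l n)) = F \<odot>\<^bsub>M\<^esub> M.comb (l n)"
   using N.comb_scale[OF \<phi>(1) l(1)] M.comb_scale[OF \<phi>(1) l(1)] \<phi>(2) by auto
  then show ?thesis using n l(1) \<phi>(1) N.MS.commute[of "F \<odot>\<^bsub>N\<^esub> v"] M.MS.commute[of "F \<odot>\<^bsub>M\<^esub> w"]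
   by (intro bexI[of _ "scale \<phi> (l n)"]) auto
 qed
 then show ?thesis unfolding same_limit_def using c F by simp
qed

text \<open>Both pointwise norms are close, in the truncated integral, to the norm
  \<open>fnorm l\<close> of a common formal sum, which is the same in both modules.\<close>

lemma same_limit_pnorm:
 assumes N: "module_differential m m' U W N e" and M: "module_differential m m' U W M d"
  and r: "same_limit N e M d v w"
 shows "pnorm N v = pnorm M w"
proof -
 interpret N: module_differential m m' U W N e by (rule N)
 interpret M: module_differential m m' U W M d by (rule M)
 have c: "v \<in> carrier N" "w \<in> carrier M" using r by (auto simp: same_limit_def)
 note [measurable] = N.pn(1)[OF c(1)] M.pn(1)[OF c(2)]
 let ?h = "\<lambda>x. \<bar>N.pn v x - M.pn w x\<bar>"
 have small: "trunc_int ?h < eps" if e: "0 < eps" for eps :: real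
 proof -
  have e2: "0 < eps / 2" using e by simp
  obtain l where l: "l \<in> forms" "mod_dist m' N v (N.comb l) < eps / 2" "mod_dist m' M w (M.comb l) < eps / 2"
   using r e2 unfolding same_limit_def by blast
  have cl: "N.comb l \<in> carrier N" "M.comb l \<in> carrier M" using l by auto
  have cd: "v \<ominus>\<^bsub>N\<^esub> N.comb l \<in> carrier N" "w \<ominus>\<^bsub>M\<^esub> M.comb l \<in> carrier M" using c cl by simp_all
  note [measurable] = N.pn(1)[OF cd(1)] M.pn(1)[OF cd(2)]
  have "AE x in m. ?h x <= N.pn (v \<ominus>\<^bsub>N\<^esub> N.comb l) x + M.pn (w \<ominus>\<^bsub>M\<^esub> M.comb l) x"
   using N.pn_abs_diff[OF c(1) cl(1)] M.pn_abs_diff[OF c(2) cl(2)] N.pn_comb[OF l(1)] M.pn_comb[OF l(1)]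
   by eventually_elim linarith
  then have "trunc_int ?h <= trunc_int (\<lambda>x. N.pn (v \<ominus>\<^bsub>N\<^esub> N.comb l) x + M.pn (w \<ominus>\<^bsub>M\<^esub> M.comb l) x)"
   by (intro trunc_int_mono) auto
  also have "... <= trunc_int (N.pn (v \<ominus>\<^bsub>N\<^esub> N.comb l)) + trunc_int (M.pn (w \<ominus>\<^bsub>M\<^esub> M.comb l))"
   by (intro trunc_int_add N.pn_nonneg M.pn_nonneg cd) auto
  also have "... < eps" using l c cl by (simp add: N.mod_dist_eq M.mod_dist_eq)
  finally show ?thesis .
 qed
 have "0 <= trunc_int ?h" by (rule trunc_int_nonneg) simp
 then have "trunc_int ?h = 0" using small[of "trunc_int ?h"] by linarith
 then have "AE x in m. ?h x = 0" by (subst (asm) trunc_int_zero_iff) auto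
 then have "AE x in m. N.pn v x = M.pn w x" by eventually_elim simp
 then show ?thesis unfolding N.pn(2)[OF c(1)] M.pn(2)[OF c(2)] using N.pn(1)[OF c(1)] M.pn(1)[OF c(2)]
  by (intro L0_class_eqI) auto
qed

text \<open>Existence comes from the graph \<open>same_limit\<close>. For uniqueness, an isomorphism
  matching the differentials is determined on formal sums, which are dense, and it preserves
  distances. The generating sets on the two sides may differ.\<close>

theorem unique_module_iso:
 assumes N: "module_differential m m' U W N e" and M: "module_differential m m' U W M d"
  and V1: "V1 \<subseteq> U" and gN: "generates m m' N (e ` V1)" and V2: "V2 \<subseteq> U" and gM: "generates m m' M (d ` V2)"
 shows "\<exists>!\<Phi>. \<Phi> \<in> module_iso m N M \<and> (\<forall>f\<in>U. \<Phi> (e f) = d f)"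
proof (rule ex_ex1I)
 interpret N: module_differential m m' U W N e by (rule N)
 interpret M: module_differential m m' U W M d by (rule M)
 let ?R = "same_limit N e M d"
 define \<Phi> where "\<Phi> = (\<lambda>v\<in>carrier N. THE w. ?R v w)"
 have \<Phi>R: "?R v (\<Phi> v)" if v: "v \<in> carrier N" for v
 proof -
  obtain w where w: "?R v w" using same_limit_exists[OF N M V1 gN v] by blast
  have "?R v (THE w. ?R v w)" by (rule theI[of _ w]) (use w same_limit_unique[OF N M] in blast)+
  then show ?thesis using v by (simp add: \<Phi>_def)
 qed
 have eq: "\<Phi> v = w" if "?R v w" for v w
  using same_limit_unique[OF N M \<Phi>R that] that by (auto simp: same_limit_def)
 have "\<Phi> \<in> module_iso m N M"
  unfolding module_iso_def
 proof (intro CollectI conjI ballI)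
  show "\<Phi> \<in> carrier N \<rightarrow>\<^sub>E carrier M" using \<Phi>R by (auto simp: \<Phi>_def same_limit_def)
  show "bij_betw \<Phi> (carrier N) (carrier M)"
   unfolding bij_betw_def
  proof
   show "inj_on \<Phi> (carrier N)"
   proof (rule inj_onI)
    fix v v' assume v: "v \<in> carrier N" "v' \<in> carrier N" "\<Phi> v = \<Phi> v'"
    from same_limit_unique[OF M N same_limit_sym[OF \<Phi>R[OF v(1)]]] same_limit_sym[OF \<Phi>R[OF v(2)]] v(3)
    show "v = v'" by simp
   qed
   show "\<Phi> ` carrier N = carrier M"
   proof
    show "\<Phi> ` carrier N \<subseteq> carrier M" using \<Phi>R by (auto simp: same_limit_def)
    show "carrier M \<subseteq> \<Phi> ` carrier N"
    proof
     fix w assume "w \<in> carrier M"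
     then obtain v where "same_limit M d N e w v" using same_limit_exists[OF M N V2 gM] by blast
     then have "?R v w" by (rule same_limit_sym)
     then show "w \<in> \<Phi> ` carrier N" using eq[of v w] by (auto simp: same_limit_def)
    qed
   qed
  qed
  fix v assume v: "v \<in> carrier N"
  show "pnorm M (\<Phi> v) = pnorm N v" using same_limit_pnorm[OF N M \<Phi>R[OF v]] by simp
  show "\<Phi> (v \<oplus>\<^bsub>N\<^esub> w) = \<Phi> v \<oplus>\<^bsub>M\<^esub> \<Phi> w" if "w \<in> carrier N" for w
   by (rule eq[OF same_limit_add[OF N M \<Phi>R[OF v] \<Phi>R[OF that]]])
  show "\<Phi> (F \<odot>\<^bsub>N\<^esub> v) = F \<odot>\<^bsub>M\<^esub> \<Phi> v" if "F \<in> carrier (L0 m)" for F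
   by (rule eq[OF same_limit_smult[OF N M \<Phi>R[OF v] that]])
 qed
 moreover have "\<Phi> (e f) = d f" if f: "f \<in> U" for f
  using eq[OF same_limit_comb[OF N M, of "[(\<lambda>_. 1, f)]"]] f by (simp add: N.comb_single M.comb_single)
 ultimately show "\<exists>\<Phi>. \<Phi> \<in> module_iso m N M \<and> (\<forall>f\<in>U. \<Phi> (e f) = d f)" by blast
next
 interpret N: module_differential m m' U W N e by (rule N)
 interpret M: module_differential m m' U W M d by (rule M)
 fix \<Phi> \<Psi> assume A: "\<Phi> \<in> module_iso m N M \<and> (\<forall>f\<in>U. \<Phi> (e f) = d f)" and B: "\<Psi> \<in> module_iso m N M \<and> (\<forall>f\<in>U. \<Psi> (e f) = d f)"
 have comb: "\<Theta> (N.comb l) = M.comb l" if T: "\<Theta> \<in> module_iso m N M \<and> (\<forall>f\<in>U. \<Theta> (e f) = d f)" and l: "l \<in> forms" for \<Theta> l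
  using l
 proof (induction l)
  case Nil
  have "\<Theta> \<zero>\<^bsub>N\<^esub> \<in> carrier M" using T by (auto simp: module_iso_def)
  moreover have "\<Theta> (L0_class m (\<lambda>_. 0) \<odot>\<^bsub>N\<^esub> \<zero>\<^bsub>N\<^esub>) = L0_class m (\<lambda>_. 0) \<odot>\<^bsub>M\<^esub> \<Theta> \<zero>\<^bsub>N\<^esub>"
  proof -
   have "\<forall>f\<in>carrier (L0 m). \<forall>v\<in>carrier N. \<Theta> (f \<odot>\<^bsub>N\<^esub> v) = f \<odot>\<^bsub>M\<^esub> \<Theta> v" using T by (simp add: module_iso_def)
   from bspec[OF bspec[OF this, of "L0_class m (\<lambda>_. 0)"], of "\<zero>\<^bsub>N\<^esub>"] show ?thesis by simp
  qed
  ultimately show ?case by (simp add: form_comb_simps N.smult_zero_class M.smult_zero_class)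
 next
  case (Cons p l)
  obtain g f where p: "p = (g, f)" by (cases p)
  have "g \<in> borel_fun" "f \<in> U" "l \<in> forms" using Cons.prems p by auto
  then show ?case using T Cons.IH N.d_closed by (simp add: p form_comb_simps module_iso_def)
 qed
 have "\<Phi> v = \<Psi> v" if v: "v \<in> carrier N" for v
 proof -
  have c: "\<Phi> v \<in> carrier M" "\<Psi> v \<in> carrier M" using A B v by (auto simp: module_iso_def)
  have "mod_dist m' M (\<Phi> v) (\<Psi> v) < eps" if e: "0 < eps" for eps :: real
  proof -
   obtain l where l: "l \<in> forms" "mod_dist m' N v (N.comb l) < eps / 2" using N.comb_dense[OF V1 gN v, of "eps / 2"] e by auto
   have "mod_dist m' M (\<Phi> v) (\<Psi> v) <= mod_dist m' M (\<Phi> v) (M.comb l) + mod_dist m' M (M.comb l) (\<Psi> v)"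
    by (rule M.mod_dist_triangle) (use c l in auto)
   also have "mod_dist m' M (\<Phi> v) (M.comb l) = mod_dist m' N v (N.comb l)"
    using module_iso_dist[OF N.L0_module_axioms M.L0_module_axioms, of \<Phi> v "N.comb l"] A v l comb[OF A] by simp
   also have "mod_dist m' M (M.comb l) (\<Psi> v) = mod_dist m' N (N.comb l) v"
    using module_iso_dist[OF N.L0_module_axioms M.L0_module_axioms, of \<Psi> "N.comb l" v] B v l comb[OF B] by simp
   finally show ?thesis using l N.MS.commute[of "N.comb l" v] by linarith
  qed
  from this[of "mod_dist m' M (\<Phi> v) (\<Psi> v)"] have "mod_dist m' M (\<Phi> v) (\<Psi> v) = 0"
   using M.MS.nonneg[of "\<Phi> v" "\<Psi> v"] by linarith
  then show ?thesis using M.MS.zero c by simp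
 qed
 then show "\<Phi> = \<Psi>" using A B by (auto simp: module_iso_def intro: PiE_ext)
qed

end

section \<open>Dual modules\<close>

text \<open>Pseudo-distances, one for each bounded set \<open>B\<close>, that describe local
  convergence in measure and, unlike the neighbourhoods in its definition, obey a triangle
  inequality.\<close>

definition L0_dist_on :: "'x::polish_space measure => 'x set => 'x l0 => 'x l0 => ennreal" where
 "L0_dist_on m B F H = (\<integral>\<^sup>+x\<in>B. ennreal (min \<bar>L0_rep F x - L0_rep H x\<bar> 1) \<partial>m)"

text \<open>The condition on a single point \<open>F\<close> that occurs inside
  \<open>L0_topology\<close>.\<close>

definition L0_nbhd :: "'x::polish_space measure => 'x l0 => 'x l0 set => bool" where
 "L0_nbhd m F U \<longleftrightarrow> (\<exists>B\<in>sets borel. bounded B \<and> (\<exists>eps>0. \<forall>H\<in>carrier (L0 m).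
   emeasure m {x\<in>B. eps < \<bar>L0_rep F x - L0_rep H x\<bar>} < ennreal eps --> H \<in> U))"

context L0_setting
begin

lemma L0_rep_borel: "F \<in> carrier (L0 m) ==> L0_rep F \<in> borel_fun"
 using L0_rep(1)[of F m] by simp

lemma L0_nbhd_mono: "L0_nbhd m F S ==> S \<subseteq> T ==> L0_nbhd m F T"
 unfolding L0_nbhd_def by (meson subsetD)

lemma L0_nbhd_Int:
 assumes F: "F \<in> carrier (L0 m)" and S: "L0_nbhd m F S" and T: "L0_nbhd m F T"
 shows "L0_nbhd m F (S \<inter> T)"
proof -
 obtain B eps where B: "B \<in> sets borel" "bounded B" "0 < eps"
  "!!H. H \<in> carrier (L0 m) ==> emeasure m {x\<in>B. eps < \<bar>L0_rep F x - L0_rep H x\<bar>} < ennreal eps ==> H \<in> S"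
  using S unfolding L0_nbhd_def by blast
 obtain C \<delta> where C: "C \<in> sets borel" "bounded C" "0 < \<delta>"
  "!!H. H \<in> carrier (L0 m) ==> emeasure m {x\<in>C. \<delta> < \<bar>L0_rep F x - L0_rep H x\<bar>} < ennreal \<delta> ==> H \<in> T"
  using T unfolding L0_nbhd_def by blast
 have "H \<in> S \<inter> T" if H: "H \<in> carrier (L0 m)"
  and le: "emeasure m {x\<in>B \<union> C. min eps \<delta> < \<bar>L0_rep F x - L0_rep H x\<bar>} < ennreal (min eps \<delta>)" for H
 proof -
  have [measurable]: "L0_rep F \<in> borel_fun" "L0_rep H \<in> borel_fun" "B \<in> sets borel" "C \<in> sets borel"
   using L0_rep_borel H F B C by auto
  have ms: "{x\<in>B \<union> C. min eps \<delta> < \<bar>L0_rep F x - L0_rep H x\<bar>} \<in> sets m" unfolding sets_m by measurable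
  have *: "emeasure m {x\<in>D. r < \<bar>L0_rep F x - L0_rep H x\<bar>} < ennreal r" if "D \<subseteq> B \<union> C" "min eps \<delta> <= r" for D r
  proof -
   have "emeasure m {x\<in>D. r < \<bar>L0_rep F x - L0_rep H x\<bar>} <= emeasure m {x\<in>B \<union> C. min eps \<delta> < \<bar>L0_rep F x - L0_rep H x\<bar>}"
    by (rule emeasure_mono[OF _ ms]) (use that in auto)
   also note le
   also have "ennreal (min eps \<delta>) <= ennreal r" using that by (intro ennreal_leI)
   finally show ?thesis .
  qed
  show ?thesis using B(4)[OF H *] C(4)[OF H *] by simp
 qed
 then show ?thesis
  unfolding L0_nbhd_def using B(1-3) C(1-3) by (intro bexI[of _ "B \<union> C"] conjI exI[of _ "min eps \<delta>"]) auto
qed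

lemma openin_L0_topology: "openin (L0_topology m) U \<longleftrightarrow> U \<subseteq> carrier (L0 m) \<and> (\<forall>F\<in>U. L0_nbhd m F U)"
proof -
 have "istopology (\<lambda>U. U \<subseteq> carrier (L0 m) \<and> (\<forall>F\<in>U. L0_nbhd m F U))"
  unfolding istopology_def
 proof (intro conjI allI impI ballI)
  fix S T F assume "S \<subseteq> carrier (L0 m) \<and> (\<forall>F\<in>S. L0_nbhd m F S)" "T \<subseteq> carrier (L0 m) \<and> (\<forall>F\<in>T. L0_nbhd m F T)" "F \<in> S \<inter> T"
  then show "L0_nbhd m F (S \<inter> T)" by (intro L0_nbhd_Int) auto
 next
  fix K F assume K: "\<forall>S\<in>K. S \<subseteq> carrier (L0 m) \<and> (\<forall>F\<in>S. L0_nbhd m F S)" and "F \<in> \<Union>K"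
  then obtain S where S: "S \<in> K" "F \<in> S" by (elim UnionE)
  then have "L0_nbhd m F S" using bspec[OF K S(1)] by simp
  then show "L0_nbhd m F (\<Union>K)" by (rule L0_nbhd_mono) (rule Union_upper[OF S(1)])
 qed (blast, simp add: Union_least)
 moreover have "L0_topology m = topology (\<lambda>U. U \<subseteq> carrier (L0 m) \<and> (\<forall>F\<in>U. L0_nbhd m F U))"
  unfolding L0_topology_def L0_nbhd_def ..
 ultimately show ?thesis by (simp add: topology_inverse')
qed

lemma topspace_L0_topology [simp]: "topspace (L0_topology m) = carrier (L0 m)"
proof
 show "topspace (L0_topology m) \<subseteq> carrier (L0 m)" unfolding topspace_def openin_L0_topology by blast
 have "openin (L0_topology m) (carrier (L0 m))"
  unfolding openin_L0_topology L0_nbhd_def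
  by (intro conjI subset_refl ballI bexI[of _ "{}"] exI[of _ "1::real"]) auto
 then show "carrier (L0 m) \<subseteq> topspace (L0_topology m)" by (rule openin_subset)
qed

lemma L0_dist_on_triangle:
 assumes "F \<in> carrier (L0 m)" "G \<in> carrier (L0 m)" "H \<in> carrier (L0 m)" "B \<in> sets borel"
 shows "L0_dist_on m B F H <= L0_dist_on m B F G + L0_dist_on m B G H"
proof -
 note [measurable] = assms(1-3)[THEN L0_rep_borel] assms(4)
 have "L0_dist_on m B F H <= (\<integral>\<^sup>+x. ennreal (min \<bar>L0_rep F x - L0_rep G x\<bar> 1) * indicator B x +
   ennreal (min \<bar>L0_rep G x - L0_rep H x\<bar> 1) * indicator B x \<partial>m)"
  unfolding L0_dist_on_def
  by (intro nn_integral_mono) (auto simp: indicator_def ennreal_plus[symmetric] simp del: ennreal_plus intro!: ennreal_leI)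
 also have "... = L0_dist_on m B F G + L0_dist_on m B G H"
  unfolding L0_dist_on_def by (rule nn_integral_add) measurable
 finally show ?thesis .
qed

lemma L0_dist_on_add:
 assumes c: "F \<in> carrier (L0 m)" "G \<in> carrier (L0 m)" "F' \<in> carrier (L0 m)" "G' \<in> carrier (L0 m)" "B \<in> sets borel"
 shows "L0_dist_on m B (F \<oplus>\<^bsub>L0 m\<^esub> F') (G \<oplus>\<^bsub>L0 m\<^esub> G') <= L0_dist_on m B F G + L0_dist_on m B F' G'"
proof -
 note [measurable] = c(1-4)[THEN L0_rep_borel] c(5)
 have ae: "AE x in m. L0_rep (F \<oplus>\<^bsub>L0 m\<^esub> F') x = L0_rep F x + L0_rep F' x"
  if "F \<in> carrier (L0 m)" "F' \<in> carrier (L0 m)" for F F'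
 proof -
  have "F \<oplus>\<^bsub>L0 m\<^esub> F' = L0_class m (\<lambda>x. L0_rep F x + L0_rep F' x)"
   using L0_add_class[of "L0_rep F" m "L0_rep F'"] L0_rep[OF that(1)] L0_rep[OF that(2)] by simp
  then show ?thesis using L0_rep_class(2)[of "\<lambda>x. L0_rep F x + L0_rep F' x" m] that[THEN L0_rep_borel] by simp
 qed
 have "L0_dist_on m B (F \<oplus>\<^bsub>L0 m\<^esub> F') (G \<oplus>\<^bsub>L0 m\<^esub> G') <=
  (\<integral>\<^sup>+x. ennreal (min \<bar>L0_rep F x - L0_rep G x\<bar> 1) * indicator B x +
   ennreal (min \<bar>L0_rep F' x - L0_rep G' x\<bar> 1) * indicator B x \<partial>m)"
  unfolding L0_dist_on_def
 proof (rule nn_integral_mono_AE)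
  show "AE x in m. ennreal (min \<bar>L0_rep (F \<oplus>\<^bsub>L0 m\<^esub> F') x - L0_rep (G \<oplus>\<^bsub>L0 m\<^esub> G') x\<bar> 1) * indicator B x <=
   ennreal (min \<bar>L0_rep F x - L0_rep G x\<bar> 1) * indicator B x + ennreal (min \<bar>L0_rep F' x - L0_rep G' x\<bar> 1) * indicator B x"
   using ae[OF c(1,3)] ae[OF c(2,4)]
   by eventually_elim
    (auto simp: indicator_def ennreal_plus[symmetric] simp del: ennreal_plus intro!: ennreal_leI)
 qed
 also have "... = L0_dist_on m B F G + L0_dist_on m B F' G'"
  unfolding L0_dist_on_def by (rule nn_integral_add) measurable
 finally show ?thesis .
qed

text \<open>On the exceptional set the truncated integrand is at least \<open>min eps 1\<close>,
  which explains the constant.\<close>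

lemma L0_dist_on_Markov:
 assumes c: "F \<in> carrier (L0 m)" "G \<in> carrier (L0 m)" "B \<in> sets borel" and e: "0 < eps"
  and d: "L0_dist_on m B F G < ennreal (eps * min eps 1)"
 shows "emeasure m {x\<in>B. eps < \<bar>L0_rep F x - L0_rep G x\<bar>} < ennreal eps"
proof (rule ccontr)
 note [measurable] = c(1,2)[THEN L0_rep_borel] c(3)
 let ?A = "{x\<in>B. eps < \<bar>L0_rep F x - L0_rep G x\<bar>}"
 have A: "?A \<in> sets m" unfolding sets_m by measurable
 assume "\<not> ?thesis"
 then have "ennreal eps * ennreal (min eps 1) <= ennreal (min eps 1) * emeasure m ?A"
  by (subst mult.commute) (auto intro!: mult_left_mono simp: not_less)
 also have "... = (\<integral>\<^sup>+x. ennreal (min eps 1) * indicator ?A x \<partial>m)"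
  using A by (simp add: nn_integral_cmult_indicator)
 also have "... <= L0_dist_on m B F G"
  unfolding L0_dist_on_def by (intro nn_integral_mono) (auto simp: indicator_def intro!: ennreal_leI)
 finally show False using d e by (simp add: ennreal_mult[symmetric] not_le[symmetric])
qed

text \<open>The integrand is at most 1 on the exceptional set and at most \<open>eps\<close> on the
  rest of \<open>B\<close>.\<close>

lemma L0_dist_on_le:
 assumes c: "F \<in> carrier (L0 m)" "G \<in> carrier (L0 m)" "B \<in> sets borel" and e: "0 < eps"
 shows "L0_dist_on m B F G <= emeasure m {x\<in>B. eps < \<bar>L0_rep F x - L0_rep G x\<bar>} + ennreal eps * emeasure m B"
proof -
 note [measurable] = c(1,2)[THEN L0_rep_borel] c(3)
 let ?A = "{x\<in>B. eps < \<bar>L0_rep F x - L0_rep G x\<bar>}"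
 have A [measurable]: "?A \<in> sets m" unfolding sets_m by measurable
 have B [measurable]: "B \<in> sets m" unfolding sets_m by measurable
 have "L0_dist_on m B F G <= (\<integral>\<^sup>+x. indicator ?A x + ennreal eps * indicator B x \<partial>m)"
  unfolding L0_dist_on_def
 proof (rule nn_integral_mono)
  fix x
  show "ennreal (min \<bar>L0_rep F x - L0_rep G x\<bar> 1) * indicator B x <= indicator ?A x + ennreal eps * indicator B x"
  proof (cases "x \<in> ?A")
   case True
   then have "ennreal (min \<bar>L0_rep F x - L0_rep G x\<bar> 1) * indicator B x <= 1"
    using ennreal_leI[of "min \<bar>L0_rep F x - L0_rep G x\<bar> 1" 1] by (simp add: indicator_def)
   also have "1 <= indicator ?A x + ennreal eps * indicator B x" using True by simp
   finally show ?thesis .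
  qed (use e in \<open>auto simp: indicator_def intro!: ennreal_leI\<close>)
 qed
 also have "... = (\<integral>\<^sup>+x. indicator ?A x \<partial>m) + (\<integral>\<^sup>+x. ennreal eps * indicator B x \<partial>m)"
  by (rule nn_integral_add) auto
 also have "... = emeasure m ?A + ennreal eps * emeasure m B"
  using A B by (simp add: nn_integral_cmult_indicator)
 finally show ?thesis .
qed

lemma L0_dist_on_zero [simp]: "L0_dist_on m B F F = 0"
 by (simp add: L0_dist_on_def)

end

context L0_module
begin

text \<open>\<open>L0_topology\<close> is given by its open sets, and its basic neighbourhoods are
  not open by definition. Balls of \<open>L0_dist_on\<close> are shown to be open, and by Markov's
  inequality every neighbourhood contains one; continuity thus becomes an epsilon-delta condition
  suited to sums of maps.\<close>

lemma continuous_map_L0_iff: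
 assumes mm: "metric_measure m"
 shows "continuous_map (mod_topology m' M) (L0_topology m) L \<longleftrightarrow> L \<in> carrier M \<rightarrow> carrier (L0 m) \<and>
  (\<forall>v\<in>carrier M. \<forall>B\<in>sets borel. bounded B --> (\<forall>eta>0. \<exists>\<delta>>0. \<forall>w\<in>carrier M.
   mod_dist m' M v w < \<delta> --> L0_dist_on m B (L v) (L w) < ennreal eta))"
  (is "?C \<longleftrightarrow> ?T \<and> ?E")
proof
 assume C: ?C
 then have T: ?T by (auto simp: continuous_map_def)
 have ?E
 proof (intro ballI impI allI)
  fix v and B :: "'x set" and eta :: real assume v: "v \<in> carrier M" and B: "B \<in> sets borel" "bounded B" and eta: "0 < eta"
  let ?U = "{H \<in> carrier (L0 m). L0_dist_on m B (L v) H < ennreal eta}"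
  have Lv: "L v \<in> carrier (L0 m)" using T v by auto
  have fin: "emeasure m B < \<infinity>" using mm B by (auto simp: metric_measure_def)
  have "openin (L0_topology m) ?U"
   unfolding openin_L0_topology
  proof (intro conjI ballI)
   fix F assume F: "F \<in> ?U"
   then have Fc: "F \<in> carrier (L0 m)" and Fd: "L0_dist_on m B (L v) F < ennreal eta" by auto
   obtain r where r: "0 <= r" "L0_dist_on m B (L v) F = ennreal r"
    using Fd by (cases "L0_dist_on m B (L v) F" rule: ennreal_cases) auto
   have reta: "r < eta" using Fd r eta by (simp add: ennreal_less_iff)
   obtain b where b: "0 <= b" "emeasure m B = ennreal b" using fin by (cases "emeasure m B" rule: ennreal_cases) auto
   define eps where "eps = (eta - r) / (1 + b)"
   have eps: "0 < eps" using reta b by (simp add: eps_def)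
   have "eps * (1 + b) = eta - r" using b by (simp add: eps_def)
   then have eb: "eps + eps * b = eta - r" by (simp add: distrib_left)
   have "H \<in> ?U" if H: "H \<in> carrier (L0 m)" and le: "emeasure m {x\<in>B. eps < \<bar>L0_rep F x - L0_rep H x\<bar>} < ennreal eps" for H
   proof -
    obtain a where a: "0 <= a" "emeasure m {x\<in>B. eps < \<bar>L0_rep F x - L0_rep H x\<bar>} = ennreal a"
     using le by (cases "emeasure m {x\<in>B. eps < \<bar>L0_rep F x - L0_rep H x\<bar>}" rule: ennreal_cases) auto
    have "a < eps" using le a eps by (simp add: ennreal_less_iff)
    have "L0_dist_on m B (L v) H <= ennreal r + (ennreal a + ennreal eps * ennreal b)"
     using L0_dist_on_triangle[OF Lv Fc H B(1)] L0_dist_on_le[OF Fc H B(1) eps] unfolding r a b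
     by (meson add_left_mono order_trans)
    also have "... = ennreal (r + (a + eps * b))" using r a b eps by (simp add: ennreal_mult)
    also have "... < ennreal eta" using \<open>a < eps\<close> eb eta r a b eps by (subst ennreal_less_iff) auto
    finally show ?thesis using H by simp
   qed
   then show "L0_nbhd m F ?U" unfolding L0_nbhd_def using B eps by blast
  qed auto
  then have "openin (mod_topology m' M) {w \<in> carrier M. L w \<in> ?U}"
   using C[unfolded continuous_map_def, THEN conjunct2, rule_format] unfolding MS.topspace_mtopology by blast
  moreover have "v \<in> {w \<in> carrier M. L w \<in> ?U}" using v Lv eta by simp
  ultimately obtain \<delta> where \<delta>: "0 < \<delta>" "MS.mball v \<delta> \<subseteq> {w \<in> carrier M. L w \<in> ?U}"
   unfolding MS.openin_mtopology by blast
  then show "\<exists>\<delta>>0. \<forall>w\<in>carrier M. mod_dist m' M v w < \<delta> --> L0_dist_on m B (L v) (L w) < ennreal eta"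
   using v by (intro exI[of _ \<delta>]) (auto simp: MS.in_mball subset_iff)
 qed
 with T show "?T \<and> ?E" by blast
next
 assume H: "?T \<and> ?E"
 show ?C
  unfolding continuous_map_def
 proof (intro conjI allI impI)
  show "L \<in> topspace (mod_topology m' M) \<rightarrow> topspace (L0_topology m)" using H by simp
  fix U assume U: "openin (L0_topology m) U"
  show "openin (mod_topology m' M) {x \<in> topspace (mod_topology m' M). L x \<in> U}"
   unfolding MS.openin_mtopology MS.topspace_mtopology
  proof (intro conjI allI impI)
   fix v assume v: "v \<in> {x \<in> carrier M. L x \<in> U}"
   then obtain B eps where B: "B \<in> sets borel" "bounded B" "0 < eps"
    "!!K. K \<in> carrier (L0 m) ==> emeasure m {x\<in>B. eps < \<bar>L0_rep (L v) x - L0_rep K x\<bar>} < ennreal eps ==> K \<in> U"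
    using U unfolding openin_L0_topology L0_nbhd_def by blast
   have eps: "0 < eps * min eps 1" using B(3) by simp
   have vM: "v \<in> carrier M" using v by simp
   obtain \<delta> where \<delta>: "0 < \<delta>" "!!w. w \<in> carrier M ==> mod_dist m' M v w < \<delta> ==> L0_dist_on m B (L v) (L w) < ennreal (eps * min eps 1)"
    using H[THEN conjunct2, rule_format, OF vM B(1,2) eps] by blast
   have "MS.mball v \<delta> \<subseteq> {x \<in> carrier M. L x \<in> U}"
   proof
    fix w assume "w \<in> MS.mball v \<delta>"
    then have w: "w \<in> carrier M" "mod_dist m' M v w < \<delta>" by auto
    have "L v \<in> carrier (L0 m)" "L w \<in> carrier (L0 m)" using H v w by auto
    with L0_dist_on_Markov[OF this B(1,3) \<delta>(2)[OF w]] B(4) w show "w \<in> {x \<in> carrier M. L x \<in> U}" by auto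
   qed
   then show "\<exists>r>0. MS.mball v r \<subseteq> {x \<in> carrier M. L x \<in> U}" using \<delta>(1) by blast
  qed auto
 qed
qed

lemma continuous_map_L0_add:
 assumes mm: "metric_measure m"
  and L: "continuous_map (mod_topology m' M) (L0_topology m) L" "continuous_map (mod_topology m' M) (L0_topology m) K"
 shows "continuous_map (mod_topology m' M) (L0_topology m) (\<lambda>v\<in>carrier M. L v \<oplus>\<^bsub>L0 m\<^esub> K v)"
 unfolding continuous_map_L0_iff[OF mm]
proof (intro conjI ballI impI allI)
 interpret R: cring "L0 m" by (rule cring_L0)
 note L = L[unfolded continuous_map_L0_iff[OF mm]]
 show "(\<lambda>v\<in>carrier M. L v \<oplus>\<^bsub>L0 m\<^esub> K v) \<in> carrier M \<rightarrow> carrier (L0 m)" using L by (auto intro!: R.add.m_closed)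
 fix v and B :: "'x set" and eta :: real assume v: "v \<in> carrier M" and B: "B \<in> sets borel" "bounded B" and eta: "0 < eta"
 have e2: "0 < eta / 2" using eta by simp
 obtain \<delta> where \<delta>: "0 < \<delta>" "!!w. w \<in> carrier M ==> mod_dist m' M v w < \<delta> ==> L0_dist_on m B (L v) (L w) < ennreal (eta / 2)"
  using L(1)[THEN conjunct2, rule_format, OF v B e2] by blast
 obtain \<delta>' where \<delta>': "0 < \<delta>'" "!!w. w \<in> carrier M ==> mod_dist m' M v w < \<delta>' ==> L0_dist_on m B (K v) (K w) < ennreal (eta / 2)"
  using L(2)[THEN conjunct2, rule_format, OF v B e2] by blast
 have "L0_dist_on m B (L v \<oplus>\<^bsub>L0 m\<^esub> K v) (L w \<oplus>\<^bsub>L0 m\<^esub> K w) < ennreal eta"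
  if w: "w \<in> carrier M" "mod_dist m' M v w < min \<delta> \<delta>'" for w
 proof -
  have "L0_dist_on m B (L v \<oplus>\<^bsub>L0 m\<^esub> K v) (L w \<oplus>\<^bsub>L0 m\<^esub> K w) <= L0_dist_on m B (L v) (L w) + L0_dist_on m B (K v) (K w)"
   by (rule L0_dist_on_add) (use L v w B in auto)
  also have "... < ennreal (eta / 2) + ennreal (eta / 2)"
   by (rule add_strict_mono) (use \<delta>(2)[of w] \<delta>'(2)[of w] w in auto)
  also have "... = ennreal eta" using eta by (simp add: ennreal_plus[symmetric] del: ennreal_plus)
  finally show ?thesis .
 qed
 then show "\<exists>\<delta>>0. \<forall>w\<in>carrier M. mod_dist m' M v w < \<delta> -->
   L0_dist_on m B ((\<lambda>v\<in>carrier M. L v \<oplus>\<^bsub>L0 m\<^esub> K v) v) ((\<lambda>v\<in>carrier M. L v \<oplus>\<^bsub>L0 m\<^esub> K v) w) < ennreal eta"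
  using \<delta>(1) \<delta>'(1) v by (intro exI[of _ "min \<delta> \<delta>'"]) auto
qed

text \<open>By contradiction through a sequence, since multiplication is known to be sequentially
  continuous.\<close>

lemma continuous_map_smult:
 assumes F: "F \<in> carrier (L0 m)"
 shows "continuous_map (mod_topology m' M) (mod_topology m' M) (\<lambda>v. F \<odot> v)"
proof -
 have H: "\<exists>\<delta>>0. \<forall>w\<in>carrier M. mod_dist m' M v w < \<delta> --> mod_dist m' M (F \<odot> v) (F \<odot> w) < eps"
  if v: "v \<in> carrier M" and e: "0 < eps" for v and eps :: real
 proof (rule ccontr)
  assume "\<not> ?thesis"
  then have "\<forall>n::nat. \<exists>w\<in>carrier M. mod_dist m' M v w < 1 / real (Suc n) \<and> \<not> mod_dist m' M (F \<odot> v) (F \<odot> w) < eps"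
   by simp
  then obtain s where s: "!!n. s n \<in> carrier M" "!!n. mod_dist m' M v (s n) < 1 / real (Suc n)"
   "!!n. \<not> mod_dist m' M (F \<odot> v) (F \<odot> s n) < eps" by metis
  have z: "(\<lambda>n. 1 / real (Suc n)) \<longlonglongrightarrow> 0" by (intro LIMSEQ_Suc lim_1_over_n)
  have "(\<lambda>n. mod_dist m' M (s n) v) \<longlonglongrightarrow> 0"
   by (rule tendsto_sandwich[OF always_eventually always_eventually tendsto_const z])
    (use s(2) MS.commute[of _ v] in \<open>auto intro: less_imp_le\<close>)
  from order_tendstoD(2)[OF mod_dist_smult_tendsto[OF F s(1) v this] e]
  obtain n where "mod_dist m' M (F \<odot> s n) (F \<odot> v) < eps" by (auto simp: eventually_sequentially)
  then show False using s(3)[of n] MS.commute[of "F \<odot> v"] by simp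
 qed
 show ?thesis
  unfolding MS.metric_continuous_map[OF MS.Metric_space_axioms]
 proof (intro conjI ballI allI impI)
  show "(\<lambda>v. F \<odot> v) ` carrier M \<subseteq> carrier M" using F by auto
 qed (use H in meson)
qed

text \<open>\<open>dual_map\<close> is extensional on the carrier of the dual, so its value on a sum
  can be computed only once the sum is known to be a functional.\<close>

lemma dual_add_closed:
 assumes mm: "metric_measure m" and L: "L \<in> carrier (dual_module m m' M)" and K: "K \<in> carrier (dual_module m m' M)"
 shows "L \<oplus>\<^bsub>dual_module m m' M\<^esub> K \<in> carrier (dual_module m m' M)"
proof -
 interpret R: cring "L0 m" by (rule cring_L0)
 have c: "!!v. v \<in> carrier M ==> L v \<in> carrier (L0 m)" "!!v. v \<in> carrier M ==> K v \<in> carrier (L0 m)"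
  using L K by (auto simp: dual_module_def)
 show ?thesis
  using L K continuous_map_L0_add[OF mm, of L K] c
  by (auto simp: dual_module_def R.a_ac R.r_distr)
qed

lemma dual_smult_closed:
 assumes F: "F \<in> carrier (L0 m)" and L: "L \<in> carrier (dual_module m m' M)"
 shows "F \<odot>\<^bsub>dual_module m m' M\<^esub> L \<in> carrier (dual_module m m' M)"
proof -
 interpret R: cring "L0 m" by (rule cring_L0)
 have c: "!!v. v \<in> carrier M ==> L v \<in> carrier (L0 m)" using L by (auto simp: dual_module_def)
 have "continuous_map (mod_topology m' M) (L0_topology m) (L \<circ> (\<lambda>v. F \<odot> v))"
  by (rule continuous_map_compose[OF continuous_map_smult[OF F]]) (use L in \<open>simp add: dual_module_def\<close>)
 then have "continuous_map (mod_topology m' M) (L0_topology m) (\<lambda>v\<in>carrier M. L (F \<odot> v))"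
  by (rule continuous_map_eq) auto
 then show ?thesis
  using L F c by (auto simp: dual_module_def smult_r_distr R.m_lcomm)
qed

end

section \<open>Transposition of isomorphisms\<close>

lemma module_iso_inverse:
 assumes N: "L0_module m m' N" and M: "L0_module m m' M" and I: "I \<in> module_iso m N M"
 shows "restrict (inv_into (carrier N) I) (carrier M) \<in> module_iso m M N"
proof -
 interpret N: L0_module m m' N by (rule N)
 interpret M: L0_module m m' M by (rule M)
 have bij: "bij_betw I (carrier N) (carrier M)" using I by (simp add: module_iso_def)
 let ?J = "inv_into (carrier N) I"
 have J: "w \<in> carrier M ==> ?J w \<in> carrier N" "w \<in> carrier M ==> I (?J w) = w"
  "v \<in> carrier N ==> ?J (I v) = v" for v w
  using bij bij_betw_inv_into_left[OF bij] bij_betw_inv_into_right[OF bij] bij_betw_apply[OF bij_betw_inv_into[OF bij]] by auto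
 have "?J (v \<oplus>\<^bsub>M\<^esub> w) = ?J v \<oplus>\<^bsub>N\<^esub> ?J w" if "v \<in> carrier M" "w \<in> carrier M" for v w
 proof -
  have "I (?J v \<oplus>\<^bsub>N\<^esub> ?J w) = v \<oplus>\<^bsub>M\<^esub> w" using I J that by (simp add: module_iso_def)
  then show ?thesis using J(3)[of "?J v \<oplus>\<^bsub>N\<^esub> ?J w"] J(1) that by simp
 qed
 moreover have "?J (F \<odot>\<^bsub>M\<^esub> w) = F \<odot>\<^bsub>N\<^esub> ?J w" if "F \<in> carrier (L0 m)" "w \<in> carrier M" for F w
 proof -
  have "I (F \<odot>\<^bsub>N\<^esub> ?J w) = F \<odot>\<^bsub>M\<^esub> w" using I J that by (simp add: module_iso_def)
  then show ?thesis using J(3)[of "F \<odot>\<^bsub>N\<^esub> ?J w"] J(1) that by simp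
 qed
 moreover have "pnorm N (?J w) = pnorm M w" if "w \<in> carrier M" for w
 proof -
  have "pnorm M (I (?J w)) = pnorm N (?J w)" using I J(1)[OF that] by (simp add: module_iso_def)
  then show ?thesis using J that by simp
 qed
 moreover have "bij_betw (restrict ?J (carrier M)) (carrier M) (carrier N)"
  using bij_betw_inv_into[OF bij] by (subst bij_betw_cong[of _ _ ?J]) auto
 ultimately show ?thesis using J(1) by (auto simp: module_iso_def)
qed

text \<open>An isomorphism preserves distances, hence is continuous, so composing with it keeps
  functionals continuous.\<close>

lemma dual_pullback:
 assumes N: "L0_module m m' N" and M: "L0_module m m' M" and I: "I \<in> module_iso m N M"
  and K: "K \<in> carrier (dual_module m m' M)"
 shows "(\<lambda>v\<in>carrier N. K (I v)) \<in> carrier (dual_module m m' N)"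
proof -
 interpret N: L0_module m m' N by (rule N)
 interpret M: L0_module m m' M by (rule M)
 have cl: "!!z. z \<in> carrier N ==> I z \<in> carrier M" using I by (auto simp: module_iso_def)
 have "continuous_map (mod_topology m' N) (mod_topology m' M) I"
  unfolding N.MS.metric_continuous_map[OF M.MS.Metric_space_axioms]
  using cl module_iso_dist[OF N M I] by auto
 then have "continuous_map (mod_topology m' N) (L0_topology m) (K \<circ> I)"
  by (rule continuous_map_compose) (use K in \<open>simp add: dual_module_def\<close>)
 then have "continuous_map (mod_topology m' N) (L0_topology m) (\<lambda>v\<in>carrier N. K (I v))"
  by (rule continuous_map_eq) auto
 then show ?thesis using K I cl by (auto simp: dual_module_def module_iso_def)
qed

text \<open>Pulling back along \<open>I\<close> and along its inverse undo each other. The norm is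
  preserved because \<open>I\<close> maps the elements of pointwise norm at most 1 onto those of
  \<open>M\<close>, so both essential suprema are taken over the same values.\<close>

theorem dual_map_module_iso:
 assumes mm: "metric_measure m" and N: "L0_module m m' N" and M: "L0_module m m' M" and I: "I \<in> module_iso m N M"
 shows "dual_map m m' N M I \<in> module_iso m (dual_module m m' N) (dual_module m m' M)"
proof -
 interpret N: L0_module m m' N by (rule N)
 interpret M: L0_module m m' M by (rule M)
 let ?N = "dual_module m m' N" and ?M = "dual_module m m' M"
 let ?J = "inv_into (carrier N) I"
 have bij: "bij_betw I (carrier N) (carrier M)" using I by (simp add: module_iso_def)
 note J = module_iso_inverse[OF N M I]
 have Jc: "w \<in> carrier M ==> ?J w \<in> carrier N" "w \<in> carrier M ==> I (?J w) = w"
  "v \<in> carrier N ==> ?J (I v) = v" "v \<in> carrier N ==> I v \<in> carrier M" for v w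
  using bij bij_betw_inv_into_left[OF bij] bij_betw_inv_into_right[OF bij] bij_betw_apply[OF bij_betw_inv_into[OF bij]] bij_betw_apply[OF bij] by auto
 have map: "dual_map m m' N M I L = (\<lambda>w\<in>carrier M. L (?J w))" if "L \<in> carrier ?N" for L
  using that by (simp add: dual_map_def)
 have closed: "dual_map m m' N M I L \<in> carrier ?M" if L: "L \<in> carrier ?N" for L
 proof -
  have "(\<lambda>w\<in>carrier M. L (restrict ?J (carrier M) w)) = (\<lambda>w\<in>carrier M. L (?J w))" by (rule restrict_ext) simp
  then show ?thesis using dual_pullback[OF M N J L] map[OF L] by simp
 qed
 have ext: "L = K" if "L \<in> carrier ?N" "K \<in> carrier ?N" "!!v. v \<in> carrier N ==> L v = K v" for L K
  using that by (auto simp: dual_module_def intro: PiE_ext)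
 have extM: "L = K" if "L \<in> carrier ?M" "K \<in> carrier ?M" "!!v. v \<in> carrier M ==> L v = K v" for L K
  using that by (auto simp: dual_module_def intro: PiE_ext)
 show ?thesis
  unfolding module_iso_def
 proof (intro CollectI conjI ballI)
  show "dual_map m m' N M I \<in> carrier ?N \<rightarrow>\<^sub>E carrier ?M" using closed by (auto simp: dual_map_def)
  show "bij_betw (dual_map m m' N M I) (carrier ?N) (carrier ?M)"
  proof (rule bij_betw_byWitness[where f' = "\<lambda>K. \<lambda>v\<in>carrier N. K (I v)"])
   show "\<forall>L\<in>carrier ?N. (\<lambda>v\<in>carrier N. dual_map m m' N M I L (I v)) = L"
    by (intro ballI ext dual_pullback[OF N M I] closed) (simp_all add: map Jc)
   show "\<forall>K\<in>carrier ?M. dual_map m m' N M I (\<lambda>v\<in>carrier N. K (I v)) = K"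
    by (intro ballI extM dual_pullback[OF N M I] closed) (simp_all add: map[OF dual_pullback[OF N M I]] Jc)
   show "dual_map m m' N M I ` carrier ?N \<subseteq> carrier ?M" using closed by blast
   show "(\<lambda>K. \<lambda>v\<in>carrier N. K (I v)) ` carrier ?M \<subseteq> carrier ?N" using dual_pullback[OF N M I] by blast
  qed
  fix L assume L: "L \<in> carrier ?N"
  show "dual_map m m' N M I (L \<oplus>\<^bsub>?N\<^esub> K) = dual_map m m' N M I L \<oplus>\<^bsub>?M\<^esub> dual_map m m' N M I K" if K: "K \<in> carrier ?N" for K
   unfolding map[OF L] map[OF K] map[OF N.dual_add_closed[OF mm L K]]
   by (auto simp: dual_module_def Jc intro!: restrict_ext)
  show "dual_map m m' N M I (F \<odot>\<^bsub>?N\<^esub> L) = F \<odot>\<^bsub>?M\<^esub> dual_map m m' N M I L" if F: "F \<in> carrier (L0 m)" for F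
  proof -
   have "?J (F \<odot>\<^bsub>M\<^esub> w) = F \<odot>\<^bsub>N\<^esub> ?J w" if "w \<in> carrier M" for w
    using J F that by (simp add: module_iso_def)
   then show ?thesis
    unfolding map[OF L] map[OF N.dual_smult_closed[OF F L]] using F
    by (auto simp: dual_module_def Jc intro!: restrict_ext)
  qed
  have "(\<lambda>w\<in>carrier M. L (?J w)) ` {w \<in> carrier M. L0_le m (pnorm M w) \<one>\<^bsub>L0 m\<^esub>} =
   L ` {v \<in> carrier N. L0_le m (pnorm N v) \<one>\<^bsub>L0 m\<^esub>}" (is "?A = ?B")
  proof
   have "pnorm N (?J w) = pnorm M w" if "w \<in> carrier M" for w using J that by (simp add: module_iso_def)
   then show "?A \<subseteq> ?B" using Jc by auto
   have "pnorm M (I v) = pnorm N v" if "v \<in> carrier N" for v using I that by (simp add: module_iso_def)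
   then show "?B \<subseteq> ?A"
   proof (intro image_subsetI)
    fix v assume "v \<in> {v \<in> carrier N. L0_le m (pnorm N v) \<one>\<^bsub>L0 m\<^esub>}"
    then show "L v \<in> ?A" using \<open>!!v. v \<in> carrier N ==> pnorm M (I v) = pnorm N v\<close> Jc
     by (intro image_eqI[of _ _ "I v"]) simp_all
   qed
  qed
  then show "pnorm ?M (dual_map m m' N M I L) = pnorm ?N L"
   unfolding map[OF L] by (simp add: dual_module_def)
 qed
qed

section \<open>Construction of the module\<close>

context seminormed_functions
begin

abbreviation form_diff :: "'x form => 'x form => 'x form" where
 "form_diff l l' \<equiv> l @ scale (\<lambda>_. -1) l'"

text \<open>The middle terms cancel in the total coefficients, which is all that
  \<open>fnorm_cong\<close> looks at. The other rules for differences use the same device.\<close>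

lemma fnorm_diff_triangle:
 assumes "l \<in> forms" "l' \<in> forms" "l'' \<in> forms"
 shows "AE x in m. fnorm (form_diff l l'') x <= fnorm (form_diff l l') x + fnorm (form_diff l' l'') x"
proof -
 have "AE x in m. fnorm (form_diff l l'') x = fnorm (form_diff l l' @ form_diff l' l'') x"
  by (rule fnorm_cong) (use assms in auto)
 moreover have "AE x in m. fnorm (form_diff l l' @ form_diff l' l'') x <= fnorm (form_diff l l') x + fnorm (form_diff l' l'') x"
  by (rule fnorm_append) (use assms in auto)
 ultimately show ?thesis by eventually_elim simp
qed

lemma fnorm_diff_sym:
 assumes "l \<in> forms" "l' \<in> forms"
 shows "AE x in m. fnorm (form_diff l l') x = fnorm (form_diff l' l) x"
proof -
 have "AE x in m. fnorm (form_diff l l') x = fnorm (scale (\<lambda>_. -1) (form_diff l' l)) x"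
  by (rule fnorm_cong) (use assms in auto)
 moreover have "AE x in m. fnorm (scale (\<lambda>_. -1) (form_diff l' l)) x = \<bar>-1\<bar> * fnorm (form_diff l' l) x"
  by (rule fnorm_scale) (use assms in auto)
 ultimately show ?thesis by eventually_elim simp
qed

lemma fnorm_le_diff:
 assumes "l \<in> forms" "l' \<in> forms"
 shows "AE x in m. fnorm l x <= fnorm l' x + fnorm (form_diff l l') x"
proof -
 have "AE x in m. fnorm l x = fnorm (l' @ form_diff l l') x"
  by (rule fnorm_cong) (use assms in auto)
 moreover have "AE x in m. fnorm (l' @ form_diff l l') x <= fnorm l' x + fnorm (form_diff l l') x"
  by (rule fnorm_append) (use assms in auto)
 ultimately show ?thesis by eventually_elim simp
qed

lemma fnorm_diff_append:
 assumes "l \<in> forms" "l' \<in> forms" "k \<in> forms" "k' \<in> forms"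
 shows "AE x in m. fnorm (form_diff (l @ k) (l' @ k')) x <= fnorm (form_diff l l') x + fnorm (form_diff k k') x"
proof -
 have "AE x in m. fnorm (form_diff (l @ k) (l' @ k')) x = fnorm (form_diff l l' @ form_diff k k') x"
  by (rule fnorm_cong) (use assms in \<open>auto simp: algebra_simps\<close>)
 moreover have "AE x in m. fnorm (form_diff l l' @ form_diff k k') x <= fnorm (form_diff l l') x + fnorm (form_diff k k') x"
  by (rule fnorm_append) (use assms in auto)
 ultimately show ?thesis by eventually_elim simp
qed

lemma fnorm_diff_scale:
 assumes "l \<in> forms" "l' \<in> forms" "\<phi> \<in> borel_fun"
 shows "AE x in m. fnorm (form_diff (scale \<phi> l) (scale \<phi> l')) x = \<bar>\<phi> x\<bar> * fnorm (form_diff l l') x"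
proof -
 have "AE x in m. fnorm (form_diff (scale \<phi> l) (scale \<phi> l')) x = fnorm (scale \<phi> (form_diff l l')) x"
  by (rule fnorm_cong) (use assms in \<open>auto simp: algebra_simps\<close>)
 moreover have "AE x in m. fnorm (scale \<phi> (form_diff l l')) x = \<bar>\<phi> x\<bar> * fnorm (form_diff l l') x"
  by (rule fnorm_scale) (use assms in auto)
 ultimately show ?thesis by eventually_elim simp
qed

lemma fnorm_diff_null:
 assumes "l \<in> forms" "l' \<in> forms" "AE x in m. \<forall>f. coef l x f = coef l' x f"
 shows "AE x in m. fnorm (form_diff l l') x = 0"
 by (rule fnorm_null) (use assms in auto)

section \<open>Almost everywhere Cauchy sequences of formal sums\<close>

text \<open>Cauchy at almost every point rather than in the integrated distance: norms then converge
  pointwise and the operations act term by term. Sequences with summable successive distances belong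
  to this set, which is enough for completeness.\<close>

definition cauchy_forms :: "(nat => 'x form) set" where
 "cauchy_forms = {s. (\<forall>k. s k \<in> forms) \<and>
   (AE x in m. \<forall>e>0. \<exists>K. \<forall>i\<ge>K. \<forall>j\<ge>K. fnorm (form_diff (s i) (s j)) x < e)}"

lemma cauchy_forms_forms [simp]: "s \<in> cauchy_forms ==> s k \<in> forms"
 by (simp add: cauchy_forms_def)

lemma cauchy_forms_AE:
 "s \<in> cauchy_forms ==> AE x in m. \<forall>e>0. \<exists>K. \<forall>i\<ge>K. \<forall>j\<ge>K. fnorm (form_diff (s i) (s j)) x < e"
 unfolding cauchy_forms_def by (drule CollectD) (erule conjunct2)

lemma cauchy_formsI:
 assumes "!!k. s k \<in> forms"
  and "AE x in m. \<forall>e>0. \<exists>K. \<forall>i\<ge>K. \<forall>j\<ge>K. fnorm (form_diff (s i) (s j)) x < e"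
 shows "s \<in> cauchy_forms"
 unfolding cauchy_forms_def by (intro CollectI conjI allI assms)

lemma cauchy_forms_const [simp]: "l \<in> forms ==> (\<lambda>_. l) \<in> cauchy_forms"
proof (rule cauchy_formsI)
 assume "l \<in> forms"
 then have "AE x in m. fnorm (form_diff l l) x = 0" by (intro fnorm_diff_null) auto
 then show "AE x in m. \<forall>e>0. \<exists>K::nat. \<forall>i\<ge>K. \<forall>j\<ge>K. fnorm (form_diff l l) x < e"
  by eventually_elim simp
qed

lemma cauchy_forms_append [simp]:
 assumes s: "s \<in> cauchy_forms" and t: "t \<in> cauchy_forms"
 shows "(\<lambda>k. s k @ t k) \<in> cauchy_forms"
proof -
 have 1: "AE x in m. \<forall>i j. fnorm (form_diff (s i @ t i) (s j @ t j)) x <= fnorm (form_diff (s i) (s j)) x + fnorm (form_diff (t i) (t j)) x"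
  unfolding AE_all_countable by (intro allI fnorm_diff_append) (use s t in auto)
 have 2: "AE x in m. \<forall>e>0. \<exists>K. \<forall>i\<ge>K. \<forall>j\<ge>K. fnorm (form_diff (s i) (s j)) x < e"
  "AE x in m. \<forall>e>0. \<exists>K. \<forall>i\<ge>K. \<forall>j\<ge>K. fnorm (form_diff (t i) (t j)) x < e"
  by (rule cauchy_forms_AE[OF s], rule cauchy_forms_AE[OF t])
 from 1 2 have "AE x in m. \<forall>e>0. \<exists>K. \<forall>i\<ge>K. \<forall>j\<ge>K. fnorm (form_diff (s i @ t i) (s j @ t j)) x < e"
 proof eventually_elim
  case (elim x)
  show ?case
  proof (intro allI impI)
   fix e :: real assume "0 < e"
   then have e: "0 < e / 2" by simp
   obtain K where K: "!!i j. K <= i ==> K <= j ==> fnorm (form_diff (s i) (s j)) x < e / 2" using elim(2)[rule_format, OF e] by blast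
   obtain K' where K': "!!i j. K' <= i ==> K' <= j ==> fnorm (form_diff (t i) (t j)) x < e / 2" using elim(3)[rule_format, OF e] by blast
   have "fnorm (form_diff (s i @ t i) (s j @ t j)) x < e" if "max K K' <= i" "max K K' <= j" for i j
    using elim(1)[rule_format, of i j] K[of i j] K'[of i j] that by linarith
   then show "\<exists>K. \<forall>i\<ge>K. \<forall>j\<ge>K. fnorm (form_diff (s i @ t i) (s j @ t j)) x < e" by blast
  qed
 qed
 then show ?thesis by (intro cauchy_formsI) (use s t in auto)
qed

lemma cauchy_forms_scale [simp]:
 assumes s: "s \<in> cauchy_forms" and \<phi>: "\<phi> \<in> borel_fun"
 shows "(\<lambda>k. scale \<phi> (s k)) \<in> cauchy_forms"
proof -
 have 1: "AE x in m. \<forall>i j. fnorm (form_diff (scale \<phi> (s i)) (scale \<phi> (s j))) x = \<bar>\<phi> x\<bar> * fnorm (form_diff (s i) (s j)) x"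
  unfolding AE_all_countable by (intro allI fnorm_diff_scale) (use s \<phi> in auto)
 have 2: "AE x in m. \<forall>e>0. \<exists>K. \<forall>i\<ge>K. \<forall>j\<ge>K. fnorm (form_diff (s i) (s j)) x < e"
  by (rule cauchy_forms_AE[OF s])
 from 1 2 have "AE x in m. \<forall>e>0. \<exists>K. \<forall>i\<ge>K. \<forall>j\<ge>K. fnorm (form_diff (scale \<phi> (s i)) (scale \<phi> (s j))) x < e"
 proof eventually_elim
  case (elim x)
  show ?case
  proof (intro allI impI)
   fix e :: real assume "0 < e"
   then have e: "0 < e / (1 + \<bar>\<phi> x\<bar>)" by (simp add: add_pos_nonneg)
   obtain K where K: "!!i j. K <= i ==> K <= j ==> fnorm (form_diff (s i) (s j)) x < e / (1 + \<bar>\<phi> x\<bar>)" using elim(2)[rule_format, OF e] by blast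
   have "fnorm (form_diff (scale \<phi> (s i)) (scale \<phi> (s j))) x < e" if "K <= i" "K <= j" for i j
   proof -
    have "\<bar>\<phi> x\<bar> * fnorm (form_diff (s i) (s j)) x <= (1 + \<bar>\<phi> x\<bar>) * fnorm (form_diff (s i) (s j)) x"
     by (rule mult_right_mono) (auto intro: fnorm_nonneg)
    also have "... < e" using K[OF that] by (simp add: pos_less_divide_eq add_pos_nonneg mult.commute)
    finally show ?thesis using elim(1) by simp
   qed
   then show "\<exists>K. \<forall>i\<ge>K. \<forall>j\<ge>K. fnorm (form_diff (scale \<phi> (s i)) (scale \<phi> (s j))) x < e" by blast
  qed
 qed
 then show ?thesis by (intro cauchy_formsI) (use s \<phi> in auto)
qed

text \<open>\<open>lim\<close> is total; for elements of \<open>cauchy_forms\<close> the limit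
  exists almost everywhere.\<close>

definition lim_norm :: "(nat => 'x form) => 'x => real" where
 "lim_norm s x = lim (\<lambda>k. fnorm (s k) x)"

lemma lim_norm_measurable: "s \<in> cauchy_forms ==> lim_norm s \<in> borel_fun"
 unfolding lim_norm_def[abs_def] by (rule borel_measurable_lim_metric) (simp add: fnorm_measurable)

lemma fnorm_tendsto_lim_norm:
 assumes s: "s \<in> cauchy_forms"
 shows "AE x in m. (\<lambda>k. fnorm (s k) x) \<longlonglongrightarrow> lim_norm s x"
proof -
 have 1: "AE x in m. \<forall>i j. fnorm (s i) x <= fnorm (s j) x + fnorm (form_diff (s i) (s j)) x"
  unfolding AE_all_countable by (intro allI fnorm_le_diff) (use s in auto)
 have 2: "AE x in m. \<forall>e>0. \<exists>K. \<forall>i\<ge>K. \<forall>j\<ge>K. fnorm (form_diff (s i) (s j)) x < e"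
  by (rule cauchy_forms_AE[OF s])
 from 1 2 show ?thesis
 proof eventually_elim
  case (elim x)
  have "Cauchy (\<lambda>k. fnorm (s k) x)"
   unfolding Cauchy_def
  proof (intro allI impI)
   fix e :: real assume e: "0 < e"
   obtain K where K: "!!i j. K <= i ==> K <= j ==> fnorm (form_diff (s i) (s j)) x < e" using elim(2)[rule_format, OF e] by blast
   have "dist (fnorm (s i) x) (fnorm (s j) x) < e" if "K <= i" "K <= j" for i j
    using elim(1)[rule_format, of i j] elim(1)[rule_format, of j i] K[OF that] K[OF that(2,1)] unfolding dist_real_def by linarith
   then show "\<exists>K. \<forall>i\<ge>K. \<forall>j\<ge>K. dist (fnorm (s i) x) (fnorm (s j) x) < e" by blast
  qed
  then show ?case unfolding lim_norm_def by (simp add: Cauchy_convergent_iff convergent_LIMSEQ_iff)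
 qed
qed

lemma lim_norm_nonneg: "s \<in> cauchy_forms ==> AE x in m. 0 <= lim_norm s x"
 using fnorm_tendsto_lim_norm[of s] by (auto elim!: eventually_mono intro: LIMSEQ_le_const fnorm_nonneg)

lemma lim_norm_eqI:
 assumes "s \<in> cauchy_forms" "AE x in m. (\<lambda>k. fnorm (s k) x) \<longlonglongrightarrow> h x"
 shows "AE x in m. lim_norm s x = h x"
 using fnorm_tendsto_lim_norm[OF assms(1)] assms(2) by eventually_elim (rule LIMSEQ_unique)

lemma lim_norm_le:
 assumes "s \<in> cauchy_forms" "t \<in> cauchy_forms" "u \<in> cauchy_forms"
  and "!!k. AE x in m. fnorm (u k) x <= fnorm (s k) x + fnorm (t k) x"
 shows "AE x in m. lim_norm u x <= lim_norm s x + lim_norm t x"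
proof -
 have "AE x in m. \<forall>k. fnorm (u k) x <= fnorm (s k) x + fnorm (t k) x" unfolding AE_all_countable using assms(4) by blast
 with assms(1-3)[THEN fnorm_tendsto_lim_norm] show ?thesis
 proof eventually_elim
  case (elim x)
  show ?case by (rule LIMSEQ_le[OF elim(3) tendsto_add[OF elim(1,2)]]) (use elim(4) in blast)
 qed
qed

abbreviation seq_diff :: "(nat => 'x form) => (nat => 'x form) => nat => 'x form" where
 "seq_diff s t \<equiv> \<lambda>k. form_diff (s k) (t k)"

definition lim_class :: "(nat => 'x form) => (nat => 'x form) set" where
 "lim_class s = {t \<in> cauchy_forms. AE x in m. lim_norm (seq_diff s t) x = 0}"

lemma lim_norm_diff_triangle:
 assumes "s \<in> cauchy_forms" "t \<in> cauchy_forms" "u \<in> cauchy_forms"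
 shows "AE x in m. lim_norm (seq_diff s u) x <= lim_norm (seq_diff s t) x + lim_norm (seq_diff t u) x"
 by (rule lim_norm_le) (use assms in \<open>auto intro!: fnorm_diff_triangle\<close>)

lemma lim_norm_diff_sym:
 assumes "s \<in> cauchy_forms" "t \<in> cauchy_forms"
 shows "AE x in m. lim_norm (seq_diff s t) x = lim_norm (seq_diff t s) x"
proof (rule lim_norm_eqI)
 have "AE x in m. \<forall>k. fnorm (form_diff (s k) (t k)) x = fnorm (form_diff (t k) (s k)) x"
  unfolding AE_all_countable by (intro allI fnorm_diff_sym) (use assms in auto)
 moreover have "AE x in m. (\<lambda>k. fnorm (form_diff (t k) (s k)) x) \<longlonglongrightarrow> lim_norm (seq_diff t s) x"
  by (rule fnorm_tendsto_lim_norm) (use assms in auto)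
 ultimately show "AE x in m. (\<lambda>k. fnorm (form_diff (s k) (t k)) x) \<longlonglongrightarrow> lim_norm (seq_diff t s) x"
  by eventually_elim simp
qed (use assms in auto)

lemma lim_norm_diff_null:
 assumes "s \<in> cauchy_forms" "t \<in> cauchy_forms" "!!k. AE x in m. fnorm (form_diff (s k) (t k)) x = 0"
 shows "AE x in m. lim_norm (seq_diff s t) x = 0"
proof (rule lim_norm_eqI)
 have "AE x in m. \<forall>k. fnorm (form_diff (s k) (t k)) x = 0" unfolding AE_all_countable using assms(3) by blast
 then show "AE x in m. (\<lambda>k. fnorm (form_diff (s k) (t k)) x) \<longlonglongrightarrow> 0" by eventually_elim simp
qed (use assms in auto)

lemma lim_class_self: "s \<in> cauchy_forms ==> s \<in> lim_class s"
 using lim_norm_diff_null[of s s] fnorm_diff_null by (simp add: lim_class_def)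

lemma lim_class_eq_iff:
 assumes s: "s \<in> cauchy_forms" and t: "t \<in> cauchy_forms"
 shows "lim_class s = lim_class t \<longleftrightarrow> (AE x in m. lim_norm (seq_diff s t) x = 0)"
proof
 assume "lim_class s = lim_class t"
 then have "t \<in> lim_class s" using lim_class_self[OF t] by simp
 then show "AE x in m. lim_norm (seq_diff s t) x = 0" by (simp add: lim_class_def)
next
 assume z: "AE x in m. lim_norm (seq_diff s t) x = 0"
 have z': "AE x in m. lim_norm (seq_diff t s) x = 0"
  using z lim_norm_diff_sym[OF s t] by eventually_elim simp
 have sub: "lim_class s \<subseteq> lim_class t"
  if s: "s \<in> cauchy_forms" and t: "t \<in> cauchy_forms" and z: "AE x in m. lim_norm (seq_diff t s) x = 0" for s t
 proof
  fix u assume "u \<in> lim_class s"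
  then have u: "u \<in> cauchy_forms" and z2: "AE x in m. lim_norm (seq_diff s u) x = 0" by (auto simp: lim_class_def)
  have ut: "seq_diff t u \<in> cauchy_forms" using t u by simp
  from z z2 lim_norm_diff_triangle[OF t s u] lim_norm_nonneg[OF ut]
  have "AE x in m. lim_norm (seq_diff t u) x = 0" by eventually_elim simp
  then show "u \<in> lim_class t" using u by (simp add: lim_class_def)
 qed
 show "lim_class s = lim_class t" using sub[OF s t z'] sub[OF t s z] by blast
qed

lemma lim_class_eqI:
 assumes s: "s \<in> cauchy_forms" "t \<in> cauchy_forms"
  and c: "!!k. AE x in m. \<forall>f. coef (s k) x f = coef (t k) x f"
 shows "lim_class s = lim_class t"
 unfolding lim_class_eq_iff[OF s] by (intro lim_norm_diff_null s fnorm_diff_null c) (use s in auto)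

definition seq_rep :: "(nat => 'x form) set => nat => 'x form" where
 "seq_rep V = (SOME s. s \<in> V)"

lemma seq_rep:
 assumes "s \<in> cauchy_forms"
 shows "seq_rep (lim_class s) \<in> cauchy_forms" "AE x in m. lim_norm (seq_diff s (seq_rep (lim_class s))) x = 0"
proof -
 have "seq_rep (lim_class s) \<in> lim_class s" unfolding seq_rep_def
  by (rule someI[of "\<lambda>t. t \<in> lim_class s", OF lim_class_self[OF assms]])
 then show "seq_rep (lim_class s) \<in> cauchy_forms" "AE x in m. lim_norm (seq_diff s (seq_rep (lim_class s))) x = 0"
  by (simp_all add: lim_class_def)
qed

text \<open>The operations are defined on chosen representatives, of the sequences by
  \<open>seq_rep\<close> and of the scalars by \<open>L0_rep\<close>; independence of these choices
  is the content of the following computation rules.\<close>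

definition form_module :: "('x, 'x formal_forms) normed_module" where
 "form_module = \<lparr>carrier = lim_class ` cauchy_forms, monoid.mult = undefined, one = undefined,
   zero = lim_class (\<lambda>_. []), add = (\<lambda>V V'. lim_class (\<lambda>k. seq_rep V k @ seq_rep V' k)),
   smult = (\<lambda>F V. lim_class (\<lambda>k. scale (L0_rep F) (seq_rep V k))),
   pnorm = (\<lambda>V. L0_class m (lim_norm (seq_rep V)))\<rparr>"

lemma form_module_carrier: "carrier form_module = lim_class ` cauchy_forms"
 and form_module_zero: "\<zero>\<^bsub>form_module\<^esub> = lim_class (\<lambda>_. [])"
 by (simp_all add: form_module_def)

lemma form_module_add:
 assumes s: "s \<in> cauchy_forms" and t: "t \<in> cauchy_forms"
 shows "lim_class s \<oplus>\<^bsub>form_module\<^esub> lim_class t = lim_class (\<lambda>k. s k @ t k)"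
proof -
 let ?s = "seq_rep (lim_class s)" and ?t = "seq_rep (lim_class t)"
 note s' = seq_rep[OF s] and t' = seq_rep[OF t]
 have c: "seq_diff (\<lambda>k. s k @ t k) (\<lambda>k. ?s k @ ?t k) \<in> cauchy_forms" using s t s' t' by simp
 have c': "seq_diff s ?s \<in> cauchy_forms" "seq_diff t ?t \<in> cauchy_forms" using s t s'(1) t'(1) by simp_all
 have "AE x in m. fnorm (form_diff (s k @ t k) (?s k @ ?t k)) x <= fnorm (form_diff (s k) (?s k)) x + fnorm (form_diff (t k) (?t k)) x" for k
  by (rule fnorm_diff_append) (use s t s'(1) t'(1) in simp_all)
 from lim_norm_le[OF c' c this]
 have "AE x in m. lim_norm (seq_diff (\<lambda>k. s k @ t k) (\<lambda>k. ?s k @ ?t k)) x <= lim_norm (seq_diff s ?s) x + lim_norm (seq_diff t ?t) x" .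
 with s'(2) t'(2) lim_norm_nonneg[OF c]
 have "AE x in m. lim_norm (seq_diff (\<lambda>k. s k @ t k) (\<lambda>k. ?s k @ ?t k)) x = 0" by eventually_elim simp
 then have "lim_class (\<lambda>k. s k @ t k) = lim_class (\<lambda>k. ?s k @ ?t k)"
  by (subst lim_class_eq_iff) (use s t s' t' in auto)
 then show ?thesis by (simp add: form_module_def)
qed

text \<open>Two choices are undone one after the other: the representative sequence, through norms,
  and the representative of the scalar, through coefficients.\<close>

lemma form_module_smult:
 assumes \<phi>: "\<phi> \<in> borel_fun" and s: "s \<in> cauchy_forms"
 shows "L0_class m \<phi> \<odot>\<^bsub>form_module\<^esub> lim_class s = lim_class (\<lambda>k. scale \<phi> (s k))"
proof -
 let ?s = "seq_rep (lim_class s)" and ?\<phi> = "L0_rep (L0_class m \<phi>)"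
 note s' = seq_rep[OF s]
 have \<phi>': "?\<phi> \<in> borel_fun" "AE x in m. ?\<phi> x = \<phi> x" using L0_rep_class[of \<phi> m] \<phi> by auto
 have "AE x in m. lim_norm (seq_diff (\<lambda>k. scale \<phi> (s k)) (\<lambda>k. scale \<phi> (?s k))) x = 0"
 proof (rule lim_norm_eqI)
  have "AE x in m. \<forall>k. fnorm (form_diff (scale \<phi> (s k)) (scale \<phi> (?s k))) x = \<bar>\<phi> x\<bar> * fnorm (form_diff (s k) (?s k)) x"
   unfolding AE_all_countable by (intro allI fnorm_diff_scale) (use s s' \<phi> in auto)
  moreover have "AE x in m. (\<lambda>k. fnorm (form_diff (s k) (?s k)) x) \<longlonglongrightarrow> lim_norm (seq_diff s ?s) x"
   by (rule fnorm_tendsto_lim_norm) (use s s' in auto)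
  ultimately show "AE x in m. (\<lambda>k. fnorm (form_diff (scale \<phi> (s k)) (scale \<phi> (?s k))) x) \<longlonglongrightarrow> 0"
   using s'(2)
  proof eventually_elim
   case (elim x)
   then have "(\<lambda>k. \<bar>\<phi> x\<bar> * fnorm (form_diff (s k) (?s k)) x) \<longlonglongrightarrow> \<bar>\<phi> x\<bar> * 0" by (intro tendsto_mult tendsto_const) simp
   then show ?case using elim(1) by simp
  qed
 qed (use s s' \<phi> in auto)
 then have "lim_class (\<lambda>k. scale \<phi> (s k)) = lim_class (\<lambda>k. scale \<phi> (?s k))"
  by (subst lim_class_eq_iff) (use s s' \<phi> in auto)
 also have "... = lim_class (\<lambda>k. scale ?\<phi> (?s k))"
 proof (rule lim_class_eqI)
  show "AE x in m. \<forall>f. coef (scale \<phi> (?s k)) x f = coef (scale ?\<phi> (?s k)) x f" for k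
   using \<phi>'(2) by eventually_elim simp
 qed (use s' \<phi> \<phi>' in auto)
 finally show ?thesis by (simp add: form_module_def)
qed

lemma form_module_pnorm:
 assumes s: "s \<in> cauchy_forms"
 shows "pnorm form_module (lim_class s) = L0_class m (lim_norm s)"
proof -
 let ?s = "seq_rep (lim_class s)"
 note s' = seq_rep[OF s]
 have le: "AE x in m. lim_norm s x <= lim_norm ?s x + lim_norm (seq_diff s ?s) x"
  by (rule lim_norm_le) (use s s'(1) in \<open>auto intro!: fnorm_le_diff\<close>)
 have le': "AE x in m. lim_norm ?s x <= lim_norm s x + lim_norm (seq_diff ?s s) x"
  by (rule lim_norm_le) (use s s'(1) in \<open>auto intro!: fnorm_le_diff\<close>)
 from le le' s'(2) lim_norm_diff_sym[OF s s'(1)] have "AE x in m. lim_norm ?s x = lim_norm s x"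
  by eventually_elim simp
 then show ?thesis unfolding form_module_def
  using lim_norm_measurable[OF s] lim_norm_measurable[OF s'(1)] by (simp add: L0_class_eq_iff)
qed

section \<open>Module axioms and distance\<close>

lemma form_module_module: "Module.module (L0 m) form_module"
proof (rule moduleI)
 show "cring (L0 m)" by (rule cring_L0)
 show "abelian_group form_module"
 proof (rule abelian_groupI)
  fix V assume "V \<in> carrier form_module"
  then obtain s where s: "s \<in> cauchy_forms" "V = lim_class s" by (auto simp: form_module_carrier)
  have "lim_class (\<lambda>k. scale (\<lambda>_. -1) (s k)) \<oplus>\<^bsub>form_module\<^esub> V = \<zero>\<^bsub>form_module\<^esub>"
   using s by (simp add: form_module_add form_module_zero) (rule lim_class_eqI; simp)
  then show "\<exists>V'\<in>carrier form_module. V' \<oplus>\<^bsub>form_module\<^esub> V = \<zero>\<^bsub>form_module\<^esub>"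
   using s by (intro bexI[of _ "lim_class (\<lambda>k. scale (\<lambda>_. -1) (s k))"]) (auto simp: form_module_carrier)
 next
  fix V V' assume "V \<in> carrier form_module" "V' \<in> carrier form_module"
  then obtain s t where s: "s \<in> cauchy_forms" "V = lim_class s" "t \<in> cauchy_forms" "V' = lim_class t" by (auto simp: form_module_carrier)
  show "V \<oplus>\<^bsub>form_module\<^esub> V' \<in> carrier form_module" using s by (simp add: form_module_add form_module_carrier)
  show "V \<oplus>\<^bsub>form_module\<^esub> V' = V' \<oplus>\<^bsub>form_module\<^esub> V"
   using s by (simp add: form_module_add) (rule lim_class_eqI; simp)
 qed (auto simp: form_module_carrier form_module_zero form_module_add)
next
 fix F V assume "F \<in> carrier (L0 m)" "V \<in> carrier form_module"
 then obtain \<phi> s where s: "s \<in> cauchy_forms" "V = lim_class s" "\<phi> \<in> borel_fun" "F = L0_class m \<phi>"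
  by (auto simp: form_module_carrier elim: L0_cases)
 then show "F \<odot>\<^bsub>form_module\<^esub> V \<in> carrier form_module" by (simp add: form_module_smult form_module_carrier)
next
 fix F G V assume "F \<in> carrier (L0 m)" "G \<in> carrier (L0 m)" "V \<in> carrier form_module"
 then obtain \<phi> \<psi> s where s [simp]: "s \<in> cauchy_forms" "V = lim_class s" "\<phi> \<in> borel_fun" "F = L0_class m \<phi>"
  "\<psi> \<in> borel_fun" "G = L0_class m \<psi>"
  by (auto simp: form_module_carrier elim!: L0_cases)
 have [simp]: "(\<lambda>x. \<phi> x + \<psi> x) \<in> borel_fun" "(\<lambda>x. \<phi> x * \<psi> x) \<in> borel_fun"
  using s(3,5) by measurable
 show "(F \<oplus>\<^bsub>L0 m\<^esub> G) \<odot>\<^bsub>form_module\<^esub> V = F \<odot>\<^bsub>form_module\<^esub> V \<oplus>\<^bsub>form_module\<^esub> G \<odot>\<^bsub>form_module\<^esub> V"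
  by (simp add: form_module_smult form_module_add) (rule lim_class_eqI; simp add: algebra_simps)
 show "(F \<otimes>\<^bsub>L0 m\<^esub> G) \<odot>\<^bsub>form_module\<^esub> V = F \<odot>\<^bsub>form_module\<^esub> (G \<odot>\<^bsub>form_module\<^esub> V)"
  by (simp add: form_module_smult) (rule lim_class_eqI; simp add: algebra_simps)
next
 fix F V V' assume "F \<in> carrier (L0 m)" "V \<in> carrier form_module" "V' \<in> carrier form_module"
 then obtain \<phi> s t where s [simp]: "s \<in> cauchy_forms" "V = lim_class s" "\<phi> \<in> borel_fun" "F = L0_class m \<phi>"
  "t \<in> cauchy_forms" "V' = lim_class t"
  by (auto simp: form_module_carrier elim!: L0_cases)
 show "F \<odot>\<^bsub>form_module\<^esub> (V \<oplus>\<^bsub>form_module\<^esub> V') = F \<odot>\<^bsub>form_module\<^esub> V \<oplus>\<^bsub>form_module\<^esub> F \<odot>\<^bsub>form_module\<^esub> V'"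
  by (simp add: form_module_smult form_module_add) (rule lim_class_eqI; simp add: algebra_simps)
next
 fix V assume "V \<in> carrier form_module"
 then obtain s where s [simp]: "s \<in> cauchy_forms" "V = lim_class s" by (auto simp: form_module_carrier)
 show "\<one>\<^bsub>L0 m\<^esub> \<odot>\<^bsub>form_module\<^esub> V = V"
  by (simp add: L0_one_class form_module_smult) (rule lim_class_eqI; simp)
qed

lemma form_module_minus:
 assumes s: "s \<in> cauchy_forms" and t: "t \<in> cauchy_forms"
 shows "lim_class s \<ominus>\<^bsub>form_module\<^esub> lim_class t = lim_class (seq_diff s t)"
proof -
 interpret Module.module "L0 m" form_module by (rule form_module_module)
 have "\<ominus>\<^bsub>form_module\<^esub> lim_class t = lim_class (\<lambda>k. scale (\<lambda>_. -1) (t k))"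
 proof (rule M.minus_equality)
  show "lim_class (\<lambda>k. scale (\<lambda>_. -1) (t k)) \<oplus>\<^bsub>form_module\<^esub> lim_class t = \<zero>\<^bsub>form_module\<^esub>"
   using t by (simp add: form_module_add form_module_zero) (rule lim_class_eqI; simp)
 qed (use t in \<open>auto simp: form_module_carrier\<close>)
 then show ?thesis using s t by (simp add: a_minus_def form_module_add)
qed

lemma form_module_dist:
 assumes s: "s \<in> cauchy_forms" and t: "t \<in> cauchy_forms"
 shows "mod_dist m' form_module (lim_class s) (lim_class t) = trunc_int (lim_norm (seq_diff s t))"
proof -
 have st: "seq_diff s t \<in> cauchy_forms" using s t by simp
 note b = lim_norm_measurable[OF st]
 have "mod_dist m' form_module (lim_class s) (lim_class t) = trunc_int (L0_rep (L0_class m (lim_norm (seq_diff s t))))"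
  using s t st by (simp add: mod_dist_def form_module_carrier form_module_minus form_module_pnorm trunc_int_def)
 also have "... = trunc_int (lim_norm (seq_diff s t))"
  by (rule trunc_int_cong_AE) (use L0_rep_class[of "lim_norm (seq_diff s t)" m] b in auto)
 finally show ?thesis .
qed

lemma form_module_metric: "Metric_space (carrier form_module) (mod_dist m' form_module)"
proof
 fix V V'
 show "0 <= mod_dist m' form_module V V'"
 proof (cases "V \<in> carrier form_module \<and> V' \<in> carrier form_module")
  case True
  then obtain s t where s: "s \<in> cauchy_forms" "V = lim_class s" "t \<in> cauchy_forms" "V' = lim_class t" by (auto simp: form_module_carrier)
  then show ?thesis by (simp add: form_module_dist trunc_int_nonneg lim_norm_nonneg)
 qed (auto simp: mod_dist_def)
 show "mod_dist m' form_module V V' = mod_dist m' form_module V' V"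
 proof (cases "V \<in> carrier form_module \<and> V' \<in> carrier form_module")
  case True
  then obtain s t where s: "s \<in> cauchy_forms" "V = lim_class s" "t \<in> cauchy_forms" "V' = lim_class t" by (auto simp: form_module_carrier)
  have "trunc_int (lim_norm (seq_diff s t)) = trunc_int (lim_norm (seq_diff t s))"
   by (rule trunc_int_cong_AE) (use s in \<open>auto intro!: lim_norm_measurable lim_norm_diff_sym\<close>)
  then show ?thesis using s by (simp add: form_module_dist)
 qed (auto simp: mod_dist_def)
next
 fix V V' assume "V \<in> carrier form_module" "V' \<in> carrier form_module"
 then obtain s t where s: "s \<in> cauchy_forms" "V = lim_class s" "t \<in> cauchy_forms" "V' = lim_class t" by (auto simp: form_module_carrier)
 have st: "seq_diff s t \<in> cauchy_forms" using s by simp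
 show "mod_dist m' form_module V V' = 0 \<longleftrightarrow> V = V'"
  using s lim_class_eq_iff[OF s(1,3)] trunc_int_zero_iff[OF lim_norm_measurable[OF st] lim_norm_nonneg[OF st]]
  by (simp add: form_module_dist)
next
 fix V V' V'' assume "V \<in> carrier form_module" "V' \<in> carrier form_module" "V'' \<in> carrier form_module"
 then obtain s t u where s: "s \<in> cauchy_forms" "V = lim_class s" "t \<in> cauchy_forms" "V' = lim_class t"
  "u \<in> cauchy_forms" "V'' = lim_class u" by (auto simp: form_module_carrier)
 have c: "seq_diff s t \<in> cauchy_forms" "seq_diff t u \<in> cauchy_forms" "seq_diff s u \<in> cauchy_forms" using s by auto
 note b = c[THEN lim_norm_measurable]
 have "trunc_int (lim_norm (seq_diff s u)) <= trunc_int (\<lambda>x. lim_norm (seq_diff s t) x + lim_norm (seq_diff t u) x)"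
  using b by (intro trunc_int_mono lim_norm_nonneg c lim_norm_diff_triangle[OF s(1,3,5)]) auto
 also have "... <= trunc_int (lim_norm (seq_diff s t)) + trunc_int (lim_norm (seq_diff t u))"
  by (intro trunc_int_add b lim_norm_nonneg c)
 finally show "mod_dist m' form_module V V'' <= mod_dist m' form_module V V' + mod_dist m' form_module V' V''"
  using s by (simp add: form_module_dist)
qed

end

section \<open>Completeness and the differential\<close>

text \<open>The truncated series has a finite integral, hence converges almost everywhere; its terms
  then tend to 0, so from some index on the truncation at 1 has no effect.\<close>

lemma (in L0_setting) trunc_int_summable_AE:
 assumes h: "!!n. h n \<in> borel_fun" "!!n. AE x in m. 0 <= h n x"
  and le: "!!n. trunc_int (h n) <= b n" and b: "summable b"
 shows "AE x in m. summable (\<lambda>n. h n x)"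
proof -
 note [measurable] = h(1)
 have b0: "0 <= b n" for n using trunc_int_nonneg[OF h(2)] le by (rule order_trans)
 have nn: "AE x in m'. \<forall>n. 0 <= h n x" unfolding AE_m' AE_all_countable using h(2) by blast
 have "(\<integral>\<^sup>+x. (\<Sum>n. ennreal (min (h n x) 1)) \<partial>m') = (\<Sum>n. \<integral>\<^sup>+x. ennreal (min (h n x) 1) \<partial>m')"
  by (rule nn_integral_suminf) measurable
 also have "... <= (\<Sum>n. ennreal (b n))"
 proof (rule suminf_le)
  fix n
  have "(\<integral>\<^sup>+x. ennreal (min (h n x) 1) \<partial>m') = ennreal (trunc_int (h n))"
   unfolding trunc_int_def
   by (rule nn_integral_eq_integral[OF integrable_trunc[OF h]]) (use nn in \<open>eventually_elim, auto\<close>)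
  then show "(\<integral>\<^sup>+x. ennreal (min (h n x) 1) \<partial>m') <= ennreal (b n)" using le[of n] by (simp add: ennreal_leI)
 qed auto
 also have "... = ennreal (\<Sum>n. b n)" by (rule suminf_ennreal2[OF b0 b])
 finally have "(\<integral>\<^sup>+x. (\<Sum>n. ennreal (min (h n x) 1)) \<partial>m') < \<infinity>" by (simp add: le_less_trans)
 then have "AE x in m'. (\<Sum>n. ennreal (min (h n x) 1)) \<noteq> \<infinity>"
  by (intro nn_integral_noteq_infinite) auto
 with nn have "AE x in m'. summable (\<lambda>n. h n x)"
 proof eventually_elim
  case (elim x)
  have s: "summable (\<lambda>n. min (h n x) 1)"
   by (rule summable_suminf_not_top) (use elim in auto)
  have "eventually (\<lambda>n. min (h n x) 1 < 1) sequentially"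
   using summable_LIMSEQ_zero[OF s] by (rule order_tendstoD) simp
  then have "eventually (\<lambda>n. min (h n x) 1 = h n x) sequentially" by eventually_elim auto
  then show ?case using s by (simp add: summable_cong)
 qed
 then show ?thesis by simp
qed

context seminormed_functions
begin

lemma lim_norm_const: "l \<in> forms ==> AE x in m. lim_norm (\<lambda>_. l) x = fnorm l x"
 by (rule lim_norm_eqI) auto

lemma form_module_dist_const:
 assumes "l \<in> forms" "l' \<in> forms"
 shows "mod_dist m' form_module (lim_class (\<lambda>_. l)) (lim_class (\<lambda>_. l')) = trunc_int (fnorm (form_diff l l'))"
 unfolding form_module_dist[OF cauchy_forms_const[OF assms(1)] cauchy_forms_const[OF assms(2)]]
 by (rule trunc_int_cong_AE) (use assms in \<open>auto intro!: lim_norm_measurable fnorm_measurable lim_norm_const\<close>)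

text \<open>The pointwise Cauchy condition makes the norm of \<open>s n\<close> minus the class of
  \<open>s\<close> tend to 0 almost everywhere, and truncated integrals follow. Classes of constant
  sequences are therefore dense.\<close>

lemma lim_class_const_tendsto:
 assumes s: "s \<in> cauchy_forms"
 shows "(\<lambda>n. mod_dist m' form_module (lim_class (\<lambda>_. s n)) (lim_class s)) \<longlonglongrightarrow> 0"
proof -
 have c: "seq_diff (\<lambda>_. s n) s \<in> cauchy_forms" for n using s by simp
 have eq: "mod_dist m' form_module (lim_class (\<lambda>_. s n)) (lim_class s) = trunc_int (lim_norm (seq_diff (\<lambda>_. s n) s))" for n
  using s by (simp add: form_module_dist)
 have lim: "AE x in m. \<forall>n. (\<lambda>k. fnorm (form_diff (s n) (s k)) x) \<longlonglongrightarrow> lim_norm (seq_diff (\<lambda>_. s n) s) x"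
  unfolding AE_all_countable using fnorm_tendsto_lim_norm[OF c] by blast
 have nn: "AE x in m. \<forall>n. 0 <= lim_norm (seq_diff (\<lambda>_. s n) s) x"
  unfolding AE_all_countable using lim_norm_nonneg[OF c] by blast
 from lim nn cauchy_forms_AE[OF s] have "AE x in m. (\<lambda>n. lim_norm (seq_diff (\<lambda>_. s n) s) x) \<longlonglongrightarrow> 0"
 proof eventually_elim
  case (elim x)
  show ?case
  proof (rule LIMSEQ_I)
   fix e :: real assume "0 < e"
   then have e: "0 < e / 2" by simp
   obtain K where K: "!!i j. K <= i ==> K <= j ==> fnorm (form_diff (s i) (s j)) x < e / 2" using elim(3)[rule_format, OF e] by blast
   have "norm (lim_norm (seq_diff (\<lambda>_. s n) s) x - 0) < e" if n: "K <= n" for n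
   proof -
    have "lim_norm (seq_diff (\<lambda>_. s n) s) x <= e / 2"
     by (rule LIMSEQ_le_const2[OF elim(1)[rule_format, of n]]) (use K n in \<open>auto intro!: exI[of _ K] less_imp_le\<close>)
    then show ?thesis using elim(2)[rule_format, of n] \<open>0 < e\<close> by simp
   qed
   then show "\<exists>N. \<forall>n\<ge>N. norm (lim_norm (seq_diff (\<lambda>_. s n) s) x - 0) < e" by blast
  qed
 qed
 then show ?thesis unfolding eq
  by (intro trunc_int_tendsto_zero lim_norm_measurable[OF c] lim_norm_nonneg[OF c])
qed

lemma lim_class_const_dense:
 assumes V: "V \<in> carrier form_module" and e: "0 < eps"
 shows "\<exists>l\<in>forms. mod_dist m' form_module V (lim_class (\<lambda>_. l)) < eps"
proof -
 interpret MS: Metric_space "carrier form_module" "mod_dist m' form_module" by (rule form_module_metric)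
 obtain s where s: "s \<in> cauchy_forms" "V = lim_class s" using V by (auto simp: form_module_carrier)
 obtain n where "mod_dist m' form_module (lim_class (\<lambda>_. s n)) (lim_class s) < eps"
  using order_tendstoD(2)[OF lim_class_const_tendsto[OF s(1)] e] by (auto simp: eventually_sequentially)
 then show ?thesis using s MS.commute[of V] by (intro bexI[of _ "s n"]) auto
qed

text \<open>Telescoping: the norm of a difference is at most the difference of two partial sums of
  the convergent series.\<close>

lemma summable_forms_cauchy:
 assumes u: "!!k::nat. u k \<in> forms" and s: "AE x in m. summable (\<lambda>k. fnorm (form_diff (u k) (u (Suc k))) x)"
 shows "u \<in> cauchy_forms"
proof (rule cauchy_formsI)
 have "AE x in m. \<forall>i j k. fnorm (form_diff (u i) (u k)) x <= fnorm (form_diff (u i) (u j)) x + fnorm (form_diff (u j) (u k)) x"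
  "AE x in m. \<forall>i. fnorm (form_diff (u i) (u i)) x = 0"
  "AE x in m. \<forall>i j. fnorm (form_diff (u i) (u j)) x = fnorm (form_diff (u j) (u i)) x"
  unfolding AE_all_countable by (intro allI fnorm_diff_triangle fnorm_diff_null fnorm_diff_sym u; simp)+
 with s show "AE x in m. \<forall>e>0. \<exists>K. \<forall>i\<ge>K. \<forall>j\<ge>K. fnorm (form_diff (u i) (u j)) x < e"
 proof eventually_elim
  case (elim x)
  let ?P = "\<lambda>n. \<Sum>k<n. fnorm (form_diff (u k) (u (Suc k))) x"
  have le: "fnorm (form_diff (u i) (u j)) x <= ?P j - ?P i" if "i <= j" for i j
   using that
  proof (induction j rule: dec_induct)
   case base then show ?case using elim(3) by simp
  next
   case (step n)
   then show ?case using elim(2)[rule_format, of i "Suc n" n] by simp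
  qed
  have C: "Cauchy ?P" using elim(1) by (simp add: summable_iff_convergent Cauchy_convergent_iff)
  show ?case
  proof (intro allI impI)
   fix e :: real assume "0 < e"
   then obtain K where K: "!!i j. K <= i ==> K <= j ==> dist (?P i) (?P j) < e" using C unfolding Cauchy_def by meson
   have "fnorm (form_diff (u i) (u j)) x < e" if "K <= i" "K <= j" for i j
   proof (cases "i <= j")
    case True
    then show ?thesis using le[OF True] K[OF that] unfolding dist_real_def by linarith
   next
    case False
    then have "fnorm (form_diff (u j) (u i)) x <= ?P i - ?P j" by (intro le) simp
    then show ?thesis using K[OF that] elim(4)[rule_format, of i j] unfolding dist_real_def by linarith
   qed
   then show "\<exists>K. \<forall>i\<ge>K. \<forall>j\<ge>K. fnorm (form_diff (u i) (u j)) x < e" by blast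
  qed
 qed
qed (rule u)

text \<open>Each member of a Cauchy sequence is approximated by the class of a constant form. Along
  a subsequence the successive distances of these forms are at most \<open>(1 / 2) ^ k\<close>, so
  the forms themselves make up an element of \<open>cauchy_forms\<close>, whose class is the
  limit.\<close>

lemma form_module_mcomplete: "Metric_space.mcomplete (carrier form_module) (mod_dist m' form_module)"
proof -
 interpret MS: Metric_space "carrier form_module" "mod_dist m' form_module" by (rule form_module_metric)
 let ?d = "mod_dist m' form_module"
 show ?thesis
  unfolding MS.mcomplete_def
 proof (intro allI impI)
  fix \<sigma> assume C: "MS.MCauchy \<sigma>"
  then have \<sigma>: "\<sigma> n \<in> carrier form_module" for n by (auto simp: MS.MCauchy_def)
  have "\<forall>n. \<exists>l\<in>forms. ?d (\<sigma> n) (lim_class (\<lambda>_. l)) < 1 / real (Suc n)"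
   using lim_class_const_dense[OF \<sigma>] by simp
  then obtain l where l: "!!n. l n \<in> forms" "!!n. ?d (\<sigma> n) (lim_class (\<lambda>_. l n)) < 1 / real (Suc n)" by metis
  let ?c = "\<lambda>n. lim_class (\<lambda>_. l n)"
  have c: "?c n \<in> carrier form_module" for n using l by (simp add: form_module_carrier)
  have "\<exists>N. \<forall>i\<ge>N. \<forall>j\<ge>N. ?d (?c i) (?c j) < (1/2)^k" for k :: nat
  proof -
   have e: "0 < (1/2::real)^k / 3" by simp
   obtain N where N: "!!i j. N <= i ==> N <= j ==> ?d (\<sigma> i) (\<sigma> j) < (1/2)^k / 3"
    using C e unfolding MS.MCauchy_def by meson
   obtain K where K: "1 / real (Suc K) < (1/2)^k / 3" using nat_approx_posE[OF e] by auto
   have "?d (?c i) (?c j) < (1/2)^k" if "max N K <= i" "max N K <= j" for i j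
   proof -
    have "1 / real (Suc i) <= 1 / real (Suc K)" "1 / real (Suc j) <= 1 / real (Suc K)" using that by (auto intro!: divide_left_mono)
    moreover have "?d (?c i) (?c j) <= ?d (?c i) (\<sigma> i) + (?d (\<sigma> i) (\<sigma> j) + ?d (\<sigma> j) (?c j))"
     using MS.triangle[OF c[of i] \<sigma>[of i] c[of j]] MS.triangle[OF \<sigma>[of i] \<sigma>[of j] c[of j]] by linarith
    ultimately show ?thesis using l(2)[of i] l(2)[of j] N[of i j] K that MS.commute[of "?c i" "\<sigma> i"] by simp
   qed
   then show ?thesis by blast
  qed
  then obtain N where N: "!!k i j. N k <= i ==> N k <= j ==> ?d (?c i) (?c j) < (1/2)^k" by metis
  \<comment> \<open>The sum dominates \<open>N k\<close>, and the summand \<open>k\<close> makes the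
    sequence strictly increasing.\<close>
  define r where "r k = (\<Sum>i\<le>k. N i) + k" for k
  have r: "strict_mono r" by (rule strict_mono_Suc_iff[THEN iffD2]) (simp add: r_def)
  have rN: "N k <= r k" for k using member_le_sum[of k "{..k}" N] by (simp add: r_def)
  have rS: "r k <= r (Suc k)" for k using r by (simp add: strict_mono_less_eq)
  define t where "t k = l (r k)" for k
  have tf: "t k \<in> forms" for k using l by (simp add: t_def)
  have "trunc_int (fnorm (form_diff (t k) (t (Suc k)))) <= (1/2)^k" for k
   using N[of k "r k" "r (Suc k)"] rN[of k] rS[of k] form_module_dist_const[OF tf tf, of k "Suc k"] by (simp add: t_def)
  then have "AE x in m. summable (\<lambda>k. fnorm (form_diff (t k) (t (Suc k))) x)"
   by (intro trunc_int_summable_AE[where b = "\<lambda>k. (1/2)^k"]) (use tf in \<open>auto intro!: fnorm_measurable simp: fnorm_nonneg\<close>)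
  then have t: "t \<in> cauchy_forms" by (rule summable_forms_cauchy[OF tf])
  have "limitin MS.mtopology (\<sigma> \<circ> r) (lim_class t) sequentially"
   unfolding MS.limitin_metric
  proof (intro conjI allI impI)
   show tc: "lim_class t \<in> carrier form_module" using t by (simp add: form_module_carrier)
   fix eps :: real assume "0 < eps"
   then have e: "0 < eps / 2" by simp
   obtain K where K: "1 / real (Suc K) < eps / 2" using nat_approx_posE[OF e] by auto
   have "eventually (\<lambda>k. ?d (lim_class (\<lambda>_. t k)) (lim_class t) < eps / 2) sequentially"
    using order_tendstoD(2)[OF lim_class_const_tendsto[OF t] e] .
   then show "eventually (\<lambda>k. (\<sigma> \<circ> r) k \<in> carrier form_module \<and> ?d ((\<sigma> \<circ> r) k) (lim_class t) < eps) sequentially"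
    using eventually_ge_at_top[of K]
   proof eventually_elim
    case (elim k)
    have "K <= r k" using elim(2) seq_suble[OF r, of k] by linarith
    then have "1 / real (Suc (r k)) <= 1 / real (Suc K)" by (auto intro!: divide_left_mono)
    moreover have "?d (\<sigma> (r k)) (lim_class t) <= ?d (\<sigma> (r k)) (?c (r k)) + ?d (?c (r k)) (lim_class t)"
     by (rule MS.triangle[OF \<sigma> c tc])
    ultimately show ?case using elim(1) l(2)[of "r k"] K \<sigma> by (simp add: t_def)
   qed
  qed
  from MS.MCauchy_convergent_subsequence[OF C r this]
  show "\<exists>x. limitin MS.mtopology \<sigma> x sequentially" by blast
 qed
qed

lemma form_module_normed: "L0_normed_module m m' form_module"
 unfolding L0_normed_module_def
proof (intro conjI ballI form_module_module form_module_metric form_module_mcomplete)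
 show "pnorm form_module \<in> carrier form_module \<rightarrow> carrier (L0 m)"
  by (auto simp: form_module_carrier form_module_pnorm lim_norm_measurable)
 fix V assume "V \<in> carrier form_module"
 then obtain s where s: "s \<in> cauchy_forms" "V = lim_class s" by (auto simp: form_module_carrier)
 note b = lim_norm_measurable[OF s(1)]
 show "L0_le m \<zero>\<^bsub>L0 m\<^esub> (pnorm form_module V)"
  using s b lim_norm_nonneg[OF s(1)] by (simp add: form_module_pnorm L0_zero_class)
 fix F assume "F \<in> carrier (L0 m)"
 then obtain \<phi> where \<phi>: "\<phi> \<in> borel_fun" "F = L0_class m \<phi>" by (auto elim: L0_cases)
 have "AE x in m. lim_norm (\<lambda>k. scale \<phi> (s k)) x = \<bar>\<phi> x\<bar> * lim_norm s x"
 proof (rule lim_norm_eqI)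
  have "AE x in m. \<forall>k. fnorm (scale \<phi> (s k)) x = \<bar>\<phi> x\<bar> * fnorm (s k) x"
   unfolding AE_all_countable by (intro allI fnorm_scale) (use s \<phi> in auto)
  then show "AE x in m. (\<lambda>k. fnorm (scale \<phi> (s k)) x) \<longlonglongrightarrow> \<bar>\<phi> x\<bar> * lim_norm s x"
   using fnorm_tendsto_lim_norm[OF s(1)] by eventually_elim (simp add: tendsto_mult_left)
 qed (use s \<phi> in auto)
 moreover have "(\<lambda>x. \<bar>\<phi> x\<bar> * lim_norm s x) \<in> borel_fun" "(\<lambda>x. \<bar>\<phi> x\<bar>) \<in> borel_fun"
  using \<phi>(1) b by measurable
 moreover have "lim_norm (\<lambda>k. scale \<phi> (s k)) \<in> borel_fun"
  by (rule lim_norm_measurable) (use s \<phi> in auto)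
 ultimately show "pnorm form_module (F \<odot>\<^bsub>form_module\<^esub> V) = L0_abs m F \<otimes>\<^bsub>L0 m\<^esub> pnorm form_module V"
  using s \<phi> b by (simp add: form_module_smult form_module_pnorm L0_class_eq_iff)
qed

definition form_d :: "('x => real) => (nat => 'x form) set" where
 "form_d f = lim_class (\<lambda>_. [(\<lambda>_. 1, f)])"

text \<open>The norm of a formal differential is \<open>fnorm_single\<close> and its linearity is
  \<open>fnorm_lincomb\<close>, after a change of coding by \<open>fnorm_cong\<close>.\<close>

lemma form_module_differential: "module_differential m m' U W form_module form_d"
proof (unfold_locales)
 show "L0_normed_module m m' form_module" by (rule form_module_normed)
 fix f assume f: "f \<in> U"
 then have c: "(\<lambda>_. [(\<lambda>_. 1, f)]) \<in> cauchy_forms" by simp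
 then show "form_d f \<in> carrier form_module" by (simp add: form_d_def form_module_carrier)
 have "AE x in m. lim_norm (\<lambda>_. [(\<lambda>_. 1, f)]) x = fnorm [(\<lambda>_. 1, f)] x" by (rule lim_norm_const) (use f in simp)
 with fnorm_single[OF f] have "AE x in m. lim_norm (\<lambda>_. [(\<lambda>_. 1, f)]) x = W f x" by eventually_elim simp
 then show "pnorm form_module (form_d f) = L0_class m (W f)"
  using c lim_norm_measurable[OF c] W_measurable[OF f] by (simp add: form_d_def form_module_pnorm L0_class_eq_iff)
 fix g a b assume g: "g \<in> U"
 let ?h = "\<lambda>x. a * f x + b * g x"
 have h: "?h \<in> U" by (rule U_lincomb[OF f g])
 have "L0_class m (\<lambda>_. a) \<odot>\<^bsub>form_module\<^esub> form_d f \<oplus>\<^bsub>form_module\<^esub> L0_class m (\<lambda>_. b) \<odot>\<^bsub>form_module\<^esub> form_d g =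
   lim_class (\<lambda>_. scale (\<lambda>_. a) [(\<lambda>_. 1, f)] @ scale (\<lambda>_. b) [(\<lambda>_. 1, g)])"
  using f g by (simp add: form_d_def form_module_smult form_module_add)
 also have "... = form_d ?h"
  unfolding form_d_def
 proof (subst lim_class_eq_iff)
  show "AE x in m. lim_norm (\<lambda>k. form_diff (scale (\<lambda>_. a) [(\<lambda>_. 1, f)] @ scale (\<lambda>_. b) [(\<lambda>_. 1, g)]) [(\<lambda>_. 1, ?h)]) x = 0"
  proof (rule lim_norm_diff_null)
   fix k
   have "AE x in m. fnorm (form_diff [(\<lambda>_. 1, ?h)] (scale (\<lambda>_. a) [(\<lambda>_. 1, f)] @ scale (\<lambda>_. b) [(\<lambda>_. 1, g)])) x =
    fnorm [(\<lambda>_. 1, ?h), (\<lambda>_. -a, f), (\<lambda>_. -b, g)] x"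
    by (rule fnorm_cong) (use f g h in \<open>simp_all add: coef_def scale_def\<close>)
   moreover have "AE x in m. fnorm (form_diff (scale (\<lambda>_. a) [(\<lambda>_. 1, f)] @ scale (\<lambda>_. b) [(\<lambda>_. 1, g)]) [(\<lambda>_. 1, ?h)]) x =
    fnorm (form_diff [(\<lambda>_. 1, ?h)] (scale (\<lambda>_. a) [(\<lambda>_. 1, f)] @ scale (\<lambda>_. b) [(\<lambda>_. 1, g)])) x"
    by (rule fnorm_diff_sym) (use f g h in auto)
   ultimately show "AE x in m. fnorm (form_diff (scale (\<lambda>_. a) [(\<lambda>_. 1, f)] @ scale (\<lambda>_. b) [(\<lambda>_. 1, g)]) [(\<lambda>_. 1, ?h)]) x = 0"
    using fnorm_lincomb[OF f g, of a b] by eventually_elim simp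
  qed (use f g h in auto)
 qed (use f g h in auto)
 finally show "form_d ?h = L0_class m (\<lambda>_. a) \<odot>\<^bsub>form_module\<^esub> form_d f \<oplus>\<^bsub>form_module\<^esub> L0_class m (\<lambda>_. b) \<odot>\<^bsub>form_module\<^esub> form_d g" ..
qed

lemma form_comb_form_d: "l \<in> forms ==> form_comb m form_module form_d l = lim_class (\<lambda>_. l)"
proof (induction l)
 case Nil then show ?case by (simp add: form_comb_simps form_module_zero)
next
 case (Cons p l)
 obtain g f where p: "p = (g, f)" by (cases p)
 have gf: "g \<in> borel_fun" "f \<in> U" "l \<in> forms" using Cons.prems p by auto
 have "form_comb m form_module form_d (p # l) = lim_class (\<lambda>_. scale g [(\<lambda>_. 1, f)] @ l)"
  using gf Cons.IH by (simp add: p form_comb_simps form_d_def[of f] form_module_smult form_module_add)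
 then show ?case by (simp add: p scale_def)
qed

lemma form_module_generates: "generates m m' form_module (form_d ` U)"
proof -
 interpret F: module_differential m m' U W form_module form_d by (rule form_module_differential)
 have "form_d ` U \<subseteq> carrier form_module" using F.d_closed by blast
 then show ?thesis
  unfolding F.generates_iff[OF \<open>form_d ` U \<subseteq> carrier form_module\<close>]
 proof (intro ballI allI impI)
  fix V and eps :: real assume "V \<in> carrier form_module" "0 < eps"
  from lim_class_const_dense[OF this] obtain l where l: "l \<in> forms" "mod_dist m' form_module V (lim_class (\<lambda>_. l)) < eps" by blast
  moreover have "F.comb l \<in> L0_combinations m form_module (form_d ` U)"
   by (rule F.comb_is_L0_combination[OF subset_refl]) (use l in \<open>simp add: forms_def\<close>)
  ultimately show "\<exists>s\<in>L0_combinations m form_module (form_d ` U). mod_dist m' form_module V s < eps"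
   by (auto simp: form_comb_form_d)
 qed
qed

end

section \<open>Smaller generating sets\<close>

context module_differential
begin

text \<open>Each function in a formal sum is replaced by a nearby one from \<open>V\<close>. Almost
  everywhere convergence of the seminorm is enough, since multiplication by the coefficient is
  continuous for the module distance.\<close>

lemma generates_subset:
 assumes gen: "generates m m' M (d ` U)" and V: "V \<subseteq> U"
  and dense: "!!f. f \<in> U ==> \<exists>g. (\<forall>n::nat. g n \<in> V) \<and> (AE x in m. (\<lambda>n. W (\<lambda>y. f y - g n y) x) \<longlonglongrightarrow> 0)"
 shows "generates m m' M (d ` V)"
proof -
 have approx: "\<exists>k. (\<forall>(g, f)\<in>set k. g \<in> borel_fun \<and> f \<in> V) \<and> mod_dist m' M (comb l) (comb k) < eps"
  if "l \<in> forms" "0 < eps" for l eps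
  using that
 proof (induction l arbitrary: eps)
  case Nil
  have "mod_dist m' M (comb []) (comb []) = 0" using MS.zero[of "comb []" "comb []"] by simp
  then show ?case using Nil by (intro exI[of _ "[]"]) simp
 next
  case (Cons p l)
  obtain g f where p: "p = (g, f)" by (cases p)
  have gf: "g \<in> borel_fun" "f \<in> U" "l \<in> forms" using Cons.prems p by auto
  have e: "0 < eps / 2" using Cons.prems by simp
  obtain k where k: "\<forall>(g, f)\<in>set k. g \<in> borel_fun \<and> f \<in> V" "mod_dist m' M (comb l) (comb k) < eps / 2"
   using Cons.IH[OF gf(3) e] by blast
  obtain h where h: "!!n::nat. h n \<in> V" "AE x in m. (\<lambda>n. W (\<lambda>y. f y - h n y) x) \<longlonglongrightarrow> 0"
   using dense[OF gf(2)] by blast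
  have hU: "h n \<in> U" for n using h V by blast
  have fh: "(\<lambda>y. f y - h n y) \<in> U" for n using U_lincomb[OF gf(2) hU, of 1 "-1" n] by simp
  have "d f \<ominus> d (h n) = d (\<lambda>y. f y - h n y)" for n
   using d_lincomb[OF gf(2) hU, of 1 "-1" n] d_closed[OF gf(2)] d_closed[OF hU[of n]]
   by (simp add: smult_one_class smult_minus_one a_minus_def)
  then have "mod_dist m' M (d (h n)) (d f) = trunc_int (W (\<lambda>y. f y - h n y))" for n
   using mod_dist_eq[OF d_closed[OF gf(2)] d_closed[OF hU[of n]]] MS.commute[of "d (h n)" "d f"]
    trunc_int_cong_AE[OF pn(1)[OF d_closed[OF fh]] W_measurable[OF fh] pn_d[OF fh]] by simp
  moreover have "(\<lambda>n. trunc_int (W (\<lambda>y. f y - h n y))) \<longlonglongrightarrow> 0"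
   by (rule trunc_int_tendsto_zero[OF W_measurable[OF fh] W_nonneg[OF fh] h(2)])
  ultimately have "(\<lambda>n. mod_dist m' M (d (h n)) (d f)) \<longlonglongrightarrow> 0" by simp
  then have "(\<lambda>n. mod_dist m' M (L0_class m g \<odot> d (h n)) (L0_class m g \<odot> d f)) \<longlonglongrightarrow> 0"
   by (intro mod_dist_smult_tendsto) (use gf hU d_closed in auto)
  from order_tendstoD(2)[OF this e] obtain n where n: "mod_dist m' M (L0_class m g \<odot> d (h n)) (L0_class m g \<odot> d f) < eps / 2"
   by (auto simp: eventually_sequentially)
  have kf: "k \<in> forms" using k(1) V by (auto simp: forms_def)
  have "mod_dist m' M (comb (p # l)) (comb ((g, h n) # k)) <=
   mod_dist m' M (L0_class m g \<odot> d f) (L0_class m g \<odot> d (h n)) + mod_dist m' M (comb l) (comb k)"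
   using gf hU kf d_closed by (simp add: p form_comb_simps mod_dist_add)
  then have "mod_dist m' M (comb (p # l)) (comb ((g, h n) # k)) < eps"
   using n k(2) MS.commute[of "L0_class m g \<odot> d f" "L0_class m g \<odot> d (h n)"] by linarith
  then show ?case using gf h k(1) by (intro exI[of _ "(g, h n) # k"]) auto
 qed
 have dV: "d ` V \<subseteq> carrier M" using V d_closed by blast
 show ?thesis
  unfolding generates_iff[OF dV]
 proof (intro ballI allI impI)
  fix v and eps :: real assume v: "v \<in> carrier M" and "0 < eps"
  then have e: "0 < eps / 2" by simp
  obtain l where l: "l \<in> forms" "mod_dist m' M v (comb l) < eps / 2" using comb_dense[OF subset_refl gen v e] by blast
  obtain k where k: "\<forall>(g, f)\<in>set k. g \<in> borel_fun \<and> f \<in> V" "mod_dist m' M (comb l) (comb k) < eps / 2"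
   using approx[OF l(1) e] by blast
  have kf: "k \<in> forms" using k(1) V by (auto simp: forms_def)
  have "mod_dist m' M v (comb k) < eps"
   using mod_dist_triangle[OF v comb_closed[OF l(1)] comb_closed[OF kf]] l(2) k(2) by linarith
  then show "\<exists>s\<in>L0_combinations m M (d ` V). mod_dist m' M v s < eps"
   using comb_is_L0_combination[OF V k(1)] by blast
 qed
qed

end

section \<open>The cotangent module\<close>

text \<open>A function in the union carries no exponent, so one is selected; for
  \<open>p\<close>-independent gradients the selection matters only up to null sets.\<close>

definition Sob_loc_exponent :: "'x::polish_space measure => ('x => real) => real" where
 "Sob_loc_exponent m f = (SOME p. 1 < p \<and> f \<in> Sob_loc m p)"

definition min_wug_some :: "'x::polish_space measure => ('x => real) => 'x => real" where
 "min_wug_some m f = min_wug_loc m (Sob_loc_exponent m f) f"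

abbreviation (input) Sob_loc_Union :: "'x::polish_space measure => ('x => real) set" where
 "Sob_loc_Union m \<equiv> \<Union>p\<in>{1<..}. Sob_loc m p"

lemma L0_combinations_mono:
 assumes "V \<subseteq> V'"
 shows "L0_combinations m M V \<subseteq> L0_combinations m M V'"
proof
 fix s assume "s \<in> L0_combinations m M V"
 then obtain n :: nat and f v where s: "s = (\<Oplus>\<^bsub>M\<^esub>i\<in>{..<n}. f i \<odot>\<^bsub>M\<^esub> v i)"
  "f \<in> {..<n} \<rightarrow> carrier (L0 m)" "v \<in> {..<n} \<rightarrow> V" unfolding L0_combinations_def by blast
 have "v \<in> {..<n} \<rightarrow> V'" using s(3) assms by auto
 with s(1,2) show "s \<in> L0_combinations m M V'" unfolding L0_combinations_def by blast
qed

section \<open>The two instances of the abstract setting\<close>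

context metric_measure_space
begin

lemma W1_subset_Sob_loc: "1 < p ==> W1 m p \<subseteq> Sob_loc m p"
 using Sob_subset_Sob_loc[of p] by (auto simp: W1_def)

lemma zero_Sob_loc: "1 < p ==> (\<lambda>_. 0) \<in> Sob_loc m p"
proof -
 assume p: "1 < p"
 then have "weak_upper_gradient m p (\<lambda>_. 0) (\<lambda>_. 0)" by (simp add: weak_upper_gradient_def Lp_fun_def)
 then have "(\<lambda>_. 0) \<in> Sob m p" by (auto simp: Sob_def)
 then show ?thesis using Sob_subset_Sob_loc[OF p] by blast
qed

lemma Sob_loc_exponent:
 assumes "1 < p" "f \<in> Sob_loc m p"
 shows "1 < Sob_loc_exponent m f" "f \<in> Sob_loc m (Sob_loc_exponent m f)"
proof -
 have "1 < Sob_loc_exponent m f \<and> f \<in> Sob_loc m (Sob_loc_exponent m f)"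
  unfolding Sob_loc_exponent_def by (rule someI[of "\<lambda>p. 1 < p \<and> f \<in> Sob_loc m p" p]) (use assms in simp)
 then show "1 < Sob_loc_exponent m f" "f \<in> Sob_loc m (Sob_loc_exponent m f)" by blast+
qed

text \<open>Two exponents are compared through their minimum, whose local class contains both of
  theirs.\<close>

lemma min_wug_some_eq:
 assumes pi: "p_independent_wug m" and p: "1 < p" and f: "f \<in> Sob_loc m p"
 shows "AE x in m. min_wug_some m f x = min_wug_loc m p f x"
proof -
 let ?q = "Sob_loc_exponent m f"
 note q = Sob_loc_exponent[OF p f]
 have r: "1 < min p ?q" using p q by simp
 have "AE x in m. min_wug_loc m (min p ?q) f x = min_wug_loc m p f x"
  by (rule min_wug_loc_independent[OF pi r _ f]) simp
 moreover have "AE x in m. min_wug_loc m (min p ?q) f x = min_wug_loc m ?q f x"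
  by (rule min_wug_loc_independent[OF pi r _ q(2)]) simp
 ultimately show ?thesis unfolding min_wug_some_def by eventually_elim simp
qed

text \<open>The smaller of the two exponents works for both functions. This is what makes the union
  a vector space and the common gradient a seminorm.\<close>

lemma Sob_loc_Union2:
 assumes "f \<in> Sob_loc_Union m" "g \<in> Sob_loc_Union m"
 obtains p where "1 < p" "f \<in> Sob_loc m p" "g \<in> Sob_loc m p"
proof -
 obtain p q where pq: "1 < p" "f \<in> Sob_loc m p" "1 < q" "g \<in> Sob_loc m q" using assms by auto
 then have "1 < min p q" "f \<in> Sob_loc m (min p q)" "g \<in> Sob_loc m (min p q)"
  using Sob_loc_mono[of "min p q" p] Sob_loc_mono[of "min p q" q] by auto
 then show thesis by (rule that)
qed

lemma seminormed_Sob_loc: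
 assumes "reference_measure m m'" and p: "1 < p"
 shows "seminormed_functions m m' (Sob_loc m p) (min_wug_loc m p)"
proof unfold_locales
 show "Sob_loc m p \<noteq> {}" using zero_Sob_loc[OF p] by blast
qed (use assms sets_m in \<open>auto intro: Sob_loc_lincomb min_wug_loc(1) min_wug_loc_nonneg min_wug_loc_lincomb\<close>)

lemma seminormed_Sob_loc_Union:
 assumes ref: "reference_measure m m'" and pi: "p_independent_wug m"
 shows "seminormed_functions m m' (Sob_loc_Union m) (min_wug_some m)"
proof unfold_locales
 show "Sob_loc_Union m \<noteq> {}" using zero_Sob_loc[of 2] by auto
 fix f assume f: "f \<in> Sob_loc_Union m"
 then obtain p where p: "1 < p" "f \<in> Sob_loc m p" by auto
 note q = Sob_loc_exponent[OF p]
 show "min_wug_some m f \<in> borel_fun" unfolding min_wug_some_def by (rule min_wug_loc(1)[OF q])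
 show "AE x in m. 0 <= min_wug_some m f x" unfolding min_wug_some_def by (rule min_wug_loc_nonneg[OF q])
 fix g a b assume g: "g \<in> Sob_loc_Union m"
 obtain r where r: "1 < r" "f \<in> Sob_loc m r" "g \<in> Sob_loc m r" by (rule Sob_loc_Union2[OF f g])
 have h: "(\<lambda>x. a * f x + b * g x) \<in> Sob_loc m r" by (rule Sob_loc_lincomb[OF r])
 then show "(\<lambda>x. a * f x + b * g x) \<in> Sob_loc_Union m" using r by auto
 from min_wug_loc_lincomb[OF r, of a b] min_wug_some_eq[OF pi r(1) h] min_wug_some_eq[OF pi r(1,2)] min_wug_some_eq[OF pi r(1,3)]
 show "AE x in m. min_wug_some m (\<lambda>x. a * f x + b * g x) x <= \<bar>a\<bar> * min_wug_some m f x + \<bar>b\<bar> * min_wug_some m g x"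
  by eventually_elim simp
qed (use ref sets_m in auto)

lemma p_cotangent_differential:
 assumes ref: "reference_measure m m'" and p: "1 < p" and c: "p_cotangent m m' p M d"
 shows "module_differential m m' (Sob_loc m p) (min_wug_loc m p) M d"
proof -
 interpret seminormed_functions m m' "Sob_loc m p" "min_wug_loc m p" by (rule seminormed_Sob_loc[OF ref p])
 show ?thesis by unfold_locales (use c in \<open>auto simp: p_cotangent_def p_differential_def\<close>)
qed

text \<open>The axioms are given for each exponent separately; they combine because any two
  functions of the union share an exponent.\<close>

lemma cotangent_differential:
 assumes ref: "reference_measure m m'" and pi: "p_independent_wug m" and c: "cotangent m m' M d"
 shows "module_differential m m' (Sob_loc_Union m) (min_wug_some m) M d"
proof -
 interpret seminormed_functions m m' "Sob_loc_Union m" "min_wug_some m" by (rule seminormed_Sob_loc_Union[OF ref pi])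
 have pd: "p_differential m m' p M d" if "1 < p" for p using c that by (simp add: cotangent_def)
 show ?thesis
 proof unfold_locales
  show "L0_normed_module m m' M" using c by (simp add: cotangent_def)
  fix f assume f: "f \<in> Sob_loc_Union m"
  then obtain p where p: "1 < p" "f \<in> Sob_loc m p" by auto
  show "d f \<in> carrier M" using pd[OF p(1)] p(2) by (auto simp: p_differential_def)
  have "pnorm M (d f) = L0_class m (min_wug_loc m p f)" using pd[OF p(1)] p(2) by (simp add: p_differential_def)
  also have "... = L0_class m (min_wug_some m f)"
   using min_wug_some_eq[OF pi p] W_measurable[OF f] min_wug_loc(1)[OF p] by (intro L0_class_eqI) (auto elim!: eventually_mono)
  finally show "pnorm M (d f) = L0_class m (min_wug_some m f)" .
  fix g a b assume g: "g \<in> Sob_loc_Union m"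
  obtain r where r: "1 < r" "f \<in> Sob_loc m r" "g \<in> Sob_loc m r" by (rule Sob_loc_Union2[OF f g])
  show "d (\<lambda>x. a * f x + b * g x) = L0_class m (\<lambda>_. a) \<odot>\<^bsub>M\<^esub> d f \<oplus>\<^bsub>M\<^esub> L0_class m (\<lambda>_. b) \<odot>\<^bsub>M\<^esub> d g"
   using pd[OF r(1)] r(2,3) by (simp add: p_differential_def)
 qed
qed

lemma cotangent_p_cotangent: "cotangent m m' M d ==> 1 < p ==> p_cotangent m m' p M d"
 by (simp add: cotangent_def p_cotangent_def)

lemma cotangent_generates: "cotangent m m' M d ==> 1 < p ==> generates m m' M (d ` W1 m p)"
 by (simp add: cotangent_def p_differential_def)

text \<open>The construction is run on the union of all local classes, whose differentials generate.
  Density of \<open>W1 m p\<close> in the seminorm then cuts the generating set down to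
  \<open>W1 m p\<close>, for each \<open>p\<close> in the same module.\<close>

lemma cotangent_exists:
 assumes ref: "reference_measure m m'" and pi: "p_independent_wug m"
 shows "\<exists>(M :: ('x, 'x formal_forms) normed_module) d. cotangent m m' M d"
proof -
 interpret S: seminormed_functions m m' "Sob_loc_Union m" "min_wug_some m" by (rule seminormed_Sob_loc_Union[OF ref pi])
 interpret D: module_differential m m' "Sob_loc_Union m" "min_wug_some m" S.form_module S.form_d
  by (rule S.form_module_differential)
 have "p_differential m m' p S.form_module S.form_d" if p: "1 < p" for p
  unfolding p_differential_def
 proof (intro conjI ballI allI)
  have sub: "Sob_loc m p \<subseteq> Sob_loc_Union m" using p by auto
  show "S.form_d \<in> Sob_loc m p \<rightarrow> carrier S.form_module" using D.d_closed sub by blast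
  fix f assume f: "f \<in> Sob_loc m p"
  then have fU: "f \<in> Sob_loc_Union m" using sub by blast
  show "pnorm S.form_module (S.form_d f) = L0_class m (min_wug_loc m p f)"
   unfolding D.d_norm[OF fU] using min_wug_some_eq[OF pi p f] S.W_measurable[OF fU] min_wug_loc(1)[OF p f]
   by (intro L0_class_eqI) auto
  fix g a b assume "g \<in> Sob_loc m p"
  then show "S.form_d (\<lambda>x. a * f x + b * g x) = L0_class m (\<lambda>_. a) \<odot>\<^bsub>S.form_module\<^esub> S.form_d f
    \<oplus>\<^bsub>S.form_module\<^esub> L0_class m (\<lambda>_. b) \<odot>\<^bsub>S.form_module\<^esub> S.form_d g"
   using D.d_lincomb[OF fU] sub by blast
 next
  show "generates m m' S.form_module (S.form_d ` W1 m p)"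
  proof (rule D.generates_subset[OF S.form_module_generates])
   show "W1 m p \<subseteq> Sob_loc_Union m" using W1_subset_Sob_loc[OF p] p by auto
   fix f assume "f \<in> Sob_loc_Union m"
   then obtain q where q: "1 < q" "f \<in> Sob_loc m q" by auto
   obtain g where g: "!!n. g n \<in> W1 m p" "!!n. g n \<in> W1 m q" "AE x in m. (\<lambda>n. min_wug_loc m q (\<lambda>x. f x - g n x) x) \<longlonglongrightarrow> 0"
    by (rule W1_dense_Sob_loc[OF pi p q]) (rule that)
   have "(\<lambda>x. f x - g n x) \<in> Sob_loc m q" for n
    using Sob_loc_lincomb[OF q, of "g n" 1 "-1"] g(2)[of n] W1_subset_Sob_loc[OF q(1)] by auto
   then have "AE x in m. \<forall>n. min_wug_some m (\<lambda>x. f x - g n x) x = min_wug_loc m q (\<lambda>x. f x - g n x) x"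
    unfolding AE_all_countable using min_wug_some_eq[OF pi q(1)] by blast
   with g(3) have "AE x in m. (\<lambda>n. min_wug_some m (\<lambda>x. f x - g n x) x) \<longlonglongrightarrow> 0" by eventually_elim simp
   then show "\<exists>g. (\<forall>n. g n \<in> W1 m p) \<and> (AE x in m. (\<lambda>n. min_wug_some m (\<lambda>x. f x - g n x) x) \<longlonglongrightarrow> 0)"
    using g(1) by blast
  qed
 qed
 then have "cotangent m m' S.form_module S.form_d" using S.form_module_normed by (simp add: cotangent_def)
 then show ?thesis by blast
qed

lemma cotangent_unique:
 assumes ref: "reference_measure m m'" and pi: "p_independent_wug m"
  and M: "cotangent m m' M d" and N: "cotangent m m' N L"
 shows "\<exists>!\<Phi>. \<Phi> \<in> module_iso m N M \<and> (\<forall>f\<in>Sob_loc_Union m. \<Phi> (L f) = d f)"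
proof -
 interpret seminormed_functions m m' "Sob_loc_Union m" "min_wug_some m" by (rule seminormed_Sob_loc_Union[OF ref pi])
 \<comment> \<open>Any exponent above 1 provides a generating set; 2 is picked.\<close>
 have W: "W1 m 2 \<subseteq> Sob_loc_Union m" using W1_subset_Sob_loc[of 2] by (auto intro!: bexI[of _ 2])
 show ?thesis
  by (rule unique_module_iso[OF cotangent_differential[OF ref pi N] cotangent_differential[OF ref pi M]
    W cotangent_generates[OF N] W cotangent_generates[OF M]]) simp_all
qed

text \<open>A cotangent module is in particular a \<open>p\<close>-cotangent module, so this also
  yields the identification of the two.\<close>

lemma p_cotangent_unique:
 assumes ref: "reference_measure m m'" and p: "1 < p"
  and M: "p_cotangent m m' p M d" and N: "p_cotangent m m' p N e"
 shows "\<exists>!I. I \<in> module_iso m N M \<and> (\<forall>f\<in>Sob_loc m p. I (e f) = d f)"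
proof -
 interpret seminormed_functions m m' "Sob_loc m p" "min_wug_loc m p" by (rule seminormed_Sob_loc[OF ref p])
 have gen: "generates m m' N (e ` W1 m p)" "generates m m' M (d ` W1 m p)"
  using M N by (simp_all add: p_cotangent_def p_differential_def)
 note W = W1_subset_Sob_loc[OF p]
 show ?thesis
  by (rule unique_module_iso[OF p_cotangent_differential[OF ref p N] p_cotangent_differential[OF ref p M] W gen(1) W gen(2)])
qed

text \<open>The part coming from one exponent already generates, and enlarging a generating set
  inside the carrier only adds combinations.\<close>

lemma cotangent_generates_Union:
 assumes ref: "reference_measure m m'" and pi: "p_independent_wug m" and M: "cotangent m m' M d"
 shows "generates m m' M (\<Union>p\<in>{1<..}. d ` W1 m p)"
proof -
 interpret D: module_differential m m' "Sob_loc_Union m" "min_wug_some m" M d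
  by (rule cotangent_differential[OF ref pi M])
 let ?V = "\<Union>p\<in>{1<..}. d ` W1 m p"
 have V: "?V \<subseteq> carrier M" using M by (auto simp: cotangent_def p_differential_def generates_def)
 have sub: "d ` W1 m 2 \<subseteq> ?V" by (intro UN_upper) simp
 have "L0_combinations m M (d ` W1 m 2) \<subseteq> L0_combinations m M ?V"
  by (rule L0_combinations_mono[OF sub])
 moreover have "\<exists>s\<in>L0_combinations m M (d ` W1 m 2). mod_dist m' M v s < eps" if "v \<in> carrier M" "0 < eps" for v eps
  using D.generates_iff[OF order_trans[OF sub V]] cotangent_generates[OF M, of 2] that by simp
 ultimately show ?thesis unfolding D.generates_iff[OF V] by (meson subsetD)
qed

end

theorem theorem4p1:
  fixes m m' :: "'x::polish_space measure"
  assumes "metric_measure m"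
    and "reference_measure m m'"
    and "p_independent_wug m"
  shows
    "(\<exists>(M :: ('x, 'x formal_forms) normed_module) d. cotangent m m' M d) \<and>
     (\<forall>(M :: ('x, 'u) normed_module) d (N :: ('x, 'v) normed_module) L.
        cotangent m m' M d \<and> cotangent m m' N L \<longrightarrow>
        (\<exists>!\<Phi>. \<Phi> \<in> module_iso m N M \<and> (\<forall>f\<in>(\<Union>p\<in>{1<..}. Sob_loc m p). \<Phi> (L f) = d f))) \<and>
     (\<forall>(M :: ('x, 'u) normed_module) d. cotangent m m' M d \<longrightarrow>
        generates m m' M (\<Union>p\<in>{1<..}. d ` W1 m p)) \<and>
     (\<forall>(M :: ('x, 'u) normed_module) d p (Mp :: ('x, 'w) normed_module) dp.
        cotangent m m' M d \<and> 1 < p \<and> p_cotangent m m' p Mp dp \<longrightarrow>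
        (\<exists>!I. I \<in> module_iso m Mp M \<and> (\<forall>f\<in>Sob_loc m p. I (dp f) = d f)) \<and>
        (\<forall>I. I \<in> module_iso m Mp M \<and> (\<forall>f\<in>Sob_loc m p. I (dp f) = d f) \<longrightarrow>
           dual_map m m' Mp M I \<in> module_iso m (dual_module m m' Mp) (dual_module m m' M)))"
proof -
 interpret metric_measure_space m by unfold_locales (rule assms(1))
 note ref = assms(2) and pi = assms(3)
 have mod: "L0_module m m' M" if "L0_normed_module m m' M" for M :: "('x, 'c) normed_module"
  by unfold_locales (use that ref sets_m in auto)
 show ?thesis
 proof (intro conjI allI impI)
  show "\<exists>(M :: ('x, 'x formal_forms) normed_module) d. cotangent m m' M d" by (rule cotangent_exists[OF ref pi])
 next
  fix M :: "('x, 'u) normed_module" and d and N :: "('x, 'v) normed_module" and L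
  assume "cotangent m m' M d \<and> cotangent m m' N L"
  then show "\<exists>!\<Phi>. \<Phi> \<in> module_iso m N M \<and> (\<forall>f\<in>(\<Union>p\<in>{1<..}. Sob_loc m p). \<Phi> (L f) = d f)"
   by (intro cotangent_unique[OF ref pi]) simp_all
 next
  fix M :: "('x, 'u) normed_module" and d
  assume "cotangent m m' M d"
  then show "generates m m' M (\<Union>p\<in>{1<..}. d ` W1 m p)" by (rule cotangent_generates_Union[OF ref pi])
 next
  fix M :: "('x, 'u) normed_module" and d and p and Mp :: "('x, 'w) normed_module" and dp
  assume A: "cotangent m m' M d \<and> 1 < p \<and> p_cotangent m m' p Mp dp"
  then show "\<exists>!I. I \<in> module_iso m Mp M \<and> (\<forall>f\<in>Sob_loc m p. I (dp f) = d f)"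
   by (intro p_cotangent_unique[OF ref]) (simp_all add: cotangent_p_cotangent)
  fix I assume "I \<in> module_iso m Mp M \<and> (\<forall>f\<in>Sob_loc m p. I (dp f) = d f)"
  then show "dual_map m m' Mp M I \<in> module_iso m (dual_module m m' Mp) (dual_module m m' M)"
   by (intro dual_map_module_iso[OF assms(1)] mod) (use A in \<open>simp_all add: cotangent_def p_cotangent_def\<close>)
 qed
qed

end
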